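(* The trigraded algebra of weak $\tilde A_n$-invariant Jacobi forms $J_{\bullet,\bullet,\bullet}=\bigoplus_{k,l,m}J_{k,l,m}$ is freely generated by the $n+1$ fundamental Jacobi forms $\varphi_0,\varphi_1,\dots,\varphi_n$ over the graded ring $E_{\bullet,\bullet}:=J_{\bullet,\bullet,0}$ of Jacobi forms of index $0$: $$J_{\bullet,\bullet,\bullet}=E_{\bullet,\bullet}[\varphi_0,\varphi_1,\dots,\varphi_n].$$ Moreover, the ring $E_{\bullet,\bullet}$ consists of functions $f(v_{n+1},\tau)$ depending only on $v_{n+1}$ and $\tau$ such that, for fixed $\tau$, $v_{n+1}\mapsto f(v_{n+1},\tau)$ is an elliptic function.
   Context: Let $n\ge 1$ and let $\mathbb H$ be the upper half-plane. Put $V=\{(v_0,\dots,v_n,v_{n+1})\in\mathbb C^{n+2}:\sum_{i=0}^n v_i=0\}\cong\mathbb C^{n+1}$ (with coordinates $v_0,\dots,v_{n-1},v_{n+1}$), $L=V\cap\mathbb Z^{n+2}$, $\langle v,w\rangle=\sum_{i=0}^n v_iw_i-n(n+1)v_{n+1}w_{n+1}$, and $\Omega=\mathbb C\times V\times\mathbb H\ni(u,v,\tau)$. Three kinds of transformations act on $\Omega$: (i) $w\in A_n$ (the Weyl group $S_{n+1}$) permutes $v_0,\dots,v_n$; (ii) $t=(\lambda,\mu)\in L\times L$: $t(u,v,\tau)=(u-\langle\lambda,v\rangle-\tfrac12\langle\lambda,\lambda\rangle\tau,\ v+\lambda\tau+\mu,\ \tau)$; (iii) $\gamma=\begin{pmatrix}a&b\\c&d\end{pmatrix}\in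 SL_2(\mathbb Z)$: $\gamma(u,v,\tau)=\left(u+\frac{c\langle v,v\rangle}{2(c\tau+d)},\frac{v}{c\tau+d},\frac{a\tau+b}{c\tau+d}\right)$. A weak $\tilde A_n$-invariant Jacobi form of weight $k$, order $l$ and index $m$ is a function $\varphi$ on $\Omega$ with $\varphi(w(x))=\varphi(x)$, $\varphi(t(x))=\varphi(x)$, $\varphi(\gamma(x))=(c\tau+d)^{k}\varphi(x)$ for all $x=(u,v,\tau)\in\Omega$, all permutations $w\in A_n$, all translations $t=(\lambda,\mu)\in L\times L$ and all $\gamma=\begin{pmatrix}a&b\\c&d\end{pmatrix}\in SL_2(\mathbb Z)$, with $-\frac1{2\pi i}\partial_u\varphi=m\varphi$, and such that: (1) $\varphi$ is locally bounded in $v'=(v_0,\dots,v_{n-1})$ as $\operatorname{Im}\tau\to+\infty$; (2) for fixed $u,v',\tau$, $v_{n+1}\mapsto\varphi$ is meromorphic with poles of order at most $l+2m$ on the set $(n+1)v_{n+1}\in\mathbb Z+\tau\mathbb Z$; (3) for fixed values of the other variables with $(n+1)v_{n+1}\notin\mathbb Z+\tau\mathbb Z$, $\varphi$ is holomorphic in each $v_i$, $0\le i\le n-1$; (4) for fixed $u,v',v_{n+1}$ away from that divisor, $\varphi$ is holomorphic in $\tau$. The space of these is $J_{k,l,m}$; $J_{\bullet,\bullet,0}=\bigoplus_{k,l}J_{k,l,0}$. $\theta_1(z,\tau)$ is the odd Jacobi theta function $2\sum_{m\ge0}(-1)^me^{\pi i\tau(m+1/2)^2}\sin((2m+1)\pi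 z)$; $\wp,\zeta$ are the Weierstrass functions of the lattice $\mathbb Z+\tau\mathbb Z$, and $\wp^{(j)}$ denotes the $j$-th $z$-derivative. The forms $\varphi_0,\dots,\varphi_n$ (functions of $(u,v,\tau)$) are defined by the identity in $z$ $$e^{-2\pi iu}\frac{\prod_{i=0}^n\theta_1(z-v_i+v_{n+1},\tau)}{\theta_1^n(z,\tau)\,\theta_1(z+(n+1)v_{n+1},\tau)}=\sum_{k=2}^n\varphi_k\,\wp^{(k-2)}(z,\tau)+\varphi_1\left[\zeta(z,\tau)-\zeta(z+(n+1)v_{n+1},\tau)+\zeta((n+1)v_{n+1},\tau)\right]+\varphi_0 .$$
   Formalization: The sum over k, l, m is taken inside the space of functions and is direct only in weight k and index m: J_{k,l,m} lies in J_{k,l+1,m}, so the order l is a filtration, not a grading, and generation is not claimed to respect l (for n=1 it does not). *)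

theory Defs
  imports
    "HOL-Complex_Analysis.Complex_Analysis"
    "HOL-Library.Poly_Mapping"
    "HOL-Library.Function_Algebras"
begin

section \<open>Theta and Weierstrass functions of the lattice \<open>\<int> + \<tau>\<int>\<close>\<close>

definition upper_half_plane :: "complex set"  where
  "upper_half_plane = {\<tau>. Im \<tau> > 0}"

definition period_lattice :: "complex \<Rightarrow> complex set"  where
  "period_lattice \<tau> = {of_int a + of_int b * \<tau> | a b. True}"

definition theta1 :: "complex \<Rightarrow> complex \<Rightarrow> complex"  where
  "theta1 z \<tau> = 2 * suminf (\<lambda>m. (-1) ^ m * exp (of_real pi * \<i> * \<tau> * (of_nat m + 1/2)\<^sup>2)
                          * sin (of_nat (2 * m + 1) * of_real pi * z))"

definition weierstrass_p :: "complex \<Rightarrow> complex \<Rightarrow> complex"  where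
  "weierstrass_p z \<tau> =
     1 / z\<^sup>2 + (\<Sum>\<^sub>\<infinity>\<omega>\<in>period_lattice \<tau> - {0}. 1 / (z - \<omega>)\<^sup>2 - 1 / \<omega>\<^sup>2)"

definition weierstrass_zeta :: "complex \<Rightarrow> complex \<Rightarrow> complex"  where
  "weierstrass_zeta z \<tau> =
     1 / z + (\<Sum>\<^sub>\<infinity>\<omega>\<in>period_lattice \<tau> - {0}. 1 / (z - \<omega>) + 1 / \<omega> + z / \<omega>\<^sup>2)"

definition elliptic :: "complex \<Rightarrow> (complex \<Rightarrow> complex) \<Rightarrow> bool"  where
  "elliptic \<tau> g \<longleftrightarrow> g nicely_meromorphic_on UNIV \<and>
     (\<forall>z. \<forall>\<omega>\<in>period_lattice \<tau>. g (z + \<omega>) = g z)"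

section \<open>The domain and the group actions\<close>

text \<open>A vector \<open>(v\<^sub>0, \<dots>, v\<^sub>n, v\<^sub>n\<^sub>+\<^sub>1)\<close> is a function on the natural numbers which is zero
  beyond \<open>n + 1\<close>.\<close>

definition V :: "nat \<Rightarrow> (nat \<Rightarrow> complex) set"  where
  "V n = {v. (\<Sum>i=0..n. v i) = 0 \<and> (\<forall>i>n+1. v i = 0)}"

definition L :: "nat \<Rightarrow> (nat \<Rightarrow> complex) set"  where
  "L n = {v \<in> V n. \<forall>i. v i \<in> \<int>}"

definition form :: "nat \<Rightarrow> (nat \<Rightarrow> complex) \<Rightarrow> (nat \<Rightarrow> complex) \<Rightarrow> complex"  where
  "form n v w = (\<Sum>i=0..n. v i * w i) - of_nat (n * (n + 1)) * v (n+1) * w (n+1)"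

type_synonym point = "complex \<times> (nat \<Rightarrow> complex) \<times> complex"

definition Omega :: "nat \<Rightarrow> point set"  where
  "Omega n = UNIV \<times> V n \<times> upper_half_plane"

text \<open>The complement of the polar divisor \<open>(n + 1) v\<^sub>n\<^sub>+\<^sub>1 \<in> \<int> + \<tau>\<int>\<close>.\<close>

definition Omega_reg :: "nat \<Rightarrow> point set"  where
  "Omega_reg n = {(u, v, \<tau>). (u, v, \<tau>) \<in> Omega n \<and> of_nat (n+1) * v (n+1) \<notin> period_lattice \<tau>}"

fun act_perm :: "(nat \<Rightarrow> nat) \<Rightarrow> point \<Rightarrow> point"  where
  "act_perm w (u, v, \<tau>) = (u, v \<circ> w, \<tau>)"

fun act_trans :: "nat \<Rightarrow> (nat \<Rightarrow> complex) \<Rightarrow> (nat \<Rightarrow> complex) \<Rightarrow> point \<Rightarrow> point"  where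
  "act_trans n lam mu (u, v, \<tau>) =
     (u - form n lam v - 1/2 * form n lam lam * \<tau>, (\<lambda>i. v i + lam i * \<tau> + mu i), \<tau>)"

fun act_SL2 :: "nat \<Rightarrow> int \<Rightarrow> int \<Rightarrow> int \<Rightarrow> int \<Rightarrow> point \<Rightarrow> point"  where
  "act_SL2 n a b c d (u, v, \<tau>) =
     (u + of_int c * form n v v / (2 * (of_int c * \<tau> + of_int d)),
      (\<lambda>i. v i / (of_int c * \<tau> + of_int d)),
      (of_int a * \<tau> + of_int b) / (of_int c * \<tau> + of_int d))"

section \<open>Weak Jacobi forms\<close>

text \<open>\<open>g\<close> is meromorphic on the plane, its poles lie in \<open>D\<close>, and they have order at most \<open>N\<close>.
  For \<open>N < 0\<close> this means a zero of order at least \<open>-N\<close> at each point of \<open>D\<close>. The values of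
  \<open>g\<close> on \<open>D\<close> play no role when the points of \<open>D\<close> are isolated.\<close>

definition poles_bounded :: "(complex \<Rightarrow> complex) \<Rightarrow> complex set \<Rightarrow> int \<Rightarrow> bool"  where
  "poles_bounded g D N \<longleftrightarrow> g meromorphic_on UNIV \<and> g holomorphic_on (- D) \<and>
     (\<forall>p\<in>D. (\<exists>\<^sub>F s in at p. g s \<noteq> 0) \<longrightarrow> - zorder g p \<le> N)"

text \<open>The space of weak Jacobi forms of weight \<open>k\<close>, order \<open>l\<close> and index \<open>m\<close>. A form has no
  meaningful value on the polar divisor, so it is a function on \<open>Omega_reg\<close>. It is represented by
  its extension by zero, which makes equality of forms equality of HOL functions. The divisor is
  stable under all three group actions, so the transformation laws can be stated on the whole of
  \<open>Omega\<close>. The coordinates are \<open>v\<^sub>0, \<dots>, v\<^sub>n\<^sub>-\<^sub>1, v\<^sub>n\<^sub>+\<^sub>1\<close>: varying \<open>v\<^sub>i\<close> with \<open>i < n\<close> changes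
  \<open>v\<^sub>n\<close> as well. In the boundedness condition \<open>u\<close> and \<open>v\<^sub>n\<^sub>+\<^sub>1\<close> are fixed.\<close>

definition Jacobi :: "nat \<Rightarrow> int \<Rightarrow> int \<Rightarrow> int \<Rightarrow> (point \<Rightarrow> complex) set"  where
  "Jacobi n k l m = {f.
     (\<forall>x. x \<notin> Omega_reg n \<longrightarrow> f x = 0) \<and>
     (\<forall>w. w permutes {0..n} \<longrightarrow> (\<forall>x\<in>Omega n. f (act_perm w x) = f x)) \<and>
     (\<forall>lam\<in>L n. \<forall>mu\<in>L n. \<forall>x\<in>Omega n. f (act_trans n lam mu x) = f x) \<and>
     (\<forall>a b c d. a * d - b * c = 1 \<longrightarrow>
        (\<forall>(u, v, \<tau>)\<in>Omega n.
           f (act_SL2 n a b c d (u, v, \<tau>)) = (of_int c * \<tau> + of_int d) powi k * f (u, v, \<tau>))) \<and>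
     (\<forall>(u, v, \<tau>)\<in>Omega n.
        ((\<lambda>u'. f (u', v, \<tau>)) has_field_derivative
           - (2 * of_real pi * \<i>) * of_int m * f (u, v, \<tau>)) (at u)) \<and>
     (\<forall>u. \<forall>v\<in>V n. \<exists>\<epsilon>>0. \<exists>Y B. \<forall>v'\<in>V n. \<forall>\<tau>.
        v' (n+1) = v (n+1) \<and> (\<forall>i<n. dist (v' i) (v i) < \<epsilon>) \<and> \<tau> \<in> upper_half_plane \<and> Im \<tau> > Y
          \<longrightarrow> norm (f (u, v', \<tau>)) \<le> B) \<and>
     (\<forall>(u, v, \<tau>)\<in>Omega n.
        poles_bounded (\<lambda>s. f (u, v(n+1 := s), \<tau>))
          {s. of_nat (n+1) * s \<in> period_lattice \<tau>} (l + 2 * m)) \<and>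
     (\<forall>(u, v, \<tau>)\<in>Omega_reg n. \<forall>i<n.
        (\<lambda>s. f (u, v(i := s, n := v n + v i - s), \<tau>)) holomorphic_on UNIV) \<and>
     (\<forall>u. \<forall>v\<in>V n.
        (\<lambda>\<tau>. f (u, v, \<tau>)) holomorphic_on
          {\<tau> \<in> upper_half_plane. of_nat (n+1) * v (n+1) \<notin> period_lattice \<tau>})}"

text \<open>The sum of the spaces of Jacobi forms whose tridegree \<open>(k, l, m)\<close> lies in \<open>D\<close>, taken inside
  the space of functions. For fixed \<open>k\<close> and \<open>m\<close> these spaces increase with \<open>l\<close>, so only the
  sum over \<open>(k, m)\<close> can be direct; \<open>l\<close> is a filtration degree.\<close>

definition Jacobi_sum :: "nat \<Rightarrow> (int \<times> int \<times> int) set \<Rightarrow> (point \<Rightarrow> complex) set"  where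
  "Jacobi_sum n D = {(\<lambda>x. \<Sum>d\<in>I. g d x) | I g.
     finite I \<and> I \<subseteq> D \<and> (\<forall>(k, l, m)\<in>I. g (k, l, m) \<in> Jacobi n k l m)}"

definition Jacobi_algebra :: "nat \<Rightarrow> (point \<Rightarrow> complex) set"  where
  "Jacobi_algebra n = Jacobi_sum n UNIV"

definition Jacobi_index0 :: "nat \<Rightarrow> (point \<Rightarrow> complex) set"  where
  "Jacobi_index0 n = Jacobi_sum n {(k, l, m). m = 0}"

definition Jacobi_one :: "nat \<Rightarrow> point \<Rightarrow> complex"  where
  "Jacobi_one n x = (if x \<in> Omega_reg n then 1 else 0)"

section \<open>The fundamental Jacobi forms\<close>

text \<open>The coefficients \<open>c 0, \<dots>, c n\<close> satisfy the defining identity at the point \<open>(u, v, \<tau>)\<close>,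
  for all \<open>z\<close> at which both sides are regular.\<close>

definition generating_identity ::
    "nat \<Rightarrow> complex \<Rightarrow> (nat \<Rightarrow> complex) \<Rightarrow> complex \<Rightarrow> (nat \<Rightarrow> complex) \<Rightarrow> bool"  where
  "generating_identity n u v \<tau> c \<longleftrightarrow>
     (let w = of_nat (n+1) * v (n+1) in
      \<forall>z. z \<notin> period_lattice \<tau> \<and> z + w \<notin> period_lattice \<tau> \<longrightarrow>
        exp (- 2 * of_real pi * \<i> * u) *
          ((\<Prod>i=0..n. theta1 (z - v i + v (n+1)) \<tau>) / (theta1 z \<tau> ^ n * theta1 (z + w) \<tau>)) =
        (\<Sum>k=2..n. c k * (deriv ^^ (k - 2)) (\<lambda>y. weierstrass_p y \<tau>) z)
        + c 1 * (weierstrass_zeta z \<tau> - weierstrass_zeta (z + w) \<tau> + weierstrass_zeta w \<tau>)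
        + c 0)"

definition fundamental :: "nat \<Rightarrow> nat \<Rightarrow> point \<Rightarrow> complex"  where
  "fundamental n k = (\<lambda>(u, v, \<tau>).
     if (u, v, \<tau>) \<in> Omega_reg n
     then (THE c. (\<forall>i>n. c i = 0) \<and> generating_identity n u v \<tau> c) k else 0)"

text \<open>Polynomials in the variables \<open>X\<^sub>0, \<dots>, X\<^sub>n\<close> with coefficients in \<open>Jacobi_index0 n\<close>
  (finitely supported maps from exponent vectors to coefficients), and their evaluation at the
  fundamental forms.\<close>

definition index0_polys :: "nat \<Rightarrow> ((nat \<Rightarrow>\<^sub>0 nat) \<Rightarrow>\<^sub>0 (point \<Rightarrow> complex)) set"  where
  "index0_polys n = {p. (\<forall>\<alpha>. Poly_Mapping.lookup p \<alpha> \<in> Jacobi_index0 n) \<and>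
     (\<forall>\<alpha>\<in>Poly_Mapping.keys p. Poly_Mapping.keys \<alpha> \<subseteq> {0..n})}"

definition eval_fundamental ::
    "nat \<Rightarrow> ((nat \<Rightarrow>\<^sub>0 nat) \<Rightarrow>\<^sub>0 (point \<Rightarrow> complex)) \<Rightarrow> point \<Rightarrow> complex"  where
  "eval_fundamental n p x =
     (\<Sum>\<alpha>\<in>Poly_Mapping.keys p. Poly_Mapping.lookup p \<alpha> x *
        (\<Prod>i=0..n. fundamental n i x ^ Poly_Mapping.lookup \<alpha> i))"

end

theory Submission
  imports Defs
begin

text \<open>For fixed \<open>s = v\<^sub>n\<^sub>+\<^sub>1\<close> and \<open>\<tau>\<close>, a form of index \<open>m\<close> is symmetric in \<open>v\<^sub>0, \<dots>, v\<^sub>n\<close>, and along each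
  line \<open>v\<^sub>i + v\<^sub>n\<close> constant it is an entire theta function of degree \<open>2m\<close>. Hence it is determined by its
  values at the points where \<open>v\<^sub>0, \<dots>, v\<^sub>n\<^sub>-\<^sub>1\<close> are distinct members of a set of \<open>m + n\<close> real nodes, and Lagrange
  interpolation writes it as a combination of products of \<open>m\<close> functions \<open>\<Prod>i. \<theta>(x - v\<^sub>i)\<close>, \<open>x\<close> a node. By the
  defining identity at \<open>z = x - s\<close> each of these is a linear form in the fundamental forms whose coefficients
  depend on \<open>s\<close> and \<open>\<tau>\<close> only. So a form of index \<open>m\<close> is a homogeneous polynomial of degree \<open>m\<close> in the
  fundamental forms. For fixed \<open>s\<close> and \<open>\<tau>\<close> the fundamental forms take all nonzero vectors as values, so the
  coefficients are unique. Uniqueness gives their transformation laws; their regularity is read off from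
  the interpolation formula, with nodes adapted to the given point. All theta functions are treated as
  functions of the nome, analytic at \<open>0\<close>, which includes the cusp.\<close>

text \<open>Two descriptions of the same functions have to be matched. The weights of the
  fundamental forms come from the homogeneity of the lattice sums zeta and wp, whereas bounds at the
  cusp, pole orders and holomorphy come from theta series; so zeta(z) is first identified with
  theta'(z)/theta(z) + c z. The constant c drops out of zeta(z) - zeta(z + w) + zeta(w), where w is
  \<open>(n + 1) * v (n + 1)\<close>. The coefficients of a form are defined pointwise, by
  uniqueness at one (s, tau), and no single node set is admissible everywhere; hence the need to
  change nodes from point to point. Nodes are real numbers in (0, 1/(n + 2)) because a non-zero
  difference of two of them, or a sum of at most n + 2, has modulus in (0, 1), so that it lies in no
  lattice Z + tau Z, nor in Z, which replaces the lattice at the cusp. Their number m + n comes from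
  counting zeros: with n - 1 coordinates at nodes, m + 1 nodes are left, and each gives two zeros of
  a theta function of degree 2 m.\<close>

abbreviation (input) uhp :: "complex set" where "uhp \<equiv> upper_half_plane"
abbreviation (input) Lat :: "complex \<Rightarrow> complex set" where "Lat \<equiv> period_lattice"
abbreviation (input) lookup :: "('a \<Rightarrow>\<^sub>0 'b::zero) \<Rightarrow> 'a \<Rightarrow> 'b" where "lookup \<equiv> Poly_Mapping.lookup"
abbreviation (input) keys :: "('a \<Rightarrow>\<^sub>0 'b::zero) \<Rightarrow> 'a set" where "keys \<equiv> Poly_Mapping.keys"

section \<open>The theta series as a function of the nome\<close>

definition nome :: "complex => complex" where
 "nome tau = exp (of_real pi * \<i> * tau)"

definition theta_freq :: "nat => complex" where
 "theta_freq m = of_nat (2 * m + 1) * of_real pi * \<i>"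

text \<open>The \<open>r\<close>-th z-derivative of \<open>2 * sin ((2 m + 1) pi z)\<close>, written
  with \<open>2 sin x = (exp (i x) - exp (- i x)) / i\<close>. The exponent
  \<open>m * (m + 1)\<close> is \<open>(m + 1/2)^2 - 1/4\<close>.\<close>

definition th_term :: "nat => complex => complex => nat => complex" where
 "th_term r z q m = (-1) ^ m * q ^ (m * (m + 1)) *
   (theta_freq m ^ r * (exp (theta_freq m * z) - (-1) ^ r * exp (- theta_freq m * z)) / \<i>)"

text \<open>The \<open>r\<close>-th \<open>z\<close>-derivative of the theta function, divided by \<open>exp (\<pi>\<i>\<tau>/4)\<close> so that it becomes
  a power series in the nome.\<close>

definition th :: "nat => complex => complex => complex" where
 "th r z q = suminf (%m. th_term r z q m)"

section \<open>Convergence and z-derivatives of the theta series\<close>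

lemma summable_theta_majorant:
 fixes r B :: real
 assumes "0 \<le> r" "r < 1" "0 \<le> B"
 shows "summable (%m. r ^ (m * (m + 1)) * B ^ (2 * m + 1))"
proof -
 \<comment> \<open>The m-th term of the series is B times the m-th power of this sequence, so
   eventually it is at most \<open>B * (1/2) ^ m\<close>.\<close>
 have "(%m. r ^ m * (r * B\<^sup>2)) \<longlonglongrightarrow> 0 * (r * B\<^sup>2)"
  using assms by (intro tendsto_mult LIMSEQ_realpow_zero) auto
 then have ev: "eventually (%m. r ^ m * (r * B\<^sup>2) < 1/2) sequentially"
  by (intro order_tendstoD) auto
 show ?thesis
 proof (rule summable_comparison_test_ev)
  show "eventually (%m. norm (r ^ (m * (m + 1)) * B ^ (2 * m + 1)) \<le> B * (1/2) ^ m) sequentially"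
   using ev
  proof eventually_elim
   case (elim m)
   have "r ^ (m * (m + 1)) * B ^ (2 * m + 1) = B * (r ^ m * (r * B\<^sup>2)) ^ m"
    by (simp add: power_mult_distrib power_mult[symmetric] power_add algebra_simps)
   moreover have "(r ^ m * (r * B\<^sup>2)) ^ m \<le> (1/2) ^ m"
    using elim assms by (intro power_mono) auto
   ultimately have "r ^ (m * (m + 1)) * B ^ (2 * m + 1) \<le> B * (1/2) ^ m"
    using assms by (simp only:) (intro mult_left_mono, auto)
   moreover have "0 \<le> r ^ (m * (m + 1)) * B ^ (2 * m + 1)"
    using assms by simp
   ultimately show ?case by simp
  qed
  show "summable (%m. B * (1/2) ^ m)"
   by (intro summable_mult summable_geometric) auto
 qed
qed

text \<open>One term of the exponential series is at most the whole sum. This trades the power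
  produced by r differentiations for one more exponential.\<close>

lemma power_le_fact_exp:
 fixes x :: real
 assumes "x \<ge> 0"
 shows "x ^ r \<le> fact r * exp x"
proof -
 have "(\<Sum>k\<in>{r}. x ^ k /\<^sub>R fact k) \<le> suminf (%k. x ^ k /\<^sub>R fact k)"
  by (rule sum_le_suminf[OF summable_exp_generic]) (use assms in auto)
 then show ?thesis
  by (simp add: exp_def field_simps)
qed

text \<open>With x = (2 m + 1) pi, a factor exp x absorbs the power x^r coming from r
  differentiations, and exp (x R) bounds the exponentials for |z| at most R. The bound is uniform in
  z and q, so it serves continuity, z-derivatives and holomorphy in q alike.\<close>

definition th_bound :: "nat => real => real => nat => real" where
 "th_bound r R \<rho> m = 2 * fact r * (\<rho> ^ (m * (m + 1)) * exp (pi * (1 + R)) ^ (2 * m + 1))"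

lemma summable_th_bound: "0 \<le> \<rho> ==> \<rho> < 1 ==> summable (th_bound r R \<rho>)"
 unfolding th_bound_def by (intro summable_mult summable_theta_majorant) auto

lemma norm_th_term_le:
 assumes "norm z \<le> R" "norm q \<le> \<rho>"
 shows "norm (th_term r z q m) \<le> th_bound r R \<rho> m"
proof -
 define x where "x = pi * real (2 * m + 1)"
 have x0: "x \<ge> 0" by (simp add: x_def)
 have fr: "norm (theta_freq m) = x"
  by (simp add: theta_freq_def x_def norm_mult del: of_nat_add of_nat_Suc of_nat_mult)
 have e: "norm (exp (c * theta_freq m * z)) \<le> exp (x * R)" if "norm c = 1" for c
 proof -
  have "norm (exp (c * theta_freq m * z)) \<le> exp (norm (c * theta_freq m * z))"
   by (rule norm_exp)
  also have "norm (c * theta_freq m * z) \<le> x * R"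
   using assms x0 that by (auto simp: norm_mult fr intro!: mult_left_mono)
  finally show ?thesis by simp
 qed
 have "norm (exp (theta_freq m * z) - (-1) ^ r * exp (- theta_freq m * z))
   \<le> norm (exp (theta_freq m * z)) + norm ((-1) ^ r * exp (- theta_freq m * z))"
  by (rule norm_triangle_ineq4)
 also have "\<dots> \<le> exp (x * R) + exp (x * R)"
  using e[of 1] e[of "-1"] by (intro add_mono) (auto simp: norm_mult norm_power)
 finally have 1: "norm (exp (theta_freq m * z) - (-1) ^ r * exp (- theta_freq m * z)) \<le> 2 * exp (x * R)"
  by simp
 have 2: "norm q ^ (m * (m + 1)) \<le> \<rho> ^ (m * (m + 1))"
  using assms by (intro power_mono) auto
 have "norm (th_term r z q m) = norm q ^ (m * (m + 1)) * (x ^ r *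
   norm (exp (theta_freq m * z) - (-1) ^ r * exp (- theta_freq m * z)))"
  by (simp only: th_term_def norm_mult norm_divide norm_power fr) simp
 also have "\<dots> \<le> \<rho> ^ (m * (m + 1)) * ((fact r * exp x) * (2 * exp (x * R)))"
  using 1 2 x0 power_le_fact_exp[OF x0, of r] assms order_trans[OF norm_ge_zero assms(2)]
  by (intro mult_mono) auto
 also have "\<dots> = th_bound r R \<rho> m"
 proof -
  have "exp x * exp (x * R) = exp (pi * (1 + R)) ^ (2 * m + 1)"
   unfolding exp_of_nat_mult[symmetric] exp_add[symmetric] by (simp add: x_def algebra_simps)
  then show ?thesis by (simp add: th_bound_def algebra_simps)
 qed
 finally show ?thesis .
qed

lemma summable_th_term:
 assumes "norm q < 1"
 shows "summable (th_term r z q)"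
 by (rule summable_comparison_test'[OF summable_th_bound[of "norm q" r "norm z"], of 0])
   (use assms norm_th_term_le in auto)

lemma th_uniform_limit:
 assumes "0 \<le> \<rho>" "\<rho> < 1" "A \<subseteq> cball 0 R \<times> cball 0 \<rho>"
 shows "uniform_limit A (%N x. \<Sum>m<N. th_term r (fst x) (snd x) m) (%x. th r (fst x) (snd x)) sequentially"
 unfolding th_def
 by (rule Weierstrass_m_test[OF _ summable_th_bound[of \<rho> r R]])
   (use assms in \<open>auto intro!: norm_th_term_le\<close>)

lemma continuous_on_th_term:
 "continuous_on A (%x. th_term r (fst x) (snd x) m)"
 unfolding th_term_def theta_freq_def by (intro continuous_intros) auto

lemma continuous_on_th: "continuous_on (UNIV \<times> ball 0 1) (%x. th r (fst x) (snd x))"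
proof -
 have "\<exists>d>0. ball x d \<subseteq> UNIV \<times> ball 0 1 \<and> continuous_on (ball x d) (%x. th r (fst x) (snd x))"
  if x: "x \<in> UNIV \<times> ball 0 1" for x :: "complex \<times> complex"
 proof -
  obtain \<rho> where \<rho>: "norm (snd x) < \<rho>" "\<rho> < 1" using x dense by (auto simp: mem_Times_iff)
  then have \<rho>0: "0 \<le> \<rho>" by (meson norm_ge_zero order_trans less_imp_le)
  define R where "R = norm (fst x) + 1"
  have o: "open (ball 0 R \<times> ball 0 \<rho> :: (complex \<times> complex) set)" by (intro open_Times) auto
  have "x \<in> ball 0 R \<times> ball 0 \<rho>" using \<rho> by (auto simp: R_def mem_Times_iff)
  then obtain d where d: "d > 0" "ball x d \<subseteq> ball 0 R \<times> ball 0 \<rho>"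
   using o by (meson openE)
  have "uniform_limit (ball x d) (%N x. \<Sum>m<N. th_term r (fst x) (snd x) m) (%x. th r (fst x) (snd x)) sequentially"
   using d \<rho> \<rho>0 by (intro th_uniform_limit[of \<rho> _ R]) auto
  then have "continuous_on (ball x d) (%x. th r (fst x) (snd x))"
   by (rule uniform_limit_theorem[rotated])
     (auto intro!: always_eventually continuous_on_sum continuous_on_th_term)
  moreover have "ball 0 R \<times> ball 0 \<rho> \<subseteq> (UNIV \<times> ball 0 1 :: (complex \<times> complex) set)"
   using \<rho> by auto
  ultimately show ?thesis using d by blast
 qed
 then show ?thesis
  by (metis (no_types, lifting) continuous_on_eq_continuous_at continuous_on_interior
    continuous_at_imp_continuous_on centre_in_ball interior_open open_ball)
qed

lemma th_term_deriv: "((%z. th_term r z q m) has_field_derivative th_term (Suc r) z q m) (at z)"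
 unfolding th_term_def by (auto intro!: derivative_eq_intros simp: algebra_simps)

lemma has_field_derivative_th:
 assumes "norm q < 1"
 shows "((%z. th r z q) has_field_derivative th (Suc r) z q) (at z)"
proof -
 have ul: "uniform_limit (cball z 1) (%N z. \<Sum>m<N. th_term r z q m) (%z. th r z q) sequentially"
  unfolding th_def
 proof (rule Weierstrass_m_test[OF _ summable_th_bound[of "norm q" r "norm z + 1"]])
  fix n w assume "w \<in> cball z 1"
  then have "norm w \<le> norm z + 1"
   using norm_triangle_ineq2[of w z] by (auto simp: dist_norm norm_minus_commute)
  then show "norm (th_term r w q n) \<le> th_bound r (norm z + 1) (norm q) n"
   by (intro norm_th_term_le) auto
 qed (use assms in auto)
 have D: "((%z. \<Sum>m<N. th_term r z q m) has_field_derivative (\<Sum>m<N. th_term (Suc r) w q m)) (at w)" for N w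
  by (intro DERIV_sum th_term_deriv)
 have ev: "\<forall>\<^sub>F N in sequentially. continuous_on (cball z 1) (%z. \<Sum>m<N. th_term r z q m) \<and>
   (\<forall>w \<in> ball z 1. ((%z. \<Sum>m<N. th_term r z q m) has_field_derivative (\<Sum>m<N. th_term (Suc r) w q m)) (at w))"
  by (intro always_eventually allI conjI ballI D DERIV_continuous_on[OF DERIV_subset[OF D]]) auto
 obtain g' where g': "!!w. w \<in> ball z 1 ==> ((%z. th r z q) has_field_derivative g' w) (at w) \<and>
   (%N. \<Sum>m<N. th_term (Suc r) w q m) \<longlonglongrightarrow> g' w"
  using has_complex_derivative_uniform_limit[OF ev ul] by auto
 have "(%N. \<Sum>m<N. th_term (Suc r) z q m) \<longlonglongrightarrow> th (Suc r) z q"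
  unfolding th_def by (rule summable_LIMSEQ[OF summable_th_term[OF assms]])
 then have "g' z = th (Suc r) z q"
  using g'[of z] LIMSEQ_unique by auto
 then show ?thesis using g'[of z] by auto
qed

lemma holomorphic_on_th [holomorphic_intros]:
 assumes "norm q < 1" "f holomorphic_on A"
 shows "(%z. th r (f z) q) holomorphic_on A"
proof -
 have "(%z. th r z q) holomorphic_on UNIV"
  using has_field_derivative_th[OF assms(1)] holomorphic_on_open by blast
 then show ?thesis
  using holomorphic_on_compose[OF assms(2) holomorphic_on_subset, of "%z. th r z q" UNIV] by (auto simp: o_def)
qed

lemma analytic_on_th [analytic_intros]:
 assumes "norm q < 1" "f analytic_on A"
 shows "(%z. th r (f z) q) analytic_on A"
proof -
 have "(%z. th r z q) analytic_on UNIV"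
  by (simp add: analytic_on_open holomorphic_on_th[OF assms(1)])
 then show ?thesis
  using analytic_on_compose[OF assms(2) analytic_on_subset, of "%z. th r z q" UNIV] by (auto simp: o_def)
qed

section \<open>Dependence on the nome and elementary values\<close>

lemma holomorphic_on_th_nome: "(%q. th r z q) holomorphic_on ball 0 1"
proof (rule holomorphic_uniform_sequence[OF open_ball])
 show "(%q. \<Sum>m<N. th_term r z q m) holomorphic_on ball 0 1" for N
  unfolding th_term_def by (intro holomorphic_intros)
 fix q :: complex assume q: "q \<in> ball 0 1"
 define d where "d = (1 - norm q) / 2"
 have d: "d > 0" "cball q d \<subseteq> ball 0 1" and qd: "norm q + d < 1"
  using q by (auto simp: d_def dist_norm field_simps) (smt (verit) norm_triangle_ineq2 norm_minus_commute)
 have "uniform_limit (cball q d) (%N q. \<Sum>m<N. th_term r z q m) (%q. th r z q) sequentially"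
  unfolding th_def
 proof (rule Weierstrass_m_test[OF _ summable_th_bound[of "norm q + d" r "norm z"]])
  fix n x assume "x \<in> cball q d"
  then have "norm x \<le> norm q + d"
   using norm_triangle_ineq2[of x q] by (auto simp: dist_norm norm_minus_commute)
  then show "norm (th_term r z x n) \<le> th_bound r (norm z) (norm q + d) n"
   by (intro norm_th_term_le) auto
 qed (use d qd in auto)
 then show "\<exists>d>0. cball q d \<subseteq> ball 0 1 \<and> uniform_limit (cball q d) (%N q. \<Sum>m<N. th_term r z q m) (%q. th r z q) sequentially"
  using d by blast
qed

lemma analytic_on_th_nome [analytic_intros]:
 assumes "f analytic_on A" "!!t. t \<in> A ==> norm (f t) < 1"
 shows "(%t. th r z (f t)) analytic_on A"
proof -
 have "(%q. th r z q) analytic_on ball 0 1"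
  by (simp add: analytic_on_open holomorphic_on_th_nome)
 then have "(%q. th r z q) analytic_on f ` A"
  by (rule analytic_on_subset) (use assms in auto)
 then show ?thesis
  using analytic_on_compose[OF assms(1), of "%q. th r z q"] by (auto simp: o_def)
qed

lemma th_minus: "th r (- z) q = (-1) ^ Suc r * th r z q" if "norm q < 1"
proof -
 have "th_term r (- z) q m = (-1) ^ Suc r * th_term r z q m" for m
  by (cases "even r") (simp_all add: th_term_def algebra_simps)
 then show ?thesis
  using suminf_mult[OF summable_th_term[OF that], of "(-1) ^ Suc r" r z] by (simp add: th_def)
qed

lemma th_0_0 [simp]: "norm q < 1 ==> th 0 0 q = 0"
 using th_minus[of q 0 0] by simp

lemma th_2_0 [simp]: "norm q < 1 ==> th 2 0 q = 0"
 using th_minus[of q 2 0] by simp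

lemma th_nome_0: "th 0 z 0 = 2 * sin (of_real pi * z)"
proof -
 have "th 0 z 0 = (\<Sum>m\<in>{0}. th_term 0 z 0 m)"
  unfolding th_def by (rule suminf_finite) (auto simp: th_term_def)
 also have "\<dots> = 2 * sin (of_real pi * z)"
  by (simp add: th_term_def theta_freq_def sin_exp_eq field_simps)
 finally show ?thesis .
qed

lemma exp_theta_freq: "exp (theta_freq m) = -1"
 using exp_integer_2pi_plus1[of "real m"] by (simp add: theta_freq_def add.commute)

lemma th_plus_1: "norm q < 1 ==> th r (z + 1) q = - th r z q"
proof -
 assume q: "norm q < 1"
 have "th_term r (z + 1) q m = - th_term r z q m" for m
  by (simp add: th_term_def distrib_left exp_add exp_diff exp_theta_freq)
   (simp add: algebra_simps)?
 then show ?thesis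
  using suminf_minus[OF summable_th_term[OF q]] by (simp add: th_def)
qed

lemma nome_nonzero [simp]: "nome tau ~= 0"
 by (simp add: nome_def)

lemma norm_nome_less_1 [simp]: "tau \<in> uhp ==> norm (nome tau) < 1"
 by (simp add: nome_def upper_half_plane_def norm_exp)

lemma analytic_nome [analytic_intros]: "f analytic_on A ==> (%x. nome (f x)) analytic_on A"
 unfolding nome_def by (intro analytic_intros)

lemma nome_surj:
 assumes "q ~= 0" "norm q < 1"
 obtains tau where "tau \<in> uhp" "nome tau = q"
proof
 let ?t = "Ln q / (of_real pi * \<i>)"
 show n: "nome ?t = q" using assms by (simp add: nome_def)
 have "norm (nome ?t) = exp (- pi * Im ?t)" by (simp only: nome_def norm_exp_eq_Re times_complex.sel) simp
 then have "exp (- pi * Im ?t) < 1" unfolding n using assms by simp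
 then show "?t \<in> uhp" by (simp add: upper_half_plane_def zero_less_mult_iff del: Im_divide)
qed

subsection \<open>Quasi-periodicity\<close>

text \<open>A partial theta series H. With x = exp (pi i z), theta is x H(x^2) minus its mirror
  image under x -> 1/x, divided by i. H is a power series in one variable with a simple functional
  equation, from which the quasi-period tau is derived.\<close>

definition theta_half :: "complex => complex => complex" where
 "theta_half q y = suminf (%m. ((-1) ^ m * q ^ (m * (m + 1))) * y ^ m)"

lemma summable_theta_half:
 fixes q y :: complex
 assumes "norm q < 1"
 shows "summable (%m. ((-1) ^ m * q ^ (m * (m + 1))) * y ^ m)"
proof (rule summable_comparison_test'[of _ 0])
 define B where "B = max 1 (norm y)"
 show "summable (%m. norm q ^ (m * (m + 1)) * B ^ (2 * m + 1))"
  using assms by (intro summable_theta_majorant) (auto simp: B_def)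
 fix m :: nat
 have "norm y ^ m \<le> B ^ m" by (intro power_mono) (auto simp: B_def)
 also have "\<dots> \<le> B ^ (2 * m + 1)" by (intro power_increasing) (auto simp: B_def)
 finally show "norm (((-1) ^ m * q ^ (m * (m + 1))) * y ^ m) \<le> norm q ^ (m * (m + 1)) * B ^ (2 * m + 1)"
  by (auto simp: norm_mult norm_power intro!: mult_left_mono)
qed

lemma th_eq_theta_half:
 assumes "norm q < 1" "x = exp (of_real pi * \<i> * z)"
 shows "th 0 z q = (x * theta_half q (x\<^sup>2) - inverse x * theta_half q (inverse x ^ 2)) / \<i>"
proof -
 have e1: "exp (theta_freq m * z) = x * (x\<^sup>2) ^ m" for m
  unfolding assms(2) exp_of_nat_mult[symmetric] exp_add[symmetric]
  by (simp add: theta_freq_def algebra_simps)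
 have e2: "exp (- (theta_freq m * z)) = inverse x * (inverse x ^ 2) ^ m" for m
  by (simp add: exp_minus e1 power_inverse)
 have "th_term 0 z q m = (x * (((-1) ^ m * q ^ (m * (m + 1))) * (x\<^sup>2) ^ m) -
   inverse x * (((-1) ^ m * q ^ (m * (m + 1))) * (inverse x ^ 2) ^ m)) / \<i>" for m
  by (simp only: th_term_def e1 e2 minus_mult_left[symmetric]) (simp add: algebra_simps)
 moreover have "(%m. (x * (((-1) ^ m * q ^ (m * (m + 1))) * (x\<^sup>2) ^ m) -
   inverse x * (((-1) ^ m * q ^ (m * (m + 1))) * (inverse x ^ 2) ^ m)) / \<i>) sums
   ((x * theta_half q (x\<^sup>2) - inverse x * theta_half q (inverse x ^ 2)) / \<i>)"
  unfolding theta_half_def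
  by (intro sums_divide sums_diff sums_mult summable_sums summable_theta_half assms)
 ultimately show ?thesis by (simp add: th_def sums_iff)
qed

text \<open>\<open>(m + 1) * (m + 2) = m * (m + 1) + 2 * (m + 1)\<close>, so rescaling the argument
  by q^2 shifts the index by one and loses only the constant term 1.\<close>

lemma theta_half_shift:
 assumes "norm q < 1"
 shows "theta_half q y = 1 - q\<^sup>2 * y * theta_half q (q\<^sup>2 * y)"
proof -
 have s: "(%m. ((-1) ^ m * q ^ (m * (m + 1))) * (q\<^sup>2 * y) ^ m) sums theta_half q (q\<^sup>2 * y)"
  unfolding theta_half_def by (intro summable_sums summable_theta_half assms)
 have "(%m. - (q\<^sup>2 * y) * (((-1) ^ m * q ^ (m * (m + 1))) * (q\<^sup>2 * y) ^ m)) sums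
   (- (q\<^sup>2 * y) * theta_half q (q\<^sup>2 * y))"
  by (intro sums_mult s)
 also have "(%m. - (q\<^sup>2 * y) * (((-1) ^ m * q ^ (m * (m + 1))) * (q\<^sup>2 * y) ^ m)) =
   (%m. ((-1) ^ Suc m * q ^ (Suc m * (Suc m + 1))) * y ^ Suc m)"
  by (rule ext) (simp add: power_mult_distrib power_add power_mult[symmetric] algebra_simps power2_eq_square)
 finally have "(%m. ((-1) ^ m * q ^ (m * (m + 1))) * y ^ m) sums (- (q\<^sup>2 * y) * theta_half q (q\<^sup>2 * y) + 1)"
  by (subst (asm) sums_Suc_iff) (simp add: algebra_simps)
 then show ?thesis by (simp add: theta_half_def sums_iff)
qed

text \<open>Under z -> z + tau the variable x becomes x q. Both halves move by one step of
  \<open>theta_half_shift\<close>, in opposite directions, and the two constant terms that appear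
  cancel.\<close>

lemma th_plus_tau:
 assumes "tau \<in> uhp"
 shows "th 0 (z + tau) (nome tau) = - (exp (- of_real pi * \<i> * tau) * exp (- 2 * of_real pi * \<i> * z)) * th 0 z (nome tau)"
proof -
 define q where "q = nome tau"
 define x where "x = exp (of_real pi * \<i> * z)"
 have q: "norm q < 1" "q ~= 0" using assms by (auto simp: q_def)
 have x0: "x ~= 0" by (simp add: x_def)
 have xq: "x * q = exp (of_real pi * \<i> * (z + tau))"
  by (simp add: x_def q_def nome_def exp_add[symmetric] algebra_simps)
 have c: "exp (- of_real pi * \<i> * tau) * exp (- 2 * of_real pi * \<i> * z) = inverse q * inverse x ^ 2"
  by (simp add: x_def q_def nome_def exp_minus[symmetric] exp_of_nat_mult[symmetric] algebra_simps)
 have 1: "q\<^sup>2 * x\<^sup>2 * theta_half q (q\<^sup>2 * x\<^sup>2) = 1 - theta_half q (x\<^sup>2)"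
  using theta_half_shift[OF q(1), of "x\<^sup>2"] by simp
 have 2: "theta_half q (inverse (x * q) ^ 2) = 1 - inverse x ^ 2 * theta_half q (inverse x ^ 2)"
  using theta_half_shift[OF q(1), of "inverse (x * q) ^ 2"] q x0
  by (simp add: power_mult_distrib inverse_eq_divide field_simps)
 have A: "x * q * theta_half q ((x * q)\<^sup>2) = inverse q * inverse x * (1 - theta_half q (x\<^sup>2))"
  unfolding 1[symmetric] using q x0 by (simp add: field_simps power2_eq_square)
 have "th 0 (z + tau) q = (inverse q * inverse x * (1 - theta_half q (x\<^sup>2)) -
   inverse (x * q) * (1 - inverse x ^ 2 * theta_half q (inverse x ^ 2))) / \<i>"
  by (simp only: th_eq_theta_half[OF q(1) xq] A 2)
 also have "\<dots> = - (inverse q * inverse x ^ 2) * ((x * theta_half q (x\<^sup>2) - inverse x * theta_half q (inverse x ^ 2)) / \<i>)"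
  using q x0 by (simp add: field_simps power2_eq_square)
 also have "\<dots> = - (inverse q * inverse x ^ 2) * th 0 z q"
  by (simp only: th_eq_theta_half[OF q(1) x_def])
 finally show ?thesis unfolding c q_def .
qed

text \<open>If theta vanished for all z, the partial series g would satisfy y g(y) = g(1/y). The
  entire function y g(y) would then be bounded, on the unit disc by compactness and outside it by
  this symmetry, hence constant and equal to its value 0 at 0; but g(0) = 1.\<close>

lemma th_not_identically_0:
 assumes "norm q < 1"
 obtains z where "th 0 z q ~= 0"
proof -
 have False if Z: "!!z. th 0 z q = 0"
 proof -
  define g where "g = theta_half q"
  have g: "(g has_field_derivative (suminf (%m. diffs (%m. (-1) ^ m * q ^ (m * (m + 1))) m * y ^ m))) (at y)" for y
   unfolding g_def theta_half_def
   by (rule termdiffs_strong_converges_everywhere[OF summable_theta_half[OF assms]])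
  then have hg: "g holomorphic_on UNIV" using holomorphic_on_open by blast
  have g0: "g 0 = 1"
  proof -
   have "g 0 = (\<Sum>m\<in>{0}. ((-1) ^ m * q ^ (m * (m + 1))) * 0 ^ m)"
    unfolding g_def theta_half_def by (rule suminf_finite) auto
   then show ?thesis by simp
  qed
  have sym: "y * g y = g (inverse y)" if y: "y ~= 0" for y
  proof -
   define z where "z = Ln y / (2 * of_real pi * \<i>)"
   define x where "x = exp (of_real pi * \<i> * z)"
   have x0: "x ~= 0" by (simp add: x_def)
   have "x\<^sup>2 = exp (2 * of_real pi * \<i> * z)"
    unfolding x_def exp_of_nat_mult[symmetric] by (simp add: algebra_simps)
   also have "\<dots> = y" using y by (simp add: z_def)
   finally have x2: "x\<^sup>2 = y" .
   have "x * g (x\<^sup>2) = inverse x * g (inverse x ^ 2)"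
    using th_eq_theta_half[OF assms x_def] Z[of z] by (simp add: g_def)
   then have "x * (x * g (x\<^sup>2)) = g (inverse (x\<^sup>2))" using x0 by (simp add: power_inverse)
   then show ?thesis unfolding x2[symmetric] by (simp add: power2_eq_square mult.assoc)
  qed
  have "compact (g ` cball 0 1)"
   by (intro compact_continuous_image holomorphic_on_imp_continuous_on holomorphic_on_subset[OF hg]) auto
  then have "bounded (g ` cball 0 1)" by (rule compact_imp_bounded)
  then obtain B where "\<forall>x\<in>g ` cball 0 1. norm x \<le> B" by (auto simp only: bounded_iff)
  then have B: "!!y. norm y \<le> 1 ==> norm (g y) \<le> B" by auto
  have "norm (y * g y) \<le> max B 0" for y
  proof (cases "norm y \<le> 1")
   case True
   then have "norm y * norm (g y) \<le> 1 * max B 0" using B[of y] by (intro mult_mono) auto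
   then show ?thesis by (simp add: norm_mult)
  next
   case False
   then have "y ~= 0" "norm (inverse y) \<le> 1" by (auto simp: norm_inverse inverse_le_1_iff)
   then show ?thesis using sym[of y] B[of "inverse y"] by (simp add: le_max_iff_disj)
  qed
  then have "bounded (range (%y. y * g y))" by (auto simp: bounded_iff)
  moreover have "(%y. y * g y) holomorphic_on UNIV" by (intro holomorphic_intros hg)
  ultimately have "(%y. y * g y) constant_on UNIV" by (rule Liouville_theorem[rotated])
  then obtain c where c: "!!y. y * g y = c" by (auto simp: constant_on_def)
  from c[of 0] have gz: "g y = 0" if "y ~= 0" for y using c[of y] that by simp
  have "(g \<longlongrightarrow> g 0) (at 0)"
   using g[of 0] by (metis DERIV_isCont isCont_def)
  moreover have "(g \<longlongrightarrow> 0) (at 0)"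
   by (rule tendsto_eventually) (auto simp: eventually_at_filter gz)
  ultimately have "g 0 = 0" using tendsto_unique[OF at_neq_bot] by blast
  with g0 show False by simp
 qed
 then show ?thesis using that by blast
qed

section \<open>Quasi-periodic entire functions\<close>

lemma zero_in_period_lattice [simp, intro]: "0 \<in> Lat tau"
 unfolding period_lattice_def by (rule CollectI, rule exI[of _ 0], rule exI[of _ 0]) simp

lemma period_lattice_add: "x \<in> Lat tau ==> y \<in> Lat tau ==> x + y \<in> Lat tau"
 unfolding period_lattice_def
 by clarify (metis (no_types, opaque_lifting) add.assoc add.left_commute distrib_right of_int_add)

lemma period_lattice_minus: "x \<in> Lat tau ==> - x \<in> Lat tau"
 unfolding period_lattice_def
 by clarify (metis (no_types, opaque_lifting) minus_add_distrib mult_minus_left of_int_minus)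

lemma period_lattice_uminus_iff [simp]: "- x \<in> Lat tau \<longleftrightarrow> x \<in> Lat tau"
 using period_lattice_minus[of x] period_lattice_minus[of "-x"] by auto

lemma period_lattice_add_iff: "y \<in> Lat tau ==> x + y \<in> Lat tau \<longleftrightarrow> x \<in> Lat tau"
 using period_lattice_add[of x tau y] period_lattice_add[of "x + y" tau "- y"] by auto

lemma period_latticeI [intro]: "of_int a + of_int b * tau \<in> Lat tau"
 by (auto simp: period_lattice_def)

lemma period_lattice_basis [simp]: "1 \<in> Lat tau" "tau \<in> Lat tau"
 using period_latticeI[of 1 0 tau] period_latticeI[of 0 1 tau] by auto

lemma upper_half_plane_iff: "tau \<in> uhp \<longleftrightarrow> Im tau > 0"
 by (simp add: upper_half_plane_def)

lemma int_induct2: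
 fixes k :: int
 assumes "P 0" "!!k. P k \<longleftrightarrow> P (k + 1)"
 shows "P k"
proof (induction k rule: int_induct[where k = 0])
 case (step2 i)
 then show ?case using assms(2)[of "i - 1"] by simp
qed (use assms in auto)

lemma periodic_int:
 fixes h :: "complex => 'a"
 assumes "!!z. h (z + w) = h z"
 shows "h (z + of_int k * w) = h z"
proof (induction k rule: int_induct2)
 case (2 k)
 show ?case using assms[of "z + of_int k * w"] by (simp add: algebra_simps)
qed auto

lemma periodic_period_lattice:
 assumes "!!z. h (z + 1) = h z" "!!z. h (z + tau) = h z" "\<omega> \<in> Lat tau"
 shows "h (z + \<omega>) = h z"
proof -
 obtain a b where "\<omega> = of_int a + of_int b * tau" using assms(3) by (auto simp: period_lattice_def)
 then show ?thesis
  using periodic_int[of h tau "z + of_int a" b] periodic_int[of h 1 z a] assms(1,2)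
  by (simp add: add.assoc)
qed

lemma entire_elliptic_constant:
 assumes h: "h holomorphic_on UNIV" and tau: "tau \<in> uhp"
  and "!!z. h (z + 1) = h z" "!!z. h (z + tau) = h z"
 obtains c where "!!z. h z = c"
proof -
 define K where "K = (%(x, y). of_real x + of_real y * tau) ` ({0..1} \<times> {0..1})"
 have "compact K" unfolding K_def
  by (intro compact_continuous_image compact_Times)
    (auto intro!: continuous_intros simp: case_prod_unfold)
 then have "compact (h ` K)"
  by (intro compact_continuous_image holomorphic_on_imp_continuous_on holomorphic_on_subset[OF h]) auto
 moreover have "range h \<subseteq> h ` K"
 proof safe
  fix z
  \<comment> \<open>Real coordinates of z in the basis 1, tau; their fractional parts place a
    translate of z in the compact parallelogram \<open>K\<close>.\<close>
  define y where "y = Im z / Im tau"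
  define x where "x = Re z - y * Re tau"
  have z: "z = of_real x + of_real y * tau"
   using tau by (auto simp: complex_eq_iff x_def y_def upper_half_plane_iff)
  define z' where "z' = of_real (frac x) + of_real (frac y) * tau"
  have "z' = z + (of_int (- \<lfloor>x\<rfloor>) + of_int (- \<lfloor>y\<rfloor>) * tau)"
   by (simp add: z z'_def frac_def algebra_simps)
  then have "h z' = h z"
   using periodic_period_lattice[of h tau, OF assms(3,4) period_latticeI] by metis
  moreover have "z' \<in> K" unfolding K_def z'_def
   by (rule image_eqI[of _ _ "(frac x, frac y)"]) (auto simp: frac_lt_1 less_imp_le)
  ultimately show "h z \<in> h ` K" by (metis imageI)
 qed
 ultimately have "bounded (range h)" using compact_imp_bounded bounded_subset by blast
 then have "h constant_on UNIV" using Liouville_theorem h by blast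
 then show ?thesis using that by (auto simp: constant_on_def)
qed

text \<open>The identity theorem: f vanishes on the non-empty open set where g does not. It serves
  to cancel a theta factor without looking at its zeros.\<close>

lemma entire_mult_eq_0:
 assumes "f holomorphic_on UNIV" "g holomorphic_on UNIV" "!!z. f z * g z = 0" "g z0 ~= 0"
 shows "f z = 0"
proof -
 have o: "open (g -` (- {0}))"
  using holomorphic_on_imp_continuous_on[OF assms(2)] by (intro open_vimage) auto
 have "f w = 0" if "w \<in> g -` (- {0})" for w
  using assms(3)[of w] that by auto
 then show ?thesis
  using analytic_continuation_open[OF o open_UNIV, of f "%_. 0" z] assms by auto
qed

text \<open>At a zero of k the quotient gets the value \<open>deriv f z / deriv k z\<close>. By
  l'Hopital it is continuous there, and a continuous isolated singularity is removable.\<close>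

lemma entire_divide:
 assumes f: "f holomorphic_on UNIV" and k: "k holomorphic_on UNIV"
  and simple: "!!z. k z = 0 ==> deriv k z ~= 0" and van: "!!z. k z = 0 ==> f z = 0"
 obtains g where "g holomorphic_on UNIV" "!!z. f z = k z * g z"
proof
 define g where "g = (%z. if k z = 0 then deriv f z / deriv k z else f z / k z)"
 show "f z = k z * g z" for z using van by (auto simp: g_def)
 have "\<exists>e>0. g holomorphic_on ball z e" for z
 proof -
  obtain z1 where "k z1 ~= 0"
  proof (rule ccontr)
   assume "\<not> thesis"
   then have "k = (%_. 0)" using that by auto
   then show False using simple[of 0] by simp
  qed
  have "\<exists>e>0. \<forall>w. dist w z < e \<and> w ~= z --> k w ~= 0"
  proof (cases "k z = 0")
   case True
   obtain r where "0 < r" "ball z r \<subseteq> UNIV" "!!w. w \<in> ball z r - {z} ==> k w ~= 0"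
    using isolated_zeros[OF k open_UNIV connected_UNIV UNIV_I True UNIV_I \<open>k z1 ~= 0\<close>] by metis
   then show ?thesis by (metis DiffI dist_commute mem_ball singletonD)
  next
   case False
   have "isCont k z"
    using holomorphic_on_imp_continuous_on[OF k] by (auto simp: continuous_on_eq_continuous_at)
   then show ?thesis using continuous_at_avoid[of z k 0] False by (metis dist_commute)
  qed
  then have "\<exists>e>0. \<forall>w\<in>ball z e - {z}. k w ~= 0" by (auto simp: dist_commute)
  then obtain e where e: "e > 0" "!!w. w \<in> ball z e - {z} ==> k w ~= 0" by blast
  have "g holomorphic_on ball z e"
  proof (rule no_isolated_singularity'[where K = "{z}"])
   have "(%w. f w / k w) holomorphic_on ball z e - {z}"
    by (intro holomorphic_intros holomorphic_on_subset[OF f] holomorphic_on_subset[OF k]) (use e in auto)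
   then show "g holomorphic_on ball z e - {z}"
    by (rule holomorphic_transform) (use e in \<open>auto simp: g_def\<close>)
   have "(g \<longlongrightarrow> g z) (at z)"
   proof (cases "k z = 0")
    case True
    have "((%w. f w / k w) \<longlongrightarrow> deriv f z / deriv k z) (at z)"
     using simple[OF True] van[OF True] True
     by (intro lhopital_complex_simple[OF holomorphic_derivI[OF f] holomorphic_derivI[OF k]]) auto
    moreover have "eventually (%w. f w / k w = g w) (at z)"
     using e by (auto simp: eventually_at g_def dist_commute intro!: exI[of _ e])
    ultimately have "(g \<longlongrightarrow> deriv f z / deriv k z) (at z)" by (rule Lim_transform_eventually)
    then show ?thesis using True by (simp add: g_def)
   next
    case False
    have "isCont (%w. f w / k w) z"
     using False holomorphic_on_imp_continuous_on[OF f] holomorphic_on_imp_continuous_on[OF k]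
     by (intro continuous_divide) (auto simp: continuous_on_eq_continuous_at)
    then have "((%w. f w / k w) \<longlongrightarrow> g z) (at z)" using False by (simp add: isCont_def g_def)
    moreover have "eventually (%w. f w / k w = g w) (at z)"
     using e by (auto simp: eventually_at g_def dist_commute intro!: exI[of _ e])
    ultimately show ?thesis by (rule Lim_transform_eventually)
   qed
   then show "(g \<longlongrightarrow> g w) (at w within ball z e)" if "w \<in> {z}" for w
    using that tendsto_within_subset[OF \<open>(g \<longlongrightarrow> g z) (at z)\<close>] by simp
  qed auto
  then show ?thesis using e by blast
 qed
 then have "g analytic_on UNIV" by (auto simp: analytic_on_def)
 then show "g holomorphic_on UNIV" by (rule analytic_imp_holomorphic)
qed

subsection \<open>The zeros of the theta function\<close>

text \<open>The \<open>q\<close>-exponential \<open>\<Prod>k. (1 - Q\<^sup>k x)\<close>, as its power series; its zeros are found from the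
  functional equation instead of the product.\<close>

definition qexp_coeff :: "complex => nat => complex" where
 "qexp_coeff Q k = (\<Prod>j<k. - (Q ^ j) / (1 - Q ^ Suc j))"

definition qexp :: "complex => complex => complex" where
 "qexp Q x = suminf (%k. qexp_coeff Q k * x ^ k)"

lemma one_minus_power_nonzero: "norm Q < 1 ==> 1 - Q ^ Suc j ~= (0 :: complex)"
 by (metis eq_iff_diff_eq_0 norm_one norm_power power_Suc_less_one norm_ge_zero less_irrefl
   power_less_one_iff zero_less_Suc nat.distinct(1) order_le_less)

lemma summable_qexp:
 assumes "norm Q < 1"
 shows "summable (%k. qexp_coeff Q k * x ^ k)"
proof -
 have "(%k. norm (- (Q ^ k) / (1 - Q ^ Suc k) * x)) \<longlonglongrightarrow> norm (- 0 / (1 - 0) * x)"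
  by (intro tendsto_intros LIMSEQ_Suc LIMSEQ_power_zero assms) auto
 then have "eventually (%k. norm (- (Q ^ k) / (1 - Q ^ Suc k) * x) < 1/2) sequentially"
  by (rule order_tendstoD) auto
 then obtain N where N: "!!k. k \<ge> N ==> norm (- (Q ^ k) / (1 - Q ^ Suc k) * x) < 1/2"
  by (auto simp: eventually_sequentially)
 show ?thesis
 proof (rule summable_ratio_test[of "1/2" N])
  fix k assume "k \<ge> N"
  have "norm (qexp_coeff Q (Suc k) * x ^ Suc k) =
    norm (- (Q ^ k) / (1 - Q ^ Suc k) * x) * norm (qexp_coeff Q k * x ^ k)"
   by (simp add: qexp_coeff_def norm_mult norm_divide norm_power)
  also have "\<dots> \<le> 1/2 * norm (qexp_coeff Q k * x ^ k)"
   using N[OF \<open>k \<ge> N\<close>] by (intro mult_right_mono) auto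
  finally show "norm (qexp_coeff Q (Suc k) * x ^ Suc k) \<le> 1/2 * norm (qexp_coeff Q k * x ^ k)" .
 qed auto
qed

text \<open>Coefficientwise this is \<open>qexp_coeff Q (Suc k) * (1 - Q ^ Suc k) = - (Q ^ k) *
  qexp_coeff Q k\<close>, the recursion that the product formula for the coefficients
  solves.\<close>

lemma qexp_shift:
 assumes "norm Q < 1"
 shows "qexp Q x = (1 - x) * qexp Q (Q * x)"
proof -
 have c: "qexp_coeff Q (Suc k) * (1 - Q ^ Suc k) = - (Q ^ k) * qexp_coeff Q k" for k
  using one_minus_power_nonzero[OF assms, of k] by (simp add: qexp_coeff_def)
 have s: "(%k. qexp_coeff Q k * x ^ k) sums qexp Q x" for x
  unfolding qexp_def by (intro summable_sums summable_qexp assms)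
 have "(%k. qexp_coeff Q k * x ^ k - qexp_coeff Q k * (Q * x) ^ k) sums (qexp Q x - qexp Q (Q * x))"
  by (intro sums_diff s)
 then have "(%k. qexp_coeff Q (Suc k) * x ^ (Suc k) - qexp_coeff Q (Suc k) * (Q * x) ^ (Suc k)) sums
   (qexp Q x - qexp Q (Q * x))"
  by (subst sums_Suc_iff) simp
 also have "(%k. qexp_coeff Q (Suc k) * x ^ (Suc k) - qexp_coeff Q (Suc k) * (Q * x) ^ (Suc k)) =
   (%k. - x * (qexp_coeff Q k * (Q * x) ^ k))"
 proof
  fix k
  have "qexp_coeff Q (Suc k) * x ^ (Suc k) - qexp_coeff Q (Suc k) * (Q * x) ^ (Suc k) =
    (qexp_coeff Q (Suc k) * (1 - Q ^ Suc k)) * x ^ Suc k"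
   by (simp only: power_mult_distrib) (simp add: algebra_simps)
  also have "\<dots> = - x * (qexp_coeff Q k * (Q * x) ^ k)"
   unfolding c by (simp add: power_mult_distrib algebra_simps)
  finally show "qexp_coeff Q (Suc k) * x ^ (Suc k) - qexp_coeff Q (Suc k) * (Q * x) ^ (Suc k) =
   - x * (qexp_coeff Q k * (Q * x) ^ k)" .
 qed
 finally have "qexp Q x - qexp Q (Q * x) = - x * qexp Q (Q * x)"
  using sums_mult[OF s[of "Q * x"], of "- x"] sums_unique2 by blast
 then show ?thesis by (simp add: algebra_simps)
qed

lemma holomorphic_qexp: "norm Q < 1 ==> qexp Q holomorphic_on UNIV"
 unfolding qexp_def
 using termdiffs_strong_converges_everywhere[OF summable_qexp] holomorphic_on_open by blast

lemma qexp_0 [simp]: "qexp Q 0 = 1"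
proof -
 have "qexp Q 0 = (\<Sum>k\<in>{0}. qexp_coeff Q k * 0 ^ k)"
  unfolding qexp_def by (rule suminf_finite) auto
 then show ?thesis by (simp add: qexp_coeff_def)
qed

lemma qexp_shift_power:
 "norm Q < 1 ==> qexp Q x = (\<Prod>j<k. 1 - (Q ^ j) * x) * qexp Q (Q ^ k * x)"
proof (induction k)
 case (Suc k)
 then show ?case using qexp_shift[of Q "Q ^ k * x"] by (simp add: mult.assoc)
qed auto

lemma qexp_eventually_nonzero:
 assumes "norm Q < 1"
 shows "eventually (%k. qexp Q (Q ^ k * x) ~= 0) sequentially"
proof -
 have "(%k. Q ^ k * x) \<longlonglongrightarrow> 0 * x"
  by (intro tendsto_intros LIMSEQ_power_zero assms)
 moreover have "isCont (qexp Q) 0"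
  using holomorphic_on_imp_continuous_on[OF holomorphic_qexp[OF assms]] by (simp add: continuous_on_eq_continuous_at)
 ultimately have "(%k. qexp Q (Q ^ k * x)) \<longlonglongrightarrow> qexp Q 0"
  by (intro isCont_tendsto_compose[of 0 "qexp Q"]) auto
 then show ?thesis by (rule tendsto_imp_eventually_ne) auto
qed

text \<open>Iterating the functional equation splits off linear factors and moves the argument
  towards 0, where \<open>qexp\<close> is 1. A zero must therefore come from one of the factors
  split off.\<close>

lemma qexp_eq_0D:
 assumes "norm Q < 1" "qexp Q x = 0"
 obtains k where "Q ^ k * x = 1"
proof -
 obtain k where "qexp Q (Q ^ k * x) ~= 0"
  using eventually_happens[OF qexp_eventually_nonzero[OF assms(1), of x]] by auto
 then have "\<exists>j. 1 - (Q ^ j) * x = 0" using qexp_shift_power[OF assms(1), of x k] assms(2) by auto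
 then show ?thesis using that by (auto simp: algebra_simps)
qed

text \<open>The powers of Q have distinct moduli, so exactly one factor 1 - Q^k x vanishes. The
  cofactor g is non-zero at x, and the product rule leaves - Q^k g(x).\<close>

lemma qexp_simple_zero:
 assumes "norm Q < 1" "qexp Q x = 0" "Q ~= 0"
 shows "deriv (qexp Q) x ~= 0"
proof -
 obtain k where k: "Q ^ k * x = 1" using qexp_eq_0D[OF assms(1,2)] .
 have inj: "Q ^ j * x ~= 1" if "j ~= k" for j
 proof
  assume "Q ^ j * x = 1"
  then have "norm Q ^ j = norm Q ^ k" using k by (metis mult_cancel_right norm_power zero_neq_one mult_zero_right)
  then show False using that assms power_strict_decreasing[of j k "norm Q"] power_strict_decreasing[of k j "norm Q"]
   by (cases j k rule: linorder_cases) auto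
 qed
 define g where "g = (%y. (\<Prod>j<k. 1 - (Q ^ j) * y) * qexp Q (Q ^ Suc k * y))"
 have eq: "qexp Q = (%y. (1 - (Q ^ k) * y) * g y)"
  by (rule ext, subst qexp_shift_power[OF assms(1), of _ "Suc k"]) (simp add: g_def)
 have "qexp Q (Q ^ Suc k * x) ~= 0"
 proof
  assume "qexp Q (Q ^ Suc k * x) = 0"
  then obtain j where "Q ^ j * (Q ^ Suc k * x) = 1" using qexp_eq_0D[OF assms(1)] by blast
  then have "Q ^ (j + Suc k) * x = 1" by (simp add: power_add algebra_simps)
  then show False using inj[of "j + Suc k"] by auto
 qed
 then have gx: "g x ~= 0" using inj by (auto simp: g_def)
 have "g holomorphic_on UNIV"
  unfolding g_def
  by (intro holomorphic_intros holomorphic_on_compose_gen[OF _ holomorphic_qexp[OF assms(1)], unfolded o_def]) auto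
 then have "(g has_field_derivative deriv g x) (at x)" by (intro holomorphic_derivI) auto
 then have "((%y. (1 - (Q ^ k) * y) * g y) has_field_derivative (- (Q ^ k) * g x)) (at x)"
  using k by (auto intro!: derivative_eq_intros)
 then have "deriv (qexp Q) x = - (Q ^ k) * g x" unfolding eq by (rule DERIV_imp_deriv)
 then show ?thesis using gx assms by auto
qed

lemma nome_square: "(nome tau)\<^sup>2 = exp (2 * of_real pi * \<i> * tau)"
 unfolding nome_def exp_of_nat_mult[symmetric] by (simp add: algebra_simps)

lemma exp_2pi_eq_1_iff: "exp (2 * of_real pi * \<i> * z) = 1 \<longleftrightarrow> z \<in> \<int>"
proof
 assume "exp (2 * of_real pi * \<i> * z) = 1"
 then obtain n :: int where "Im (2 * of_real pi * \<i> * z) = of_int (2 * n) * pi" "Re (2 * of_real pi * \<i> * z) = 0"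
  unfolding exp_eq_1 by auto
 then have "z = of_int n" by (auto simp: complex_eq_iff)
 then show "z \<in> \<int>" by simp
next
 assume "z \<in> \<int>"
 then obtain n where "z = of_int n" by (auto elim: Ints_cases)
 then show "exp (2 * of_real pi * \<i> * z) = 1"
  unfolding exp_eq_1 by (intro conjI exI[of _ n]) (auto simp: algebra_simps)
qed

lemma entire_div_periodic:
 assumes "G holomorphic_on UNIV" "g holomorphic_on UNIV" "G z0 ~= 0"
  and "!!z. G (z + w) = A z * G z" "!!z. G (z + w) * g (z + w) = (A z * c) * (G z * g z)" "!!z. A z ~= 0"
 shows "g (z + w) = c * g z"
proof -
 have "(%z. g (z + w)) holomorphic_on UNIV"
  by (intro holomorphic_on_compose_gen[OF _ assms(2), unfolded o_def] holomorphic_intros) auto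
 then have "g (z + w) - c * g z = 0"
  using assms(1,2,3)
  by (intro entire_mult_eq_0[of "%z. g (z + w) - c * g z" G z0 z])
    (use assms(4-6) in \<open>auto intro!: holomorphic_intros simp: algebra_simps\<close>)
 then show ?thesis by simp
qed

text \<open>The Jacobi triple product up to the value of its constant. G stands for the product of
  all 1 - Q^k X and 1 - Q^(k+1)/X with X = exp (2 pi i z). Its zeros are simple and lie in the
  lattice, and it has the multipliers of theta times exp (pi i z). The latter vanishes on the
  lattice, so its quotient by G is entire and elliptic, hence a constant; consequently G vanishes on
  the whole lattice.\<close>

lemma theta_product:
 assumes tau: "tau \<in> uhp"
 obtains G c where "G holomorphic_on UNIV" "c ~= 0"
  "!!z. th 0 z (nome tau) = c * exp (- of_real pi * \<i> * z) * G z"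
  "!!z. G z = 0 \<longleftrightarrow> z \<in> Lat tau"
  "!!z. G z = 0 ==> deriv G z ~= 0"
proof -
 define Q where "Q = (nome tau)\<^sup>2"
 have Q: "norm Q < 1" "Q ~= 0"
  using norm_nome_less_1[OF tau] by (auto simp: Q_def norm_power abs_square_less_1)
 define X where "X = (%z. exp (2 * of_real pi * \<i> * z))"
 have X0: "X z ~= 0" for z by (simp add: X_def)
 define G where "G = (%z. qexp Q (X z) * qexp Q (Q / X z))"
 have X1: "X (z + 1) = X z" for z
  using exp_2pi_eq_1_iff[of 1] by (simp add: X_def algebra_simps exp_add)
 have Xtau: "X (z + tau) = Q * X z" for z by (simp add: X_def Q_def nome_square algebra_simps exp_add)
 have XL: "z \<in> Lat tau" if "Q ^ k * X z = 1 \<or> Q ^ k * X (-z) = 1" for z k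
 proof -
  have "Q ^ k * X w = X (w + of_nat k * tau)" for w
  proof (induction k)
   case (Suc k)
   have "w + of_nat (Suc k) * tau = (w + of_nat k * tau) + tau" by (simp add: algebra_simps)
   then show ?case using Suc by (simp only: Xtau power_Suc mult.assoc)
  qed auto
  then have "X (z + of_nat k * tau) = 1 \<or> X (- z + of_nat k * tau) = 1" using that by auto
  then have "z + of_nat k * tau \<in> \<int> \<or> - z + of_nat k * tau \<in> \<int>"
   by (simp only: X_def exp_2pi_eq_1_iff)
  then show ?thesis
  proof
   assume "z + of_nat k * tau \<in> \<int>"
   then obtain a where "z + of_nat k * tau = of_int a" by (auto elim: Ints_cases)
   then have "z = of_int a + of_int (- int k) * tau" by (simp add: algebra_simps)
   then show ?thesis by (metis period_latticeI)
  next
   assume "- z + of_nat k * tau \<in> \<int>"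
   then obtain a where a: "- z + of_nat k * tau = of_int a" by (auto elim: Ints_cases)
   have "z = of_int (- a) + of_int (int k) * tau" by (simp add: a[symmetric])
   then show ?thesis by (metis period_latticeI)
  qed
 qed
 have Xm: "X (- z) = inverse (X z)" for z by (simp add: X_def exp_minus)
 have hX: "X holomorphic_on UNIV" unfolding X_def by (intro holomorphic_intros)
 have hG: "G holomorphic_on UNIV"
  unfolding G_def
  by (intro holomorphic_intros holomorphic_on_compose_gen[OF _ holomorphic_qexp[OF Q(1)], unfolded o_def] hX)
    (auto simp: X0)
 have G1: "G (z + 1) = G z" for z by (simp add: G_def X1)
 have Gtau: "G (z + tau) = - inverse (X z) * G z" for z
 proof -
  have a: "Q / X (z + tau) = inverse (X z)" using Q(2) by (simp add: Xtau inverse_eq_divide)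
  have b: "qexp Q (inverse (X z)) = (1 - inverse (X z)) * qexp Q (Q / X z)"
   using qexp_shift[OF Q(1), of "inverse (X z)"] by (simp add: divide_inverse)
  have c: "qexp Q (X z) = (1 - X z) * qexp Q (Q * X z)" by (rule qexp_shift[OF Q(1)])
  show ?thesis
   unfolding G_def a unfolding Xtau b c using X0[of z] by (simp add: field_simps)
 qed
 have GL: "z \<in> Lat tau" if z: "G z = 0" for z
 proof -
  have "qexp Q (X z) = 0 \<or> qexp Q (Q / X z) = 0" using z by (auto simp: G_def)
  then obtain k where "Q ^ k * X z = 1 \<or> Q ^ k * (Q / X z) = 1" using qexp_eq_0D[OF Q(1)] by metis
  then have "Q ^ k * X z = 1 \<or> Q ^ Suc k * X (- z) = 1" by (auto simp: Xm field_simps)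
  then show ?thesis using XL by blast
 qed
 have Gs: "deriv G z ~= 0" if z: "G z = 0" for z
 proof -
  have D: "(qexp Q has_field_derivative deriv (qexp Q) y) (at y)" for y
   using holomorphic_qexp[OF Q(1)] by (intro holomorphic_derivI) auto
  have DX: "(X has_field_derivative 2 * of_real pi * \<i> * X z) (at z)"
   unfolding X_def by (auto intro!: derivative_eq_intros)
  have D1: "((%z. qexp Q (X z)) has_field_derivative deriv (qexp Q) (X z) * (2 * of_real pi * \<i> * X z)) (at z)"
   using DERIV_chain2[OF D DX] .
  have DX2: "((%z. Q / X z) has_field_derivative - Q / X z * (2 * of_real pi * \<i>)) (at z)"
   by (rule derivative_eq_intros DX refl X0 | simp add: X0)+
  have D2: "((%z. qexp Q (Q / X z)) has_field_derivative deriv (qexp Q) (Q / X z) * (- Q / X z * (2 * of_real pi * \<i>))) (at z)"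
   using DERIV_chain2[OF D DX2] .
  have dG: "deriv G z = deriv (qexp Q) (X z) * (2 * of_real pi * \<i> * X z) * qexp Q (Q / X z) +
    qexp Q (X z) * (deriv (qexp Q) (Q / X z) * (- Q / X z * (2 * of_real pi * \<i>)))"
   unfolding G_def by (rule DERIV_imp_deriv) (auto intro!: derivative_eq_intros D1 D2)
  \<comment> \<open>The two factors have no common zero: it would give Q^(k + j + 1) = 1.\<close>
  have nb: False if A: "qexp Q (X z) = 0" and B: "qexp Q (Q / X z) = 0"
  proof -
   obtain k where k: "Q ^ k * X z = 1" using qexp_eq_0D[OF Q(1) A] .
   obtain j where "Q ^ j * (Q / X z) = 1" using qexp_eq_0D[OF Q(1) B] .
   then have "Q ^ Suc j = X z" using X0[of z] by (simp add: field_simps)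
   then have "Q ^ (k + Suc j) = 1" using k by (simp only: power_add)
   then have "norm Q ^ (k + Suc j) = 1" by (metis norm_one norm_power)
   then show False using power_less_one_iff[of "norm Q" "k + Suc j"] Q(1) by simp
  qed
  show ?thesis
   using z nb qexp_simple_zero[OF Q(1) _ Q(2), of "X z"] qexp_simple_zero[OF Q(1) _ Q(2), of "Q / X z"] X0[of z] Q(2)
   unfolding dG by (auto simp: G_def)
 qed
 define q where "q = nome tau"
 have q: "norm q < 1" using tau by (simp add: q_def)
 \<comment> \<open>The exponential removes the sign in \<open>th_plus_1\<close>, so that H has the
   same multipliers as G.\<close>
 define H where "H = (%z. th 0 z q * exp (of_real pi * \<i> * z))"
 have hH: "H holomorphic_on UNIV" unfolding H_def using q by (intro holomorphic_intros)
 have H1: "H (z + 1) = H z" for z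
  by (simp add: H_def th_plus_1[OF q] distrib_left exp_add)
 have Htau: "H (z + tau) = - inverse (X z) * H z" for z
 proof -
  have "exp (- of_real pi * \<i> * tau) * exp (of_real pi * \<i> * (z + tau)) = exp (of_real pi * \<i> * z)"
   unfolding exp_add[symmetric] by (simp add: algebra_simps)
  moreover have "exp (- 2 * of_real pi * \<i> * z) = inverse (X z)"
   by (simp add: X_def exp_minus[symmetric])
  ultimately show ?thesis
   unfolding H_def q_def th_plus_tau[OF tau] by (simp only: mult_minus_left) (simp add: mult_ac)
 qed
 have TL: "H z = 0" if "z \<in> Lat tau" for z
 proof -
  have "(H (0 + z) = 0) = (H 0 = 0)"
   by (rule periodic_period_lattice[of "%z. H z = 0" tau]) (use that X0 in \<open>auto simp: H1 Htau\<close>)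
  then show ?thesis using q by (simp add: H_def)
 qed
 obtain g where g: "g holomorphic_on UNIV" "!!z. H z = G z * g z"
  using entire_divide[OF hH hG Gs TL[OF GL]] by blast
 obtain z0 where "th 0 z0 q ~= 0" using th_not_identically_0[OF q] .
 then have z0: "G z0 ~= 0" "g z0 ~= 0" using g(2)[of z0] by (auto simp: H_def)
 have "G (z + 1) * g (z + 1) = (1 * 1) * (G z * g z)" for z
  unfolding g(2)[symmetric] by (simp add: H1)
 then have "g (z + 1) = 1 * g z" for z
  by (intro entire_div_periodic[OF hG g(1) z0(1), of _ "%_. 1"]) (auto simp: G1)
 moreover have "G (z + tau) * g (z + tau) = (- inverse (X z) * 1) * (G z * g z)" for z
  unfolding g(2)[symmetric] by (simp add: Htau)
 then have "g (z + tau) = 1 * g z" for z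
  by (intro entire_div_periodic[OF hG g(1) z0(1), of _ "%z. - inverse (X z)"]) (auto simp: Gtau X0)
 ultimately obtain c where c: "!!z. g z = c"
  using entire_elliptic_constant[OF g(1) tau] by auto
 have T: "th 0 z q = c * exp (- of_real pi * \<i> * z) * G z" for z
  using g(2)[of z] by (simp add: H_def c exp_minus field_simps)
 show ?thesis
 proof
  show "c ~= 0" using z0 c by auto
  show "G z = 0 \<longleftrightarrow> z \<in> Lat tau" for z
   using GL TL[of z] \<open>c ~= 0\<close> by (auto simp: H_def T)
 qed (use T hG Gs q_def in auto)
qed

lemma th_eq_0_iff:
 assumes "tau \<in> uhp"
 shows "th 0 z (nome tau) = 0 \<longleftrightarrow> z \<in> Lat tau"
 using theta_product[OF assms] by (metis exp_not_eq_zero mult_eq_0_iff)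

lemma th_nome_0_eq_0_iff: "th 0 z 0 = 0 \<longleftrightarrow> z \<in> \<int>"
proof -
 have "th 0 z 0 = 0 \<longleftrightarrow> (\<exists>n. of_real pi * z = of_real (of_int n * pi))"
  by (simp add: th_nome_0 sin_eq_0)
 also have "\<dots> \<longleftrightarrow> z \<in> \<int>" by (auto simp: Ints_def)
 finally show ?thesis .
qed

text \<open>At the nome 0 theta is 2 sin (pi z). Any other q is the nome of some tau, and the simple
  zeros found in \<open>theta_product\<close> apply.\<close>

lemma th_simple_zero:
 assumes "norm q < 1" "th 0 z q = 0"
 shows "th 1 z q ~= 0"
proof (cases "q = 0")
 case True
 have "((%z. 2 * sin (of_real pi * z)) has_field_derivative 2 * of_real pi * cos (of_real pi * z)) (at z)"
  by (auto intro!: derivative_eq_intros)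
 then have "th 1 z 0 = 2 * of_real pi * cos (of_real pi * z)"
  using has_field_derivative_th[of 0 0 z] by (simp add: th_nome_0 DERIV_unique)
 moreover have "sin (of_real pi * z) = 0" using assms True by (simp add: th_nome_0)
 then have "cos (of_real pi * z) ~= 0" using sin_cos_squared_add[of "of_real pi * z"] by auto
 ultimately show ?thesis using True by simp
next
 case False
 then obtain tau where tau: "tau \<in> uhp" "nome tau = q" using nome_surj assms(1) by blast
 obtain G c where G: "G holomorphic_on UNIV" "c ~= 0"
   "!!z. th 0 z (nome tau) = c * exp (- of_real pi * \<i> * z) * G z"
   "!!z. G z = 0 ==> deriv G z ~= 0"
  using theta_product[OF tau(1)] by metis
 have Gz: "G z = 0" using G(2) G(3)[of z] assms tau by auto
 have "(G has_field_derivative deriv G z) (at z)" using G(1) by (intro holomorphic_derivI) auto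
 then have "((%z. c * exp (- of_real pi * \<i> * z) * G z) has_field_derivative
   c * exp (- of_real pi * \<i> * z) * deriv G z) (at z)"
  by (auto intro!: derivative_eq_intros simp: Gz)
 then have "th 1 z q = c * exp (- of_real pi * \<i> * z) * deriv G z"
  using has_field_derivative_th[OF assms(1), of 0 z] tau G(3) by (simp add: DERIV_unique)
 then show ?thesis using G(2,4) Gz by simp
qed

subsection \<open>Multipliers\<close>

text \<open>Theta functions of degree N with multipliers \<epsilon> and C. Both constants belong to
  the predicate because linear combinations stay in the class only between functions with equal
  multipliers. The zero function satisfies it for all non-zero multipliers.\<close>

definition qper :: "complex => int => complex => complex => (complex => complex) => bool" where
 "qper tau N \<epsilon> C h \<longleftrightarrow> h holomorphic_on UNIV \<and> \<epsilon> ~= 0 \<and> C ~= 0 \<and>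
   (\<forall>z. h (z + 1) = \<epsilon> * h z \<and> h (z + tau) = C * exp (- 2 * of_real pi * \<i> * of_int N * z) * h z)"

definition theta_mult :: "complex => complex" where
 "theta_mult tau = - exp (- of_real pi * \<i> * tau)"

lemma theta_mult_nonzero [simp]: "theta_mult tau ~= 0"
 by (simp add: theta_mult_def)

lemma qper_mult:
 assumes "qper tau N \<epsilon> C h" "qper tau N' \<epsilon>' C' h'"
 shows "qper tau (N + N') (\<epsilon> * \<epsilon>') (C * C') (%z. h z * h' z)"
proof -
 have "exp (- 2 * of_real pi * \<i> * of_int (N + N') * z) =
   exp (- 2 * of_real pi * \<i> * of_int N * z) * exp (- 2 * of_real pi * \<i> * of_int N' * z)" for z
  unfolding exp_add[symmetric] by (simp add: algebra_simps)
 then show ?thesis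
  using assms unfolding qper_def by (auto intro!: holomorphic_intros simp del: of_int_add)
qed

lemma qper_const: "qper tau 0 1 1 (%_. c)"
 by (auto simp: qper_def)

lemma qper_power: "qper tau N \<epsilon> C h ==> qper tau (int k * N) (\<epsilon> ^ k) (C ^ k) (%z. h z ^ k)"
proof (induction k)
 case (Suc k)
 then show ?case using qper_mult[OF Suc.prems Suc.IH[OF Suc.prems]] by (simp add: algebra_simps)
qed (simp add: qper_const)

lemma qper_prod:
 assumes "finite I" "!!i. i \<in> I ==> qper tau (N i) (\<epsilon> i) (C i) (h i)"
 shows "qper tau (sum N I) (prod \<epsilon> I) (prod C I) (%z. \<Prod>i\<in>I. h i z)"
 using assms by (induction rule: finite_induct) (auto simp: qper_const intro!: qper_mult)

lemma qper_theta:
 assumes "tau \<in> uhp"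
 shows "qper tau 1 (-1) (theta_mult tau * exp (2 * of_real pi * \<i> * a)) (%z. th 0 (z - a) (nome tau))"
proof -
 have "th 0 (z + 1 - a) (nome tau) = - th 0 (z - a) (nome tau)" for z
  using th_plus_1[of "nome tau" 0 "z - a"] assms by (simp add: algebra_simps)
 moreover have "th 0 (z + tau - a) (nome tau) = theta_mult tau * exp (2 * of_real pi * \<i> * a) *
   exp (- 2 * of_real pi * \<i> * z) * th 0 (z - a) (nome tau)" for z
 proof -
  have "exp (2 * of_real pi * \<i> * a) * exp (- 2 * of_real pi * \<i> * z) = exp (- 2 * of_real pi * \<i> * (z - a))"
   unfolding exp_add[symmetric] by (simp add: algebra_simps)
  then show ?thesis
   using th_plus_tau[OF assms, of "z - a"] by (simp add: algebra_simps theta_mult_def)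
 qed
 ultimately show ?thesis
  unfolding qper_def using assms by (auto intro!: holomorphic_intros)
qed

lemma qper_exp: "qper tau 0 (exp b) (exp (b * tau)) (%z. exp (b * z))"
 by (auto simp: qper_def algebra_simps exp_add intro!: holomorphic_intros)

lemma qper_add: "qper tau N \<epsilon> C h ==> qper tau N \<epsilon> C h' ==> qper tau N \<epsilon> C (%z. h z + h' z)"
 by (auto simp: qper_def algebra_simps intro!: holomorphic_intros)

lemma qper_cmult: "qper tau N \<epsilon> C h ==> qper tau N \<epsilon> C (%z. c * h z)"
 by (auto simp: qper_def intro!: holomorphic_intros)

lemma qper_diff: "qper tau N \<epsilon> C h ==> qper tau N \<epsilon> C h' ==> qper tau N \<epsilon> C (%z. h z - h' z)"
 by (auto simp: qper_def algebra_simps intro!: holomorphic_intros)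

lemma qper_sum:
 assumes "finite I" "qper tau N \<epsilon> C (%_. 0)" "!!i. i \<in> I ==> qper tau N \<epsilon> C (h i)"
 shows "qper tau N \<epsilon> C (%z. \<Sum>i\<in>I. h i z)"
 using assms by (induction rule: finite_induct) (auto intro!: qper_add)

lemma qper_zero_periodic:
 assumes "qper tau N \<epsilon> C h" "\<omega> \<in> Lat tau"
 shows "h (z + \<omega>) = 0 \<longleftrightarrow> h z = 0"
 using periodic_period_lattice[of "%z. h z = 0" tau \<omega> z] assms by (auto simp: qper_def)

lemma th_zero_deriv:
 assumes "tau \<in> uhp" "th 0 (z - a) (nome tau) = 0"
 shows "deriv (%z. th 0 (z - a) (nome tau)) z ~= 0"
proof -
 have "((%z. th 0 (z - a) (nome tau)) has_field_derivative th 1 (z - a) (nome tau)) (at z)"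
  using DERIV_shift[of "%z. th 0 z (nome tau)" "th 1 (z - a) (nome tau)" z "- a"]
   has_field_derivative_th[of "nome tau" 0 "z - a"] assms(1) by simp
 then show ?thesis using th_simple_zero[OF _ assms(2)] assms(1) DERIV_imp_deriv by fastforce
qed

text \<open>The zeros of theta(z - a) are simple and form the coset of a modulo the lattice. The
  zeros of h are stable under the lattice, so h vanishes on that coset and the quotient is entire;
  its multipliers are the quotients of the given ones.\<close>

lemma qper_divide_zero:
 assumes tau: "tau \<in> uhp" and h: "qper tau N \<epsilon> C h" and "h a = 0"
 obtains g where "!!z. h z = th 0 (z - a) (nome tau) * g z"
  "qper tau (N - 1) (- \<epsilon>) (C / (theta_mult tau * exp (2 * of_real pi * \<i> * a))) g"
proof -
 define T where "T = (%z. th 0 (z - a) (nome tau))"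
 define D where "D = theta_mult tau * exp (2 * of_real pi * \<i> * a)"
 have D0: "D ~= 0" by (simp add: D_def)
 have qT: "qper tau 1 (-1) D T" unfolding T_def D_def by (rule qper_theta[OF tau])
 have hT: "T holomorphic_on UNIV" and hh: "h holomorphic_on UNIV" using qT h by (auto simp: qper_def)
 have van: "h z = 0" if "T z = 0" for z
 proof -
  have "z - a \<in> Lat tau" using that th_eq_0_iff[OF tau] by (simp add: T_def)
  then show ?thesis using qper_zero_periodic[OF h, of "z - a" a] assms(3) by simp
 qed
 obtain g where g: "g holomorphic_on UNIV" "!!z. h z = T z * g z"
  using entire_divide[OF hh hT _ van] th_zero_deriv[OF tau] unfolding T_def by metis
 obtain z0 where "th 0 z0 (nome tau) ~= 0" using th_not_identically_0[OF norm_nome_less_1[OF tau]] .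
 then have z0: "T (z0 + a) ~= 0" by (simp add: T_def)
 define E where "E = (%z. exp (- 2 * of_real pi * \<i> * of_int (N - 1) * z))"
 have E: "exp (- 2 * of_real pi * \<i> * of_int N * z) = E z * exp (- 2 * of_real pi * \<i> * z)" for z
  unfolding E_def exp_add[symmetric] by (simp add: algebra_simps)
 have "T (z + 1) * g (z + 1) = (-1 * - \<epsilon>) * (T z * g z)" for z
  unfolding g(2)[symmetric] using h by (simp add: qper_def)
 then have 1: "g (z + 1) = - \<epsilon> * g z" for z
  by (intro entire_div_periodic[OF hT g(1) z0, of _ "%_. -1"]) (use qT in \<open>auto simp: qper_def\<close>)
 have hE: "(%z. g (z + tau) - C / D * E z * g z) holomorphic_on UNIV"
  unfolding E_def
  by (intro holomorphic_intros g(1) holomorphic_on_compose_gen[OF _ g(1), unfolded o_def]) auto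
 have 2: "g (z + tau) - C / D * E z * g z = 0" for z
 proof (rule entire_mult_eq_0[OF hE hT _ z0])
  fix z
  have "T (z + tau) * g (z + tau) = C * (E z * exp (- 2 * of_real pi * \<i> * z)) * (T z * g z)"
   unfolding g(2)[symmetric] E[symmetric] using h unfolding qper_def by blast
  moreover have "T (z + tau) = D * exp (- 2 * of_real pi * \<i> * z) * T z"
   using qT by (simp add: qper_def)
  ultimately show "(g (z + tau) - C / D * E z * g z) * T z = 0"
   using D0 by (simp add: field_simps)
 qed
 show ?thesis
 proof
  show "h z = th 0 (z - a) (nome tau) * g z" for z using g by (simp add: T_def)
  show "qper tau (N - 1) (- \<epsilon>) (C / (theta_mult tau * exp (2 * of_real pi * \<i> * a))) g"
   using 1 2 g(1) h D0 unfolding qper_def D_def[symmetric] E_def by auto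
 qed
qed

lemma exp_surj_nonzero: "w ~= 0 ==> \<exists>a. exp (2 * of_real pi * \<i> * a) = (w :: complex)"
 by (rule exI[of _ "Ln w / (2 * of_real pi * \<i>)"]) simp

text \<open>Multiplication by theta functions with suitably chosen zeros turns a function of negative
  order into an elliptic entire function that has a zero.\<close>

lemma qper_negative:
 assumes tau: "tau \<in> uhp" and h: "qper tau N \<epsilon> C h" and "N < 0"
 shows "h z = 0"
proof -
 define M where "M = nat (- N)"
 have M: "M > 0" "N = - int M" using assms(3) by (auto simp: M_def)
 \<comment> \<open>The factor exp (b z) of \<open>F\<close> cancels the multiplier of z -> z + 1;
   the zero a of its last theta factor is then chosen to cancel the multiplier of z -> z +
   tau.\<close>
 obtain b where b: "exp b = inverse (\<epsilon> * (-1) ^ M)"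
  using h by (metis exp_Ln qper_def inverse_nonzero_iff_nonzero mult_eq_0_iff power_eq_0_iff neg_equal_0_iff_equal one_neq_zero)
 define D where "D = C * exp (b * tau) * theta_mult tau ^ M"
 have "inverse D ~= 0" using h by (auto simp: D_def qper_def)
 then obtain a where a: "exp (2 * of_real pi * \<i> * a) = inverse D" using exp_surj_nonzero by metis
 define T where "T = (%z. th 0 z (nome tau))"
 have qT: "qper tau 1 (-1) (theta_mult tau) T" using qper_theta[OF tau, of 0] by (simp add: T_def)
 have qTa: "qper tau 1 (-1) (theta_mult tau * inverse D) (%z. T (z - a))"
  using qper_theta[OF tau, of a] by (simp add: T_def a)
 define F where "F = (%z. h z * exp (b * z) * T z ^ (M - 1) * T (z - a))"
 have "qper tau (N + 0 + int (M - 1) * 1 + 1) (\<epsilon> * exp b * (-1) ^ (M - 1) * (-1))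
   (C * exp (b * tau) * theta_mult tau ^ (M - 1) * (theta_mult tau * inverse D)) F"
  unfolding F_def by (intro qper_mult qper_power h qper_exp qT qTa)
 moreover have "N + 0 + int (M - 1) * 1 + 1 = 0" using M by auto
 moreover have "\<epsilon> * exp b * (-1) ^ (M - 1) * (-1) = 1"
 proof -
  have "(-1) ^ (M - 1) * (-1) = (-1 :: complex) ^ M" using M by (cases M) auto
  then have "\<epsilon> * exp b * (-1) ^ (M - 1) * (-1) = \<epsilon> * exp b * (-1) ^ M"
   by (simp only: mult.assoc)
  also have "\<dots> = (\<epsilon> * (-1) ^ M) * inverse (\<epsilon> * (-1) ^ M)"
   unfolding b by (simp only: mult_ac)
  also have "\<dots> = 1" using h by (intro right_inverse) (auto simp: qper_def)
  finally show ?thesis .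
 qed
 moreover have "C * exp (b * tau) * theta_mult tau ^ (M - 1) * (theta_mult tau * inverse D) = 1"
 proof -
  have "theta_mult tau ^ (M - 1) * theta_mult tau = theta_mult tau ^ M" using M by (cases M) auto
  then have "C * exp (b * tau) * theta_mult tau ^ (M - 1) * (theta_mult tau * inverse D) = D * inverse D"
   unfolding D_def by (simp only: mult.assoc[symmetric]) (simp only: mult.assoc)
  also have "\<dots> = 1" using h by (intro right_inverse) (auto simp: D_def qper_def)
  finally show ?thesis .
 qed
 ultimately have "qper tau 0 1 1 F" by simp
 then obtain c where c: "!!z. F z = c"
  using entire_elliptic_constant[of F tau] tau by (auto simp: qper_def)
 have "F a = 0" using tau by (simp add: F_def T_def)
 then have F0: "F z = 0" for z using c by metis
 obtain z0 where z0: "T z0 ~= 0" using th_not_identically_0[OF norm_nome_less_1[OF tau]] by (auto simp: T_def)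
 have hol: "h holomorphic_on UNIV" "T holomorphic_on UNIV" "(%z. T (z - a)) holomorphic_on UNIV"
  using h qT qTa by (auto simp: qper_def)
 have "h z * exp (b * z) * T z ^ (M - 1) = 0" for z
  by (rule entire_mult_eq_0[of _ "%z. T (z - a)" "z0 + a"])
    (use F0 z0 in \<open>auto intro!: holomorphic_intros hol simp: F_def\<close>)
 then have "h z * exp (b * z) = 0"
  by (intro entire_mult_eq_0[of "%z. h z * exp (b * z)" "%z. T z ^ (M - 1)" z0])
    (use z0 in \<open>auto intro!: holomorphic_intros hol\<close>)
 then show ?thesis by simp
qed

text \<open>Each zero splits off a theta factor and lowers the degree by one. This factor does not
  vanish at the other, incongruent zeros, so they remain, and in the end the degree is
  negative.\<close>

lemma qper_too_many_zeros:
 assumes tau: "tau \<in> uhp" and "finite A"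
  and "qper tau N \<epsilon> C h" "int (card A) > N" "!!a. a \<in> A ==> h a = 0"
  and "!!a b. a \<in> A ==> b \<in> A ==> a ~= b ==> a - b ~: Lat tau"
 shows "h z = 0"
 using assms(2-)
proof (induction A arbitrary: h N \<epsilon> C rule: finite_induct)
 case empty
 then show ?case using qper_negative[OF tau empty(1)] by simp
next
 case (insert a A)
 obtain g where g: "!!z. h z = th 0 (z - a) (nome tau) * g z"
  "qper tau (N - 1) (- \<epsilon>) (C / (theta_mult tau * exp (2 * of_real pi * \<i> * a))) g"
  using qper_divide_zero[OF tau insert.prems(1)] insert.prems(3) by blast
 have "g b = 0" if "b \<in> A" for b
 proof -
  have "b ~= a" using insert that by auto
  then have "th 0 (b - a) (nome tau) ~= 0" using insert.prems(4)[of b a] that th_eq_0_iff[OF tau] by auto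
  then show ?thesis using g(1)[of b] insert.prems(3)[of b] that by auto
 qed
 then have "g z = 0"
  using insert.hyps insert.prems by (intro insert.IH[OF g(2)]) auto
 then show ?case using g by simp
qed

text \<open>The logarithmic derivative l is entire and changes by a constant under each period, so
  its derivative is elliptic, hence constant. The period 1 forces the slope of l to be 0; then l is
  constant, N = 0, and h is an exponential.\<close>

lemma qper_zero_free:
 assumes tau: "tau \<in> uhp" and h: "qper tau N \<epsilon> C h" and nz: "!!z. h z ~= 0"
 obtains b K where "N = 0" "K ~= 0" "!!z. h z = K * exp (b * z)"
proof -
 have hol: "h holomorphic_on UNIV" using h by (simp add: qper_def)
 have hd: "(h has_field_derivative deriv h z) (at z)" for z
  using hol by (intro holomorphic_derivI) auto
 define l where "l = (%z. deriv h z / h z)"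
 have hl: "l holomorphic_on UNIV" unfolding l_def
  by (intro holomorphic_intros holomorphic_deriv hol) (auto simp: nz)
 have l1: "l (z + 1) = l z" for z
 proof -
  have "((%z. h (z + 1)) has_field_derivative deriv h (z + 1)) (at z)"
   using DERIV_shift[of h "deriv h (z + 1)" z 1] hd by simp
  moreover have "(%z. h (z + 1)) = (%z. \<epsilon> * h z)" using h by (auto simp: qper_def)
  ultimately have "deriv h (z + 1) = \<epsilon> * deriv h z"
   using DERIV_unique[OF _ DERIV_cmult[OF hd]] by metis
  then show ?thesis using h nz by (auto simp: l_def qper_def)
 qed
 define E where "E = (%z. exp (- 2 * of_real pi * \<i> * of_int N * z))"
 have E0: "E z ~= 0" for z by (simp add: E_def)
 have ltau: "l (z + tau) = l z - 2 * of_real pi * \<i> * of_int N" for z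
 proof -
  have "((%z. h (z + tau)) has_field_derivative deriv h (z + tau)) (at z)"
   using DERIV_shift[of h "deriv h (z + tau)" z tau] hd by simp
  moreover have eq: "(%z. h (z + tau)) = (%z. C * E z * h z)" using h by (auto simp: qper_def E_def)
  moreover have "((%z. C * E z * h z) has_field_derivative
    C * E z * deriv h z - C * E z * h z * (2 * of_real pi * \<i> * of_int N)) (at z)"
   unfolding E_def by (rule derivative_eq_intros hd refl | simp add: algebra_simps)+
  ultimately have "deriv h (z + tau) = C * E z * deriv h z - C * E z * h z * (2 * of_real pi * \<i> * of_int N)"
   using DERIV_unique by metis
  moreover have "h (z + tau) = C * E z * h z" using eq by metis
  ultimately show ?thesis using h nz E0 by (simp add: l_def qper_def field_simps)
 qed
 have dl: "(l has_field_derivative deriv l z) (at z)" for z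
  using hl by (intro holomorphic_derivI) auto
 have "deriv l (z + 1) = deriv l z" for z
  using DERIV_shift[of l "deriv l (z + 1)" z 1] dl[of z] dl[of "z + 1"] DERIV_unique by (fastforce simp: l1)
 moreover have "deriv l (z + tau) = deriv l z" for z
 proof -
  have "((%z. l (z + tau)) has_field_derivative deriv l (z + tau)) (at z)"
   using DERIV_shift[of l "deriv l (z + tau)" z tau] dl by simp
  moreover have "((%z. l (z + tau)) has_field_derivative deriv l z) (at z)"
   unfolding ltau by (rule derivative_eq_intros dl refl | simp)+
  ultimately show ?thesis using DERIV_unique by blast
 qed
 ultimately obtain \<kappa> where \<kappa>: "!!z. deriv l z = \<kappa>"
  using entire_elliptic_constant[OF holomorphic_deriv[OF hl] tau] by auto
 have "((%z. l z - \<kappa> * z) has_field_derivative 0) (at z within UNIV)" for z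
  using dl[of z] by (auto intro!: derivative_eq_intros simp: \<kappa>)
 then obtain b where b: "!!z. l z - \<kappa> * z = b"
  using has_field_derivative_zero_constant[of UNIV "%z. l z - \<kappa> * z"] by auto
 have "\<kappa> = 0" using b[of 0] b[of 1] l1[of 0] by (simp add: algebra_simps)
 then have lb: "l z = b" for z using b[of z] by simp
 have N: "N = 0" using ltau[of 0] by (simp add: lb)
 have dh: "deriv h z = b * h z" for z using lb[of z] nz[of z] by (simp add: l_def field_simps)
 have "((%z. h z * exp (- b * z)) has_field_derivative 0) (at z within UNIV)" for z
  using hd[of z] by (auto intro!: derivative_eq_intros simp: dh)
 then obtain K where K: "!!z. h z * exp (- b * z) = K"
  using has_field_derivative_zero_constant[of UNIV "%z. h z * exp (- b * z)"] by auto
 have "h z = K * exp (b * z)" for z using K[of z] by (simp add: exp_minus field_simps)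
 moreover from this have "K ~= 0" using nz by auto
 ultimately show ?thesis using that N by blast
qed

text \<open>Induction on the degree. A function of positive degree has a zero by
  \<open>qper_zero_free\<close>, and the zero is split off; a non-zero function of degree 0 has
  none, since splitting it off would leave degree -1.\<close>

lemma qper_factor:
 assumes tau: "tau \<in> uhp" and "qper tau N \<epsilon> C h" "h z0 ~= 0"
 obtains b K a where "K ~= 0" "N \<ge> 0" "!!z. h z = K * exp (b * z) * (\<Prod>i<nat N. th 0 (z - a i) (nome tau))"
proof -
 have N: "N \<ge> 0" using qper_negative[OF tau assms(2), of z0] assms(3) by force
 have "\<exists>b K a. K ~= 0 \<and> (\<forall>z. h z = K * exp (b * z) * (\<Prod>i<m. th 0 (z - a i) (nome tau)))"
  if "qper tau (int m) \<epsilon> C h" "h z0 ~= 0" for m \<epsilon> C h z0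
  using that
 proof (induction m arbitrary: \<epsilon> C h z0)
  case 0
  have nz: "h z ~= 0" for z
  proof
   assume "h z = 0"
   then obtain g where g: "!!w. h w = th 0 (w - z) (nome tau) * g w"
    "qper tau (int 0 - 1) (- \<epsilon>) (C / (theta_mult tau * exp (2 * of_real pi * \<i> * z))) g"
    using qper_divide_zero[OF tau 0(1)] by blast
   then show False using qper_negative[OF tau g(2), of z0] 0(2) by auto
  qed
  show ?case
  proof (rule qper_zero_free[OF tau 0(1) nz])
   fix b K assume "K ~= 0" "!!z. h z = K * exp (b * z)"
   then show ?thesis by (intro exI[of _ b] exI[of _ K]) auto
  qed
 next
  case (Suc m)
  obtain z where z: "h z = 0"
  proof (rule ccontr)
   assume "\<not> thesis"
   then have nz: "h z ~= 0" for z using that by blast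
   show False by (rule qper_zero_free[OF tau Suc.prems(1) nz]) simp
  qed
  obtain g where g: "!!w. h w = th 0 (w - z) (nome tau) * g w"
   "qper tau (int (Suc m) - 1) (- \<epsilon>) (C / (theta_mult tau * exp (2 * of_real pi * \<i> * z))) g"
   using qper_divide_zero[OF tau Suc.prems(1) z] by blast
  have gq: "qper tau (int m) (- \<epsilon>) (C / (theta_mult tau * exp (2 * of_real pi * \<i> * z))) g"
   using g(2) by simp
  have "g z0 ~= 0" using g(1)[of z0] Suc.prems(2) by auto
  then obtain b K a where bKa: "K ~= 0" "!!w. g w = K * exp (b * w) * (\<Prod>i<m. th 0 (w - a i) (nome tau))"
   using Suc.IH[OF gq, of z0] \<open>g z0 ~= 0\<close> by blast
  have "h w = K * exp (b * w) * (\<Prod>i<Suc m. th 0 (w - (a(m := z)) i) (nome tau))" for w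
   unfolding g(1)[of w] bKa(2)[of w] by (simp add: algebra_simps)
  then show ?case using bKa(1) by blast
 qed
 from this[of "nat N" \<epsilon> C h z0] show ?thesis using that assms N by auto
qed

section \<open>Weierstrass functions in terms of theta functions\<close>

lemma period_lattice_lower_bound:
 assumes "tau \<in> uhp"
 obtains \<delta> :: real where "\<delta> > 0" "!!a b :: int. \<delta> * \<bar>real_of_int a\<bar> \<le> norm (of_int a + of_int b * tau)"
  "!!a b :: int. \<delta> * \<bar>real_of_int b\<bar> \<le> norm (of_int a + of_int b * tau)"
proof
 define y where "y = Im tau"
 have y: "y > 0" using assms by (simp add: upper_half_plane_iff y_def)
 \<comment> \<open>The imaginary part bounds |b| by the norm divided by y; then |a| is at most the
   norm plus |b| times the norm of tau.\<close>
 define \<delta> where "\<delta> = min y (1 / (1 + norm tau / y))"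
 show "\<delta> > 0" using y by (auto simp: \<delta>_def intro!: divide_pos_pos add_pos_nonneg)
 have b: "y * \<bar>real_of_int b\<bar> \<le> norm (of_int a + of_int b * tau)" for a b :: int
  using abs_Im_le_cmod[of "of_int a + of_int b * tau"] y by (simp add: y_def abs_mult mult.commute)
 show "\<delta> * \<bar>real_of_int b\<bar> \<le> norm (of_int a + of_int b * tau)" for a b :: int
  by (rule order_trans[OF mult_right_mono b]) (auto simp: \<delta>_def)
 have a: "\<bar>real_of_int a\<bar> \<le> (1 + norm tau / y) * norm (of_int a + of_int b * tau)" for a b :: int
 proof -
  have "\<bar>real_of_int a\<bar> = norm ((of_int a + of_int b * tau) - of_int b * tau)" by simp
  also have "\<dots> \<le> norm (of_int a + of_int b * tau) + \<bar>b\<bar> * norm tau"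
   by (rule order_trans[OF norm_triangle_ineq4]) (simp add: norm_mult)
  also have "\<bar>b\<bar> * norm tau \<le> (norm (of_int a + of_int b * tau) / y) * norm tau"
   using b[of b a] y by (intro mult_right_mono) (auto simp: field_simps)
  finally show ?thesis by (simp add: algebra_simps)
 qed
 show "\<delta> * \<bar>real_of_int a\<bar> \<le> norm (of_int a + of_int b * tau)" for a b :: int
 proof -
  have "\<delta> * \<bar>real_of_int a\<bar> \<le> (1 / (1 + norm tau / y)) * \<bar>real_of_int a\<bar>" by (intro mult_right_mono) (auto simp: \<delta>_def)
  also have "\<dots> \<le> norm (of_int a + of_int b * tau)"
   using a[of a b] y by (simp add: divide_le_eq add_pos_nonneg mult.commute)
  finally show ?thesis .
 qed
qed

lemma finite_period_lattice_bounded: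
 assumes "tau \<in> uhp"
 shows "finite {\<omega> \<in> Lat tau. norm \<omega> \<le> R}"
proof -
 obtain \<delta> :: real where \<delta>: "\<delta> > 0" "!!a b :: int. \<delta> * \<bar>real_of_int a\<bar> \<le> norm (of_int a + of_int b * tau)"
  "!!a b :: int. \<delta> * \<bar>real_of_int b\<bar> \<le> norm (of_int a + of_int b * tau)"
  using period_lattice_lower_bound[OF assms] by blast
 define K where "K = \<lceil>R / \<delta>\<rceil>"
 have "{\<omega> \<in> Lat tau. norm \<omega> \<le> R} \<subseteq> (%(a, b). of_int a + of_int b * tau) ` ({-K..K} \<times> {-K..K})"
 proof
  fix \<omega> assume "\<omega> \<in> {\<omega> \<in> Lat tau. norm \<omega> \<le> R}"
  then obtain a b where ab: "\<omega> = of_int a + of_int b * tau" "norm \<omega> \<le> R"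
   by (auto simp: period_lattice_def)
  have "\<delta> * \<bar>real_of_int a\<bar> \<le> R" "\<delta> * \<bar>real_of_int b\<bar> \<le> R" using \<delta>(2)[of a b] \<delta>(3)[of b a] ab by auto
  then have "\<bar>real_of_int a\<bar> \<le> R / \<delta>" "\<bar>real_of_int b\<bar> \<le> R / \<delta>" using \<delta>(1) by (auto simp: field_simps)
  then have "\<bar>a\<bar> \<le> K" "\<bar>b\<bar> \<le> K" unfolding K_def by linarith+
  then show "\<omega> \<in> (%(a, b). of_int a + of_int b * tau) ` ({-K..K} \<times> {-K..K})"
   using ab by (intro image_eqI[of _ _ "(a, b)"]) auto
 qed
 then show ?thesis by (rule finite_subset) auto
qed

text \<open>The exponent 3/2 is half of 3: the lattice sum of |\<omega>|^(-3) is going to be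
  dominated by a product of two such sums.\<close>

lemma summable_on_int_powr: "(%a :: int. (1 + \<bar>real_of_int a\<bar>) powr (-3/2)) summable_on UNIV"
proof -
 let ?f = "%a :: int. (1 + \<bar>real_of_int a\<bar>) powr (-3/2)"
 have "summable (%n. real n powr (-3/2))" by (simp add: summable_real_powr_iff)
 then have "summable (%n. real (Suc n) powr (-3/2))"
  using summable_Suc_iff[of "%n. real n powr (-3/2)"] by (simp only:)
 then have s: "(%n. real (Suc n) powr (-3/2)) summable_on UNIV"
  by (intro norm_summable_imp_summable_on) simp
 have e: "?f \<circ> int = (%n. real (Suc n) powr (-3/2))" "?f \<circ> (%n. - int n) = (%n. real (Suc n) powr (-3/2))"
  by (auto simp: add.commute)
 have "?f summable_on int ` UNIV"
  using s by (subst summable_on_reindex) (simp_all only: e inj_of_nat)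
 moreover have "?f summable_on (%n. - int n) ` UNIV"
  using s by (subst summable_on_reindex) (simp_all only: e, simp add: inj_on_def)
 ultimately  have "?f summable_on (int ` UNIV \<union> (%n. - int n) ` UNIV)" by (rule summable_on_union)
 moreover have "int ` UNIV \<union> (%n. - int n) ` UNIV = UNIV"
  by (auto, metis int_cases2 rangeI)
 ultimately show ?thesis by simp
qed

text \<open>Off the origin the maximum M of |a| and |b| is at least 1, so 1 + |a| and 1 + |b| are at
  most 2 M, while |\<omega>| is at least \<delta> M. Hence |\<omega>|^(-3) is bounded by a constant
  times (1 + |a|)^(-3/2) (1 + |b|)^(-3/2), and the sum of this over a rectangle factorises.\<close>

lemma summable_on_lattice_cube:
 assumes "tau \<in> uhp"
 shows "(%\<omega>. 1 / norm \<omega> ^ 3) summable_on (Lat tau - {0})"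
proof -
 obtain \<delta> :: real where \<delta>: "\<delta> > 0" "!!a b :: int. \<delta> * \<bar>real_of_int a\<bar> \<le> norm (of_int a + of_int b * tau)"
  "!!a b :: int. \<delta> * \<bar>real_of_int b\<bar> \<le> norm (of_int a + of_int b * tau)"
  using period_lattice_lower_bound[OF assms] by blast
 define f where "f = (%a :: int. (1 + \<bar>real_of_int a\<bar>) powr (-3/2))"
 have f0: "f a \<ge> 0" for a by (simp add: f_def)
 define S where "S = infsum f UNIV"
 have fs: "sum f A \<le> S" if "finite A" for A
  unfolding S_def using summable_on_int_powr that f0 by (intro finite_sum_le_infsum) (auto simp: f_def)
 define h where "h = (%(a, b). of_int a + of_int b * tau)"
 define X where "X = UNIV - {(0 :: int, 0 :: int)}"
 have "(%(a, b). f a * f b) summable_on X"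
 proof (rule nonneg_bdd_above_summable_on)
  show "bdd_above (sum (%(a, b). f a * f b) ` {F. F \<subseteq> X \<and> finite F})"
  proof (rule bdd_aboveI2)
   fix F assume "F \<in> {F. F \<subseteq> X \<and> finite F}"
   then have F: "finite F" by auto
   have "F \<subseteq> fst ` F \<times> snd ` F" by force
   then have "(\<Sum>(a, b)\<in>F. f a * f b) \<le> (\<Sum>(a, b)\<in>fst ` F \<times> snd ` F. f a * f b)"
    using F by (intro sum_mono2) (auto simp: f0)
   also have "\<dots> = sum f (fst ` F) * sum f (snd ` F)"
    by (simp add: sum_product sum.cartesian_product)
   also have "\<dots> \<le> S * S"
    using F order_trans[OF sum_nonneg fs, of "{}"] by (intro mult_mono fs sum_nonneg f0) auto
   finally show "(\<Sum>(a, b)\<in>F. f a * f b) \<le> S * S" .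
  qed
 qed (use f0 in auto)
 then have sX: "(%x. (2 / \<delta>) ^ 3 * (case x of (a, b) => f a * f b)) summable_on X"
  by (rule summable_on_cmult_right)
 have "(%x. 1 / norm (h x) ^ 3) summable_on X"
 proof (rule summable_on_comparison_test[OF sX])
  fix x assume "x \<in> X"
  then obtain a b where x: "x = (a, b)" and ab: "a ~= 0 \<or> b ~= 0" by (cases x) (auto simp: X_def)
  define M where "M = max \<bar>real_of_int a\<bar> \<bar>real_of_int b\<bar>"
  have M1: "M \<ge> 1" using ab by (auto simp: M_def)
  have hM: "\<delta> * M \<le> norm (h x)" using \<delta>(2)[of a b] \<delta>(3)[of b a] by (simp add: x h_def M_def max_def)
  have g: "1 / (2 * M) powr (3/2) \<le> f c" if "\<bar>real_of_int c\<bar> \<le> M" for c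
  proof -
   have "(2 * M) powr (-3/2) \<le> f c" unfolding f_def
    by (rule powr_mono2') (use M1 that in auto)
   moreover have "(2 * M) powr (-3/2) = 1 / (2 * M) powr (3/2)"
    using powr_minus_divide[of "2 * M" "3/2"] by simp
   ultimately show ?thesis by (simp only:)
  qed
  have "1 / (2 * M) ^ 3 = (1 / (2 * M) powr (3/2)) * (1 / (2 * M) powr (3/2))"
   using M1 by (simp add: powr_add[symmetric] powr_numeral)
  also have "\<dots> \<le> f a * f b" by (intro mult_mono g) (auto simp: M_def f0)
  finally have 1: "1 / (2 * M) ^ 3 \<le> f a * f b" .
  have "1 / norm (h x) ^ 3 \<le> 1 / (\<delta> * M) ^ 3"
   by (intro frac_le power_mono zero_less_power)
     (simp_all only: hM mult_pos_pos[OF \<delta>(1) less_le_trans[OF zero_less_one M1]] less_imp_le order_refl zero_le_one)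
  also have "\<dots> = (2 / \<delta>) ^ 3 * (1 / (2 * M) ^ 3)" using \<delta>(1) M1 by (simp add: field_simps)
  also have "\<dots> \<le> (2 / \<delta>) ^ 3 * (f a * f b)" using 1 \<delta>(1) by (intro mult_left_mono) auto
  finally show "1 / norm (h x) ^ 3 \<le> (2 / \<delta>) ^ 3 * (case x of (a, b) => f a * f b)" by (simp add: x)
 qed auto
 moreover have inj: "inj_on h X"
 proof (rule inj_onI)
  fix x y assume "h x = h y"
  then have "of_int (fst x - fst y) + of_int (snd x - snd y) * tau = 0"
   by (simp add: h_def case_prod_unfold algebra_simps)
  then have "\<delta> * \<bar>real_of_int (fst x - fst y)\<bar> \<le> 0" "\<delta> * \<bar>real_of_int (snd x - snd y)\<bar> \<le> 0"
   using \<delta>(2)[of "fst x - fst y" "snd x - snd y"] \<delta>(3)[of "snd x - snd y" "fst x - fst y"] by auto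
  then show "x = y" using \<delta>(1) by (simp add: mult_le_0_iff prod_eq_iff)
 qed
 moreover have "h ` X = Lat tau - {0}"
 proof -
  have "h x ~= 0" if "x \<in> X" for x
  proof
   assume "h x = 0"
   then have "\<delta> * \<bar>real_of_int (fst x)\<bar> \<le> 0" "\<delta> * \<bar>real_of_int (snd x)\<bar> \<le> 0"
    using \<delta>(2)[of "fst x" "snd x"] \<delta>(3)[of "snd x" "fst x"] by (auto simp: h_def case_prod_unfold)
   then show False using \<delta>(1) that by (cases x) (auto simp: mult_le_0_iff X_def)
  qed
  moreover have "\<omega> \<in> h ` X" if "\<omega> \<in> Lat tau - {0}" for \<omega>
  proof -
   from that obtain a b where "\<omega> = of_int a + of_int b * tau" "\<omega> ~= 0" by (auto simp: period_lattice_def)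
   then show ?thesis by (intro image_eqI[of _ _ "(a, b)"]) (auto simp: h_def X_def)
  qed
  ultimately show ?thesis by (auto simp: h_def X_def)
 qed
 ultimately show ?thesis using summable_on_reindex[OF inj, of "%\<omega>. 1 / norm \<omega> ^ 3"] by (simp add: o_def)
qed

text \<open>Weierstrass' theorem along the filter of finite subsets. It also yields the convergence
  of the sums of derivatives, so a majorant of f alone suffices.\<close>

lemma infsum_has_field_derivative:
 fixes f :: "'a => complex => complex"
 assumes "M summable_on X" "!!\<omega> z. \<omega> \<in> X ==> z \<in> cball 0 R ==> norm (f \<omega> z) \<le> M \<omega>"
  and D: "!!\<omega> z. \<omega> \<in> X ==> z \<in> cball 0 R ==> (f \<omega> has_field_derivative f' \<omega> z) (at z)"
  and z: "z \<in> ball 0 R"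
 shows "((%z. \<Sum>\<^sub>\<infinity>\<omega>\<in>X. f \<omega> z) has_field_derivative (\<Sum>\<^sub>\<infinity>\<omega>\<in>X. f' \<omega> z)) (at z)"
proof -
 have ul: "uniform_limit (cball 0 R) (%F z. \<Sum>\<omega>\<in>F. f \<omega> z) (%z. \<Sum>\<^sub>\<infinity>\<omega>\<in>X. f \<omega> z) (finite_subsets_at_top X)"
  by (rule Weierstrass_m_test_general[OF assms(2,1)])
 have DF: "((%z. \<Sum>\<omega>\<in>F. f \<omega> z) has_field_derivative (\<Sum>\<omega>\<in>F. f' \<omega> w)) (at w)"
  if "F \<subseteq> X" "w \<in> cball 0 R" for F w
  using that by (intro DERIV_sum D) auto
 have "\<forall>\<^sub>F F in finite_subsets_at_top X. continuous_on (cball 0 R) (%z. \<Sum>\<omega>\<in>F. f \<omega> z) \<and>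
   (\<forall>w\<in>ball 0 R. ((%z. \<Sum>\<omega>\<in>F. f \<omega> z) has_field_derivative (\<Sum>\<omega>\<in>F. f' \<omega> w)) (at w))"
  by (rule eventually_finite_subsets_at_top_weakI)
    (auto intro!: DF DERIV_continuous_on[OF DERIV_subset[OF DF]])
 moreover have "0 < R" using z by (metis ball_eq_empty empty_iff not_le)
 ultimately obtain g' where g': "!!w. w \<in> ball 0 R ==>
   ((%z. \<Sum>\<^sub>\<infinity>\<omega>\<in>X. f \<omega> z) has_field_derivative g' w) (at w) \<and>
   ((%F. \<Sum>\<omega>\<in>F. f' \<omega> w) \<longlongrightarrow> g' w) (finite_subsets_at_top X)"
  using has_complex_derivative_uniform_limit[OF _ ul, of "%F w. \<Sum>\<omega>\<in>F. f' \<omega> w"] by auto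
 then have "((%\<omega>. f' \<omega> z) has_sum g' z) X" using z unfolding has_sum_def by blast
 then show ?thesis using g'[OF z] infsumI by metis
qed

text \<open>The summands of zeta, of - wp and of - wp' for j = 0, 1, 2; each is the z-derivative of
  the preceding one.\<close>

definition zeta_term :: "nat => complex => complex => complex" where
 "zeta_term j \<omega> z =
   (if j = 0 then 1 / (z - \<omega>) + 1 / \<omega> + z / \<omega>\<^sup>2 else if j = 1 then - (1 / (z - \<omega>)\<^sup>2 - 1 / \<omega>\<^sup>2)
   else 2 / (z - \<omega>) ^ 3)"

lemma has_field_derivative_zeta_term:
 assumes "z ~= \<omega>" "\<omega> ~= 0" "j < 2"
 shows "(zeta_term j \<omega> has_field_derivative zeta_term (Suc j) \<omega> z) (at z)"
proof -
 have "j = 0 \<or> j = 1" using assms by auto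
 then show ?thesis
 proof
  assume j: "j = 0"
  have "((%z. 1 / (z - \<omega>) + 1 / \<omega> + z / \<omega>\<^sup>2) has_field_derivative - (1 / (z - \<omega>)\<^sup>2 - 1 / \<omega>\<^sup>2)) (at z)"
   using assms by (auto intro!: derivative_eq_intros simp: power2_eq_square)
  then show ?thesis using j by (simp add: zeta_term_def[abs_def])
 next
  assume j: "j = 1"
  have "((%y. - (1 / y\<^sup>2 - 1 / \<omega>\<^sup>2)) has_field_derivative 2 / y ^ 3) (at y)" if "y ~= 0" for y
   using that assms by (auto intro!: derivative_eq_intros simp: power2_eq_square power3_eq_cube)
  from this[of "z - \<omega>"] have "((%z. - (1 / (z - \<omega>)\<^sup>2 - 1 / \<omega>\<^sup>2)) has_field_derivative 2 / (z - \<omega>) ^ 3) (at z)"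
   using DERIV_shift[of "%y. - (1 / y\<^sup>2 - 1 / \<omega>\<^sup>2)" "2 / (z - \<omega>) ^ 3" z "- \<omega>"] assms by simp
  then show ?thesis using j by (simp add: zeta_term_def[abs_def])
 qed
qed

text \<open>For |\<omega>| > 2 R the distance |z - \<omega>| is at least |\<omega>| / 2. Combining
  the fractions gives the constants 2 R^2, 10 R and 16 for j = 0, 1, 2; their sum covers all three
  cases.\<close>

lemma norm_zeta_term_le:
 assumes "norm z \<le> R" "2 * R < norm \<omega>" "j \<le> 2"
 shows "norm (zeta_term j \<omega> z) \<le> (2 * R\<^sup>2 + 10 * R + 16) * (1 / norm \<omega> ^ 3)"
proof -
 define W where "W = norm \<omega>"
 have R: "R \<ge> 0" using assms(1) norm_ge_zero order_trans by blast
 have W: "W > 0" using assms(2) R unfolding W_def by linarith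
 then have w0: "\<omega> ~= 0" by (auto simp: W_def)
 have d: "norm (z - \<omega>) \<ge> W / 2"
  using norm_triangle_ineq2[of \<omega> z] assms by (simp add: W_def norm_minus_commute)
 then have zw: "z - \<omega> ~= 0" using W by auto
 have A: "x * y / W ^ 3 \<le> (2 * R\<^sup>2 + 10 * R + 16) * (1 / W ^ 3)" if "x * y \<le> 2 * R\<^sup>2 + 10 * R + 16" for x y
  using divide_right_mono[OF that, of "W ^ 3"] W by simp
 consider "j = 0" | "j = 1" | "j = 2" using assms(3) by linarith
 then show ?thesis
 proof cases
  case 1
  have "zeta_term j \<omega> z = z\<^sup>2 / ((z - \<omega>) * \<omega>\<^sup>2)"
   using w0 zw 1 by (simp add: zeta_term_def field_simps power2_eq_square)
  then have "norm (zeta_term j \<omega> z) = (norm z)\<^sup>2 / (norm (z - \<omega>) * W\<^sup>2)"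
   by (simp add: norm_divide norm_mult norm_power W_def)
  also have "\<dots> \<le> R\<^sup>2 / (W / 2 * W\<^sup>2)"
   using d W assms R by (intro frac_le mult_right_mono power_mono) auto
  also have "\<dots> = 2 * R\<^sup>2 / W ^ 3" using W by (simp add: field_simps power2_eq_square power3_eq_cube)
  also have "\<dots> \<le> (2 * R\<^sup>2 + 10 * R + 16) * (1 / W ^ 3)" using R by (intro A) auto
  finally show ?thesis by (simp add: W_def)
 next
  case 2
  have "zeta_term j \<omega> z = z * (z - 2 * \<omega>) / ((z - \<omega>)\<^sup>2 * \<omega>\<^sup>2)"
  proof -
   define d where "d = z - \<omega>"
   have z: "z = \<omega> + d" and "d ~= 0" using zw by (auto simp: d_def)
   then show ?thesis
    unfolding z using w0 2 by (simp add: zeta_term_def field_simps power2_eq_square)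
  qed
  then have "norm (zeta_term j \<omega> z) = norm z * norm (z - 2 * \<omega>) / ((norm (z - \<omega>))\<^sup>2 * W\<^sup>2)"
   by (simp add: norm_divide norm_mult norm_power W_def)
  also have "\<dots> \<le> R * (5/2 * W) / ((W / 2)\<^sup>2 * W\<^sup>2)"
  proof (intro frac_le mult_right_mono mult_mono power_mono)
   show "norm (z - 2 * \<omega>) \<le> 5/2 * W"
    using norm_triangle_ineq4[of z "2 * \<omega>"] assms by (simp add: W_def norm_mult)
  qed (use d W assms R in auto)
  also have "\<dots> = 10 * R / W ^ 3" using W by (simp add: field_simps power2_eq_square power3_eq_cube)
  also have "\<dots> \<le> (2 * R\<^sup>2 + 10 * R + 16) * (1 / W ^ 3)" using R by (intro A) auto
  finally show ?thesis by (simp add: W_def)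
 next
  case 3
  then have "norm (zeta_term j \<omega> z) = 2 / norm (z - \<omega>) ^ 3"
   by (simp add: zeta_term_def norm_divide norm_power)
  also have "\<dots> \<le> 2 / (W / 2) ^ 3" using d W by (intro frac_le power_mono) auto
  also have "\<dots> = 8 * 2 / W ^ 3" using W by (simp add: field_simps)
  also have "\<dots> \<le> (2 * R\<^sup>2 + 10 * R + 16) * (1 / W ^ 3)" using R by (intro A) auto
  finally show ?thesis by (simp add: W_def)
 qed
qed

definition zeta_sum :: "complex => nat => complex => complex" where
 "zeta_sum tau j z = (\<Sum>\<^sub>\<infinity>\<omega>\<in>Lat tau - {0}. zeta_term j \<omega> z)"

lemma zeta_sum_split:
 assumes "tau \<in> uhp" "norm z \<le> R" "j \<le> 2"
 shows "zeta_sum tau j z = (\<Sum>\<omega>\<in>{\<omega> \<in> Lat tau - {0}. norm \<omega> \<le> 2 * R}. zeta_term j \<omega> z) +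
   (\<Sum>\<^sub>\<infinity>\<omega>\<in>{\<omega> \<in> Lat tau - {0}. 2 * R < norm \<omega>}. zeta_term j \<omega> z)"
  and "(%\<omega>. zeta_term j \<omega> z) summable_on {\<omega> \<in> Lat tau - {0}. 2 * R < norm \<omega>}"
  and "(%\<omega>. zeta_term j \<omega> z) summable_on Lat tau - {0}"
proof -
 let ?A = "{\<omega> \<in> Lat tau - {0}. norm \<omega> \<le> 2 * R}"
 let ?B = "{\<omega> \<in> Lat tau - {0}. 2 * R < norm \<omega>}"
 have fin: "finite ?A" by (rule finite_subset[OF _ finite_period_lattice_bounded[OF assms(1), of "2 * R"]]) auto
 have "(%\<omega>. (2 * R\<^sup>2 + 10 * R + 16) * (1 / norm \<omega> ^ 3)) summable_on ?B"
  by (intro summable_on_cmult_right summable_on_subset_banach[OF summable_on_lattice_cube[OF assms(1)]]) auto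
 then have "(%\<omega>. norm (zeta_term j \<omega> z)) summable_on ?B"
  by (rule summable_on_comparison_test) (use norm_zeta_term_le[OF assms(2) _ assms(3)] in auto)
 then show B: "(%\<omega>. zeta_term j \<omega> z) summable_on ?B"
  by (rule abs_summable_summable)
 have U: "Lat tau - {0} = ?A \<union> ?B" by auto
 have "(%\<omega>. zeta_term j \<omega> z) summable_on (?A \<union> ?B)"
  using fin B by (intro summable_on_union) auto
 then show "(%\<omega>. zeta_term j \<omega> z) summable_on Lat tau - {0}"
  unfolding U[symmetric] .
 have "infsum (%\<omega>. zeta_term j \<omega> z) (?A \<union> ?B) = (\<Sum>\<omega>\<in>?A. zeta_term j \<omega> z) + (\<Sum>\<^sub>\<infinity>\<omega>\<in>?B. zeta_term j \<omega> z)"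
  using fin B by (subst infsum_Un_disjoint) (auto simp del: not_less)
 then show "zeta_sum tau j z = (\<Sum>\<omega>\<in>?A. zeta_term j \<omega> z) + (\<Sum>\<^sub>\<infinity>\<omega>\<in>?B. zeta_term j \<omega> z)"
  unfolding zeta_sum_def U[symmetric] .
qed

lemma has_field_derivative_zeta_tail:
 assumes "tau \<in> uhp" "norm z < R" "j < 2"
 shows "((%z. \<Sum>\<^sub>\<infinity>\<omega>\<in>{\<omega> \<in> Lat tau - {0}. 2 * R < norm \<omega>}. zeta_term j \<omega> z) has_field_derivative
   (\<Sum>\<^sub>\<infinity>\<omega>\<in>{\<omega> \<in> Lat tau - {0}. 2 * R < norm \<omega>}. zeta_term (Suc j) \<omega> z)) (at z)"
proof (rule infsum_has_field_derivative)
 show "(%\<omega>. (2 * R\<^sup>2 + 10 * R + 16) * (1 / norm \<omega> ^ 3)) summable_on {\<omega> \<in> Lat tau - {0}. 2 * R < norm \<omega>}"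
  by (intro summable_on_cmult_right summable_on_subset_banach[OF summable_on_lattice_cube[OF assms(1)]]) auto
 fix \<omega> z assume w: "\<omega> \<in> {\<omega> \<in> Lat tau - {0}. 2 * R < norm \<omega>}" "z \<in> cball (0::complex) R"
 then show "norm (zeta_term j \<omega> z) \<le> (2 * R\<^sup>2 + 10 * R + 16) * (1 / norm \<omega> ^ 3)"
  using assms by (intro norm_zeta_term_le) auto
 have "norm z \<le> R" "0 \<le> R" "2 * R < norm \<omega>" using w order_trans[OF norm_ge_zero, of z R] by auto
 then have "z ~= \<omega>" "\<omega> ~= 0" by auto
 then show "(zeta_term j \<omega> has_field_derivative zeta_term (Suc j) \<omega> z) (at z)"
  using assms by (intro has_field_derivative_zeta_term)
qed (use assms in auto)

text \<open>Near z the sum is a finite part plus a uniformly convergent tail. Taking away the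
  summand of p makes the rest differentiable at p as well, where zeta has a pole; for p = 0 the sum
  has no such summand.\<close>

lemma has_field_derivative_zeta_sum:
 assumes tau: "tau \<in> uhp" and z: "z ~: Lat tau - {0} - {p}" and j: "j < 2"
  and p: "p \<in> Lat tau"
 shows "((%z. zeta_sum tau j z - (if p = 0 then 0 else zeta_term j p z)) has_field_derivative
   (zeta_sum tau (Suc j) z - (if p = 0 then 0 else zeta_term (Suc j) p z))) (at z)"
proof -
 \<comment> \<open>R exceeds the norms of z and of p, so the summand of p belongs to the finite
   part.\<close>
 define R where "R = norm z + norm p + 1"
 define A where "A = {\<omega> \<in> Lat tau - {0}. norm \<omega> \<le> 2 * R}"
 define tail where "tail = (%j z. \<Sum>\<^sub>\<infinity>\<omega>\<in>{\<omega> \<in> Lat tau - {0}. 2 * R < norm \<omega>}. zeta_term j \<omega> z)"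
 have fin: "finite A" unfolding A_def
  by (rule finite_subset[OF _ finite_period_lattice_bounded[OF tau, of "2 * R"]]) auto
 have eq: "zeta_sum tau k w - (if p = 0 then 0 else zeta_term k p w) =
   (\<Sum>\<omega>\<in>A - {p}. zeta_term k \<omega> w) + tail k w" if "norm w < R" "k \<le> 2" for w k
 proof -
  have "(\<Sum>\<omega>\<in>A. zeta_term k \<omega> w) = (\<Sum>\<omega>\<in>A - {p}. zeta_term k \<omega> w) + (if p = 0 then 0 else zeta_term k p w)"
  proof (cases "p = 0")
   case False
   then have "p \<in> A" using p by (auto simp: A_def R_def)
   then show ?thesis using fin False by (simp add: sum.remove)
  next
   case True
   then have "A - {p} = A" by (auto simp: A_def)
   then show ?thesis using True by simp
  qed
  then show ?thesis
   using zeta_sum_split(1)[OF tau, of w R k] that by (simp add: A_def tail_def)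
 qed
 have zR: "norm z < R" and pR: "norm p \<le> 2 * R" and zR2: "norm z \<le> 2 * R"
  using norm_ge_zero[of p] norm_ge_zero[of z] by (auto simp: R_def simp del: norm_ge_zero)
 have "((%z. (\<Sum>\<omega>\<in>A - {p}. zeta_term j \<omega> z) + tail j z) has_field_derivative
   ((\<Sum>\<omega>\<in>A - {p}. zeta_term (Suc j) \<omega> z) + tail (Suc j) z)) (at z)"
  unfolding tail_def using z j
  by (intro DERIV_add DERIV_sum has_field_derivative_zeta_term has_field_derivative_zeta_tail tau)
    (use zR in \<open>auto simp: A_def\<close>)
 then have "((%z. zeta_sum tau j z - (if p = 0 then 0 else zeta_term j p z)) has_field_derivative
   ((\<Sum>\<omega>\<in>A - {p}. zeta_term (Suc j) \<omega> z) + tail (Suc j) z)) (at z)"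
  by (rule has_field_derivative_transform_within_open[of _ _ _ "ball 0 R"])
    (use eq[of _ j] j zR in simp_all)
 then show ?thesis using eq[OF zR, of "Suc j"] j by simp
qed

text \<open>The local form of theta at a zero p, with U p = theta'(p). Where U does not vanish it
  gives theta'/theta = 1/(z - p) + U'/U.\<close>

lemma th_factor_zero:
 assumes "norm q < 1" "th 0 p q = 0"
 obtains U where "U holomorphic_on UNIV" "!!z. th 0 z q = (z - p) * U z" "U p ~= 0"
  "!!z. th 1 z q = U z + (z - p) * deriv U z"
proof -
 have hT: "(%z. th 0 z q) holomorphic_on UNIV" by (intro holomorphic_intros assms)
 have hk: "(%z. z - p) holomorphic_on UNIV" by (intro holomorphic_intros)
 have dk: "deriv (%z. z - p) z = 1" for z
  by (rule DERIV_imp_deriv) (auto intro!: derivative_eq_intros)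
 obtain U where U: "U holomorphic_on UNIV" "!!z. th 0 z q = (z - p) * U z"
  by (rule entire_divide[OF hT hk]) (use dk assms(2) in auto)
 have d: "(U has_field_derivative deriv U z) (at z)" for z
  using U(1) by (intro holomorphic_derivI) auto
 have t1: "th 1 z q = U z + (z - p) * deriv U z" for z
 proof -
  have "((%z. (z - p) * U z) has_field_derivative U z + (z - p) * deriv U z) (at z)"
   by (rule derivative_eq_intros d refl | simp)+
  then show ?thesis
   using has_field_derivative_th[OF assms(1), of 0 z] by (simp add: U(2) DERIV_unique)
 qed
 moreover have "U p ~= 0" using t1[of p] th_simple_zero[OF assms] by simp
 ultimately show ?thesis using that U by blast
qed

lemma closed_period_lattice: "tau \<in> uhp ==> closed (Lat tau)"
proof -
 assume tau: "tau \<in> uhp"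
 have "continuous_on UNIV (%z. th 0 z (nome tau))"
  using tau by (intro holomorphic_on_imp_continuous_on holomorphic_intros) auto
 then have "closed ((%z. th 0 z (nome tau)) -` {0})" by (intro closed_vimage) auto
 also have "(%z. th 0 z (nome tau)) -` {0} = Lat tau" using th_eq_0_iff[OF tau] by auto
 finally show ?thesis .
qed

lemma eventually_notin_period_lattice:
 assumes "tau \<in> uhp"
 shows "eventually (%z. z ~: Lat tau) (at p)"
proof -
 let ?F = "{\<omega> \<in> Lat tau. norm \<omega> \<le> norm p + 1}"
 have "finite (?F - {p})" using finite_period_lattice_bounded[OF assms] by blast
 then have "open (ball p 1 - (?F - {p}))" by (intro open_Diff finite_imp_closed) auto
 then have "eventually (%z. z \<in> ball p 1 - (?F - {p})) (nhds p)" by (rule eventually_nhds_in_open) auto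
 then have "eventually (%z. z \<in> ball p 1 - (?F - {p}) \<and> z ~= p) (at p)"
  by (auto simp: eventually_at_filter elim: eventually_mono)
 then show ?thesis
 proof eventually_elim
  case (elim z)
  then have "norm z \<le> norm p + 1" using norm_triangle_ineq2[of z p] by (auto simp: dist_norm norm_minus_commute)
  then show ?case using elim by auto
 qed
qed

section \<open>The Weierstrass functions as lattice sums\<close>

lemma weierstrass_zeta_eq: "weierstrass_zeta z tau = 1 / z + zeta_sum tau 0 z"
 by (simp add: weierstrass_zeta_def zeta_sum_def zeta_term_def)

lemma weierstrass_p_eq: "weierstrass_p z tau = 1 / z\<^sup>2 - zeta_sum tau 1 z"
 unfolding weierstrass_p_def zeta_sum_def zeta_term_def by (simp add: infsum_uminus[symmetric])

lemma has_field_derivative_weierstrass_zeta: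
 assumes "tau \<in> uhp" "z ~: Lat tau"
 shows "((%z. weierstrass_zeta z tau) has_field_derivative - weierstrass_p z tau) (at z)"
proof -
 have z0: "z ~= 0" using assms by auto
 have "(zeta_sum tau 0 has_field_derivative zeta_sum tau 1 z) (at z)"
  using has_field_derivative_zeta_sum[OF assms(1), of z 0 0] assms by simp
 then have "((%z. 1 / z + zeta_sum tau 0 z) has_field_derivative - (1 / z\<^sup>2) + zeta_sum tau 1 z) (at z)"
  using z0 by (auto intro!: derivative_eq_intros simp: power2_eq_square)
 then show ?thesis by (simp add: weierstrass_zeta_eq[abs_def] weierstrass_p_eq)
qed

lemma has_field_derivative_weierstrass_p:
 assumes "tau \<in> uhp" "z ~: Lat tau"
 shows "((%z. weierstrass_p z tau) has_field_derivative - (\<Sum>\<^sub>\<infinity>\<omega>\<in>Lat tau. 2 / (z - \<omega>) ^ 3)) (at z)"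
proof -
 have z0: "z ~= 0" using assms by auto
 have "(zeta_sum tau 1 has_field_derivative zeta_sum tau 2 z) (at z)"
  using has_field_derivative_zeta_sum[OF assms(1), of z 0 1] assms by (simp add: numeral_2_eq_2)
 moreover have "((%z :: complex. 1 / z\<^sup>2) has_field_derivative - (2 / z ^ 3)) (at z)"
  using z0 by (auto intro!: derivative_eq_intros simp: power2_eq_square power3_eq_cube)
 ultimately have "((%z. 1 / z\<^sup>2 - zeta_sum tau 1 z) has_field_derivative - (2 / z ^ 3) - zeta_sum tau 2 z) (at z)"
  by (rule DERIV_diff[rotated])
 moreover have "(\<Sum>\<^sub>\<infinity>\<omega>\<in>Lat tau. 2 / (z - \<omega>) ^ 3) = 2 / z ^ 3 + zeta_sum tau 2 z"
 proof -
  have "(%\<omega>. 2 / (z - \<omega>) ^ 3) summable_on Lat tau - {0}"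
   using zeta_sum_split(3)[OF assms(1), of z "norm z" 2] by (simp add: zeta_term_def)
  moreover have "Lat tau = {0} \<union> (Lat tau - {0})" by auto
  ultimately have "(\<Sum>\<^sub>\<infinity>\<omega>\<in>Lat tau. 2 / (z - \<omega>) ^ 3) =
    (\<Sum>\<^sub>\<infinity>\<omega>\<in>{0}. 2 / (z - \<omega>) ^ 3) + (\<Sum>\<^sub>\<infinity>\<omega>\<in>Lat tau - {0}. 2 / (z - \<omega>) ^ 3)"
   using infsum_Un_disjoint[of "%\<omega>. 2 / (z - \<omega>) ^ 3" "{0}" "Lat tau - {0}"] by simp
  then show ?thesis by (simp add: zeta_sum_def zeta_term_def)
 qed
 ultimately show ?thesis by (simp add: weierstrass_p_eq[abs_def])
qed

lemma bij_betw_shift_lattice: "\<omega> \<in> Lat tau ==> bij_betw (%x. x + \<omega>) (Lat tau) (Lat tau)"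
 by (rule bij_betwI[of _ _ _ "%x. x - \<omega>"])
   (auto simp: period_lattice_add_iff period_lattice_add dest: period_lattice_add[of _ tau "- \<omega>"])

lemma bij_betw_uminus_lattice: "bij_betw uminus (Lat tau - {0}) (Lat tau - {0})"
 by (rule bij_betwI[of _ _ _ uminus]) auto

lemma infsum_cube_periodic:
 assumes "\<omega>' \<in> Lat tau"
 shows "(\<Sum>\<^sub>\<infinity>\<omega>\<in>Lat tau. 2 / (z + \<omega>' - \<omega>) ^ 3) = (\<Sum>\<^sub>\<infinity>\<omega>\<in>Lat tau. 2 / (z - \<omega>) ^ 3)"
 using infsum_reindex_bij_betw[OF bij_betw_shift_lattice[OF assms], of "%\<omega>. 2 / (z + \<omega>' - \<omega>) ^ 3"]
 by (simp add: algebra_simps)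

lemma weierstrass_zeta_minus: "weierstrass_zeta (- z) tau = - weierstrass_zeta z tau"
proof -
 have "zeta_sum tau 0 (- z) = (\<Sum>\<^sub>\<infinity>\<omega>\<in>Lat tau - {0}. zeta_term 0 (- \<omega>) (- z))"
  unfolding zeta_sum_def using infsum_reindex_bij_betw[OF bij_betw_uminus_lattice, of "%\<omega>. zeta_term 0 \<omega> (- z)" tau] by simp
 also have "\<dots> = (\<Sum>\<^sub>\<infinity>\<omega>\<in>Lat tau - {0}. - zeta_term 0 \<omega> z)"
 proof (rule infsum_cong)
  fix \<omega> :: complex
  have "1 / (\<omega> - z) = - (1 / (z - \<omega>))" by (metis minus_diff_eq minus_divide_right)
  then show "zeta_term 0 (- \<omega>) (- z) = - zeta_term 0 \<omega> z" by (simp add: zeta_term_def)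
 qed
 finally show ?thesis by (simp add: weierstrass_zeta_eq zeta_sum_def infsum_uminus)
qed

section \<open>Expression of zeta and wp by theta\<close>

definition theta_logderiv :: "complex => complex => complex" where
 "theta_logderiv z q = th 1 z q / th 0 z q"

text \<open>The constant \<open>c\<close> in \<open>\<zeta>(z) = \<theta>'(z)/\<theta>(z) + c z\<close>.\<close>

definition theta_const :: "complex => complex" where
 "theta_const q = - th 3 0 q / (3 * th 1 0 q)"

text \<open>This is wp, obtained as minus the derivative of theta'/theta + c z. The formula involves
  only the nome and so makes sense at the nome 0 too.\<close>

definition wpq0 :: "complex => complex => complex" where
 "wpq0 z q = - ((th 2 z q * th 0 z q - (th 1 z q)\<^sup>2) * inverse (th 0 z q) ^ 2) - theta_const q"

definition wpq :: "nat => complex => complex => complex" where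
 "wpq j z q = (deriv ^^ j) (%z. wpq0 z q) z"

lemma has_field_derivative_theta_logderiv:
 assumes "norm q < 1" "th 0 z q ~= 0"
 shows "((%z. theta_logderiv z q) has_field_derivative - wpq0 z q - theta_const q) (at z)"
proof -
 have D: "((%z. th r z q) has_field_derivative th (Suc r) z q) (at z)" for r
  by (rule has_field_derivative_th[OF assms(1)])
 have "((%z. th 1 z q / th 0 z q) has_field_derivative
   (th 2 z q * th 0 z q - th 1 z q * th 1 z q) / (th 0 z q * th 0 z q)) (at z)"
  using DERIV_divide[OF D[of 1] D[of 0] assms(2)] by (simp add: numeral_2_eq_2)
 then show ?thesis
  using assms(2) by (simp add: theta_logderiv_def[abs_def] wpq0_def field_simps power2_eq_square)
qed

text \<open>The value of E at a singular point is an artefact of division by zero, so the hypothesis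
  compares E with an analytic function only off p. \<open>remove_sings\<close> glues these local
  functions together.\<close>

lemma entire_extension:
 assumes "!!p. \<exists>h. h analytic_on {p} \<and> eventually (%z. E z = h z) (at p)"
 obtains F where "F holomorphic_on UNIV" "!!p. E analytic_on {p} ==> F p = E p"
proof
 have "remove_sings E analytic_on {p}" for p
 proof -
  obtain h where h: "h analytic_on {p}" "eventually (%z. E z = h z) (at p)" using assms by blast
  have a: "eventually (%z. h analytic_on {z}) (nhds p)"
   using h(1) by (metis (mono_tags, lifting) analytic_at analytic_on_analytic_at eventually_nhds)
  have e: "eventually (%z. z ~= p --> E z = h z) (nhds p)"
   using h(2) by (simp add: eventually_at_filter)
  have "eventually (%z. remove_sings E z = h z) (nhds p)"
   using a eventually_eventually[THEN iffD2, OF e]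
  proof eventually_elim
   case (elim z)
   have "eventually (%w. E w = h w) (at z)"
   proof (cases "z = p")
    case False
    then have "eventually (%w. w ~= p) (nhds z)" by (intro t1_space_nhds) auto
    with elim(2) have "eventually (%w. E w = h w) (nhds z)" by eventually_elim auto
    then show ?thesis by (auto simp: eventually_at_filter elim: eventually_mono)
   qed (use h in auto)
   then have "remove_sings E z = remove_sings h z" by (rule remove_sings_cong) auto
   then show ?case using elim(1) by simp
  qed
  then show ?thesis using h(1) analytic_at_cong by blast
 qed
 then show "remove_sings E holomorphic_on UNIV"
  by (intro analytic_imp_holomorphic) (meson analytic_on_analytic_at)
 show "remove_sings E p = E p" if "E analytic_on {p}" for p
  using that by simp
qed

text \<open>Both functions have a simple pole of residue 1 at each lattice point p. For theta'/theta
  this is read off from theta = (z - p) U; for zeta the pole is the separate term 1/z if p = 0 and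
  the summand of p otherwise.\<close>

lemma zeta_minus_logderiv_extends:
 assumes tau: "tau \<in> uhp"
 shows "\<exists>h. h analytic_on {p} \<and>
  eventually (%z. weierstrass_zeta z tau - theta_logderiv z (nome tau) = h z) (at p)"
proof (cases "p \<in> Lat tau")
 case False
 have "(%z. weierstrass_zeta z tau - theta_logderiv z (nome tau)) holomorphic_on - Lat tau"
  by (intro holomorphic_on_diff)
    (use has_field_derivative_weierstrass_zeta[OF tau] has_field_derivative_theta_logderiv[of "nome tau"]
     th_eq_0_iff[OF tau] tau closed_period_lattice[OF tau]
    in \<open>auto simp: holomorphic_on_open open_Compl\<close>)
 then have "(%z. weierstrass_zeta z tau - theta_logderiv z (nome tau)) analytic_on {p}"
  using closed_period_lattice[OF tau] False by (auto simp: analytic_at open_Compl intro!: exI[of _ "- Lat tau"])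
 then show ?thesis by (intro exI conjI) auto
next
 case True
 obtain U where U: "U holomorphic_on UNIV" "!!z. th 0 z (nome tau) = (z - p) * U z" "U p ~= 0"
  "!!z. th 1 z (nome tau) = U z + (z - p) * deriv U z"
  using th_factor_zero[of "nome tau" p] th_eq_0_iff[OF tau] True tau by auto
 define G where "G = (%z. zeta_sum tau 0 z - (if p = 0 then 0 else zeta_term 0 p z))"
 define S where "S = ball p 1 - ({\<omega> \<in> Lat tau. norm \<omega> \<le> norm p + 1} - {p})"
 have oS: "open S" unfolding S_def using finite_period_lattice_bounded[OF tau, of "norm p + 1"]
  by (intro open_Diff finite_imp_closed) auto
 have Sz: "z ~: Lat tau - {0} - {p}" if "z \<in> S" for z
 proof -
  have "norm z \<le> norm p + 1"
   using norm_triangle_ineq2[of z p] that by (auto simp: S_def dist_norm norm_minus_commute)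
  then show ?thesis using that by (auto simp: S_def)
 qed
 have "(G has_field_derivative (zeta_sum tau 1 z - (if p = 0 then 0 else zeta_term 1 p z))) (at z)" if "z \<in> S" for z
  using has_field_derivative_zeta_sum[OF tau Sz[OF that] pos2 True] unfolding G_def One_nat_def by fast
 then have "G holomorphic_on S"
  using holomorphic_on_open[OF oS] by metis
 then have G: "G analytic_on {p}" using oS by (auto simp: analytic_at S_def intro!: exI[of _ S])
 define h where "h = (%z. (if p = 0 then 0 else 1 / z + 1 / p + z / p\<^sup>2) + G z - deriv U z / U z)"
 have Ua: "U analytic_on {p}" "deriv U analytic_on {p}"
  using U(1) holomorphic_deriv[OF U(1)] by (auto simp: analytic_on_open intro: analytic_on_subset[of _ UNIV])
 have "h analytic_on {p}"
  unfolding h_def using U(3) G Ua by (cases "p = 0") (auto intro!: analytic_intros)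
 moreover have "isCont U p" using continuous_on_interior[OF holomorphic_on_imp_continuous_on[OF U(1)]] by simp
 then have "eventually (%z. U z ~= 0) (at p)" using U(3) by (intro tendsto_imp_eventually_ne) (auto simp: isCont_def)
 then have "eventually (%z. U z ~= 0 \<and> z ~= p) (at p)" by (simp add: eventually_at_filter)
 then have "eventually (%z. weierstrass_zeta z tau - theta_logderiv z (nome tau) = h z) (at p)"
 proof eventually_elim
  case (elim z)
  then have "theta_logderiv z (nome tau) = 1 / (z - p) + deriv U z / U z"
   by (simp add: theta_logderiv_def U(2,4)[unfolded One_nat_def] field_simps)
  then show ?case by (auto simp: h_def G_def weierstrass_zeta_eq zeta_term_def)
 qed
 ultimately show ?thesis by blast
qed

lemma th_1_plus_tau:
 assumes "tau \<in> uhp"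
 shows "th 1 (z + tau) (nome tau) = theta_mult tau * exp (- 2 * of_real pi * \<i> * z) *
  (th 1 z (nome tau) - 2 * of_real pi * \<i> * th 0 z (nome tau))"
proof -
 have D: "((%z. th 0 z (nome tau)) has_field_derivative th 1 z (nome tau)) (at z)" for z
  using has_field_derivative_th[of "nome tau" 0 z] assms by simp
 define E where "E = (%z. theta_mult tau * exp (- 2 * of_real pi * \<i> * z))"
 have dE: "(E has_field_derivative - 2 * of_real pi * \<i> * E z) (at z)" for z
  unfolding E_def by (auto intro!: derivative_eq_intros)
 have eq: "th 0 (z + tau) (nome tau) = E z * th 0 z (nome tau)" for z
  using th_plus_tau[OF assms] by (simp add: E_def theta_mult_def)
 have "((%z. th 0 (z + tau) (nome tau)) has_field_derivative th 1 (z + tau) (nome tau)) (at z)"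
  using DERIV_shift[of "%z. th 0 z (nome tau)" "th 1 (z + tau) (nome tau)" z tau] D by simp
 moreover have "((%z. E z * th 0 z (nome tau)) has_field_derivative E z * (th 1 z (nome tau) - 2 * of_real pi * \<i> * th 0 z (nome tau))) (at z)"
  by (rule DERIV_cong[OF DERIV_mult[OF dE D]]) (simp add: algebra_simps)
 ultimately show ?thesis
  unfolding eq E_def using DERIV_unique by blast
qed

lemma theta_logderiv_periods:
 assumes "tau \<in> uhp"
 shows "theta_logderiv (z + 1) (nome tau) = theta_logderiv z (nome tau)"
  and "z ~: Lat tau ==> theta_logderiv (z + tau) (nome tau) = theta_logderiv z (nome tau) - 2 * of_real pi * \<i>"
proof -
 show "theta_logderiv (z + 1) (nome tau) = theta_logderiv z (nome tau)"
  using assms by (simp add: theta_logderiv_def th_plus_1)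
 assume z: "z ~: Lat tau"
 then have "th 0 z (nome tau) ~= 0" using th_eq_0_iff[OF assms] by simp
 then show "theta_logderiv (z + tau) (nome tau) = theta_logderiv z (nome tau) - 2 * of_real pi * \<i>"
  unfolding theta_logderiv_def th_1_plus_tau[OF assms] th_plus_tau[OF assms] theta_mult_def
  by (simp add: field_simps)
qed

lemma theta_logderiv_minus: "norm q < 1 ==> theta_logderiv (- z) q = - theta_logderiv z q"
 by (simp add: theta_logderiv_def th_minus)

text \<open>The difference F of zeta and theta'/theta is entire after removal of singularities. Its
  second derivative is elliptic: wp' is a sum over the full lattice and so visibly periodic, and
  theta'/theta changes by constants under the periods. Thus F is a polynomial of degree at most 2,
  and being odd it is a multiple of z. Passing to the second derivative makes it possible to do
  without the quasi-periods of zeta.\<close>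

lemma weierstrass_zeta_eq_theta_aux:
 assumes tau: "tau \<in> uhp"
 obtains c where "!!z. z ~: Lat tau ==>
  weierstrass_zeta z tau = theta_logderiv z (nome tau) + c * z"
proof -
 define q where "q = nome tau"
 have q: "norm q < 1" using tau by (simp add: q_def)
 have T0: "th 0 z q = 0 \<longleftrightarrow> z \<in> Lat tau" for z using th_eq_0_iff[OF tau] by (simp add: q_def)
 have oL: "open (- Lat tau)" using closed_period_lattice[OF tau] by (simp add: open_Compl)
 define E where "E = (%z. weierstrass_zeta z tau - theta_logderiv z q)"
 obtain F where F: "F holomorphic_on UNIV" and FE: "!!p. E analytic_on {p} ==> F p = E p"
  using entire_extension[of E] zeta_minus_logderiv_extends[OF tau] by (auto simp: E_def q_def)
 have dE: "(E has_field_derivative - weierstrass_p z tau + wpq0 z q + theta_const q) (at z)" if "z ~: Lat tau" for z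
  unfolding E_def
  by (rule DERIV_cong[OF DERIV_diff[OF has_field_derivative_weierstrass_zeta[OF tau that]
     has_field_derivative_theta_logderiv[OF q]]])
    (use that T0 in simp_all)
 then have "E holomorphic_on - Lat tau" using oL by (auto simp: holomorphic_on_open)
 then have "E analytic_on - Lat tau" using oL by (simp add: analytic_on_open)
 then have FE: "F z = E z" if "z ~: Lat tau" for z
  using FE that by (meson ComplI analytic_on_analytic_at)
 have dF: "(F has_field_derivative deriv F z) (at z)" "(deriv F has_field_derivative deriv (deriv F) z) (at z)" for z
  using F holomorphic_deriv[OF F] by (auto intro!: holomorphic_derivI[of _ UNIV])
 have F1: "deriv F z = - weierstrass_p z tau + wpq0 z q + theta_const q" if "z ~: Lat tau" for z
  by (rule DERIV_imp_deriv, rule has_field_derivative_transform_within_open[OF dE oL])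
    (use that FE in auto)
 have per2: "deriv (deriv F) (z + w) = deriv (deriv F) z"
  if w: "w \<in> Lat tau" and k: "!!z. z ~: Lat tau ==> theta_logderiv (z + w) q = theta_logderiv z q - k" for z w k
 proof -
  have wL: "z + w \<in> Lat tau \<longleftrightarrow> z \<in> Lat tau" for z by (rule period_lattice_add_iff[OF w])
  have dshift: "((%z. f (z + w)) has_field_derivative D) (at z)" if "(f has_field_derivative D) (at (z + w))" for f D and z :: complex
   using DERIV_shift[of f D z w] that by simp
  have w0: "wpq0 (z + w) q = wpq0 z q" if z: "z ~: Lat tau" for z
  proof -
   have "((%z. theta_logderiv (z + w) q) has_field_derivative - wpq0 (z + w) q - theta_const q) (at z)"
    by (intro dshift has_field_derivative_theta_logderiv q) (use z wL T0 in auto)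
   moreover have "((%z. theta_logderiv z q - k) has_field_derivative - wpq0 z q - theta_const q) (at z)"
    by (rule DERIV_cong[OF DERIV_diff[OF has_field_derivative_theta_logderiv[OF q] DERIV_const]]) (use z T0 in simp_all)
   then have "((%z. theta_logderiv (z + w) q) has_field_derivative - wpq0 z q - theta_const q) (at z)"
    by (rule has_field_derivative_transform_within_open[OF _ oL]) (use z k in auto)
   ultimately show ?thesis using DERIV_unique by fastforce
  qed
  have main: "deriv (deriv F) (z + w) = deriv (deriv F) z" if z: "z ~: Lat tau" for z
  proof -
   define P where "P = (%z. weierstrass_p z tau)"
   define D where "D = (%z. - (\<Sum>\<^sub>\<infinity>\<omega>\<in>Lat tau. 2 / (z - \<omega>) ^ 3))"
   have dP: "(P has_field_derivative D z) (at z)" if "z ~: Lat tau" for z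
    unfolding P_def D_def by (rule has_field_derivative_weierstrass_p[OF tau that])
   have dW: "((%z. wpq0 z q) has_field_derivative deriv (deriv F) z + D z) (at z)" if z: "z ~: Lat tau" for z
   proof -
    have "((%z. deriv F z + P z - theta_const q) has_field_derivative deriv (deriv F) z + D z) (at z)"
     using dF(2)[of z] dP[OF z] by (auto intro!: derivative_eq_intros)
    then show ?thesis
     by (rule has_field_derivative_transform_within_open[OF _ oL]) (use z F1 P_def in auto)
   qed
   have "((%z. wpq0 (z + w) q) has_field_derivative deriv (deriv F) (z + w) + D (z + w)) (at z)"
    using z wL by (intro dshift dW) auto
   then have "((%z. wpq0 z q) has_field_derivative deriv (deriv F) (z + w) + D (z + w)) (at z)"
    by (rule has_field_derivative_transform_within_open[OF _ oL]) (use z w0 in auto)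
   then have "deriv (deriv F) (z + w) + D (z + w) = deriv (deriv F) z + D z"
    using dW[OF z] DERIV_unique by blast
   moreover have "D (z + w) = D z" using infsum_cube_periodic[OF w, of z] by (simp add: D_def)
   ultimately show ?thesis by simp
  qed
  have hF: "deriv (deriv F) holomorphic_on UNIV" by (intro holomorphic_deriv F) auto
  obtain z0 where "th 0 z0 q ~= 0" using th_not_identically_0[OF q] .
  then have "deriv (deriv F) (z + w) - deriv (deriv F) z = 0"
   by (intro entire_mult_eq_0[of "%z. deriv (deriv F) (z + w) - deriv (deriv F) z" "%z. th 0 z q" z0])
     (use main T0 q in \<open>auto intro!: holomorphic_intros hF holomorphic_on_compose_gen[OF _ hF, unfolded o_def]\<close>)
  then show ?thesis by simp
 qed
 have "deriv (deriv F) (z + 1) = deriv (deriv F) z" for z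
  by (rule per2[of 1 0]) (use theta_logderiv_periods(1)[OF tau] in \<open>auto simp: q_def\<close>)
 moreover have "deriv (deriv F) (z + tau) = deriv (deriv F) z" for z
  by (rule per2[of tau "2 * of_real pi * \<i>"]) (use theta_logderiv_periods(2)[OF tau] in \<open>auto simp: q_def\<close>)
 ultimately obtain \<kappa> where \<kappa>: "!!z. deriv (deriv F) z = \<kappa>"
  using entire_elliptic_constant[of "deriv (deriv F)" tau] tau holomorphic_deriv[OF holomorphic_deriv[OF F]] by auto
 have "((%z. deriv F z - \<kappa> * z) has_field_derivative 0) (at z within UNIV)" for z
  using dF(2)[of z] by (auto intro!: derivative_eq_intros simp: \<kappa>)
 then obtain c where c: "!!z. deriv F z - \<kappa> * z = c"
  using has_field_derivative_zero_constant[of UNIV "%z. deriv F z - \<kappa> * z"] by auto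
 then have c: "deriv F z = \<kappa> * z + c" for z by (metis diff_add_cancel add.commute)
 have "((%z. F z - \<kappa> * z\<^sup>2 / 2 - c * z) has_field_derivative 0) (at z within UNIV)" for z
  using dF(1)[of z] by (auto intro!: derivative_eq_intros simp: c)
 then obtain d where d: "!!z. F z - \<kappa> * z\<^sup>2 / 2 - c * z = d"
  using has_field_derivative_zero_constant[of UNIV "%z. F z - \<kappa> * z\<^sup>2 / 2 - c * z"] by auto
 then have d: "F z = \<kappa> * z\<^sup>2 / 2 + c * z + d" for z by (metis add.commute diff_add_cancel diff_diff_add)
 obtain z0 where "th 0 z0 q ~= 0" using th_not_identically_0[OF q] .
 have Fm: "(F (- z) + F z) * th 0 z q = 0" for z
 proof (cases "z \<in> Lat tau")
  case False
  then show ?thesis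
   using FE[of z] FE[of "- z"] by (simp add: E_def weierstrass_zeta_minus theta_logderiv_minus[OF q])
 qed (simp add: T0)
 have hFm: "(%z. F (- z) + F z) holomorphic_on UNIV"
  by (intro holomorphic_on_add F holomorphic_on_compose_gen[OF _ F, unfolded o_def] holomorphic_on_minus
    holomorphic_on_ident) auto
 have odd: "F (- z) + F z = 0" for z
  by (rule entire_mult_eq_0[OF hFm _ Fm \<open>th 0 z0 q ~= 0\<close>]) (intro holomorphic_intros q)
 have "d = 0" using odd[of 0] by (simp add: d)
 moreover have "\<kappa> = 0" using odd[of 1] \<open>d = 0\<close> by (simp add: d)
 ultimately have "F z = c * z" for z by (simp add: d)
 then have "weierstrass_zeta z tau = theta_logderiv z q + c * z" if "z ~: Lat tau" for z
  using FE[OF that] by (simp add: E_def algebra_simps)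
 then show ?thesis using that by (auto simp: q_def)
qed

text \<open>The slope c is found by comparing derivatives at 0. The sum over \<omega> ~= 0 in zeta
  has derivative 0 there. The regular part U'/U of theta'/theta has derivative U''(0)/U(0), because
  U'(0) = 0; and U''(0) = theta'''(0)/3, U(0) = theta'(0).\<close>

lemma weierstrass_zeta_eq_theta:
 assumes tau: "tau \<in> uhp" and z: "z ~: Lat tau"
 shows "weierstrass_zeta z tau = theta_logderiv z (nome tau) + theta_const (nome tau) * z"
proof -
 define q where "q = nome tau"
 have q: "norm q < 1" using tau by (simp add: q_def)
 obtain c where c: "!!z. z ~: Lat tau ==> weierstrass_zeta z tau = theta_logderiv z q + c * z"
  using weierstrass_zeta_eq_theta_aux[OF tau] unfolding q_def by blast
 obtain U where U: "U holomorphic_on UNIV" "!!z. th 0 z q = z * U z" "U 0 ~= 0" "!!z. th 1 z q = U z + z * deriv U z"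
  using th_factor_zero[OF q, of 0] q by auto
 have dU: "(U has_field_derivative deriv U z) (at z)" "(deriv U has_field_derivative deriv (deriv U) z) (at z)"
  "(deriv (deriv U) has_field_derivative deriv (deriv (deriv U)) z) (at z)" for z
  using U(1) holomorphic_deriv[OF U(1)] holomorphic_deriv[OF holomorphic_deriv[OF U(1)]]
  by (auto intro!: holomorphic_derivI[of _ UNIV])
 have t2: "th 2 z q = 2 * deriv U z + z * deriv (deriv U) z" for z
 proof -
  have "((%z. U z + z * deriv U z) has_field_derivative 2 * deriv U z + z * deriv (deriv U) z) (at z)"
   by (rule derivative_eq_intros dU refl | simp)+
  moreover have "((%z. U z + z * deriv U z) has_field_derivative th 2 z q) (at z)"
   using has_field_derivative_th[OF q, of 1 z] by (simp add: U(4)[unfolded One_nat_def] numeral_2_eq_2)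
  ultimately show ?thesis using DERIV_unique by blast
 qed
 have t3: "th 3 z q = 3 * deriv (deriv U) z + z * deriv (deriv (deriv U)) z" for z
 proof -
  have "((%z. 2 * deriv U z + z * deriv (deriv U) z) has_field_derivative
    3 * deriv (deriv U) z + z * deriv (deriv (deriv U)) z) (at z)"
   by (rule derivative_eq_intros dU refl | simp)+
  moreover have "((%z. 2 * deriv U z + z * deriv (deriv U) z) has_field_derivative th 3 z q) (at z)"
   using has_field_derivative_th[OF q, of 2 z] by (simp add: t2 numeral_3_eq_3)
  ultimately show ?thesis using DERIV_unique by blast
 qed
 have U0: "deriv U 0 = 0" using t2[of 0] q by simp
 define k where "k = (%z. zeta_sum tau 0 z - deriv U z / U z - c * z)"
 have "(zeta_sum tau 0 has_field_derivative zeta_sum tau 1 0) (at 0)"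
  using has_field_derivative_zeta_sum[OF tau, of 0 0 0] by simp
 moreover have "zeta_sum tau 1 0 = 0" by (simp add: zeta_sum_def zeta_term_def)
 ultimately have dk: "(k has_field_derivative (- (deriv (deriv U) 0 / U 0) - c)) (at 0)"
  unfolding k_def by (auto intro!: derivative_eq_intros dU simp: U0 U(3) power2_eq_square)
 have "isCont U 0" using dU(1) DERIV_isCont by blast
 then have "eventually (%z. U z ~= 0) (at 0)" using U(3) by (metis isCont_def tendsto_imp_eventually_ne)
 moreover have "eventually (%z. z ~= 0) (at (0::complex))" by (simp add: eventually_at_filter)
 ultimately have ev: "eventually (%z. k z = 0) (at 0)"
  using eventually_notin_period_lattice[OF tau, of 0]
 proof eventually_elim
  case (elim z)
  then have "theta_logderiv z q = 1 / z + deriv U z / U z"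
   by (simp add: theta_logderiv_def U(2,4)[unfolded One_nat_def] field_simps)
  then show ?case using c[OF elim(3)] by (simp add: k_def weierstrass_zeta_eq)
 qed
 have "(k \<longlongrightarrow> k 0) (at 0)" using DERIV_isCont[OF dk] by (simp add: isCont_def)
 moreover have "(k \<longlongrightarrow> 0) (at 0)" using ev by (rule tendsto_eventually)
 ultimately have "k 0 = 0" using tendsto_unique[OF at_neq_bot] by blast
 then have "eventually (%z. k z = 0) (nhds 0)" using ev by (auto simp: eventually_at_filter elim: eventually_mono)
 then have "(k has_field_derivative 0) (at 0) \<longleftrightarrow> ((%_. 0 :: complex) has_field_derivative (0::complex)) (at 0)"
  by (intro DERIV_cong_ev) auto
 then have "- (deriv (deriv U) 0 / U 0) - c = 0" using dk DERIV_unique by force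
 moreover have "th 3 0 q = 3 * deriv (deriv U) 0" "th 1 0 q = U 0" using t3[of 0] U(4)[of 0] by auto
 ultimately have "c = theta_const q" using U(3) by (simp add: theta_const_def field_simps)
 then show ?thesis using c[OF z] by (simp add: q_def)
qed

lemma weierstrass_p_eq_theta:
 assumes tau: "tau \<in> uhp" and z: "z ~: Lat tau"
 shows "weierstrass_p z tau = wpq0 z (nome tau)"
proof -
 have oL: "open (- Lat tau)" using closed_period_lattice[OF tau] by (simp add: open_Compl)
 have "((%z. theta_logderiv z (nome tau) + theta_const (nome tau) * z) has_field_derivative - wpq0 z (nome tau)) (at z)"
  by (rule DERIV_cong[OF DERIV_add[OF has_field_derivative_theta_logderiv DERIV_cmult[OF DERIV_ident]]])
    (use th_eq_0_iff[OF tau] tau z in simp_all)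
 then have "((%z. weierstrass_zeta z tau) has_field_derivative - wpq0 z (nome tau)) (at z)"
  by (rule has_field_derivative_transform_within_open[OF _ oL])
    (use z weierstrass_zeta_eq_theta[OF tau] in auto)
 then show ?thesis using has_field_derivative_weierstrass_zeta[OF tau z] DERIV_unique by force
qed

lemma higher_deriv_weierstrass_p:
 assumes tau: "tau \<in> uhp" and z: "z ~: Lat tau"
 shows "(deriv ^^ j) (%y. weierstrass_p y tau) z = wpq j z (nome tau)"
proof -
 have "eventually (%y. y \<in> - Lat tau) (nhds z)"
  using closed_period_lattice[OF tau] z by (intro eventually_nhds_in_open) (auto simp: open_Compl)
 then have "eventually (%y. weierstrass_p y tau = wpq0 y (nome tau)) (nhds z)"
  by eventually_elim (use weierstrass_p_eq_theta[OF tau] in auto)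
 then show ?thesis unfolding wpq_def by (intro higher_deriv_cong_ev) auto
qed

section \<open>The defining identity\<close>

subsection \<open>Polynomials in theta functions\<close>

text \<open>These are closed under \<open>z\<close>-derivatives and analytic in the nome on the whole disc; analyticity
  at the nome \<open>0\<close> gives boundedness as \<open>Im \<tau> \<rightarrow> \<infinity>\<close>.\<close>

inductive theta_poly :: "(complex => complex => complex) => bool" where
 theta_poly_th: "theta_poly (th r)"
| theta_poly_const: "f analytic_on ball 0 1 ==> theta_poly (%z q. f q)"
| theta_poly_add: "theta_poly f ==> theta_poly g ==> theta_poly (%z q. f z q + g z q)"
| theta_poly_mult: "theta_poly f ==> theta_poly g ==> theta_poly (%z q. f z q * g z q)"

lemma theta_poly_deriv:
 assumes "theta_poly f"
 shows "\<exists>g. theta_poly g \<and> (\<forall>z q. norm q < 1 --> ((%z. f z q) has_field_derivative g z q) (at z))"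
 using assms
proof induction
 case (theta_poly_th r)
 then show ?case using has_field_derivative_th theta_poly.theta_poly_th by blast
next
 case (theta_poly_const f)
 then show ?case by (intro exI[of _ "%z q. (%_. 0) q"] conjI theta_poly.theta_poly_const) auto
next
 case (theta_poly_add f g)
 then obtain f' g' where fg: "theta_poly f'" "theta_poly g'"
  "!!z q. norm q < 1 ==> ((%z. f z q) has_field_derivative f' z q) (at z)"
  "!!z q. norm q < 1 ==> ((%z. g z q) has_field_derivative g' z q) (at z)" by metis
 show ?case
  by (intro exI[of _ "%z q. f' z q + g' z q"] conjI allI impI theta_poly.theta_poly_add DERIV_add fg)
next
 case (theta_poly_mult f g)
 then obtain f' g' where fg: "theta_poly f'" "theta_poly g'"
  "!!z q. norm q < 1 ==> ((%z. f z q) has_field_derivative f' z q) (at z)"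
  "!!z q. norm q < 1 ==> ((%z. g z q) has_field_derivative g' z q) (at z)" by metis
 show ?case
  by (intro exI[of _ "%z q. f' z q * g z q + g' z q * f z q"] conjI allI impI
    theta_poly.theta_poly_add theta_poly.theta_poly_mult DERIV_mult fg theta_poly_mult)
qed

lemma theta_poly_analytic_nome:
 assumes "theta_poly f" "norm q < 1"
 shows "(%q. f z q) analytic_on {q}"
 using assms(1)
proof induction
 case (theta_poly_const f)
 then show ?case by (rule analytic_on_subset) (use assms in auto)
next
 case (theta_poly_th r)
 show ?case by (intro analytic_on_th_nome analytic_intros) (use assms in auto)
qed (auto intro!: analytic_intros)

lemma theta_poly_holomorphic:
 assumes "theta_poly f" "norm q < 1"
 shows "(%z. f z q) holomorphic_on UNIV"
 using theta_poly_deriv[OF assms(1)] assms(2) by (auto simp: holomorphic_on_open)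

lemma analytic_theta_const: "theta_const analytic_on ball 0 1"
proof -
 have "th 0 0 q = 0 ==> th 1 0 q ~= 0" if "norm q < 1" for q using th_simple_zero that by blast
 then show ?thesis
  unfolding theta_const_def by (intro analytic_intros) auto
qed

text \<open>If the j-th derivative of wp is P / theta^(j + 2), then the next one has the numerator
  P' theta - (j + 2) P theta'. The last clause says that the pole at 0 has the exact order j + 2;
  this is what separates the basis functions from each other.\<close>

lemma wpq_numerator:
 "\<exists>P. theta_poly P \<and> (\<forall>z q. norm q < 1 \<and> th 0 z q ~= 0 --> wpq j z q = P z q / th 0 z q ^ (j + 2)) \<and>
   (\<forall>q. norm q < 1 --> P 0 q ~= 0)"
proof (induction j)
 case 0
 define P where "P = (%z q. th 1 z q * th 1 z q + (%_. -1) q * (th 0 z q * th 2 z q + theta_const q * (th 0 z q * th 0 z q)))"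
 have "theta_poly P" unfolding P_def by (intro theta_poly.intros analytic_theta_const analytic_intros)
 moreover have "wpq 0 z q = P z q / th 0 z q ^ (0 + 2)" if "norm q < 1" "th 0 z q ~= 0" for z q
  using that by (simp add: wpq_def wpq0_def P_def field_simps power2_eq_square)
 moreover have "P 0 q ~= 0" if "norm q < 1" for q
  using that th_simple_zero[OF that, of 0] by (simp add: P_def)
 ultimately show ?case by blast
next
 case (Suc j)
 then obtain P where P: "theta_poly P" "!!z q. norm q < 1 ==> th 0 z q ~= 0 ==> wpq j z q = P z q / th 0 z q ^ (j + 2)"
  "!!q. norm q < 1 ==> P 0 q ~= 0" by blast
 obtain P' where P': "theta_poly P'" "!!z q. norm q < 1 ==> ((%z. P z q) has_field_derivative P' z q) (at z)"
  using theta_poly_deriv[OF P(1)] by blast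
 define R where "R = (%z q. P' z q * th 0 z q + (%_. - of_nat (j + 2)) q * (P z q * th 1 z q))"
 have "theta_poly R" unfolding R_def by (intro theta_poly.intros P' P analytic_intros)
 moreover have "wpq (Suc j) z q = R z q / th 0 z q ^ (Suc j + 2)" if q: "norm q < 1" and z: "th 0 z q ~= 0" for z q
 proof -
  define S where "S = {z. th 0 z q ~= 0}"
  have oS: "open S" unfolding S_def
   by (rule open_Collect_neq) (intro holomorphic_on_imp_continuous_on holomorphic_intros q continuous_intros)+
  have D: "((%z. P z q / th 0 z q ^ Suc (Suc j)) has_field_derivative
    (P' z q * th 0 z q ^ Suc (Suc j) - P z q * (of_nat (Suc (Suc j)) * (th 1 z q * th 0 z q ^ Suc j))) /
    (th 0 z q ^ Suc (Suc j) * th 0 z q ^ Suc (Suc j))) (at z)"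
   by (rule DERIV_cong[OF DERIV_divide[OF P'(2)[OF q] DERIV_power[OF has_field_derivative_th[OF q, of 0], of "Suc (Suc j)"]]])
     (use z in auto)
  have "((%z. wpq j z q) has_field_derivative
    (P' z q * th 0 z q ^ Suc (Suc j) - P z q * (of_nat (Suc (Suc j)) * (th 1 z q * th 0 z q ^ Suc j))) /
    (th 0 z q ^ Suc (Suc j) * th 0 z q ^ Suc (Suc j))) (at z)"
   by (rule has_field_derivative_transform_within_open[OF D oS]) (use z P(2)[OF q] S_def in auto)
  then have "deriv (%z. wpq j z q) z =
    (P' z q * th 0 z q ^ Suc (Suc j) - P z q * (of_nat (Suc (Suc j)) * (th 1 z q * th 0 z q ^ Suc j))) /
    (th 0 z q ^ Suc (Suc j) * th 0 z q ^ Suc (Suc j))"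
   by (rule DERIV_imp_deriv)
  also have "\<dots> = R z q / th 0 z q ^ (Suc j + 2)"
  proof -
   have *: "(a * t ^ Suc (Suc j) - p * (m * (d * t ^ Suc j))) / (t ^ Suc (Suc j) * t ^ Suc (Suc j)) =
     (a * t + - m * (p * d)) / t ^ Suc (Suc (Suc j))" if "t ~= 0" for a t p m d :: complex
   proof -
    have "a * t ^ Suc (Suc j) - p * (m * (d * t ^ Suc j)) = (a * t + - m * (p * d)) * t ^ Suc j"
     by (simp add: algebra_simps)
    moreover have "t ^ Suc (Suc j) * t ^ Suc (Suc j) = t ^ Suc (Suc (Suc j)) * t ^ Suc j"
     by (simp add: algebra_simps)
    ultimately show ?thesis by (simp only: mult_divide_mult_cancel_right[OF power_not_zero[OF that]])
   qed
   show ?thesis using *[OF z] by (simp only: R_def add_2_eq_Suc')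
  qed
  finally show ?thesis by (simp add: wpq_def[abs_def])
 qed
 moreover have "R 0 q ~= 0" if "norm q < 1" for q
 proof -
  have "of_nat (j + 2) ~= (0 :: complex)" by (metis add_2_eq_Suc' of_nat_neq_0)
  moreover have "R 0 q = - of_nat (j + 2) * (P 0 q * th 1 0 q)" using that by (simp add: R_def)
  ultimately show ?thesis using th_simple_zero[OF that th_0_0[OF that]] P(3)[OF that]
   by (metis mult_eq_0_iff neg_equal_0_iff_equal)
 qed
 ultimately show ?case by blast
qed

definition wnum :: "nat => complex => complex => complex" where
 "wnum j = (SOME P. theta_poly P \<and> (\<forall>z q. norm q < 1 \<and> th 0 z q ~= 0 --> wpq j z q = P z q / th 0 z q ^ (j + 2)) \<and>
   (\<forall>q. norm q < 1 --> P 0 q ~= 0))"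

lemma wnum:
 "theta_poly (wnum j)"
 "norm q < 1 ==> th 0 z q ~= 0 ==> wpq j z q = wnum j z q / th 0 z q ^ (j + 2)"
 "norm q < 1 ==> wnum j 0 q ~= 0"
 using someI_ex[OF wpq_numerator[of j]] unfolding wnum_def by blast+

lemma analytic_at_transform:
 "eventually (%x. f x = g x) (nhds a) ==> g analytic_on {a} ==> f analytic_on {a}"
 by (simp add: analytic_at_cong)

lemma analytic_eventually_nonzero:
 assumes "f analytic_on {a}" "f a ~= 0"
 shows "eventually (%x. f x ~= 0) (nhds a)"
 using tendsto_imp_eventually_ne[of f "f a" "at a" 0] analytic_at_imp_isCont[OF assms(1)] assms(2)
 by (simp add: isCont_def eventually_nhds_conv_at)

lemma analytic_wpq_nome:
 assumes "norm q < 1" "th 0 z q ~= 0"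
 shows "(%q. wpq j z q) analytic_on {q}"
proof -
 have a: "(%q. th 0 z q) analytic_on {q}" by (intro analytic_on_th_nome analytic_intros) (use assms in auto)
 have "eventually (%q'. th 0 z q' ~= 0) (nhds q)"
  by (rule analytic_eventually_nonzero[OF a assms(2)])
 moreover have "eventually (%q'. q' \<in> ball 0 1) (nhds q)" by (rule eventually_nhds_in_open) (use assms in auto)
 ultimately have "eventually (%q'. wpq j z q' = wnum j z q' / th 0 z q' ^ (j + 2)) (nhds q)"
  by eventually_elim (auto simp: wnum(2))
 moreover have "(%q'. wnum j z q' / th 0 z q' ^ (j + 2)) analytic_on {q}"
  using assms by (intro analytic_intros a theta_poly_analytic_nome wnum) auto
 ultimately show ?thesis by (rule analytic_at_transform)
qed

lemma analytic_wpq: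
 assumes "norm q < 1" "f analytic_on {s}" "th 0 (f s) q ~= 0"
 shows "(%s. wpq j (f s) q) analytic_on {s}"
proof -
 have a: "(%s. th 0 (f s) q) analytic_on {s}" by (intro analytic_intros assms)
 have "eventually (%s'. th 0 (f s') q ~= 0) (nhds s)"
  by (rule analytic_eventually_nonzero[OF a assms(3)])
 then have "eventually (%s'. wpq j (f s') q = wnum j (f s') q / th 0 (f s') q ^ (j + 2)) (nhds s)"
  by eventually_elim (auto simp: wnum(2) assms)
 moreover have "(%z. wnum j z q) analytic_on UNIV"
  by (simp add: analytic_on_open theta_poly_holomorphic wnum assms)
 then have "(%s'. wnum j (f s') q) analytic_on {s}"
  using analytic_on_compose[OF assms(2), of "%z. wnum j z q"] by (auto simp: o_def intro: analytic_on_subset)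
 then have "(%s'. wnum j (f s') q / th 0 (f s') q ^ (j + 2)) analytic_on {s}"
  using assms by (intro analytic_intros a) auto
 ultimately show ?thesis by (rule analytic_at_transform)
qed

lemma entire_eqI:
 assumes "f holomorphic_on UNIV" "g holomorphic_on UNIV" "G holomorphic_on UNIV" "G z0 ~= 0"
  and "!!z. G z ~= 0 ==> f z = g z"
 shows "f z = (g z :: complex)"
proof -
 have "f z - g z = 0"
  by (rule entire_mult_eq_0[of "%z. f z - g z" G z0])
    (use assms in \<open>auto intro!: holomorphic_intros\<close>)
 then show ?thesis by simp
qed

lemma wpq0_eq_deriv:
 "norm q < 1 ==> th 0 z q ~= 0 ==> wpq0 z q = - deriv (%z. theta_logderiv z q) z - theta_const q"
 using DERIV_imp_deriv[OF has_field_derivative_theta_logderiv] by simp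

lemma deriv_shift_eq: "deriv (%z. f (z + w)) z = deriv f (z + w)" for z w :: complex
 using DERIV_shift[of f _ z w] by (simp add: deriv_def)

lemma higher_deriv_shift_eq: "(deriv ^^ j) (%z. f (z + w)) z = (deriv ^^ j) f (z + w)" for z w :: complex
proof (induction j arbitrary: z)
 case (Suc j)
 then have "(deriv ^^ j) (%z. f (z + w)) = (%z. (deriv ^^ j) f (z + w))" by auto
 then show ?case by (simp add: deriv_shift_eq)
qed auto

lemma wpq_periodic:
 assumes tau: "tau \<in> uhp" and w: "w = 1 \<or> w = tau" and z: "z ~: Lat tau"
 shows "wpq j (z + w) (nome tau) = wpq j z (nome tau)"
proof -
 define q where "q = nome tau"
 have q: "norm q < 1" using tau by (simp add: q_def)
 have oL: "open (- Lat tau)" using closed_period_lattice[OF tau] by (simp add: open_Compl)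
 have wL: "x + w \<in> Lat tau \<longleftrightarrow> x \<in> Lat tau" for x
  using w by (intro period_lattice_add_iff) auto
 have T0: "th 0 x q ~= 0" if "x ~: Lat tau" for x using that th_eq_0_iff[OF tau] by (simp add: q_def)
 obtain k where k: "!!x. x ~: Lat tau ==> theta_logderiv (x + w) q = theta_logderiv x q - k"
  using w theta_logderiv_periods[OF tau] unfolding q_def by (metis diff_zero)
 have w0: "wpq0 (x + w) q = wpq0 x q" if x: "x ~: Lat tau" for x
 proof -
  have "((%x. theta_logderiv x q - k) has_field_derivative - wpq0 x q - theta_const q) (at x)"
   by (rule DERIV_cong[OF DERIV_diff[OF has_field_derivative_theta_logderiv[OF q T0[OF x]] DERIV_const]]) simp
  then have "((%x. theta_logderiv (x + w) q) has_field_derivative - wpq0 x q - theta_const q) (at x)"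
   by (rule has_field_derivative_transform_within_open[OF _ oL]) (use x k in auto)
  then have "- wpq0 x q - theta_const q = deriv (%x. theta_logderiv x q) (x + w)"
   using DERIV_imp_deriv deriv_shift_eq[of "%x. theta_logderiv x q" w x] by metis
  moreover have "wpq0 (x + w) q = - deriv (%x. theta_logderiv x q) (x + w) - theta_const q"
   using wpq0_eq_deriv[OF q T0[of "x + w"]] x wL by blast
  ultimately show ?thesis by (metis add.commute add_diff_cancel diff_conv_add_uminus minus_diff_eq)
 qed
 have "eventually (%x. x \<in> - Lat tau) (nhds z)" using oL z by (intro eventually_nhds_in_open) auto
 then have "eventually (%x. wpq0 (x + w) q = wpq0 x q) (nhds z)" by eventually_elim (use w0 in auto)
 then have "(deriv ^^ j) (%x. wpq0 (x + w) q) z = (deriv ^^ j) (%x. wpq0 x q) z"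
  by (rule higher_deriv_cong_ev) auto
 then show ?thesis
  unfolding higher_deriv_shift_eq[where f = "%x. wpq0 x q" and w = w and z = z] by (simp add: wpq_def q_def)
qed

text \<open>The numerator is theta^(j + 2) times an elliptic function, so it has the multipliers of
  theta^(j + 2). The laws hold off the lattice and extend by \<open>entire_eqI\<close>.\<close>

lemma qper_wnum:
 assumes tau: "tau \<in> uhp"
 shows "qper tau (int (j + 2)) ((-1) ^ (j + 2)) (theta_mult tau ^ (j + 2)) (%z. wnum j z (nome tau))"
proof -
 define q where "q = nome tau"
 have q: "norm q < 1" using tau by (simp add: q_def)
 define T where "T = (%z. th 0 z q ^ (j + 2))"
 have qT: "qper tau (int (j + 2)) ((-1) ^ (j + 2)) (theta_mult tau ^ (j + 2)) T"
  using qper_power[OF qper_theta[OF tau, of 0], of "j + 2"] by (simp add: T_def q_def)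
 have hP: "(%z. wnum j z q) holomorphic_on UNIV" by (intro theta_poly_holomorphic wnum q)
 have hPs: "(%z. wnum j (z + w) q) holomorphic_on UNIV" for w
  by (intro holomorphic_on_compose_gen[OF _ hP, unfolded o_def] holomorphic_intros) auto
 have hT: "(%z. th 0 z q) holomorphic_on UNIV" by (intro holomorphic_intros q)
 obtain z0 where z0: "th 0 z0 q ~= 0" using th_not_identically_0[OF q] .
 have eq: "wnum j z q = T z * wpq j z q" if "th 0 z q ~= 0" for z
  using wnum(2)[OF q that, of j] that by (simp add: T_def)
 have L: "th 0 z q = 0 \<longleftrightarrow> z \<in> Lat tau" for z using th_eq_0_iff[OF tau] by (simp add: q_def)
 have per: "wnum j (z + w) q = M z * wnum j z q"
  if w: "w = 1 \<or> w = tau" and M: "!!z. T (z + w) = M z * T z" "M holomorphic_on UNIV" for w M z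
 proof (rule entire_eqI[OF hPs _ hT z0])
  show "(%z. M z * wnum j z q) holomorphic_on UNIV" by (intro holomorphic_intros M hP)
  fix z assume z: "th 0 z q ~= 0"
  have "w \<in> Lat tau" using w by (rule disjE) simp_all
  then have "th 0 (z + w) q ~= 0" using z L[of z] L[of "z + w"] period_lattice_add_iff[of w tau z] by blast
  then show "wnum j (z + w) q = M z * wnum j z q"
   using eq z wpq_periodic[OF tau w, of z j] L M(1) by (simp add: q_def)
 qed
 show ?thesis
  unfolding qper_def q_def[symmetric]
 proof (intro conjI allI)
  show "wnum j (z + 1) q = (-1) ^ (j + 2) * wnum j z q" for z
   by (rule per[OF disjI1[OF refl]]) (use qT in \<open>auto simp: qper_def\<close>)
  show "wnum j (z + tau) q = theta_mult tau ^ (j + 2) * exp (- 2 * of_real pi * \<i> * of_int (int (j + 2)) * z) * wnum j z q" for z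
  proof (rule per[OF disjI2[OF refl]])
   show "(%z. theta_mult tau ^ (j + 2) * exp (- 2 * of_real pi * \<i> * of_int (int (j + 2)) * z)) holomorphic_on UNIV"
    by (intro holomorphic_intros)
  qed (use qT in \<open>simp_all only: qper_def\<close>)
 qed (use hP in auto)
qed

subsection \<open>The basis functions\<close>

text \<open>The function that multiplies the k-th unknown in the defining identity, with w for
  \<open>(n + 1) * v (n + 1)\<close>. In \<open>bas 1\<close> zeta could be replaced by
  theta'/theta: the linear terms c z - c (z + w) + c w cancel.\<close>

definition bas :: "nat => complex => complex => complex => complex" where
 "bas k z w q = (if k = 0 then 1
   else if k = 1 then theta_logderiv z q - theta_logderiv (z + w) q + theta_logderiv w q
   else wpq (k - 2) z q)"

lemma bas_simps: "bas 0 z w q = 1"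
 "bas (Suc 0) z w q = theta_logderiv z q - theta_logderiv (z + w) q + theta_logderiv w q"
 "k \<ge> 2 ==> bas k z w q = wpq (k - 2) z q"
 by (auto simp: bas_def)

definition den :: "nat => complex => complex => complex => complex" where
 "den n z w q = th 0 z q ^ n * th 0 (z + w) q"

text \<open>The numerator over theta(z) theta(z + w). Under z -> z + tau both logarithmic
  derivatives drop by 2 pi i, and this cancels in their difference. At 0 the value is theta'(0)
  theta(w).\<close>

lemma bas_1_numerator:
 assumes tau: "tau \<in> uhp" and w: "w ~: Lat tau"
 obtains e where "e 0 ~= 0" "qper tau 2 1 (theta_mult tau ^ 2 * exp (- 2 * of_real pi * \<i> * w)) e"
  "!!z. z ~: Lat tau ==> z + w ~: Lat tau ==> e z = den 1 z w (nome tau) * bas 1 z w (nome tau)"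
proof -
 define q where "q = nome tau"
 have q: "norm q < 1" using tau by (simp add: q_def)
 define T where "T = (%z. th 0 z q)"
 define T' where "T' = (%z. th 1 z q)"
 have T0: "T z = 0 \<longleftrightarrow> z \<in> Lat tau" for z using th_eq_0_iff[OF tau] by (simp add: T_def q_def)
 define e where "e = (%z. T' z * T (z + w) - T z * T' (z + w) + T z * T (z + w) * theta_logderiv w q)"
 have e0: "e 0 ~= 0" using th_simple_zero[OF q, of 0] q w T0[of w] by (simp add: e_def T_def T'_def)
 define C where "C = theta_mult tau ^ 2 * exp (- 2 * of_real pi * \<i> * w)"
 have he: "e holomorphic_on UNIV" unfolding e_def T_def T'_def by (intro holomorphic_intros q)
 have "e (z + tau) = C * exp (- 2 * of_real pi * \<i> * of_int 2 * z) * e z" for z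
 proof -
  define E where "E = theta_mult tau * exp (- 2 * of_real pi * \<i> * z)"
  define E' where "E' = theta_mult tau * exp (- 2 * of_real pi * \<i> * (z + w))"
  have a: "T (z + tau) = E * T z" "T (z + w + tau) = E' * T (z + w)"
   "T' (z + tau) = E * (T' z - 2 * of_real pi * \<i> * T z)"
   "T' (z + w + tau) = E' * (T' (z + w) - 2 * of_real pi * \<i> * T (z + w))"
   using th_plus_tau[OF tau] th_1_plus_tau[OF tau]
   by (simp_all add: T_def T'_def E_def E'_def q_def theta_mult_def)
  have zw: "z + tau + w = z + w + tau" by simp
  have "e (z + tau) = E * E' * e z" unfolding e_def zw a by (simp add: algebra_simps)
  also have "exp (- 2 * of_real pi * \<i> * z) * exp (- 2 * of_real pi * \<i> * (z + w)) =
    exp (- 2 * of_real pi * \<i> * w) * exp (- 2 * of_real pi * \<i> * of_int 2 * z)"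
   unfolding exp_add[symmetric] by (simp add: algebra_simps)
  then have "E * E' = C * exp (- 2 * of_real pi * \<i> * of_int 2 * z)"
   by (simp add: E_def E'_def C_def power2_eq_square mult_ac)
  finally show ?thesis .
 qed
 moreover have "e (z + 1) = 1 * e z" for z
 proof -
  have a: "T (z + 1) = - T z" "T (z + w + 1) = - T (z + w)" "T' (z + 1) = - T' z" "T' (z + w + 1) = - T' (z + w)"
   by (simp_all only: T_def T'_def th_plus_1[OF q])
  have zw: "z + 1 + w = z + w + 1" by simp
  show ?thesis unfolding e_def zw a by simp
 qed
 ultimately have qe: "qper tau 2 1 C e"
  unfolding qper_def using he by (auto simp: C_def)
 show ?thesis
 proof (rule that[OF e0 qe[unfolded C_def]])
  fix z assume z: "z ~: Lat tau" "z + w ~: Lat tau"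
  have "e z = T z * T (z + w) * bas 1 z w q"
   using z T0[of z] T0[of "z + w"] by (simp add: bas_simps e_def theta_logderiv_def T_def T'_def field_simps)
  then show "e z = den 1 z w (nome tau) * bas 1 z w (nome tau)"
   by (simp add: den_def T_def q_def)
 qed
qed

text \<open>A multiple of the numerator of \<open>bas 1\<close> is subtracted to create a zero at 0,
  theta is divided out, and the same is done with theta(z + w). The remaining factor r has degree 0
  and multipliers 1 and exp (- 2 pi i w). If it were non-zero it would be an exponential, and its
  multipliers would put w into the lattice.\<close>

lemma bas_expansion_exists_1:
 assumes tau: "tau \<in> uhp" and w: "w ~: Lat tau"
  and h: "qper tau 2 1 (theta_mult tau ^ 2 * exp (- 2 * of_real pi * \<i> * w)) h"
 obtains c where "!!z. z ~: Lat tau ==> z + w ~: Lat tau ==>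
  h z = den 1 z w (nome tau) * (\<Sum>k\<le>1. c k * bas k z w (nome tau))"
proof -
 define q where "q = nome tau"
 have q: "norm q < 1" using tau by (simp add: q_def)
 define T where "T = (%z. th 0 z q)"
 have T0: "T z = 0 \<longleftrightarrow> z \<in> Lat tau" for z using th_eq_0_iff[OF tau] by (simp add: T_def q_def)
 obtain e where e0: "e 0 ~= 0" and qe: "qper tau 2 1 (theta_mult tau ^ 2 * exp (- 2 * of_real pi * \<i> * w)) e"
  and eb: "!!z. z ~: Lat tau ==> z + w ~: Lat tau ==> e z = den 1 z w (nome tau) * bas 1 z w (nome tau)"
  by (rule bas_1_numerator[OF tau w]) (rule that, (assumption | blast)+)
 define C where "C = theta_mult tau ^ 2 * exp (- 2 * of_real pi * \<i> * w)"
 note qe = qe[folded C_def]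
 define c1 where "c1 = h 0 / e 0"
 have "qper tau 2 1 C (%z. h z - c1 * e z)" using h unfolding C_def[symmetric] by (intro qper_diff qper_cmult qe)
 moreover have "h 0 - c1 * e 0 = 0" using e0 by (simp add: c1_def)
 ultimately obtain g where g: "!!z. h z - c1 * e z = T z * g z" and qg: "qper tau 1 (-1) (C / theta_mult tau) g"
  using qper_divide_zero[OF tau, of 2 1 C "%z. h z - c1 * e z" 0] by (auto simp: T_def q_def)
 have C1: "C / theta_mult tau = theta_mult tau * exp (- 2 * of_real pi * \<i> * w)"
  by (simp add: C_def power2_eq_square)
 have qTw: "qper tau 1 (-1) (C / theta_mult tau) (%z. T (z + w))"
  using qper_theta[OF tau, of "- w"] unfolding C1 by (simp add: T_def q_def)
 define c0 where "c0 = g 0 / T w"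
 have Tw: "T w ~= 0" using w T0 by simp
 have "qper tau 1 (-1) (C / theta_mult tau) (%z. g z - c0 * T (z + w))" by (intro qper_diff qper_cmult qg qTw)
 moreover have "g 0 - c0 * T (0 + w) = 0" using Tw by (simp add: c0_def)
 ultimately obtain r where r: "!!z. g z - c0 * T (z + w) = T z * r z"
  and qr: "qper tau 0 1 (exp (- 2 * of_real pi * \<i> * w)) r"
  using qper_divide_zero[OF tau, of 1 "-1" "C / theta_mult tau" "%z. g z - c0 * T (z + w)" 0]
  unfolding C1 by (auto simp: T_def q_def)
 have "r z = 0" for z
 proof (rule ccontr)
  assume "r z ~= 0"
  then obtain K b a where Kb: "K ~= 0" "!!z. r z = K * exp (b * z) * (\<Prod>i<nat 0. th 0 (z - a i) (nome tau))"
   using qper_factor[OF tau qr] by metis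
  then have rr: "r z = K * exp (b * z)" for z by simp
  have "r (0 + 1) = 1 * r 0" using qr unfolding qper_def by blast
  then have "exp b = 1" using Kb(1) by (simp add: rr)
  moreover have "b = 2 * of_real pi * \<i> * (b / (2 * of_real pi * \<i>))" by simp
  ultimately obtain m where m: "b / (2 * of_real pi * \<i>) = of_int m"
   using exp_2pi_eq_1_iff[of "b / (2 * of_real pi * \<i>)"] by (auto elim: Ints_cases)
  then have b: "b = 2 * of_real pi * \<i> * of_int m" by (simp add: field_simps)
  have "r (0 + tau) = exp (- 2 * of_real pi * \<i> * w) * exp (- 2 * of_real pi * \<i> * of_int 0 * 0) * r 0"
   using qr unfolding qper_def by blast
  then have "exp (b * tau) = exp (- 2 * of_real pi * \<i> * w)" using Kb(1) by (simp add: rr)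
  then have "exp (2 * of_real pi * \<i> * (of_int m * tau + w)) = 1"
   by (simp add: b algebra_simps exp_add exp_minus)
  then obtain l where "of_int m * tau + w = of_int l" unfolding exp_2pi_eq_1_iff by (auto elim: Ints_cases)
  then have "w = of_int l + of_int (- m) * tau" by (simp add: algebra_simps)
  then show False using w by (metis period_latticeI)
 qed
 then have gz: "g z = c0 * T (z + w)" for z using r[of z] by simp
 show ?thesis
 proof
  fix z assume z: "z ~: Lat tau" "z + w ~: Lat tau"
  have "h z = c1 * e z + T z * (c0 * T (z + w))" using g[of z] by (simp add: gz algebra_simps)
  moreover have "e z = T z * T (z + w) * bas 1 z w q"
   using eb[OF z] by (simp add: den_def T_def q_def)
  ultimately show "h z = den 1 z w (nome tau) * (\<Sum>k\<le>1. (if k = 0 then c0 else c1) * bas k z w (nome tau))"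
   by (simp add: den_def bas_simps T_def q_def algebra_simps)
 qed
qed

text \<open>Induction on n, removing one pole order at z = 0 each time. The numerator of
  \<open>bas (Suc n)\<close> is non-zero at 0, so a multiple of it cancels \<open>h 0\<close>;
  dividing the rest by theta leads back to n.\<close>

lemma bas_expansion_exists:
 assumes tau: "tau \<in> uhp" and w: "w ~: Lat tau" and n: "n \<ge> 1"
  and h: "qper tau (int (n + 1)) ((-1) ^ (n + 1)) (theta_mult tau ^ (n + 1) * exp (- 2 * of_real pi * \<i> * w)) h"
 obtains c where "!!z. z ~: Lat tau ==> z + w ~: Lat tau ==>
  h z = den n z w (nome tau) * (\<Sum>k\<le>n. c k * bas k z w (nome tau))"
proof -
 define q where "q = nome tau"
 have q: "norm q < 1" using tau by (simp add: q_def)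
 have T0: "th 0 z q = 0 \<longleftrightarrow> z \<in> Lat tau" for z using th_eq_0_iff[OF tau] by (simp add: q_def)
 have "\<exists>c. \<forall>z. z ~: Lat tau --> z + w ~: Lat tau -->
   h z = den n z w q * (\<Sum>k\<le>n. c k * bas k z w q)"
  using n h
 proof (induction n arbitrary: h rule: nat_induct_at_least)
  case base
  then have "qper tau 2 1 (theta_mult tau ^ 2 * exp (- 2 * of_real pi * \<i> * w)) h"
   by (simp add: power2_eq_square)
  then obtain c where "!!z. z ~: Lat tau ==> z + w ~: Lat tau ==>
    h z = den 1 z w (nome tau) * (\<Sum>k\<le>1. c k * bas k z w (nome tau))"
   using bas_expansion_exists_1[OF tau w] by blast
  then show ?case unfolding q_def by blast
 next
  case (Suc n)
  define C where "C = theta_mult tau ^ (Suc n + 1) * exp (- 2 * of_real pi * \<i> * w)"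
  define e where "e = (%z. wnum (n - 1) z q * th 0 (z + w) q)"
  have n1: "n - 1 + 2 = Suc n" using Suc.hyps by simp
  have e0: "e 0 ~= 0" using wnum(3)[OF q] T0[of w] w by (simp add: e_def)
  have "qper tau (int (n - 1 + 2) + 1) ((-1) ^ (n - 1 + 2) * (-1)) (theta_mult tau ^ (n - 1 + 2) * (theta_mult tau * exp (2 * of_real pi * \<i> * (- w)))) e"
   unfolding e_def q_def using qper_theta[OF tau, of "- w"] by (intro qper_mult qper_wnum tau) simp
  then have qe: "qper tau (int (Suc n + 1)) ((-1) ^ (Suc n + 1)) C e"
   unfolding n1 by (simp add: C_def algebra_simps)
  define c1 where "c1 = h 0 / e 0"
  have "qper tau (int (Suc n + 1)) ((-1) ^ (Suc n + 1)) C (%z. h z - c1 * e z)"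
   using Suc.prems unfolding C_def[symmetric] by (intro qper_diff qper_cmult qe)
  moreover have "h 0 - c1 * e 0 = 0" using e0 by (simp add: c1_def)
  ultimately obtain g where g: "!!z. h z - c1 * e z = th 0 z q * g z"
   and qg: "qper tau (int (Suc n + 1) - 1) (- ((-1) ^ (Suc n + 1))) (C / theta_mult tau) g"
   using qper_divide_zero[OF tau, of "int (Suc n + 1)" "(-1) ^ (Suc n + 1)" C "%z. h z - c1 * e z" 0]
   by (auto simp: q_def)
  have "qper tau (int (n + 1)) ((-1) ^ (n + 1)) (theta_mult tau ^ (n + 1) * exp (- 2 * of_real pi * \<i> * w)) g"
   using qg by (simp add: C_def mult.assoc)
  then obtain c where c: "!!z. z ~: Lat tau ==> z + w ~: Lat tau ==>
    g z = den n z w q * (\<Sum>k\<le>n. c k * bas k z w q)"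
   using Suc.IH by blast
  have "h z = den (Suc n) z w q * (\<Sum>k\<le>Suc n. (c(Suc n := c1)) k * bas k z w q)"
   if z: "z ~: Lat tau" "z + w ~: Lat tau" for z
  proof -
   have "h z = c1 * e z + th 0 z q * g z" using g[of z] by (simp add: algebra_simps)
   also have "e z = den (Suc n) z w q * bas (Suc n) z w q"
    using z T0 wnum(2)[OF q, of z "n - 1"] Suc.hyps by (simp add: e_def den_def bas_simps n1)
   also have "th 0 z q * g z = den (Suc n) z w q * (\<Sum>k\<le>n. c k * bas k z w q)"
    using c[OF z] by (simp add: den_def)
   finally show ?thesis by (simp add: algebra_simps)
  qed
  then show ?case by blast
 qed
 then show ?thesis using that unfolding q_def by blast
qed

text \<open>The functions \<open>bas k\<close> with k ~= 1 have poles of the pairwise different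
  orders 0, 2, 3, ... at 0. After multiplication by theta^N, with N the largest index of a non-zero
  coefficient, only that term survives as z tends to 0. The nome 0 is included.\<close>

lemma bas_independent_polar:
 assumes q: "norm q < 1"
  and ev: "eventually (%z. (\<Sum>k\<in>{..n} - {1}. c k * bas k z w q) = 0) (at 0)"
  and k: "k \<in> {..n} - {1}"
 shows "c k = 0"
proof (rule ccontr)
 assume "c k ~= 0"
 define K where "K = {k \<in> {..n} - {1}. c k ~= 0}"
 define N where "N = Max K"
 have finK: "finite K" "k \<in> K" using k \<open>c k ~= 0\<close> by (auto simp: K_def)
 then have NK: "N \<in> K" unfolding N_def by (intro Max_in) auto
 have le: "j \<le> N" if "j \<in> K" for j using finK that by (simp add: N_def)
 define g where "g = (%j z. if j = 0 then 1 else wnum (j - 2) z q)"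
 have g: "isCont (g j) 0" "g j 0 ~= 0" for j
 proof -
  have "(%z. g j z) holomorphic_on UNIV"
   unfolding g_def by (cases "j = 0") (auto intro!: theta_poly_holomorphic wnum q)
  then show "isCont (g j) 0"
   using continuous_on_interior[OF holomorphic_on_imp_continuous_on] by fastforce
  show "g j 0 ~= 0" using wnum(3)[OF q] by (simp add: g_def)
 qed
 have contT: "isCont (%z. th 0 z q) 0" using has_field_derivative_th[OF q, of 0 0] DERIV_isCont by blast
 have "((%z. \<Sum>j\<in>K. c j * (th 0 z q ^ (N - j) * g j z)) \<longlongrightarrow> (\<Sum>j\<in>K. c j * (th 0 0 q ^ (N - j) * g j 0))) (at 0)"
  using contT g(1) unfolding isCont_def by (intro tendsto_intros) auto
 also have "(\<Sum>j\<in>K. c j * (th 0 0 q ^ (N - j) * g j 0)) = (\<Sum>j\<in>{N}. c j * (th 0 0 q ^ (N - j) * g j 0))"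
  using finK NK le q by (intro sum.mono_neutral_right) (auto simp: power_0_left dest!: le)
 finally have lim: "((%z. \<Sum>j\<in>K. c j * (th 0 z q ^ (N - j) * g j z)) \<longlongrightarrow> c N * g N 0) (at 0)" by simp
 obtain U where U: "U holomorphic_on UNIV" "!!z. th 0 z q = (z - 0) * U z" "U 0 ~= 0"
  using th_factor_zero[OF q, of 0] q by (metis th_0_0)
 have "U analytic_on {0}" using U(1) by (auto simp: analytic_at)
 then have "eventually (%z. U z ~= 0) (nhds 0)" using U(3) by (intro analytic_eventually_nonzero) auto
 then have "eventually (%z. th 0 z q ~= 0) (at 0)"
  unfolding eventually_at_filter by eventually_elim (use U(2) in auto)
 with ev have "eventually (%z. (\<Sum>j\<in>K. c j * (th 0 z q ^ (N - j) * g j z)) = 0) (at 0)"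
 proof eventually_elim
  case (elim z)
  have t: "th 0 z q ^ (N - j) * g j z = th 0 z q ^ N * bas j z w q" if j: "j \<in> K" for j
  proof (cases "j = 0")
   case False
   then have j2: "j \<ge> 2" using j by (auto simp: K_def)
   then have "th 0 z q ^ N = th 0 z q ^ (N - j) * th 0 z q ^ (j - 2 + 2)"
   proof -
    have "N = (N - j) + (j - 2 + 2)" using le[OF j] j2 by linarith
    then show ?thesis by (metis power_add)
   qed
   then show ?thesis
    using wnum(2)[OF q elim(2), of "j - 2"] elim(2) j2 by (simp add: g_def bas_simps)
  qed (simp add: g_def bas_simps)
  have "(\<Sum>j\<in>K. c j * (th 0 z q ^ (N - j) * g j z)) = th 0 z q ^ N * (\<Sum>j\<in>K. c j * bas j z w q)"
   unfolding sum_distrib_left by (intro sum.cong refl) (simp only: t, simp only: mult_ac)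
  also have "(\<Sum>j\<in>K. c j * bas j z w q) = (\<Sum>j\<in>{..n} - {1}. c j * bas j z w q)"
   by (rule sum.mono_neutral_left) (auto simp: K_def)
  finally show ?case using elim(1) by simp
 qed
 then have "((%z. \<Sum>j\<in>K. c j * (th 0 z q ^ (N - j) * g j z)) \<longlongrightarrow> 0) (at 0)" by (rule tendsto_eventually)
 then have "c N * g N 0 = 0" using lim tendsto_unique[OF at_neq_bot] by blast
 then show False using NK g(2) by (auto simp: K_def)
qed

text \<open>Among the basis functions \<open>bas 1\<close> alone is singular at z = - w, with
  residue -1. Multiplying by theta(z + w) and letting z tend to - w isolates its
  coefficient.\<close>

lemma bas_coefficient_1:
 assumes tau: "tau \<in> uhp" and w: "w ~: Lat tau" and n: "n \<ge> 1"
  and G: "isCont G (- w)"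
  and eq: "!!z. z ~: Lat tau ==> z + w ~: Lat tau ==>
   G z = th 0 (z + w) (nome tau) * (\<Sum>k\<le>n. c k * bas k z w (nome tau))"
 shows "c 1 = - G (- w) / th 1 0 (nome tau)"
proof -
 define q where "q = nome tau"
 have q: "norm q < 1" using tau by (simp add: q_def)
 have T0: "th 0 z q = 0 \<longleftrightarrow> z \<in> Lat tau" for z using th_eq_0_iff[OF tau] by (simp add: q_def)
 have Tw: "th 0 (- w) q ~= 0" using w T0 by simp
 define b where "b = (%k z. if k = 1 then (theta_logderiv z q + theta_logderiv w q) * th 0 (z + w) q - th 1 (z + w) q
   else th 0 (z + w) q * bas k z w q)"
 have C0: "isCont (%z. th r (z + a) q) z" for r a z
  using DERIV_isCont[OF DERIV_shift[THEN iffD1, OF has_field_derivative_th[OF q]]] by simp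
 have cont: "isCont (b k) (- w)" for k
 proof (cases "k = 1")
  case True
  have "isCont (%z. theta_logderiv z q) (- w)"
   unfolding theta_logderiv_def using C0[where r = 0 and a = 0 and z = "- w"] C0[where r = 1 and a = 0 and z = "- w"] Tw by (intro continuous_intros) auto
  then show ?thesis unfolding b_def using True C0 by (auto intro!: continuous_intros)
 next
  case False
  have "(%z. wpq (k - 2) z q) analytic_on {- w}" by (rule analytic_wpq[OF q]) (use Tw in auto)
  then have "isCont (%z. bas k z w q) (- w)"
   using False by (cases "k = 0") (simp_all add: bas_def analytic_at_imp_isCont)
  then show ?thesis unfolding b_def using False C0 by (auto intro!: continuous_intros)
 qed
 have "((%z. \<Sum>k\<le>n. c k * b k z) \<longlongrightarrow> (\<Sum>k\<le>n. c k * b k (- w))) (at (- w))"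
  using cont unfolding isCont_def by (intro tendsto_intros) auto
 also have "(\<Sum>k\<le>n. c k * b k (- w)) = (\<Sum>k\<in>{1}. c k * b k (- w))"
  using n q by (intro sum.mono_neutral_right) (auto simp: b_def)
 finally have lim: "((%z. \<Sum>k\<le>n. c k * b k z) \<longlongrightarrow> - c 1 * th 1 0 q) (at (- w))" using q by (simp add: b_def)
 have "eventually (%z. z ~: Lat tau) (at (- w))" by (rule eventually_notin_period_lattice[OF tau])
 moreover have "eventually (%z. z + w ~: Lat tau) (at (- w))"
  using eventually_notin_period_lattice[OF tau, of 0] by (subst at_to_0) (simp add: eventually_filtermap)
 ultimately have "eventually (%z. G z = (\<Sum>k\<le>n. c k * b k z)) (at (- w))"
 proof eventually_elim
  case (elim z)
  have "th 0 (z + w) q * bas k z w q = b k z" for k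
   using elim(2) T0[of "z + w"] by (auto simp: b_def bas_simps theta_logderiv_def field_simps)
  then show ?case using eq[OF elim] by (simp add: q_def[symmetric] sum_distrib_left mult.left_commute)
 qed
 then have "(G \<longlongrightarrow> - c 1 * th 1 0 q) (at (- w))" using lim by (simp add: tendsto_cong)
 then have "G (- w) = - c 1 * th 1 0 q" using G tendsto_unique[OF at_neq_bot] unfolding isCont_def by blast
 moreover have "th 1 0 q ~= 0" using th_simple_zero[OF q, of 0] q by simp
 ultimately show ?thesis by (simp add: q_def field_simps)
qed

text \<open>The coefficient of \<open>bas 1\<close> is found at z = - w; the remaining functions do
  not involve w and are separated by their poles at z = 0.\<close>

lemma bas_independent:
 assumes tau: "tau \<in> uhp" and w: "w ~: Lat tau" and n: "n \<ge> 1"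
  and eq: "!!z. z ~: Lat tau ==> z + w ~: Lat tau ==> (\<Sum>k\<le>n. c k * bas k z w (nome tau)) = 0"
  and k: "k \<le> n"
 shows "c k = 0"
proof -
 have c1: "c 1 = 0" using bas_coefficient_1[OF tau w n, of "%_. 0" c] eq by simp
 have "eventually (%z. z ~: Lat tau) (at 0)" by (rule eventually_notin_period_lattice[OF tau])
 moreover have "eventually (%z. z + w ~: Lat tau) (at 0)"
 proof -
  have "open (- Lat tau)" using closed_period_lattice[OF tau] by (simp add: open_Compl)
  then have "open ((%z. z + w) -` (- Lat tau))" by (rule open_vimage) (intro continuous_intros)
  then have "eventually (%z. z \<in> (%z. z + w) -` (- Lat tau)) (nhds 0)"
   by (rule eventually_nhds_in_open) (use w in auto)
  then show ?thesis by (auto simp: eventually_at_filter elim: eventually_mono)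
 qed
 ultimately have "eventually (%z. (\<Sum>k\<in>{..n} - {1}. c k * bas k z w (nome tau)) = 0) (at 0)"
 proof eventually_elim
  case (elim z)
  have "(\<Sum>k\<in>{..n} - {1}. c k * bas k z w (nome tau)) = (\<Sum>k\<le>n. c k * bas k z w (nome tau))"
   using c1 n by (intro sum.mono_neutral_left) auto
  then show ?case using eq[OF elim] by simp
 qed
 then show ?thesis using bas_independent_polar[where q = "nome tau" and n = n and c = c and w = w and k = k] tau c1 k by (cases "k = 1") auto
qed

text \<open>Gaussian elimination with an analytic parameter. Independence at t0 alone provides
  finitely many sample points J from which the unknowns are recovered for all t near t0. The weights
  A are analytic at t0 and depend neither on the unknowns c nor on the data F. Each step uses a
  pivot y with \<open>b k0 y t0 ~= 0\<close>.\<close>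

lemma elimination:
 fixes b :: "nat => complex => complex => complex"
 assumes "finite K" "!!k z. k \<in> K ==> z \<in> Z ==> b k z analytic_on {t0}"
  and "!!c k. (!!z. z \<in> Z ==> (\<Sum>k\<in>K. c k * b k z t0) = 0) ==> k \<in> K ==> c k = 0"
 shows "\<exists>J A. finite J \<and> J \<subseteq> Z \<and> (\<forall>k\<in>K. \<forall>z\<in>J. A k z analytic_on {t0}) \<and>
  eventually (%t. \<forall>c F. (\<forall>z\<in>J. F z = (\<Sum>k\<in>K. c k * b k z t)) -->
   (\<forall>k\<in>K. c k = (\<Sum>z\<in>J. A k z t * F z))) (nhds t0)"
 using assms
proof (induction K arbitrary: b rule: finite_induct)
 case empty
 then show ?case by (intro exI[of _ "{}"]) auto
next
 case (insert k0 K)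
 have "\<exists>z\<in>Z. b k0 z t0 ~= 0"
 proof (rule ccontr)
  assume H: "\<not> (\<exists>z\<in>Z. b k0 z t0 ~= 0)"
  have "(\<Sum>k\<in>insert k0 K. (if k = k0 then 1 else 0) * b k z t0) = 0" if "z \<in> Z" for z
   using H that insert.hyps by (auto intro!: sum.neutral)
  from insert.prems(2)[OF this, of k0] show False by simp
 qed
 then obtain y where y: "y \<in> Z" "b k0 y t0 ~= 0" by blast
 have an: "b k z analytic_on {t0}" if "k = k0 \<or> k \<in> K" "z \<in> Z" for k z using insert.prems(1) that by auto
 \<comment> \<open>The system that is left when the unknown of k0 has been eliminated by means of
   the equation at y.\<close>
 define b' where "b' = (%k z t. b k z t - b k0 z t * b k y t / b k0 y t)"
 have "\<exists>J A. finite J \<and> J \<subseteq> Z \<and> (\<forall>k\<in>K. \<forall>z\<in>J. A k z analytic_on {t0}) \<and>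
  eventually (%t. \<forall>c F. (\<forall>z\<in>J. F z = (\<Sum>k\<in>K. c k * b' k z t)) -->
   (\<forall>k\<in>K. c k = (\<Sum>z\<in>J. A k z t * F z))) (nhds t0)"
 proof (rule insert.IH)
  show "b' k z analytic_on {t0}" if "k \<in> K" "z \<in> Z" for k z
   unfolding b'_def using that y by (intro analytic_intros an) auto
  fix c k assume H: "!!z. z \<in> Z ==> (\<Sum>k\<in>K. c k * b' k z t0) = 0" and k: "k \<in> K"
  define d where "d = (\<Sum>k\<in>K. c k * b k y t0) / b k0 y t0"
  define c' where "c' = (%k. if k = k0 then - d else c k)"
  have "(\<Sum>k\<in>insert k0 K. c' k * b k z t0) = 0" if z: "z \<in> Z" for z
  proof -
   have "(\<Sum>k\<in>K. c' k * b k z t0) = (\<Sum>k\<in>K. c k * b k z t0)"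
    using insert.hyps by (intro sum.cong) (auto simp: c'_def)
   moreover have "(\<Sum>k\<in>K. c k * b' k z t0) = (\<Sum>k\<in>K. c k * b k z t0) - d * b k0 z t0"
   proof -
    have "c k * b' k z t0 = c k * b k z t0 - (c k * b k y t0 / b k0 y t0) * b k0 z t0" for k
     by (simp add: b'_def algebra_simps)
    then show ?thesis
     by (simp only: sum_subtractf sum_distrib_right[symmetric] sum_divide_distrib[symmetric] d_def)
   qed
   ultimately show ?thesis using H[OF z] insert.hyps by (simp add: c'_def)
  qed
  then have "c' k = 0" using insert.prems(2)[of c' k] k by blast
  then show "c k = 0" using k insert.hyps by (auto simp: c'_def split: if_splits)
 qed
 then obtain J A where J: "finite J" "J \<subseteq> Z" "!!k z. k \<in> K ==> z \<in> J ==> A k z analytic_on {t0}"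
  and ev: "eventually (%t. \<forall>c F. (\<forall>z\<in>J. F z = (\<Sum>k\<in>K. c k * b' k z t)) -->
   (\<forall>k\<in>K. c k = (\<Sum>z\<in>J. A k z t * F z))) (nhds t0)" by blast
 \<comment> \<open>Weights after back substitution. The point y may already belong to J, so its
   contribution is added to a weight that may exist there.\<close>
 define S where "S = (%k t. \<Sum>z\<in>J. A k z t * b k0 z t / b k0 y t)"
 define B where "B = (%k z t. (if z \<in> J then A k z t else 0) - (if z = y then S k t else 0))"
 define B0 where "B0 = (%z t. ((if z = y then 1 else 0) - (\<Sum>k\<in>K. B k z t * b k y t)) / b k0 y t)"
 have aB: "B k z analytic_on {t0}" if "k \<in> K" "z \<in> insert y J" for k z
 proof -
  have "S k analytic_on {t0}" unfolding S_def using that J y by (intro analytic_intros an J) auto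
  then show ?thesis unfolding B_def using that J by (cases "z \<in> J"; cases "z = y") (auto intro!: analytic_intros)
 qed
 have aB0: "B0 z analytic_on {t0}" if "z \<in> insert y J" for z
  unfolding B0_def using that y J by (intro analytic_intros an aB) auto
 have "eventually (%t. b k0 y t ~= 0) (nhds t0)" using an y by (intro analytic_eventually_nonzero) auto
 with ev have "eventually (%t. \<forall>c F. (\<forall>z\<in>insert y J. F z = (\<Sum>k\<in>insert k0 K. c k * b k z t)) -->
   (\<forall>k\<in>insert k0 K. c k = (\<Sum>z\<in>insert y J. (if k = k0 then B0 else B k) z t * F z))) (nhds t0)"
 proof eventually_elim
  case (elim t)
  show ?case
  proof (intro allI impI)
   fix c F assume F: "\<forall>z\<in>insert y J. F z = (\<Sum>k\<in>insert k0 K. c k * b k z t)"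
   then have Fz: "F z = c k0 * b k0 z t + (\<Sum>k\<in>K. c k * b k z t)" if "z \<in> insert y J" for z
    using bspec[OF F that] insert.hyps by simp
   have FJ: "F z - b k0 z t / b k0 y t * F y = (\<Sum>k\<in>K. c k * b' k z t)" if "z \<in> J" for z
    using Fz[of z] Fz[of y] that elim(2)
    by (simp add: b'_def right_diff_distrib sum_subtractf sum_distrib_left sum_distrib_right
      sum_divide_distrib distrib_left mult_ac)
   have ck: "c k = (\<Sum>z\<in>J. A k z t * (F z - b k0 z t / b k0 y t * F y))" if "k \<in> K" for k
    by (rule elim(1)[rule_format, of "%z. F z - b k0 z t / b k0 y t * F y"]) (use FJ that in auto)
   have ckB: "c k = (\<Sum>z\<in>insert y J. B k z t * F z)" if "k \<in> K" for k
   proof -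
    have "(\<Sum>z\<in>insert y J. B k z t * F z) = (\<Sum>z\<in>insert y J. (if z \<in> J then A k z t * F z else 0)) -
      (\<Sum>z\<in>insert y J. (if z = y then S k t * F y else 0))"
     unfolding sum_subtractf[symmetric] by (intro sum.cong) (auto simp: B_def algebra_simps)
    also have "(\<Sum>z\<in>insert y J. (if z \<in> J then A k z t * F z else 0)) = (\<Sum>z\<in>J. A k z t * F z)"
     using J by (intro sum.mono_neutral_cong_right) auto
    also have "(\<Sum>z\<in>insert y J. (if z = y then S k t * F y else 0)) = S k t * F y"
     using J by (simp add: sum.delta)
    also have "(\<Sum>z\<in>J. A k z t * F z) - S k t * F y = c k"
    proof -
     have "A k z t * (F z - b k0 z t / b k0 y t * F y) = A k z t * F z - (A k z t * b k0 z t / b k0 y t) * F y" for z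
      by (simp add: algebra_simps)
     then show ?thesis
      unfolding ck[OF that] S_def by (simp only: sum_subtractf sum_distrib_right)
    qed
    finally show ?thesis ..
   qed
   have "c k0 = (F y - (\<Sum>k\<in>K. c k * b k y t)) / b k0 y t"
    using Fz[of y] elim(2) by (simp add: field_simps)
   also have "(\<Sum>k\<in>K. c k * b k y t) = (\<Sum>z\<in>insert y J. (\<Sum>k\<in>K. B k z t * b k y t) * F z)"
   proof -
    have "(\<Sum>k\<in>K. c k * b k y t) = (\<Sum>k\<in>K. \<Sum>z\<in>insert y J. B k z t * b k y t * F z)"
    proof (rule sum.cong[OF refl])
     fix k assume "k \<in> K"
     then have "c k * b k y t = (\<Sum>z\<in>insert y J. B k z t * F z) * b k y t" by (simp only: ckB)
     also have "\<dots> = (\<Sum>z\<in>insert y J. B k z t * b k y t * F z)"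
      unfolding sum_distrib_right by (simp only: mult_ac)
     finally show "c k * b k y t = (\<Sum>z\<in>insert y J. B k z t * b k y t * F z)" .
    qed
    also have "\<dots> = (\<Sum>z\<in>insert y J. \<Sum>k\<in>K. B k z t * b k y t * F z)" by (rule sum.swap)
    finally show ?thesis by (simp only: sum_distrib_right)
   qed
   also have "F y = (\<Sum>z\<in>insert y J. (if z = y then 1 else 0) * F z)"
    using J by (simp add: if_distrib[of "%x. x * _"] sum.delta cong: if_cong)
   also have "((\<Sum>z\<in>insert y J. (if z = y then 1 else 0) * F z) -
     (\<Sum>z\<in>insert y J. (\<Sum>k\<in>K. B k z t * b k y t) * F z)) / b k0 y t = (\<Sum>z\<in>insert y J. B0 z t * F z)"
    unfolding sum_subtractf[symmetric] sum_divide_distrib B0_def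
    by (intro sum.cong) (simp_all add: algebra_simps diff_divide_distrib)
   finally have "c k0 = (\<Sum>z\<in>insert y J. B0 z t * F z)" .
   then show "\<forall>k\<in>insert k0 K. c k = (\<Sum>z\<in>insert y J. (if k = k0 then B0 else B k) z t * F z)"
    using ckB by auto
  qed
 qed
 moreover have "\<forall>k\<in>insert k0 K. \<forall>z\<in>insert y J. (if k = k0 then B0 else B k) z analytic_on {t0}"
  using aB aB0 by auto
 ultimately show ?case using J y
  by (intro exI[of _ "insert y J"] exI[of _ "%k. if k = k0 then B0 else B k"]) auto
qed

section \<open>Poles of bounded order\<close>

text \<open>A bound for the pole order stated by a local analytic factor h, with N of either sign;
  the function may vanish identically near p. In contrast to \<open>zorder\<close> it passes to sums
  and products without case distinctions.\<close>

definition pole_le :: "(complex => complex) => complex => int => bool" where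
 "pole_le f p N \<longleftrightarrow> (\<exists>h. h analytic_on {p} \<and> eventually (%s. f s = h s * (s - p) powi (- N)) (at p))"

lemma pole_le_analytic: "f analytic_on {p} ==> pole_le f p 0"
 unfolding pole_le_def by (intro exI[of _ f]) auto

lemma pole_le_cong:
 assumes "pole_le f p N" "eventually (%s. g s = f s) (at p)"
 shows "pole_le g p N"
proof -
 obtain h where h: "h analytic_on {p}" "eventually (%s. f s = h s * (s - p) powi (- N)) (at p)"
  using assms unfolding pole_le_def by blast
 have "eventually (%s. g s = h s * (s - p) powi (- N)) (at p)"
  using assms(2) h(2) by eventually_elim simp
 then show ?thesis using h(1) unfolding pole_le_def by blast
qed

lemma pole_le_add:
 assumes "pole_le f p N" "pole_le g p N"
 shows "pole_le (%s. f s + g s) p N"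
proof -
 obtain h k where h: "h analytic_on {p}" "eventually (%s. f s = h s * (s - p) powi (- N)) (at p)"
  and k: "k analytic_on {p}" "eventually (%s. g s = k s * (s - p) powi (- N)) (at p)"
  using assms unfolding pole_le_def by blast
 have "eventually (%s. f s + g s = (h s + k s) * (s - p) powi (- N)) (at p)"
  using h(2) k(2) by eventually_elim (simp add: algebra_simps)
 then show ?thesis unfolding pole_le_def using h(1) k(1)
  by (intro exI[of _ "%s. h s + k s"]) (auto intro: analytic_intros)
qed

lemma eventually_neq_self: "eventually (%s. s ~= p) (at p)"
 by (simp add: eventually_at_filter)

lemma pole_le_mult:
 assumes "pole_le f p N" "pole_le g p M"
 shows "pole_le (%s. f s * g s) p (N + M)"
proof -
 obtain h k where h: "h analytic_on {p}" "eventually (%s. f s = h s * (s - p) powi (- N)) (at p)"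
  and k: "k analytic_on {p}" "eventually (%s. g s = k s * (s - p) powi (- M)) (at p)"
  using assms unfolding pole_le_def by blast
 have "eventually (%s. f s * g s = (h s * k s) * (s - p) powi (- (N + M))) (at p)"
  using h(2) k(2) eventually_neq_self
 proof eventually_elim
  case (elim s)
  then have "(s - p) powi (- (N + M)) = (s - p) powi (- N) * (s - p) powi (- M)"
   by (simp add: power_int_add[symmetric])
  then show ?case using elim by (simp add: algebra_simps)
 qed
 then show ?thesis unfolding pole_le_def using h(1) k(1)
  by (intro exI[of _ "%s. h s * k s"]) (auto intro: analytic_intros)
qed

lemma pole_le_mono:
 assumes "pole_le f p N" "N \<le> M"
 shows "pole_le f p M"
proof -
 obtain h where h: "h analytic_on {p}" "eventually (%s. f s = h s * (s - p) powi (- N)) (at p)"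
  using assms unfolding pole_le_def by blast
 have "eventually (%s. f s = (h s * (s - p) ^ nat (M - N)) * (s - p) powi (- M)) (at p)"
  using h(2) eventually_neq_self
 proof eventually_elim
  case (elim s)
  then have "(s - p) powi (- N) = (s - p) powi (M - N) * (s - p) powi (- M)"
   by (simp add: power_int_add[symmetric])
  also have "(s - p) powi (M - N) = (s - p) ^ nat (M - N)"
   using assms(2) by (metis diff_ge_0_iff_ge power_int_nonneg_exp)
  finally show ?case using elim by simp
 qed
 then show ?thesis unfolding pole_le_def using h(1)
  by (intro exI[of _ "%s. h s * (s - p) ^ nat (M - N)"]) (auto intro!: analytic_intros)
qed

lemma pole_le_sum:
 assumes "finite I" "!!i. i \<in> I ==> pole_le (f i) p N"
 shows "pole_le (%s. \<Sum>i\<in>I. f i s) p N"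
 using assms
proof (induction rule: finite_induct)
 case empty
 then show ?case unfolding pole_le_def by (intro exI[of _ "%_. 0"]) auto
qed (auto intro: pole_le_add)

lemma pole_le_prod:
 assumes "finite I" "!!i. i \<in> I ==> pole_le (f i) p (N i)"
 shows "pole_le (%s. \<Prod>i\<in>I. f i s) p (sum N I)"
 using assms
 by (induction rule: finite_induct) (auto intro: pole_le_mult pole_le_analytic)

lemma pole_le_simple:
 assumes "f analytic_on {p}" "U analytic_on {p}" "U p ~= 0" "c ~= 0"
  "eventually (%s. g s = f s / (c * (s - p) * U s)) (at p)"
 shows "pole_le g p 1"
 unfolding pole_le_def
proof (intro exI conjI)
 show "(%s. f s / (c * U s)) analytic_on {p}" using assms by (intro analytic_intros) auto
 show "eventually (%s. g s = f s / (c * U s) * (s - p) powi (- 1)) (at p)"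
  using assms(5) by eventually_elim (simp add: power_int_minus field_simps)
qed

text \<open>The factor h may itself vanish at p; if m is the order of that zero, then f has order m
  - N. That f is frequently non-zero near p excludes the case h = 0.\<close>

lemma pole_le_imp_poles_bounded:
 assumes "closed D" "!!p. p ~: D ==> f analytic_on {p}" "!!p. p \<in> D ==> pole_le f p N"
 shows "poles_bounded f D N"
 unfolding poles_bounded_def
proof (intro conjI ballI impI)
 have "f analytic_on - D" using assms(2) by (meson ComplD analytic_on_analytic_at)
 then show "f holomorphic_on - D" by (rule analytic_imp_holomorphic)
 show "f meromorphic_on UNIV"
  unfolding meromorphic_on_meromorphic_at[of f UNIV]
 proof
  fix p
  show "f meromorphic_on {p}"
  proof (cases "p \<in> D")
   case True
   then obtain h where h: "h analytic_on {p}" "eventually (%s. f s = h s * (s - p) powi (- N)) (at p)"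
    using assms(3) unfolding pole_le_def by blast
   have "(%s. h s * (s - p) powi (- N)) meromorphic_on {p}"
    by (intro meromorphic_intros analytic_on_imp_meromorphic_on h)
   then show ?thesis using h(2) by (subst meromorphic_on_cong[where g = "%s. h s * (s - p) powi (- N)"]) auto
  next
   case False
   then show ?thesis using assms(2) by (intro analytic_on_imp_meromorphic_on) auto
  qed
 qed
 fix p assume p: "p \<in> D" and fr: "\<exists>\<^sub>F s in at p. f s ~= 0"
 obtain h where h: "h analytic_on {p}" "eventually (%s. f s = h s * (s - p) powi (- N)) (at p)"
  using assms(3)[OF p] unfolding pole_le_def by blast
 obtain S where S: "open S" "p \<in> S" "h holomorphic_on S" using h(1) by (auto simp: analytic_at)
 then obtain r where r: "r > 0" "ball p r \<subseteq> S" using openE by blast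
 have hr: "h holomorphic_on ball p r" using S(3) r(2) by (rule holomorphic_on_subset)
 have ex: "\<exists>w\<in>ball p r. h w ~= 0"
 proof (rule ccontr)
  assume H: "\<not> (\<exists>w\<in>ball p r. h w ~= 0)"
  have "eventually (%s. s \<in> ball p r) (at p)" using r by (intro eventually_at_in_open') auto
  with h(2) have "eventually (%s. f s = 0) (at p)" by eventually_elim (use H in auto)
  then show False using fr by (simp add: frequently_def)
 qed
 from zorder_exist_zero[OF hr open_ball _ _ ex] r obtain m g e where
  g: "e > 0" "cball p e \<subseteq> ball p r" "g holomorphic_on cball p e" "!!w. w \<in> cball p e ==> h w = g w * (w - p) ^ m \<and> g w ~= 0"
  by (metis centre_in_ball connected_ball)
 obtain d where d: "d > 0" "!!s. s ~= p ==> dist s p < d ==> f s = h s * (s - p) powi (- N)"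
  using h(2) unfolding eventually_at by blast
 have "zorder f p = int m - N"
 proof (rule zorder_eqI)
  show "g holomorphic_on ball p (min d e)" by (rule holomorphic_on_subset[OF g(3)]) auto
  show "g p ~= 0" using g(1) g(4)[of p] by auto
  fix w assume w: "w \<in> ball p (min d e)" "w ~= p"
  then have "f w = g w * (w - p) ^ m * (w - p) powi (- N)"
   using d(2)[of w] g(4)[of w] by (auto simp: dist_commute)
  also have "\<dots> = g w * (w - p) powi (int m - N)"
   using w(2) by (simp add: power_int_diff power_int_minus divide_inverse)
  finally show "f w = g w * (w - p) powi (int m - N)" .
 qed (use d g in auto)
 then show "- zorder f p \<le> N" by simp
qed

lemma poles_bounded_imp_pole_le:
 assumes "poles_bounded f D N" "p \<in> D"
 shows "pole_le f p N"
proof (cases "\<exists>\<^sub>F s in at p. f s ~= 0")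
 case False
 then have "eventually (%s. f s = 0 * (s - p) powi (- N)) (at p)" by (simp add: frequently_def)
 then show ?thesis unfolding pole_le_def by (intro exI[of _ "%_. 0"]) auto
next
 case True
 have m: "f meromorphic_on {p}" using assms unfolding poles_bounded_def by (auto intro: meromorphic_on_subset)
 have zo: "- zorder f p \<le> N" using assms True unfolding poles_bounded_def by blast
 from zorder_exist[of f p] m True obtain g r where
  g: "r > 0" "g holomorphic_on cball p r" "!!w. w \<in> cball p r - {p} ==> f w = g w * (w - p) powi (zorder f p)"
  by (auto simp: meromorphic_at_iff)
 have "g analytic_on {p}"
  using g(1) holomorphic_on_subset[OF g(2) ball_subset_cball] by (auto simp: analytic_at intro!: exI[of _ "ball p r"])
 moreover have "eventually (%s. s \<in> ball p r) (at p)" using g(1) by (intro eventually_at_in_open') auto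
 then have "eventually (%s. f s = g s * (s - p) powi (- (- zorder f p))) (at p)"
  using eventually_neq_self by eventually_elim (use g(3) in auto)
 ultimately have "pole_le f p (- zorder f p)" unfolding pole_le_def by blast
 then show ?thesis using zo pole_le_mono by blast
qed

lemma poles_bounded_imp_analytic:
 assumes "poles_bounded f D N" "closed D" "p ~: D"
 shows "f analytic_on {p}"
 using assms by (auto simp: poles_bounded_def analytic_at open_Compl intro!: exI[of _ "- D"])

section \<open>The fundamental forms\<close>

lemma theta1_eq:
 assumes "tau \<in> uhp"
 shows "theta1 z tau = exp (of_real pi * \<i> * tau / 4) * th 0 z (nome tau)"
proof -
 have "2 * ((-1) ^ m * exp (of_real pi * \<i> * tau * (of_nat m + 1/2)\<^sup>2) * sin (of_nat (2 * m + 1) * of_real pi * z))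
   = exp (of_real pi * \<i> * tau / 4) * th_term 0 z (nome tau) m" for m
 proof -
  have "exp (of_real pi * \<i> * tau * (of_nat m + 1/2)\<^sup>2) = exp (of_real pi * \<i> * tau / 4 + of_nat (m * (m + 1)) * (of_real pi * \<i> * tau))"
   by (simp add: power2_eq_square field_simps)
  also have "\<dots> = exp (of_real pi * \<i> * tau / 4) * nome tau ^ (m * (m + 1))"
   unfolding exp_add exp_of_nat_mult nome_def ..
  finally have 1: "exp (of_real pi * \<i> * tau * (of_nat m + 1/2)\<^sup>2) = exp (of_real pi * \<i> * tau / 4) * nome tau ^ (m * (m + 1))" .
  have f: "\<i> * (of_nat (2 * m + 1) * of_real pi * z) = theta_freq m * z" by (simp add: theta_freq_def)
  have 2: "2 * sin (of_nat (2 * m + 1) * of_real pi * z) = (exp (theta_freq m * z) - exp (- theta_freq m * z)) / \<i>"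
   unfolding sin_exp_eq minus_mult_left[symmetric] f by (simp add: field_simps)
  have "2 * ((-1) ^ m * (exp (of_real pi * \<i> * tau / 4) * nome tau ^ (m * (m + 1))) * sin (of_nat (2 * m + 1) * of_real pi * z))
    = exp (of_real pi * \<i> * tau / 4) * ((-1) ^ m * nome tau ^ (m * (m + 1)) * (2 * sin (of_nat (2 * m + 1) * of_real pi * z)))"
   by (simp only: mult_ac)
  then show ?thesis unfolding 1 2 th_term_def by (simp only: power_0 mult_1)
 qed
 then have "(%m. 2 * ((-1) ^ m * exp (of_real pi * \<i> * tau * (of_nat m + 1/2)\<^sup>2) * sin (of_nat (2 * m + 1) * of_real pi * z)))
   sums (exp (of_real pi * \<i> * tau / 4) * th 0 z (nome tau))"
  unfolding th_def using sums_mult[OF summable_sums[OF summable_th_term[of "nome tau" 0 z]]] assms by simp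
 then have "(%m. (2 * ((-1) ^ m * exp (of_real pi * \<i> * tau * (of_nat m + 1/2)\<^sup>2) * sin (of_nat (2 * m + 1) * of_real pi * z))) / 2)
   sums (exp (of_real pi * \<i> * tau / 4) * th 0 z (nome tau) / 2)" by (rule sums_divide)
 then have S: "(%m. (-1) ^ m * exp (of_real pi * \<i> * tau * (of_nat m + 1/2)\<^sup>2) * sin (of_nat (2 * m + 1) * of_real pi * z))
   sums (exp (of_real pi * \<i> * tau / 4) * th 0 z (nome tau) / 2)" by simp
 show ?thesis unfolding theta1_def sums_unique[OF S, symmetric] by simp
qed

definition num :: "nat => (nat => complex) => complex => complex => complex" where
 "num n v z q = (\<Prod>i=0..n. th 0 (z - v i + v (n + 1)) q)"

text \<open>The factor exp (pi i tau / 4) occurs n + 1 times in the numerator and n + 1 times in the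
  denominator.\<close>

lemma theta1_ratio:
 assumes "tau \<in> uhp"
 shows "(\<Prod>i=0..n. theta1 (z - v i + v (n+1)) tau) / (theta1 z tau ^ n * theta1 (z + w) tau) =
  num n v z (nome tau) / den n z w (nome tau)"
proof -
 define \<kappa> where "\<kappa> = exp (of_real pi * \<i> * tau / 4)"
 have "\<kappa> ~= 0" by (simp add: \<kappa>_def)
 have "(\<Prod>i=0..n. theta1 (z - v i + v (n+1)) tau) = \<kappa> ^ (n + 1) * num n v z (nome tau)"
  by (simp add: theta1_eq[OF assms] prod.distrib num_def \<kappa>_def)
 moreover have "theta1 z tau ^ n * theta1 (z + w) tau = \<kappa> ^ (n + 1) * den n z w (nome tau)"
  by (simp add: theta1_eq[OF assms] den_def power_mult_distrib \<kappa>_def)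
 ultimately show ?thesis using \<open>\<kappa> ~= 0\<close> by simp
qed

lemma zeta_combination:
 assumes "tau \<in> uhp" "z ~: Lat tau" "z + w ~: Lat tau" "w ~: Lat tau"
 shows "weierstrass_zeta z tau - weierstrass_zeta (z + w) tau + weierstrass_zeta w tau = bas 1 z w (nome tau)"
 using assms by (simp add: weierstrass_zeta_eq_theta bas_simps algebra_simps)

lemma generating_identity_iff:
 assumes "n \<ge> 1" "(u, v, tau) \<in> Omega_reg n" "w = of_nat (n + 1) * v (n + 1)"
 shows "generating_identity n u v tau c \<longleftrightarrow>
  (\<forall>z. z ~: Lat tau --> z + w ~: Lat tau -->
   exp (- 2 * of_real pi * \<i> * u) * (num n v z (nome tau) / den n z w (nome tau)) =
   (\<Sum>k\<le>n. c k * bas k z w (nome tau)))"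
proof -
 have tau: "tau \<in> uhp" and w: "w ~: Lat tau"
  using assms by (auto simp: Omega_reg_def Omega_def)
 have S: "(\<Sum>k=2..n. c k * (deriv ^^ (k - 2)) (%y. weierstrass_p y tau) z)
    + c 1 * (weierstrass_zeta z tau - weierstrass_zeta (z + w) tau + weierstrass_zeta w tau)
    + c 0 = (\<Sum>k\<le>n. c k * bas k z w (nome tau))"
  if z: "z ~: Lat tau" "z + w ~: Lat tau" for z
 proof -
  have "{..n} = insert 0 (insert 1 {2..n})" using assms(1) by auto
  then have "(\<Sum>k\<le>n. c k * bas k z w (nome tau)) = c 0 + (c 1 * bas 1 z w (nome tau) + (\<Sum>k=2..n. c k * bas k z w (nome tau)))"
   by (simp add: bas_simps(1))
  moreover have "(\<Sum>k=2..n. c k * bas k z w (nome tau)) = (\<Sum>k=2..n. c k * (deriv ^^ (k - 2)) (%y. weierstrass_p y tau) z)"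
   by (intro sum.cong) (auto simp: higher_deriv_weierstrass_p[OF tau z(1)] bas_simps)
  ultimately show ?thesis using zeta_combination[OF tau z w] by simp
 qed
 show ?thesis
  unfolding generating_identity_def Let_def assms(3)[symmetric]
  using S theta1_ratio[OF tau, where n = n and v = v and w = w] by auto
qed

lemma den_nonzero:
 assumes "tau \<in> uhp" "z ~: Lat tau" "z + w ~: Lat tau"
 shows "den n z w (nome tau) ~= 0"
 using assms th_eq_0_iff[OF assms(1)] by (auto simp: den_def)

text \<open>The product of the constants exp (2 pi i (v i - v (n + 1))) is exp (- 2 pi i w), because
  v 0, ..., v n have sum 0. These are the multipliers of \<open>den\<close>, so the left-hand side
  of the defining identity is elliptic in z.\<close>

lemma qper_num:
 assumes tau: "tau \<in> uhp" and v: "v \<in> V n"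
 shows "qper tau (int (n + 1)) ((-1) ^ (n + 1))
  (theta_mult tau ^ (n + 1) * exp (- 2 * of_real pi * \<i> * (of_nat (n + 1) * v (n + 1)))) (%z. num n v z (nome tau))"
proof -
 have "qper tau (\<Sum>i=0..n. 1) (\<Prod>i=0..n. -1) (\<Prod>i=0..n. theta_mult tau * exp (2 * of_real pi * \<i> * (v i - v (n + 1))))
   (%z. \<Prod>i=0..n. th 0 (z - (v i - v (n + 1))) (nome tau))"
  by (intro qper_prod qper_theta tau) auto
 moreover have "(\<Prod>i=0..n. theta_mult tau * exp (2 * of_real pi * \<i> * (v i - v (n + 1)))) =
   theta_mult tau ^ (n + 1) * exp (- 2 * of_real pi * \<i> * (of_nat (n + 1) * v (n + 1)))"
 proof -
  have "(\<Prod>i=0..n. exp (2 * of_real pi * \<i> * (v i - v (n + 1)))) = exp (2 * of_real pi * \<i> * (\<Sum>i=0..n. v i - v (n + 1)))"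
   by (simp only: exp_sum[symmetric] sum_distrib_left finite_atLeastAtMost)
  also have "(\<Sum>i=0..n. v i - v (n + 1)) = - (of_nat (n + 1) * v (n + 1))"
   using v by (simp add: sum_subtractf V_def)
  finally show ?thesis by (simp add: prod.distrib)
 qed
 ultimately show ?thesis by (simp add: num_def[abs_def] algebra_simps)
qed

text \<open>Existence holds since \<open>num\<close> has the multipliers required by
  \<open>bas_expansion_exists\<close>, uniqueness by \<open>bas_independent\<close>. The clause on i
  > n makes c unique as a function, as the definite description requires.\<close>

lemma fundamental_exists_unique:
 assumes n: "n \<ge> 1" and x: "(u, v, tau) \<in> Omega_reg n"
 shows "\<exists>!c. (\<forall>i>n. c i = 0) \<and> generating_identity n u v tau c"
proof -
 define w where "w = of_nat (n + 1) * v (n + 1)"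
 have tau: "tau \<in> uhp" and w: "w ~: Lat tau" and v: "v \<in> V n"
  using x by (auto simp: Omega_reg_def Omega_def w_def)
 obtain c where c: "!!z. z ~: Lat tau ==> z + w ~: Lat tau ==>
   num n v z (nome tau) = den n z w (nome tau) * (\<Sum>k\<le>n. c k * bas k z w (nome tau))"
  using bas_expansion_exists[OF tau w n qper_num[OF tau v, folded w_def]] by blast
 define c' where "c' = (%k. if k \<le> n then exp (- 2 * of_real pi * \<i> * u) * c k else 0)"
 have "(\<Sum>k\<le>n. c' k * bas k z w (nome tau)) = exp (- 2 * of_real pi * \<i> * u) * (\<Sum>k\<le>n. c k * bas k z w (nome tau))" for z
  by (simp add: c'_def sum_distrib_left mult.assoc)
 then have "generating_identity n u v tau c'"
  unfolding generating_identity_iff[OF n x w_def] using c den_nonzero[OF tau] by simp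
 moreover have "d = c'" if d: "\<forall>i>n. d i = 0" "generating_identity n u v tau d" for d
 proof
  fix k
  have "d k - c' k = 0" if "k \<le> n"
  proof (rule bas_independent[OF tau w n _ that, of "%k. d k - c' k"])
   fix z assume "z ~: Lat tau" "z + w ~: Lat tau"
   then show "(\<Sum>k\<le>n. (d k - c' k) * bas k z w (nome tau)) = 0"
    using d(2) \<open>generating_identity n u v tau c'\<close>
    unfolding generating_identity_iff[OF n x w_def] by (simp add: left_diff_distrib sum_subtractf)
  qed
  then show "d k = c' k" using d(1) by (cases "k \<le> n") (auto simp: c'_def)
 qed
 ultimately show ?thesis by (intro ex1I[of _ c']) (auto simp: c'_def)
qed

lemma fundamental_identity:
 assumes n: "n \<ge> 1" and x: "(u, v, tau) \<in> Omega_reg n"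
 shows "generating_identity n u v tau (%k. fundamental n k (u, v, tau))"
 using theI'[OF fundamental_exists_unique[OF assms]] x by (simp add: fundamental_def)

lemma fundamental_eqI:
 assumes n: "n \<ge> 1" and x: "(u, v, tau) \<in> Omega_reg n" and c: "generating_identity n u v tau c" and k: "k \<le> n"
 shows "fundamental n k (u, v, tau) = c k"
proof -
 define w where "w = of_nat (n + 1) * v (n + 1)"
 have tau: "tau \<in> uhp" and w: "w ~: Lat tau"
  using x by (auto simp: Omega_reg_def Omega_def w_def)
 have "fundamental n k (u, v, tau) - c k = 0"
 proof (rule bas_independent[OF tau w n _ k, of "%k. fundamental n k (u, v, tau) - c k"])
  fix z assume "z ~: Lat tau" "z + w ~: Lat tau"
  then show "(\<Sum>k\<le>n. (fundamental n k (u, v, tau) - c k) * bas k z w (nome tau)) = 0"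
   using c fundamental_identity[OF n x]
   unfolding generating_identity_iff[OF n x w_def] by (simp add: left_diff_distrib sum_subtractf)
 qed
 then show ?thesis by simp
qed

section \<open>Formulas for the fundamental forms\<close>

definition coef1 :: "nat => (nat => complex) => complex => complex => complex" where
 "coef1 n v w q = - num n v (- w) q / (th 0 (- w) q ^ n * th 1 0 q)"

lemma isCont_num: "norm q < 1 ==> isCont (%z. num n v z q) z"
 unfolding num_def
 by (intro analytic_at_imp_isCont analytic_intros) auto

text \<open>The residue of the left-hand side at z = - w, divided by the residue -1 of
  \<open>bas 1\<close>; \<open>coef1\<close> is the value at u = 0.\<close>

lemma fundamental_1:
 assumes n: "n \<ge> 1" and x: "(u, v, tau) \<in> Omega_reg n" and w': "w = of_nat (n + 1) * v (n + 1)"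
 shows "fundamental n 1 (u, v, tau) = exp (- 2 * of_real pi * \<i> * u) * coef1 n v w (nome tau)"
proof -
 define q where "q = nome tau"
 have tau: "tau \<in> uhp" and w: "w ~: Lat tau" and q: "norm q < 1"
  using x by (auto simp: Omega_reg_def Omega_def w' q_def)
 have Tw: "th 0 (- w) q ~= 0" using w th_eq_0_iff[OF tau] by (simp add: q_def)
 define G where "G = (%z. exp (- 2 * of_real pi * \<i> * u) * (num n v z q / th 0 z q ^ n))"
 have "isCont (%z. th 0 z q) (- w)" using has_field_derivative_th[OF q] DERIV_isCont by blast
 then have "isCont G (- w)" unfolding G_def using Tw isCont_num[OF q] by (intro continuous_intros) auto
 moreover have "G z = th 0 (z + w) q * (\<Sum>k\<le>n. fundamental n k (u, v, tau) * bas k z w q)"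
  if z: "z ~: Lat tau" "z + w ~: Lat tau" for z
 proof -
  have "(\<Sum>k\<le>n. fundamental n k (u, v, tau) * bas k z w q) = exp (- 2 * of_real pi * \<i> * u) * (num n v z q / den n z w q)"
   using fundamental_identity[OF n x] z unfolding generating_identity_iff[OF n x w'] q_def by simp
  then show ?thesis using den_nonzero[OF tau z, of n] by (simp add: G_def den_def q_def)
 qed
 ultimately have "fundamental n 1 (u, v, tau) = - G (- w) / th 1 0 q"
  using bas_coefficient_1[OF tau w n, of G "%k. fundamental n k (u, v, tau)"] unfolding q_def by blast
 then show ?thesis by (simp add: G_def coef1_def q_def)
qed

lemma eventually_th_nonzero:
 assumes "norm q < 1"
 shows "eventually (%z. th 0 (z + a) q ~= 0) (at p)"
proof (cases "th 0 (p + a) q = 0")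
 case False
 have "(%z. th 0 (z + a) q) analytic_on {p}" by (intro analytic_intros assms)
 then show ?thesis
  using analytic_eventually_nonzero[of "%z. th 0 (z + a) q" p] False by (auto simp: eventually_nhds_conv_at)
next
 case True
 obtain U where U: "U holomorphic_on UNIV" "!!z. th 0 z q = (z - (p + a)) * U z" "U (p + a) ~= 0"
   "!!z. th 1 z q = U z + (z - (p + a)) * deriv U z"
  by (rule th_factor_zero[OF assms True]) (rule that, (assumption | blast)+)
 have "U analytic_on UNIV" using U(1) by (simp add: analytic_on_open)
 moreover have sh: "(%z. z + a) analytic_on {p}" by (intro analytic_intros)
 ultimately have "(%z. U (z + a)) analytic_on {p}"
  using analytic_on_compose[of "%z. z + a" "{p}" U] analytic_on_subset[of U UNIV "{p + a}"]
   sh by (simp add: o_def)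
 then have "eventually (%z. U (z + a) ~= 0) (at p)"
  using analytic_eventually_nonzero[of "%z. U (z + a)" p] U(3) by (auto simp: eventually_nhds_conv_at)
 then show ?thesis using eventually_neq_self by eventually_elim (auto simp: U(2))
qed

text \<open>The coefficients other than the first are finite linear combinations of values of the left-hand
  side of the defining identity, with weights that depend on the nome only.\<close>

lemma fundamental_elimination:
 assumes n: "n \<ge> 1" and q0: "norm q0 < 1"
 obtains J A where "finite J" "!!z. z \<in> J ==> th 0 z q0 ~= 0 \<and> th 0 (z + w0) q0 ~= 0"
  "!!k z. z \<in> J ==> k \<in> {..n} - {1} ==> A k z analytic_on {q0}"
  "eventually (%q. \<forall>u v tau w k. (u, v, tau) \<in> Omega_reg n --> w = of_nat (n + 1) * v (n + 1) --> nome tau = q -->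
    k \<in> {..n} - {1} --> (\<forall>z\<in>J. th 0 z q ~= 0 \<and> th 0 (z + w) q ~= 0) -->
    fundamental n k (u, v, tau) = exp (- 2 * of_real pi * \<i> * u) *
     (\<Sum>z\<in>J. A k z q * (num n v z q / den n z w q - coef1 n v w q * bas 1 z w q))) (nhds q0)"
proof -
 define Z where "Z = {z. th 0 z q0 ~= 0 \<and> th 0 (z + w0) q0 ~= 0}"
 \<comment> \<open>For k ~= 1 the function \<open>bas k\<close> does not involve w, and 0 stands in
   for it.\<close>
 define b where "b = (%k z q. bas k z 0 q)"
 have b: "bas k z w q = b k z q" if "k ~= 1" for k z w q using that by (simp add: b_def bas_def)
 have "\<exists>J A. finite J \<and> J \<subseteq> Z \<and> (\<forall>k\<in>{..n} - {1}. \<forall>z\<in>J. A k z analytic_on {q0}) \<and>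
  eventually (%t. \<forall>c F. (\<forall>z\<in>J. F z = (\<Sum>k\<in>{..n} - {1}. c k * b k z t)) -->
   (\<forall>k\<in>{..n} - {1}. c k = (\<Sum>z\<in>J. A k z t * F z))) (nhds q0)"
 proof (rule elimination)
  show "b k z analytic_on {q0}" if "k \<in> {..n} - {1}" "z \<in> Z" for k z
  proof (cases "k = 0")
   case True
   then have "b k z = (%_. 1)" by (simp add: b_def bas_def fun_eq_iff)
   then show ?thesis by simp
  next
   case False
   then have "b k z = (%q. wpq (k - 2) z q)" using that by (auto simp: b_def bas_def)
   then show ?thesis using analytic_wpq_nome[OF q0, of z "k - 2"] that by (simp add: Z_def)
  qed
  fix c k assume H: "!!z. z \<in> Z ==> (\<Sum>k\<in>{..n} - {1}. c k * b k z q0) = 0" and k: "k \<in> {..n} - {1}"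
  have "eventually (%z. (\<Sum>k\<in>{..n} - {1}. c k * bas k z 0 q0) = 0) (at 0)"
   using eventually_th_nonzero[OF q0, of 0 0] eventually_th_nonzero[OF q0, of w0 0]
   by eventually_elim (use H in \<open>auto simp: Z_def b_def\<close>)
  then show "c k = 0" using bas_independent_polar[OF q0 _ k] by blast
 qed auto
 then obtain J A where J: "finite J" "J \<subseteq> Z" "!!k z. k \<in> {..n} - {1} ==> z \<in> J ==> A k z analytic_on {q0}"
  and ev: "eventually (%t. \<forall>c F. (\<forall>z\<in>J. F z = (\<Sum>k\<in>{..n} - {1}. c k * b k z t)) -->
   (\<forall>k\<in>{..n} - {1}. c k = (\<Sum>z\<in>J. A k z t * F z))) (nhds q0)" by blast
 show ?thesis
 proof (rule that[of J A])
  show "eventually (%q. \<forall>u v tau w k. (u, v, tau) \<in> Omega_reg n --> w = of_nat (n + 1) * v (n + 1) --> nome tau = q -->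
    k \<in> {..n} - {1} --> (\<forall>z\<in>J. th 0 z q ~= 0 \<and> th 0 (z + w) q ~= 0) -->
    fundamental n k (u, v, tau) = exp (- 2 * of_real pi * \<i> * u) *
     (\<Sum>z\<in>J. A k z q * (num n v z q / den n z w q - coef1 n v w q * bas 1 z w q))) (nhds q0)"
   using ev
  proof (eventually_elim, intro allI impI)
   fix q u v tau w k
   assume E: "\<forall>c F. (\<forall>z\<in>J. F z = (\<Sum>k\<in>{..n} - {1}. c k * b k z q)) -->
     (\<forall>k\<in>{..n} - {1}. c k = (\<Sum>z\<in>J. A k z q * F z))"
    and x: "(u, v, tau) \<in> Omega_reg n" and w: "w = of_nat (n + 1) * v (n + 1)" and q: "nome tau = q"
    and k: "k \<in> {..n} - {1}" and nz: "\<forall>z\<in>J. th 0 z q ~= 0 \<and> th 0 (z + w) q ~= 0"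
   have tau: "tau \<in> uhp" using x by (auto simp: Omega_reg_def Omega_def)
   define e where "e = exp (- 2 * of_real pi * \<i> * u)"
   define F where "F = (%z. e * (num n v z q / den n z w q - coef1 n v w q * bas 1 z w q))"
   have "F z = (\<Sum>k\<in>{..n} - {1}. fundamental n k (u, v, tau) * b k z q)" if "z \<in> J" for z
   proof -
    have zL: "z ~: Lat tau" "z + w ~: Lat tau" using nz that th_eq_0_iff[OF tau] q by auto
    have "e * (num n v z q / den n z w q) = (\<Sum>k\<le>n. fundamental n k (u, v, tau) * bas k z w q)"
     using fundamental_identity[OF n x] zL unfolding generating_identity_iff[OF n x w] q e_def by blast
    also have "\<dots> = fundamental n 1 (u, v, tau) * bas 1 z w q + (\<Sum>k\<in>{..n} - {1}. fundamental n k (u, v, tau) * bas k z w q)"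
     using n by (subst sum.remove[of _ 1]) auto
    also have "(\<Sum>k\<in>{..n} - {1}. fundamental n k (u, v, tau) * bas k z w q) = (\<Sum>k\<in>{..n} - {1}. fundamental n k (u, v, tau) * b k z q)"
     by (intro sum.cong) (auto simp: b)
    finally show ?thesis unfolding F_def fundamental_1[OF n x w] q e_def by (simp add: algebra_simps)
   qed
   then have "fundamental n k (u, v, tau) = (\<Sum>z\<in>J. A k z q * F z)"
    using E[rule_format, of F "%k. fundamental n k (u, v, tau)" k] k by blast
   then show "fundamental n k (u, v, tau) = exp (- 2 * of_real pi * \<i> * u) *
     (\<Sum>z\<in>J. A k z q * (num n v z q / den n z w q - coef1 n v w q * bas 1 z w q))"
    by (simp add: F_def e_def sum_distrib_left mult.left_commute)
  qed
 qed (use J Z_def in auto)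
qed

text \<open>For fixed w off the divisor \<open>coef1\<close> is itself a weight times
  \<open>num\<close> at - w, so only values of \<open>num\<close> appear, with weights analytic in
  the nome. The dependence on v sits in explicit theta products, and q0 = 0 is allowed, which treats
  the cusp. Poles in v (n + 1), where w varies, are read off from
  \<open>fundamental_elimination\<close> instead.\<close>

lemma fundamental_linear_num:
 assumes n: "n \<ge> 1" and q0: "norm q0 < 1" and w: "th 0 w q0 ~= 0" and k: "k \<le> n"
 obtains J H where "finite J" "!!z. z \<in> J ==> H z analytic_on {q0}"
  "eventually (%q. \<forall>u v tau. tau \<in> uhp --> v \<in> V n --> w = of_nat (n + 1) * v (n + 1) --> nome tau = q -->
    fundamental n k (u, v, tau) = exp (- 2 * of_real pi * \<i> * u) * (\<Sum>z\<in>J. H z q * num n v z q)) (nhds q0)"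
proof -
 have anT: "(%q. th r z q) analytic_on {q0}" for r z by (intro analytic_intros) (use q0 in auto)
 have w': "th 0 (- w) q0 ~= 0" using w th_minus[OF q0, of 0 w] by simp
 have t1: "th 1 0 q0 ~= 0" using th_simple_zero[OF q0, of 0] q0 by simp
 define H1 where "H1 = (%q. - 1 / (th 0 (- w) q ^ n * th 1 0 q))"
 have H1: "H1 analytic_on {q0}" unfolding H1_def using w' t1 by (intro analytic_intros anT) auto
 have c1: "coef1 n v w q = H1 q * num n v (- w) q" for v q by (simp add: coef1_def H1_def)
 have evw: "eventually (%q. th 0 w q ~= 0) (nhds q0)" by (intro analytic_eventually_nonzero anT w)
 have reg: "(u, v, tau) \<in> Omega_reg n"
  if "tau \<in> uhp" "v \<in> V n" "w = of_nat (n + 1) * v (n + 1)" "th 0 w (nome tau) ~= 0" for u v tau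
  using that th_eq_0_iff[OF that(1)] by (simp add: Omega_reg_def Omega_def)
 show ?thesis
 proof (cases "k = 1")
  case True
  show ?thesis
  proof (rule that[of "{- w}" "%_. H1"])
   show "eventually (%q. \<forall>u v tau. tau \<in> uhp --> v \<in> V n --> w = of_nat (n + 1) * v (n + 1) --> nome tau = q -->
     fundamental n k (u, v, tau) = exp (- 2 * of_real pi * \<i> * u) * (\<Sum>z\<in>{- w}. H1 q * num n v z q)) (nhds q0)"
    using evw
   proof (eventually_elim, intro allI impI)
    fix q u v tau assume *: "th 0 w q ~= 0" "tau \<in> uhp" "v \<in> V n" "w = of_nat (n + 1) * v (n + 1)" "nome tau = q"
    show "fundamental n k (u, v, tau) = exp (- 2 * of_real pi * \<i> * u) * (\<Sum>z\<in>{- w}. H1 q * num n v z q)"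
     using fundamental_1[OF n reg[OF *(2-4)] *(4), of u] *(1,5) by (simp add: True c1)
   qed
  qed (use H1 in auto)
 next
  case False
  obtain J A where J: "finite J" "!!z. z \<in> J ==> th 0 z q0 ~= 0 \<and> th 0 (z + w) q0 ~= 0"
   "!!k z. z \<in> J ==> k \<in> {..n} - {1} ==> A k z analytic_on {q0}"
   and ev: "eventually (%q. \<forall>u v tau w k. (u, v, tau) \<in> Omega_reg n --> w = of_nat (n + 1) * v (n + 1) --> nome tau = q -->
    k \<in> {..n} - {1} --> (\<forall>z\<in>J. th 0 z q ~= 0 \<and> th 0 (z + w) q ~= 0) -->
    fundamental n k (u, v, tau) = exp (- 2 * of_real pi * \<i> * u) *
     (\<Sum>z\<in>J. A k z q * (num n v z q / den n z w q - coef1 n v w q * bas 1 z w q))) (nhds q0)"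
   by (rule fundamental_elimination[OF n q0, of w]) (rule that, (assumption | blast)+)
  have kk: "k \<in> {..n} - {1}" using k False by auto
  define S where "S = (%q. \<Sum>z\<in>J. A k z q * bas 1 z w q)"
  have bq: "(%q. bas 1 z w q) analytic_on {q0}" if "z \<in> J" for z
   using J(2)[OF that] w by (simp add: bas_def theta_logderiv_def) (intro analytic_intros anT; simp)
  have aS: "S analytic_on {q0}" unfolding S_def using J(3) kk bq by (intro analytic_intros) auto
  define H where "H = (%z q. (if z \<in> J then A k z q / den n z w q else 0) - (if z = - w then S q * H1 q else 0))"
  have "H z analytic_on {q0}" for z
  proof -
   have "(%q. A k z q / den n z w q) analytic_on {q0}" if "z \<in> J"
    unfolding den_def using J(2,3)[OF that] kk by (intro analytic_intros anT) auto
   moreover have "(%q. S q * H1 q) analytic_on {q0}" by (intro analytic_intros aS H1)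
   ultimately show ?thesis unfolding H_def by (cases "z \<in> J"; cases "z = - w") (auto intro!: analytic_intros)
  qed
  moreover have evJ: "eventually (%q. \<forall>z\<in>J. th 0 z q ~= 0 \<and> th 0 (z + w) q ~= 0) (nhds q0)"
   using J by (intro eventually_ball_finite ballI eventually_conj analytic_eventually_nonzero anT) auto
  have "eventually (%q. \<forall>u v tau. tau \<in> uhp --> v \<in> V n --> w = of_nat (n + 1) * v (n + 1) --> nome tau = q -->
    fundamental n k (u, v, tau) = exp (- 2 * of_real pi * \<i> * u) * (\<Sum>z\<in>insert (- w) J. H z q * num n v z q)) (nhds q0)"
   using ev evJ evw
  proof (eventually_elim, intro allI impI)
   fix q u v tau
   assume E: "\<forall>u v tau w k. (u, v, tau) \<in> Omega_reg n --> w = of_nat (n + 1) * v (n + 1) --> nome tau = q -->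
     k \<in> {..n} - {1} --> (\<forall>z\<in>J. th 0 z q ~= 0 \<and> th 0 (z + w) q ~= 0) -->
     fundamental n k (u, v, tau) = exp (- 2 * of_real pi * \<i> * u) *
      (\<Sum>z\<in>J. A k z q * (num n v z q / den n z w q - coef1 n v w q * bas 1 z w q))"
    and nz: "\<forall>z\<in>J. th 0 z q ~= 0 \<and> th 0 (z + w) q ~= 0"
    and *: "th 0 w q ~= 0" "tau \<in> uhp" "v \<in> V n" "w = of_nat (n + 1) * v (n + 1)" "nome tau = q"
   have "fundamental n k (u, v, tau) = exp (- 2 * of_real pi * \<i> * u) *
      (\<Sum>z\<in>J. A k z q * (num n v z q / den n z w q - coef1 n v w q * bas 1 z w q))"
    using E reg[OF *(2-4), of u] *(1,4,5) kk nz by blast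
   also have "(\<Sum>z\<in>J. A k z q * (num n v z q / den n z w q - coef1 n v w q * bas 1 z w q)) =
     (\<Sum>z\<in>J. A k z q / den n z w q * num n v z q) - S q * H1 q * num n v (- w) q"
   proof -
    have "A k z q * (num n v z q / den n z w q - coef1 n v w q * bas 1 z w q) =
      A k z q / den n z w q * num n v z q - A k z q * bas 1 z w q * (H1 q * num n v (- w) q)" for z
     by (simp add: c1 algebra_simps)
    then show ?thesis
     by (simp only: sum_subtractf sum_distrib_right S_def mult.assoc)
   qed
   also have "(\<Sum>z\<in>J. A k z q / den n z w q * num n v z q) =
     (\<Sum>z\<in>insert (- w) J. (if z \<in> J then A k z q / den n z w q else 0) * num n v z q)"
    using J(1) by (intro sum.mono_neutral_cong_left) auto
   also have "S q * H1 q * num n v (- w) q = (\<Sum>z\<in>insert (- w) J. (if z = - w then S q * H1 q else 0) * num n v z q)"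
    using J(1) by (simp add: if_distrib[of "%x. x * _"] sum.delta cong: if_cong)
   also have "(\<Sum>z\<in>insert (- w) J. (if z \<in> J then A k z q / den n z w q else 0) * num n v z q) -
     (\<Sum>z\<in>insert (- w) J. (if z = - w then S q * H1 q else 0) * num n v z q) = (\<Sum>z\<in>insert (- w) J. H z q * num n v z q)"
    by (simp only: H_def left_diff_distrib sum_subtractf)
   finally show "fundamental n k (u, v, tau) = exp (- 2 * of_real pi * \<i> * u) * (\<Sum>z\<in>insert (- w) J. H z q * num n v z q)" .
  qed
  ultimately show ?thesis using that[of "insert (- w) J" H] J(1) by blast
 qed
qed

subsection \<open>Transformation laws\<close>

lemma fundamental_u:
 assumes "n \<ge> 1" "k \<le> n"
 shows "fundamental n k (u, v, tau) = exp (- 2 * of_real pi * \<i> * u) * fundamental n k (0, v, tau)"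
proof (cases "(0, v, tau) \<in> Omega_reg n")
 case True
 then have x: "(u, v, tau) \<in> Omega_reg n" by (simp add: Omega_reg_def Omega_def)
 show ?thesis
  by (rule fundamental_eqI[OF assms(1) x _ assms(2)])
    (use fundamental_identity[OF assms(1) True] in
     \<open>simp add: generating_identity_iff[OF assms(1) x refl] generating_identity_iff[OF assms(1) True refl]
      mult.assoc sum_distrib_left[symmetric]\<close>)
next
 case False
 then have "(u, v, tau) ~: Omega_reg n" by (simp add: Omega_reg_def Omega_def)
 then show ?thesis using False by (simp add: fundamental_def)
qed

lemma th_shift_1:
 assumes "norm q < 1"
 shows "th 0 (z + of_int k) q = exp (of_real pi * \<i> * of_int k) * th 0 z q"
proof (induction k rule: int_induct2)
 case (2 k)
 have 1: "th 0 (z + of_int (k + 1)) q = - th 0 (z + of_int k) q" for z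
  using th_plus_1[OF assms, where r = 0 and z = "z + of_int k"] by (simp add: add.assoc)
 have 2: "exp (of_real pi * \<i> * of_int (k + 1)) = - exp (of_real pi * \<i> * of_int k)"
  by (simp add: distrib_left exp_add)
 show ?case unfolding 1 2 by simp
qed auto

lemma th_shift_tau:
 assumes "tau \<in> uhp"
 shows "th 0 (z + of_int k * tau) (nome tau) =
  exp (of_real pi * \<i> * (of_int k - (of_int k)\<^sup>2 * tau - 2 * of_int k * z)) * th 0 z (nome tau)"
proof (induction k rule: int_induct2)
 case (2 k)
 define E where "E = - (exp (- of_real pi * \<i> * tau) * exp (- 2 * of_real pi * \<i> * (z + of_int k * tau)))"
 have "E ~= 0" by (simp add: E_def)
 have "z + of_int (k + 1) * tau = (z + of_int k * tau) + tau" by (simp add: algebra_simps)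
 then have 1: "th 0 (z + of_int (k + 1) * tau) (nome tau) = E * th 0 (z + of_int k * tau) (nome tau)"
  using th_plus_tau[OF assms, of "z + of_int k * tau"] by (simp only: E_def)
 have "- exp x = exp (of_real pi * \<i> + x)" for x by (simp add: exp_add)
 then have "E = exp (of_real pi * \<i> + (- of_real pi * \<i> * tau + - 2 * of_real pi * \<i> * (z + of_int k * tau)))"
  unfolding E_def exp_add[symmetric] by simp
 then have 2: "exp (of_real pi * \<i> * (of_int (k + 1) - (of_int (k + 1))\<^sup>2 * tau - 2 * of_int (k + 1) * z)) =
   E * exp (of_real pi * \<i> * (of_int k - (of_int k)\<^sup>2 * tau - 2 * of_int k * z))"
  by (simp add: exp_add[symmetric] power2_eq_square algebra_simps)
 show ?case unfolding 1 2 using \<open>E ~= 0\<close> by (simp add: mult.assoc)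
qed auto

lemma th_shift:
 assumes "tau \<in> uhp" "a \<in> \<int>" "b \<in> \<int>"
 shows "th 0 (z + a + b * tau) (nome tau) = exp (of_real pi * \<i> * (a + b - b\<^sup>2 * tau - 2 * b * z)) * th 0 z (nome tau)"
proof -
 obtain a' b' where ab: "a = of_int a'" "b = of_int b'" using assms by (auto elim!: Ints_cases)
 have "th 0 (z + a + b * tau) (nome tau) = exp (of_real pi * \<i> * a) * th 0 (z + b * tau) (nome tau)"
  using th_shift_1[of "nome tau" "z + b * tau" a'] assms by (simp add: ab add_ac)
 also have "\<dots> = exp (of_real pi * \<i> * (a + (b - b\<^sup>2 * tau - 2 * b * z))) * th 0 z (nome tau)"
  using th_shift_tau[OF assms(1), of z b'] by (simp add: ab distrib_left[of "of_real pi * \<i>" "of_int a'"] exp_add)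
 finally show ?thesis by (simp add: algebra_simps)
qed

lemma theta_logderiv_shift:
 assumes tau: "tau \<in> uhp" and a: "a \<in> \<int>" "b \<in> \<int>" and z: "z ~: Lat tau"
 shows "theta_logderiv (z + a + b * tau) (nome tau) = theta_logderiv z (nome tau) - 2 * of_real pi * \<i> * b"
proof -
 obtain a' b' where ab: "a = of_int a'" "b = of_int b'" using a by (auto elim!: Ints_cases)
 have 1: "theta_logderiv (x + of_int a') (nome tau) = theta_logderiv x (nome tau)" for x
  using periodic_int[of "%x. theta_logderiv x (nome tau)" 1 x a'] theta_logderiv_periods(1)[OF tau] by simp
 have 2: "theta_logderiv (z + of_int k * tau) (nome tau) = theta_logderiv z (nome tau) - 2 * of_real pi * \<i> * of_int k" for k
 proof (induction k rule: int_induct2)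
  case (2 k)
  have "of_int k * tau \<in> Lat tau" using period_latticeI[of 0 k tau] by simp
  then have "z + of_int k * tau ~: Lat tau" using z period_lattice_add_iff by blast
  have e: "z + of_int (k + 1) * tau = z + of_int k * tau + tau" by (simp add: distrib_right)
  show ?case
   unfolding e theta_logderiv_periods(2)[OF tau \<open>z + of_int k * tau ~: Lat tau\<close>]
   by (simp add: algebra_simps)
 qed auto
 show ?thesis using 1[of "z + of_int b' * tau"] 2[of b'] by (simp add: ab add_ac)
qed

lemma Ints_lattice_mem: "a \<in> \<int> ==> b \<in> \<int> ==> a + b * tau \<in> Lat tau"
 by (auto elim!: Ints_cases)

lemma fundamental_perm:
 assumes n: "n \<ge> 1" and p: "p permutes {0..n}" and x: "(u, v, tau) \<in> Omega n"
 shows "fundamental n k (act_perm p (u, v, tau)) = fundamental n k (u, v, tau)"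
proof -
 have pn: "p i = i" if "i > n" for i using p that by (simp add: permutes_not_in)
 have "(\<Sum>i=0..n. (v \<circ> p) i) = (\<Sum>i=0..n. v i)" using sum.permute[OF p, of v] by (simp add: o_def)
 then have V: "v \<circ> p \<in> V n \<longleftrightarrow> v \<in> V n" using pn by (auto simp: V_def)
 have num: "num n (v \<circ> p) z q = num n v z q" for z q
 proof -
  have "num n (v \<circ> p) z q = (\<Prod>i=0..n. ((%i. th 0 (z - v i + v (n + 1)) q) \<circ> p) i)"
   using pn by (simp add: num_def)
  also have "\<dots> = num n v z q" unfolding num_def by (rule prod.permute[OF p, symmetric])
  finally show ?thesis .
 qed
 have R: "(u, v \<circ> p, tau) \<in> Omega_reg n \<longleftrightarrow> (u, v, tau) \<in> Omega_reg n"
  using V pn by (simp add: Omega_reg_def Omega_def)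
 show ?thesis
 proof (cases "(u, v, tau) \<in> Omega_reg n")
  case True
  have eq: "generating_identity n u (v \<circ> p) tau c \<longleftrightarrow> generating_identity n u v tau c" for c
   using True R by (simp add: generating_identity_iff[OF n _ refl] num pn)
  show ?thesis using True R by (simp add: fundamental_def eq)
 qed (use R in \<open>simp add: fundamental_def\<close>)
qed

lemma L_subset: "lam \<in> L n ==> lam \<in> V n \<and> (\<forall>i. lam i \<in> \<int>)"
 by (auto simp: L_def)

lemma form_expand: "(\<Sum>i=0..n. v i * w i) = form n v w + of_nat (n * (n + 1)) * v (n+1) * w (n+1)"
 by (simp add: form_def)

text \<open>As \<open>lam (n + 1)\<close> and \<open>mu (n + 1)\<close> are integers, w moves by a
  lattice vector and the basis functions keep their values. The exponentials from \<open>num\<close>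
  and \<open>den\<close> depend on z in the same way, and their quotient is compensated by the shift
  of u. The weight n (n + 1) in \<open>form\<close> is N^2 - N with N = n + 1: the term N^2 comes
  from theta(z + w), and N from the factors of \<open>num\<close>.\<close>

lemma fundamental_trans:
 assumes n: "n \<ge> 1" and lam: "lam \<in> L n" and mu: "mu \<in> L n" and x: "(u, v, tau) \<in> Omega n"
 shows "fundamental n k (act_trans n lam mu (u, v, tau)) = fundamental n k (u, v, tau)"
proof -
 have tau: "tau \<in> uhp" and v: "v \<in> V n" using x by (auto simp: Omega_def)
 have lamV: "lam \<in> V n" "!!i. lam i \<in> \<int>" and muV: "mu \<in> V n" "!!i. mu i \<in> \<int>"
  using lam mu L_subset by auto
 define v' where "v' = (%i. v i + lam i * tau + mu i)"
 define u' where "u' = u - form n lam v - 1/2 * form n lam lam * tau"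
 define s where "s = v (n + 1)"
 define l where "l = lam (n + 1)"
 define m where "m = mu (n + 1)"
 define w where "w = of_nat (n + 1) * v (n + 1)"
 define w' where "w' = of_nat (n + 1) * v' (n + 1)"
 define N where "N = (of_nat (n + 1) :: complex)"
 have NI: "N * m \<in> \<int>" "N * l \<in> \<int>" using lamV muV by (auto simp: N_def l_def m_def)
 have w': "w' = w + N * m + N * l * tau"
  by (simp add: w'_def w_def v'_def N_def l_def m_def algebra_simps)
 have wL: "x + w' \<in> Lat tau \<longleftrightarrow> x + w \<in> Lat tau" for x
  using period_lattice_add_iff[OF Ints_lattice_mem[OF NI], of "x + w" tau] by (simp add: w' add.assoc)
 have V': "v' \<in> V n"
  using v lamV(1) muV(1) by (auto simp: V_def v'_def sum.distrib sum_distrib_right[symmetric])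
 have R: "(u', v', tau) \<in> Omega_reg n \<longleftrightarrow> (u, v, tau) \<in> Omega_reg n"
  using wL[of 0] V' v by (simp add: Omega_reg_def Omega_def w_def w'_def)
 show ?thesis
 proof (cases "(u, v, tau) \<in> Omega_reg n")
  case True
  then have True': "(u', v', tau) \<in> Omega_reg n" using R by simp
  have wnL: "w ~: Lat tau" using True by (simp add: Omega_reg_def w_def)
  have bas: "bas k z w' (nome tau) = bas k z w (nome tau)" if "z + w ~: Lat tau" for k z
   using theta_logderiv_shift[OF tau NI that] theta_logderiv_shift[OF tau NI wnL]
   by (simp add: bas_def w' add.assoc)
  have num: "num n v' z (nome tau) = exp (of_real pi * \<i> * (N * m + N * l - (N * l\<^sup>2 + (\<Sum>i=0..n. (lam i)\<^sup>2)) * tau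
    - 2 * (N * l * (z + s) + (\<Sum>i=0..n. lam i * v i)))) * num n v z (nome tau)" for z
  proof -
   have "th 0 (z - v' i + v' (n + 1)) (nome tau) =
     exp (of_real pi * \<i> * ((m - mu i) + (l - lam i) - (l - lam i)\<^sup>2 * tau - 2 * (l - lam i) * (z - v i + s)))
      * th 0 (z - v i + v (n + 1)) (nome tau)" for i
   proof -
    have eq: "z - v' i + v' (n + 1) = (z - v i + v (n + 1)) + (m - mu i) + (l - lam i) * tau"
     by (simp add: v'_def l_def m_def algebra_simps)
    have I: "m - mu i \<in> \<int>" "l - lam i \<in> \<int>" using lamV muV by (simp_all add: m_def l_def)
    show ?thesis by (simp only: eq th_shift[OF tau I] s_def)
   qed
   then have "num n v' z (nome tau) = exp (\<Sum>i=0..n. of_real pi * \<i> * ((m - mu i) + (l - lam i) - (l - lam i)\<^sup>2 * tau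
     - 2 * (l - lam i) * (z - v i + s))) * num n v z (nome tau)"
    by (simp add: num_def prod.distrib exp_sum)
   also have "(\<Sum>i=0..n. of_real pi * \<i> * ((m - mu i) + (l - lam i) - (l - lam i)\<^sup>2 * tau - 2 * (l - lam i) * (z - v i + s))) =
     of_real pi * \<i> * (N * m + N * l - (N * l\<^sup>2 + (\<Sum>i=0..n. (lam i)\<^sup>2)) * tau - 2 * (N * l * (z + s) + (\<Sum>i=0..n. lam i * v i)))"
   proof -
    have s0: "(\<Sum>i=0..n. v i) = 0" "(\<Sum>i=0..n. lam i) = 0" "(\<Sum>i=0..n. mu i) = 0"
     using v lamV(1) muV(1) by (auto simp: V_def)
    have "(\<Sum>i=0..n. (m - mu i) + (l - lam i) - (l - lam i)\<^sup>2 * tau - 2 * (l - lam i) * (z - v i + s)) =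
     (\<Sum>i=0..n. (m + l - l\<^sup>2 * tau - 2 * l * (z + s)) - mu i + lam i * (2 * l * tau - 1 + 2 * (z + s)) - (lam i)\<^sup>2 * tau + v i * (2 * l) - 2 * (lam i * v i))"
     by (intro sum.cong) (simp_all add: power2_eq_square algebra_simps)
    also have "\<dots> = N * (m + l - l\<^sup>2 * tau - 2 * l * (z + s)) - (\<Sum>i=0..n. (lam i)\<^sup>2) * tau - 2 * (\<Sum>i=0..n. lam i * v i)"
     by (simp add: sum.distrib sum_subtractf sum_distrib_right[symmetric] sum_distrib_left[symmetric] s0 N_def)
    finally have f: "(\<Sum>i=0..n. (m - mu i) + (l - lam i) - (l - lam i)\<^sup>2 * tau - 2 * (l - lam i) * (z - v i + s)) =
     N * (m + l - l\<^sup>2 * tau - 2 * l * (z + s)) - (\<Sum>i=0..n. (lam i)\<^sup>2) * tau - 2 * (\<Sum>i=0..n. lam i * v i)" .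
    show ?thesis
     unfolding sum_distrib_left[symmetric] f by (simp add: algebra_simps)
   qed
   finally show ?thesis .
  qed
  have den: "den n z w' (nome tau) = exp (of_real pi * \<i> * (N * m + N * l - (N * l)\<^sup>2 * tau - 2 * (N * l) * (z + w))) * den n z w (nome tau)" for z
   using th_shift[OF tau NI, of "z + w"] by (simp add: den_def w' add.assoc)
  have main: "exp (- 2 * of_real pi * \<i> * u') * (num n v' z (nome tau) / den n z w' (nome tau)) =
    exp (- 2 * of_real pi * \<i> * u) * (num n v z (nome tau) / den n z w (nome tau))" for z
  proof -
   define X where "X = of_real pi * \<i> * (N * m + N * l - (N * l\<^sup>2 + (\<Sum>i=0..n. (lam i)\<^sup>2)) * tau
    - 2 * (N * l * (z + s) + (\<Sum>i=0..n. lam i * v i)))"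
   define Y where "Y = of_real pi * \<i> * (N * m + N * l - (N * l)\<^sup>2 * tau - 2 * (N * l) * (z + w))"
   have sB: "(\<Sum>i=0..n. (lam i)\<^sup>2) = form n lam lam + (N - 1) * N * l\<^sup>2"
    using form_expand[of lam lam n] by (simp add: power2_eq_square l_def N_def algebra_simps)
   have sA: "(\<Sum>i=0..n. lam i * v i) = form n lam v + (N - 1) * N * l * s"
    using form_expand[of lam v n] by (simp add: l_def s_def N_def algebra_simps)
   have wN: "w = N * s" by (simp add: w_def N_def s_def)
   have "- 2 * of_real pi * \<i> * u' + X = - 2 * of_real pi * \<i> * u + Y"
    unfolding X_def Y_def u'_def sA sB wN by (simp add: power2_eq_square algebra_simps)
   then have "exp (- 2 * of_real pi * \<i> * u') * exp X = exp (- 2 * of_real pi * \<i> * u) * exp Y"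
    unfolding exp_add[symmetric] by (rule arg_cong)
   then have "exp (- 2 * of_real pi * \<i> * u') * exp X / exp Y = exp (- 2 * of_real pi * \<i> * u)"
    by (simp add: field_simps)
   then show ?thesis unfolding num den X_def[symmetric] Y_def[symmetric]
    by (metis (no_types, lifting) mult.assoc times_divide_eq_right times_divide_times_eq)
  qed
  have "generating_identity n u' v' tau c \<longleftrightarrow> generating_identity n u v tau c" for c
   unfolding generating_identity_iff[OF n True w_def] generating_identity_iff[OF n True' w'_def] main
   using wL by (auto simp: bas)
  then show ?thesis using True True' by (simp add: fundamental_def u'_def v'_def)
 next
  case False
  then show ?thesis using R by (simp add: fundamental_def u'_def v'_def)
 qed
qed

section \<open>Modular substitutions\<close>

locale modular_substitution =
 fixes a b c d :: int and tau :: complex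
 assumes det: "a * d - b * c = 1" and tau: "tau \<in> uhp"
begin

definition "j = of_int c * tau + of_int d"
definition "tau' = (of_int a * tau + of_int b) / j"

lemma det': "of_int a * of_int d - of_int b * of_int c = (1 :: complex)"
 using arg_cong[OF det, of "of_int :: int => complex"] by simp

lemma j_nonzero [simp]: "j ~= 0"
proof
 assume "j = 0"
 then have "of_int c * tau + of_int d = 0" by (simp add: j_def)
 then have "Im (of_int c * tau + of_int d) = 0" "Re (of_int c * tau + of_int d) = 0" by simp_all
 then have "c = 0" "d = 0" using tau by (auto simp: upper_half_plane_iff)
 then show False using det by simp
qed

text \<open>The inverse matrix expresses 1/j and tau/j in the basis 1, tau'. Hence division by j
  maps the lattice of tau onto that of tau'.\<close>

lemma inverse_j: "1 / j = of_int a - of_int c * tau'" "tau / j = of_int d * tau' - of_int b"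
proof -
 have tj: "tau' * j = of_int a * tau + of_int b" by (simp add: tau'_def)
 have "(of_int a - of_int c * tau') * j = of_int a * j - of_int c * (tau' * j)" by (simp add: algebra_simps)
 also have "\<dots> = of_int a * of_int d - of_int b * of_int c" unfolding tj by (simp add: j_def algebra_simps)
 finally have "(of_int a - of_int c * tau') * j = 1" using det' by simp
 then show "1 / j = of_int a - of_int c * tau'" by (simp add: field_simps)
 have "(of_int d * tau' - of_int b) * j = of_int d * (tau' * j) - of_int b * j" by (simp add: algebra_simps)
 also have "\<dots> = tau * (of_int a * of_int d - of_int b * of_int c)" unfolding tj by (simp add: j_def algebra_simps)
 finally have "(of_int d * tau' - of_int b) * j = tau * (of_int a * of_int d - of_int b * of_int c)" .
 then have "(of_int d * tau' - of_int b) * j = tau" unfolding det' by simp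
 then show "tau / j = of_int d * tau' - of_int b" by (simp add: field_simps)
qed

lemma tau'_uhp: "tau' \<in> uhp"
proof -
 have "Im tau' = Im tau / (norm j)\<^sup>2"
 proof -
  have "tau' = (of_int a * tau + of_int b) * cnj j / (norm j)\<^sup>2"
   unfolding tau'_def by (metis complex_div_cnj of_real_power)
  moreover have "Im ((of_int a * tau + of_int b) * cnj j) = Im tau * of_int (a * d - b * c)"
   by (simp add: j_def algebra_simps)
  ultimately show ?thesis using det by (simp del: of_int_diff of_int_mult)
 qed
 moreover have "norm j > 0" by simp
 ultimately show ?thesis using tau by (simp add: upper_half_plane_iff)
qed

lemma lattice_iff: "z / j \<in> Lat tau' \<longleftrightarrow> z \<in> Lat tau"
proof
 assume "z \<in> Lat tau"
 then obtain k l where "z = of_int k + of_int l * tau" by (auto simp: period_lattice_def)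
 then have "z / j = of_int k * (1 / j) + of_int l * (tau / j)" by (simp add: add_divide_distrib)
 also have "\<dots> = of_int (k * a - l * b) + of_int (l * d - k * c) * tau'"
  unfolding inverse_j by (simp add: algebra_simps)
 finally show "z / j \<in> Lat tau'" by (metis period_latticeI)
next
 assume "z / j \<in> Lat tau'"
 then obtain k l where "z / j = of_int k + of_int l * tau'" by (auto simp: period_lattice_def)
 then have "z = of_int k * j + of_int l * (tau' * j)" by (simp add: field_simps)
 also have "tau' * j = of_int a * tau + of_int b" by (simp add: tau'_def)
 also have "of_int k * j + of_int l * (of_int a * tau + of_int b) = of_int (k * d + l * b) + of_int (k * c + l * a) * tau"
  by (simp add: j_def algebra_simps)
 finally show "z \<in> Lat tau" by (metis period_latticeI)
qed

lemma bij_lattice: "bij_betw (%z. z / j) (Lat tau - {0}) (Lat tau' - {0})"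
proof (rule bij_betwI[of _ _ _ "%z. z * j"])
 show "(%z. z / j) \<in> Lat tau - {0} \<rightarrow> Lat tau' - {0}" using lattice_iff by auto
 show "(%z. z * j) \<in> Lat tau' - {0} \<rightarrow> Lat tau - {0}"
  using lattice_iff[of "x * j" for x] by auto
qed auto

text \<open>The lattice sum is unordered, so it may be reindexed along division by j; every summand
  is homogeneous of degree -1.\<close>

lemma weierstrass_zeta_scale: "weierstrass_zeta (z / j) tau' = j * weierstrass_zeta z tau"
proof -
 have "zeta_sum tau' 0 (z / j) = (\<Sum>\<^sub>\<infinity>\<omega>\<in>Lat tau - {0}. zeta_term 0 (\<omega> / j) (z / j))"
  unfolding zeta_sum_def by (rule infsum_reindex_bij_betw[OF bij_lattice, symmetric])
 also have "\<dots> = (\<Sum>\<^sub>\<infinity>\<omega>\<in>Lat tau - {0}. j * zeta_term 0 \<omega> z)"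
  by (rule infsum_cong)
    (simp add: zeta_term_def distrib_left power2_eq_square diff_divide_distrib[symmetric])
 also have "\<dots> = j * zeta_sum tau 0 z" unfolding zeta_sum_def by (rule infsum_cmult_right')
 finally show ?thesis by (simp add: weierstrass_zeta_eq distrib_left)
qed

lemma weierstrass_p_scale: "weierstrass_p (z / j) tau' = j\<^sup>2 * weierstrass_p z tau"
proof -
 have "zeta_sum tau' 1 (z / j) = (\<Sum>\<^sub>\<infinity>\<omega>\<in>Lat tau - {0}. zeta_term 1 (\<omega> / j) (z / j))"
  unfolding zeta_sum_def by (rule infsum_reindex_bij_betw[OF bij_lattice, symmetric])
 also have "\<dots> = (\<Sum>\<^sub>\<infinity>\<omega>\<in>Lat tau - {0}. j\<^sup>2 * zeta_term 1 \<omega> z)"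
  by (rule infsum_cong)
    (simp add: zeta_term_def right_diff_distrib power_divide diff_divide_distrib[symmetric])
 also have "\<dots> = j\<^sup>2 * zeta_sum tau 1 z" unfolding zeta_sum_def by (rule infsum_cmult_right')
 finally show ?thesis by (simp add: weierstrass_p_eq right_diff_distrib power_divide)
qed

lemma wpq_scale:
 assumes "z ~: Lat tau"
 shows "wpq k (z / j) (nome tau') = j ^ (k + 2) * wpq k z (nome tau)"
proof -
 define f where "f = (%y. weierstrass_p y tau)"
 have o: "open (- Lat tau)" "open (- Lat tau')"
  using closed_period_lattice[OF tau] closed_period_lattice[OF tau'_uhp] by (simp_all add: open_Compl)
 have f: "f holomorphic_on - Lat tau"
  using has_field_derivative_weierstrass_p[OF tau] unfolding f_def by (auto simp: holomorphic_on_open[OF o(1)])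
 have jf: "j * y \<in> - Lat tau" if "y \<in> - Lat tau'" for y
  using that lattice_iff[of "j * y"] by simp
 have zj: "z / j \<in> - Lat tau'" using assms lattice_iff by simp
 have eq: "(%y. weierstrass_p y tau') = (%y. j\<^sup>2 * f (j * y))"
  using weierstrass_p_scale[of "j * y" for y] by (auto simp: f_def)
 have hc: "(%y. f (j * y)) holomorphic_on - Lat tau'"
  by (rule holomorphic_on_compose_gen[OF _ f, unfolded o_def]) (use jf in \<open>auto intro: holomorphic_intros\<close>)
 have "wpq k (z / j) (nome tau') = (deriv ^^ k) (%y. j\<^sup>2 * f (j * y)) (z / j)"
  using higher_deriv_weierstrass_p[OF tau'_uhp, of "z / j" k] zj by (simp add: eq)
 also have "\<dots> = j\<^sup>2 * (deriv ^^ k) (%y. f (j * y)) (z / j)"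
  by (rule higher_deriv_cmult[OF hc zj o(2)])
 also have "(deriv ^^ k) (%y. f (j * y)) (z / j) = j ^ k * (deriv ^^ k) f (j * (z / j))"
  by (rule higher_deriv_compose_linear[OF f o(2) o(1) zj jf])
 also have "(deriv ^^ k) f (j * (z / j)) = wpq k z (nome tau)"
  using higher_deriv_weierstrass_p[OF tau assms] by (simp add: f_def)
 finally show ?thesis by (simp add: power_add power2_eq_square mult_ac)
qed

lemma exp_odd: "odd k ==> exp (of_real pi * \<i> * of_int k) = -1"
proof -
 assume "odd k"
 then obtain m where "k = 2 * m + 1" by (auto elim: oddE)
 then show ?thesis using exp_integer_2pi_plus1[of "of_int m"] by (simp add: algebra_simps)
qed

text \<open>The factor exp (- pi i c z^2 / j) turns theta(z/j) at tau' into a function with the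
  multipliers of theta at tau. It vanishes at 0, so division by theta leaves an entire elliptic
  function, a constant \<kappa>. Its value is not computed, since it enters \<open>num\<close> and
  \<open>den\<close> equally often.\<close>

lemma theta_scale:
 obtains \<kappa> where "\<kappa> ~= 0" "!!z. th 0 (z / j) (nome tau') = \<kappa> * exp (of_real pi * \<i> * of_int c / j * z\<^sup>2) * th 0 z (nome tau)"
proof -
 define q' where "q' = nome tau'"
 have q': "norm q' < 1" using tau'_uhp by (simp add: q'_def)
 define h where "h = (%z. exp (- of_real pi * \<i> * of_int c / j * z\<^sup>2) * th 0 (z / j) q')"
 have hh: "h holomorphic_on UNIV" unfolding h_def by (intro holomorphic_intros q') auto
 \<comment> \<open>By the determinant condition a and c are not both even, and neither are b and d;
   so the signs produced by the two translations are both -1.\<close>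
 have odd: "odd (a - c - a * c)" "odd (d - b - b * d)" using det by (metis (no_types) even_add even_diff even_mult_iff odd_one mult.commute)+
 have h1: "h (z + 1) = -1 * h z" for z
 proof -
  have "(z + 1) / j = z / j + of_int a + of_int (- c) * tau'" using inverse_j(1) by (simp add: add_divide_distrib)
  then have thA: "th 0 ((z + 1) / j) q' = exp (of_real pi * \<i> * (of_int a + of_int (- c) - (of_int (- c))\<^sup>2 * tau' - 2 * of_int (- c) * (z / j))) * th 0 (z / j) q'"
   using th_shift[OF tau'_uhp, of "of_int a" "of_int (- c)" "z / j"] by (simp only: q'_def Ints_of_int)
  have "h (z + 1) = exp (- of_real pi * \<i> * of_int c / j * (z + 1)\<^sup>2 +
    of_real pi * \<i> * (of_int a + of_int (- c) - (of_int (- c))\<^sup>2 * tau' - 2 * of_int (- c) * (z / j))) * th 0 (z / j) q'"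
   unfolding h_def thA exp_add mult.assoc by (rule refl)
  also have "- of_real pi * \<i> * of_int c / j * (z + 1)\<^sup>2 +
    of_real pi * \<i> * (of_int a + of_int (- c) - (of_int (- c))\<^sup>2 * tau' - 2 * of_int (- c) * (z / j)) =
    - of_real pi * \<i> * of_int c / j * z\<^sup>2 + of_real pi * \<i> * of_int (a - c - a * c)"
  proof -
   have "of_int c * tau' = of_int a - 1 / j" using inverse_j(1) by (simp add: algebra_simps)
   then have 2: "(of_int (- c))\<^sup>2 * tau' = of_int c * (of_int a - 1 / j)" by (simp add: power2_eq_square mult.assoc)
   show ?thesis unfolding 2 by (simp add: power2_eq_square field_simps)
  qed
  finally show ?thesis unfolding exp_add exp_odd[OF odd(1)] by (simp add: h_def)
 qed
 have htau: "h (z + tau) = theta_mult tau * exp (- 2 * of_real pi * \<i> * of_int 1 * z) * h z" for z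
 proof -
  have "(z + tau) / j = z / j + of_int (- b) + of_int d * tau'" using inverse_j(2) by (simp add: add_divide_distrib)
  then have thA: "th 0 ((z + tau) / j) q' = exp (of_real pi * \<i> * (of_int (- b) + of_int d - (of_int d)\<^sup>2 * tau' - 2 * of_int d * (z / j))) * th 0 (z / j) q'"
   using th_shift[OF tau'_uhp, of "of_int (- b)" "of_int d" "z / j"] by (simp only: q'_def Ints_of_int)
  have "h (z + tau) = exp (- of_real pi * \<i> * of_int c / j * (z + tau)\<^sup>2 +
    of_real pi * \<i> * (of_int (- b) + of_int d - (of_int d)\<^sup>2 * tau' - 2 * of_int d * (z / j))) * th 0 (z / j) q'"
   unfolding h_def thA exp_add mult.assoc by (rule refl)
  also have "- of_real pi * \<i> * of_int c / j * (z + tau)\<^sup>2 +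
    of_real pi * \<i> * (of_int (- b) + of_int d - (of_int d)\<^sup>2 * tau' - 2 * of_int d * (z / j)) =
    - of_real pi * \<i> * of_int c / j * z\<^sup>2 + of_real pi * \<i> * of_int (d - b - b * d) + (- of_real pi * \<i> * tau + - 2 * of_real pi * \<i> * z)"
  proof -
   have "of_int d * tau' = of_int b + tau / j" using inverse_j(2) by (simp add: algebra_simps)
   then have 2: "(of_int d)\<^sup>2 * tau' = of_int d * (of_int b + tau / j)" by (simp add: power2_eq_square mult.assoc)
   have dj: "of_int d = j - of_int c * tau" by (simp add: j_def)
   show ?thesis unfolding 2 by (simp add: power2_eq_square field_simps) (simp add: dj algebra_simps)
  qed
  finally show ?thesis unfolding exp_add exp_odd[OF odd(2)] by (simp add: h_def theta_mult_def)
 qed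
 have qh: "qper tau 1 (-1) (theta_mult tau) h" unfolding qper_def using hh h1 htau by auto
 have "h 0 = 0" using q' by (simp add: h_def)
 then obtain g where g: "!!z. h z = th 0 (z - 0) (nome tau) * g z" "qper tau 0 1 1 g"
  using qper_divide_zero[OF tau qh] by (metis (no_types, lifting) add.inverse_inverse cancel_comm_monoid_add_class.diff_cancel divide_self_if exp_zero mult.right_neutral mult_zero_right theta_mult_nonzero)
 then obtain \<kappa> where \<kappa>: "!!z. g z = \<kappa>"
  using entire_elliptic_constant[of g tau] tau by (auto simp: qper_def)
 have eq: "th 0 (z / j) q' = \<kappa> * exp (of_real pi * \<i> * of_int c / j * z\<^sup>2) * th 0 z (nome tau)" for z
 proof -
  have "exp (of_real pi * \<i> * of_int c / j * z\<^sup>2) * h z = th 0 (z / j) q'"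
   by (simp add: h_def mult.assoc[symmetric] exp_add[symmetric])
  then show ?thesis using g(1)[of z] by (simp add: \<kappa> mult_ac)
 qed
 obtain z0 where "th 0 z0 q' ~= 0" using th_not_identically_0[OF q'] .
 then have "\<kappa> ~= 0" using eq[of "z0 * j"] by auto
 then show ?thesis using that eq by (simp add: q'_def)
qed

text \<open>The Gaussian exponents are compared by the identity \<open>sq\<close>: the squares from
  \<open>num\<close> sum up to form n v v + n z^2 + (z + w)^2. The part that contains z cancels
  against \<open>den\<close>, and form n v v is taken up by the shift of u. The basis function k is
  multiplied by j^k, so its coefficient gets j^(- k).\<close>

lemma fundamental_SL2:
 assumes n: "n \<ge> 1" and k: "k \<le> n" and x: "(u, v, tau) \<in> Omega n"
 shows "fundamental n k (act_SL2 n a b c d (u, v, tau)) = j powi (- int k) * fundamental n k (u, v, tau)"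
proof -
 define v' where "v' = (%i. v i / j)"
 define u' where "u' = u + of_int c * form n v v / (2 * j)"
 have act: "act_SL2 n a b c d (u, v, tau) = (u', v', tau')"
  by (simp add: u'_def v'_def tau'_def j_def)
 define w where "w = of_nat (n + 1) * v (n + 1)"
 define w' where "w' = of_nat (n + 1) * v' (n + 1)"
 have w': "w' = w / j" by (simp add: w_def w'_def v'_def)
 have v: "v \<in> V n" using x by (simp add: Omega_def)
 then have V': "v' \<in> V n" by (simp add: V_def v'_def sum_divide_distrib[symmetric])
 have R: "(u', v', tau') \<in> Omega_reg n \<longleftrightarrow> (u, v, tau) \<in> Omega_reg n"
  using V' v tau tau'_uhp lattice_iff[of w] by (simp add: Omega_reg_def Omega_def w_def w'_def v'_def)
 show ?thesis
 proof (cases "(u, v, tau) \<in> Omega_reg n")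
  case True
  then have True': "(u', v', tau') \<in> Omega_reg n" using R by simp
  have wL: "w ~: Lat tau" using True by (simp add: Omega_reg_def w_def)
  obtain \<kappa> where \<kappa>: "\<kappa> ~= 0" "!!z. th 0 (z / j) (nome tau') = \<kappa> * exp (of_real pi * \<i> * of_int c / j * z\<^sup>2) * th 0 z (nome tau)"
   using theta_scale by blast
  define C where "C = of_real pi * \<i> * of_int c / j"
  have bas: "bas k (z / j) w' (nome tau') = j ^ k * bas k z w (nome tau)"
   if z: "z ~: Lat tau" "z + w ~: Lat tau" for k z
  proof -
   consider "k = 0" | "k = 1" | "k \<ge> 2" by linarith
   then show ?thesis
   proof cases
    case 2
    have "z / j + w' = (z + w) / j" by (simp add: w' add_divide_distrib)
    then have "weierstrass_zeta (z / j) tau' - weierstrass_zeta ((z + w) / j) tau' + weierstrass_zeta (w / j) tau' = bas 1 (z / j) w' (nome tau')"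
     using zeta_combination[OF tau'_uhp, of "z / j" w'] z wL lattice_iff[of z] lattice_iff[of w] lattice_iff[of "z + w"] by (simp add: w')
    then show ?thesis
     unfolding 2 weierstrass_zeta_scale zeta_combination[OF tau z wL, symmetric]
     by (simp add: algebra_simps)
   next
    case 3
    then have "k - 2 + 2 = k" by simp
    then show ?thesis using wpq_scale[OF z(1), of "k - 2"] 3 by (simp only: bas_simps(3))
   qed (simp add: bas_simps)
  qed
  have num: "num n v' (z / j) (nome tau') = \<kappa> ^ (n + 1) * exp (C * (\<Sum>i=0..n. (z - v i + v (n + 1))\<^sup>2)) * num n v z (nome tau)" for z
  proof -
   have "z / j - v' i + v' (n + 1) = (z - v i + v (n + 1)) / j" for i
    by (simp add: v'_def diff_divide_distrib add_divide_distrib)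
   then have "num n v' (z / j) (nome tau') = (\<Prod>i=0..n. \<kappa> * exp (C * (z - v i + v (n + 1))\<^sup>2) * th 0 (z - v i + v (n + 1)) (nome tau))"
    by (simp add: num_def \<kappa>(2) C_def)
   then show ?thesis by (simp add: prod.distrib num_def sum_distrib_left exp_sum)
  qed
  have den: "den n (z / j) w' (nome tau') = \<kappa> ^ (n + 1) * exp (C * (of_nat n * z\<^sup>2 + (z + w)\<^sup>2)) * den n z w (nome tau)" for z
  proof -
   have zw: "z / j + w' = (z + w) / j" by (simp add: w' add_divide_distrib)
   show ?thesis unfolding den_def zw \<kappa>(2) C_def[symmetric]
    by (simp add: power_mult_distrib exp_of_nat_mult[symmetric] distrib_left exp_add mult_ac)
  qed
  have sq: "(\<Sum>i=0..n. (z - v i + v (n + 1))\<^sup>2) = form n v v + (of_nat n * z\<^sup>2 + (z + w)\<^sup>2)" for z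
  proof -
   define s where "s = v (n + 1)"
   have "(\<Sum>i=0..n. (z - v i + v (n + 1))\<^sup>2) = (\<Sum>i=0..n. (z + s)\<^sup>2 - v i * (2 * (z + s)) + v i * v i)"
    by (intro sum.cong) (simp_all add: s_def power2_eq_square algebra_simps)
   also have "\<dots> = of_nat (n + 1) * (z + s)\<^sup>2 + (\<Sum>i=0..n. v i * v i)"
    using v by (simp add: sum.distrib sum_subtractf sum_distrib_right[symmetric] V_def)
   finally show ?thesis
    by (simp add: form_def w_def s_def power2_eq_square algebra_simps)
  qed
  have main: "exp (- 2 * of_real pi * \<i> * u') * (num n v' (z / j) (nome tau') / den n (z / j) w' (nome tau')) =
    exp (- 2 * of_real pi * \<i> * u) * (num n v z (nome tau) / den n z w (nome tau))" for z
  proof -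
   define Y where "Y = C * (of_nat n * z\<^sup>2 + (z + w)\<^sup>2)"
   have X: "C * (\<Sum>i=0..n. (z - v i + v (n + 1))\<^sup>2) = C * form n v v + Y" unfolding sq Y_def by (simp add: distrib_left)
   have "- 2 * of_real pi * \<i> * u' + C * form n v v = - 2 * of_real pi * \<i> * u"
    by (simp add: u'_def C_def field_simps)
   then have e: "exp (- 2 * of_real pi * \<i> * u') * exp (C * form n v v) = exp (- 2 * of_real pi * \<i> * u)"
    unfolding exp_add[symmetric] by (rule arg_cong)
   have "\<kappa> ^ (n + 1) * exp (C * form n v v + Y) * num n v z (nome tau) / (\<kappa> ^ (n + 1) * exp Y * den n z w (nome tau)) =
     exp (C * form n v v) * (num n v z (nome tau) / den n z w (nome tau))"
    using \<kappa>(1) by (simp add: exp_add)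
   then show ?thesis unfolding num den X Y_def[symmetric] e[symmetric] by (simp only: mult.assoc)
  qed
  have "generating_identity n u' v' tau' (%k. j powi (- int k) * fundamental n k (u, v, tau))"
   unfolding generating_identity_iff[OF n True' w'_def]
  proof (intro allI impI)
   fix y assume y: "y ~: Lat tau'" "y + w' ~: Lat tau'"
   define z where "z = y * j"
   have yz: "y = z / j" by (simp add: z_def)
   have z: "z ~: Lat tau" "z + w ~: Lat tau"
    using y lattice_iff[of z] lattice_iff[of "z + w"] by (simp_all add: yz w' add_divide_distrib)
   have "exp (- 2 * of_real pi * \<i> * u) * (num n v z (nome tau) / den n z w (nome tau)) =
     (\<Sum>k\<le>n. fundamental n k (u, v, tau) * bas k z w (nome tau))"
    using fundamental_identity[OF n True] z unfolding generating_identity_iff[OF n True w_def] by blast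
   also have "\<dots> = (\<Sum>k\<le>n. j powi (- int k) * fundamental n k (u, v, tau) * bas k y w' (nome tau'))"
    unfolding yz by (intro sum.cong refl) (simp add: bas[OF z] power_int_minus)
   finally show "exp (- 2 * of_real pi * \<i> * u') * (num n v' y (nome tau') / den n y w' (nome tau')) =
     (\<Sum>k\<le>n. j powi (- int k) * fundamental n k (u, v, tau) * bas k y w' (nome tau'))"
    using main[of z] by (simp add: yz)
  qed
  from fundamental_eqI[OF n True' this k] show ?thesis unfolding act .
 next
  case False
  then show ?thesis using R unfolding act by (simp add: fundamental_def)
 qed
qed

end

subsection \<open>Regularity\<close>

lemma eventually_nome_near_0:
 assumes "eventually P (nhds 0)"
 obtains Y where "!!tau. Im tau > Y ==> P (nome tau)"
proof -
 obtain d where d: "d > 0" "!!q. dist q 0 < d ==> P q" using assms unfolding eventually_nhds_metric by blast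
 show ?thesis
 proof (rule that[of "- ln d / pi"])
  fix tau assume "Im tau > - ln d / pi"
  then have "- pi * Im tau < ln d" by (simp add: field_simps)
  then have "exp (- pi * Im tau) < d" using d(1) by (metis exp_less_mono exp_ln)
  moreover have "norm (nome tau) = exp (- pi * Im tau)" by (simp only: nome_def norm_exp_eq_Re times_complex.sel) simp
  ultimately show "P (nome tau)" using d(2) by simp
 qed
qed

lemma analytic_locally_bounded:
 assumes "g analytic_on {a}"
 shows "eventually (%q. norm (g q) \<le> norm (g a) + 1) (nhds a)"
proof -
 have "((%q. norm (g q)) \<longlongrightarrow> norm (g a)) (at a)"
  using analytic_at_imp_isCont[OF assms] by (intro tendsto_norm) (simp add: isCont_def)
 then have "eventually (%q. norm (g q) < norm (g a) + 1) (at a)" by (rule order_tendstoD) simp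
 then show ?thesis by (auto simp: eventually_nhds_conv_at elim: eventually_mono)
qed

lemma norm_th_le:
 assumes "norm z \<le> R" "norm q \<le> \<rho>" "\<rho> < 1"
 shows "norm (th r z q) \<le> suminf (th_bound r R \<rho>)"
proof -
 have \<rho>: "0 \<le> \<rho>" using assms(2) norm_ge_zero order_trans by blast
 show ?thesis unfolding th_def
  by (rule norm_suminf_le[OF norm_th_term_le[OF assms(1,2)] summable_th_bound[OF \<rho> assms(3)]])
qed

lemma norm_num_le:
 assumes "!!i. i \<le> n ==> norm (v i) \<le> M" "norm q \<le> \<rho>" "\<rho> < 1"
 shows "norm (num n v z q) \<le> suminf (th_bound 0 (norm z + M + norm (v (n + 1))) \<rho>) ^ (n + 1)"
proof -
 have "norm (th 0 (z - v i + v (n + 1)) q) \<le> suminf (th_bound 0 (norm z + M + norm (v (n + 1))) \<rho>)" if "i \<in> {0..n}" for i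
 proof (rule norm_th_le)
  have "norm (z - v i + v (n + 1)) \<le> norm z + norm (v i) + norm (v (n + 1))"
   using norm_triangle_ineq[of "z - v i" "v (n + 1)"] norm_triangle_ineq4[of z "v i"] by simp
  then show "norm (z - v i + v (n + 1)) \<le> norm z + M + norm (v (n + 1))" using assms(1)[of i] that by simp
 qed (use assms in auto)
 then have "(\<Prod>i=0..n. norm (th 0 (z - v i + v (n + 1)) q)) \<le> (\<Prod>i=0..n. suminf (th_bound 0 (norm z + M + norm (v (n + 1))) \<rho>))"
  by (intro prod_mono) auto
 then show ?thesis by (simp add: num_def prod_norm)
qed

lemma V_last: "v \<in> V n ==> v n = - (\<Sum>i<n. v i)"
 by (simp add: V_def atLeast0AtMost lessThan_Suc_atMost[symmetric] eq_neg_iff_add_eq_0 add.commute)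

lemma V_coordinates_bounded:
 assumes "v' \<in> V n" "!!i. i < n ==> dist (v' i) (v i) < 1" "i \<le> n"
 shows "norm (v' i) \<le> (\<Sum>i<n. norm (v i) + 1)"
proof -
 have le: "norm (v' i) \<le> norm (v i) + 1" if "i < n" for i
  using assms(2)[OF that] norm_triangle_ineq2[of "v' i" "v i"] by (simp add: dist_norm)
 show ?thesis
 proof (cases "i = n")
  case True
  have "norm (v' n) \<le> (\<Sum>i<n. norm (v' i))" using V_last[OF assms(1)] by (simp add: sum_norm_le)
  also have "\<dots> \<le> (\<Sum>i<n. norm (v i) + 1)" using le by (intro sum_mono) auto
  finally show ?thesis using True by simp
 next
  case False
  then have "norm (v i) + 1 \<le> (\<Sum>i<n. norm (v i) + 1)" using assms(3) by (intro member_le_sum) auto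
  then show ?thesis using le[of i] assms(3) False by linarith
 qed
qed

text \<open>For integral w the point lies on the divisor for every tau, and the form is 0. Otherwise
  theta(w) is non-zero at the nome 0, \<open>fundamental_linear_num\<close> applies there, and the
  weights and theta products are bounded near this nome.\<close>

lemma fundamental_bounded:
 assumes n: "n \<ge> 1" and k: "k \<le> n" and v: "v \<in> V n"
 shows "\<exists>\<epsilon>>0. \<exists>Y B. \<forall>v'\<in>V n. \<forall>tau. v' (n+1) = v (n+1) \<and> (\<forall>i<n. dist (v' i) (v i) < \<epsilon>) \<and>
  tau \<in> uhp \<and> Im tau > Y --> norm (fundamental n k (u, v', tau)) \<le> B"
proof -
 define w where "w = of_nat (n + 1) * v (n + 1)"
 show ?thesis
 proof (cases "w \<in> \<int>")
  case True
  then obtain a where "w = of_int a" by (auto elim: Ints_cases)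
  then have "w \<in> Lat tau" for tau using period_latticeI[of a 0 tau] by simp
  then have "fundamental n k (u, v', tau) = 0" if "v' (n + 1) = v (n + 1)" for v' tau
   using that by (simp add: fundamental_def Omega_reg_def w_def)
  then show ?thesis by (intro exI[of _ 1] conjI exI[of _ 0]) auto
 next
  case False
  then have w0: "th 0 w 0 ~= 0" by (simp add: th_nome_0_eq_0_iff)
  obtain J H where J: "finite J" "!!z. z \<in> J ==> H z analytic_on {0}"
   and ev: "eventually (%q. \<forall>u v tau. tau \<in> uhp --> v \<in> V n --> w = of_nat (n + 1) * v (n + 1) --> nome tau = q -->
    fundamental n k (u, v, tau) = exp (- 2 * of_real pi * \<i> * u) * (\<Sum>z\<in>J. H z q * num n v z q)) (nhds 0)"
   by (rule fundamental_linear_num[OF n _ w0 k]) (simp, rule that, (assumption | blast)+)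
  have "eventually (%q. \<forall>z\<in>J. norm (H z q) \<le> norm (H z 0) + 1) (nhds 0)"
   using J by (intro eventually_ball_finite ballI analytic_locally_bounded) auto
  moreover have "eventually (%q::complex. q \<in> ball 0 (1/2)) (nhds 0)" by (intro eventually_nhds_in_open) auto
  ultimately obtain Y where Y: "!!tau. Im tau > Y ==> (\<forall>u v tau'. tau' \<in> uhp --> v \<in> V n --> w = of_nat (n + 1) * v (n + 1) --> nome tau' = nome tau -->
    fundamental n k (u, v, tau') = exp (- 2 * of_real pi * \<i> * u) * (\<Sum>z\<in>J. H z (nome tau) * num n v z (nome tau))) \<and>
    (\<forall>z\<in>J. norm (H z (nome tau)) \<le> norm (H z 0) + 1) \<and> nome tau \<in> ball 0 (1/2)"
   using eventually_nome_near_0[OF eventually_conj[OF ev eventually_conj]] by blast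
  define M where "M = (\<Sum>i<n. norm (v i) + 1)"
  define T where "T = (%z :: complex. suminf (th_bound 0 (norm z + M + norm (v (n + 1))) (1/2)) ^ (n + 1))"
  define B where "B = norm (exp (- 2 * of_real pi * \<i> * u)) * (\<Sum>z\<in>J. (norm (H z 0) + 1) * T z)"
  have "norm (fundamental n k (u, v', tau)) \<le> B"
   if *: "v' \<in> V n" "v' (n + 1) = v (n + 1)" "\<forall>i<n. dist (v' i) (v i) < 1" "tau \<in> uhp" "Im tau > Y" for v' tau
  proof -
   have f: "fundamental n k (u, v', tau) = exp (- 2 * of_real pi * \<i> * u) * (\<Sum>z\<in>J. H z (nome tau) * num n v' z (nome tau))"
    using Y[OF *(5)] *(1,2,4) by (simp add: w_def)
   have "norm (num n v' z (nome tau)) \<le> T z" for z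
   proof -
    have "norm (num n v' z (nome tau)) \<le> suminf (th_bound 0 (norm z + M + norm (v' (n + 1))) (1/2)) ^ (n + 1)"
     by (rule norm_num_le) (use V_coordinates_bounded[OF *(1)] *(3) Y[OF *(5)] in \<open>auto simp: M_def\<close>)
    then show ?thesis using *(2) by (simp add: T_def)
   qed
   then have "norm (H z (nome tau) * num n v' z (nome tau)) \<le> (norm (H z 0) + 1) * T z" if "z \<in> J" for z
    unfolding norm_mult using Y[OF *(5)] that by (intro mult_mono) auto
   then have "norm (\<Sum>z\<in>J. H z (nome tau) * num n v' z (nome tau)) \<le> (\<Sum>z\<in>J. (norm (H z 0) + 1) * T z)"
    by (intro sum_norm_le) auto
   then show ?thesis unfolding f B_def norm_mult by (intro mult_left_mono) auto
  qed
  then show ?thesis by (intro exI[of _ 1] conjI exI[of _ Y] exI[of _ B]) auto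
 qed
qed

lemma fundamental_holomorphic_tau:
 assumes n: "n \<ge> 1" and k: "k \<le> n" and v: "v \<in> V n"
 shows "(%tau. fundamental n k (u, v, tau)) holomorphic_on
  {tau \<in> uhp. of_nat (n+1) * v (n+1) ~: Lat tau}"
proof -
 define w where "w = of_nat (n + 1) * v (n + 1)"
 have "(%tau. fundamental n k (u, v, tau)) analytic_on {tau0}" if tau0: "tau0 \<in> uhp" "w ~: Lat tau0" for tau0
 proof -
  define q0 where "q0 = nome tau0"
  have q0: "norm q0 < 1" and w0: "th 0 w q0 ~= 0" using tau0 th_eq_0_iff[OF tau0(1)] by (auto simp: q0_def)
  obtain J H where J: "finite J" "!!z. z \<in> J ==> H z analytic_on {q0}"
   and ev: "eventually (%q. \<forall>u v tau. tau \<in> uhp --> v \<in> V n --> w = of_nat (n + 1) * v (n + 1) --> nome tau = q -->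
    fundamental n k (u, v, tau) = exp (- 2 * of_real pi * \<i> * u) * (\<Sum>z\<in>J. H z q * num n v z q)) (nhds q0)"
   by (rule fundamental_linear_num[OF n q0 w0 k]) (rule that, (assumption | blast)+)
  have nan: "nome analytic_on {tau0}" using analytic_nome[of "%x. x" "{tau0}"] by simp
  have "(nome \<longlongrightarrow> q0) (nhds tau0)"
   using analytic_at_imp_isCont[OF nan] by (simp add: q0_def isCont_def tendsto_at_iff_tendsto_nhds)
  then have "eventually (%tau. \<forall>u v tau'. tau' \<in> uhp --> v \<in> V n --> w = of_nat (n + 1) * v (n + 1) --> nome tau' = nome tau -->
    fundamental n k (u, v, tau') = exp (- 2 * of_real pi * \<i> * u) * (\<Sum>z\<in>J. H z (nome tau) * num n v z (nome tau))) (nhds tau0)"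
   using ev unfolding filterlim_iff by blast
  moreover have "open uhp" unfolding upper_half_plane_def by (rule open_halfspace_Im_gt)
  then have "eventually (%tau. tau \<in> uhp) (nhds tau0)" using tau0 by (intro eventually_nhds_in_open)
  ultimately have "eventually (%tau. fundamental n k (u, v, tau) =
    exp (- 2 * of_real pi * \<i> * u) * (\<Sum>z\<in>J. H z (nome tau) * num n v z (nome tau))) (nhds tau0)"
   by eventually_elim (use v w_def in blast)
  moreover have "(%q. num n v z q) analytic_on {q0}" for z
   unfolding num_def by (intro analytic_intros) (use q0 in auto)
  then have "(%q. exp (- 2 * of_real pi * \<i> * u) * (\<Sum>z\<in>J. H z q * num n v z q)) analytic_on {q0}"
   by (intro analytic_intros J) auto
  then have "(%tau. exp (- 2 * of_real pi * \<i> * u) * (\<Sum>z\<in>J. H z (nome tau) * num n v z (nome tau))) analytic_on {tau0}"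
   using analytic_on_compose[OF nan, of "%q. exp (- 2 * of_real pi * \<i> * u) * (\<Sum>z\<in>J. H z q * num n v z q)"]
   by (simp add: o_def q0_def)
  ultimately show ?thesis by (rule analytic_at_transform)
 qed
 then show ?thesis unfolding w_def
  by (intro analytic_imp_holomorphic, subst analytic_on_analytic_at) auto
qed

lemma fundamental_holomorphic_v:
 assumes n: "n \<ge> 1" and k: "k \<le> n" and x: "(u, v, tau) \<in> Omega_reg n" and i: "i < n"
 shows "(%s. fundamental n k (u, v(i := s, n := v n + v i - s), tau)) holomorphic_on UNIV"
proof -
 define w where "w = of_nat (n + 1) * v (n + 1)"
 define q where "q = nome tau"
 have tau: "tau \<in> uhp" and v: "v \<in> V n" and w: "w ~: Lat tau"
  using x by (auto simp: Omega_reg_def Omega_def w_def)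
 have q: "norm q < 1" and w0: "th 0 w q ~= 0" using tau w th_eq_0_iff[OF tau] by (auto simp: q_def)
 obtain J H where J: "finite J" "!!z. z \<in> J ==> H z analytic_on {q}"
  and ev: "eventually (%q. \<forall>u v tau. tau \<in> uhp --> v \<in> V n --> w = of_nat (n + 1) * v (n + 1) --> nome tau = q -->
    fundamental n k (u, v, tau) = exp (- 2 * of_real pi * \<i> * u) * (\<Sum>z\<in>J. H z q * num n v z q)) (nhds q)"
  by (rule fundamental_linear_num[OF n q w0 k]) (rule that, (assumption | blast)+)
 define vs where "vs = (%s. v(i := s, n := v n + v i - s))"
 have vsV: "vs s \<in> V n" for s
 proof -
  have "(\<Sum>j=0..n. vs s j) = vs s n + (vs s i + (\<Sum>j\<in>{0..n} - {n} - {i}. vs s j))"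
   using i by (subst sum.remove[of _ n], simp, simp, subst sum.remove[of _ i]) auto
  also have "(\<Sum>j\<in>{0..n} - {n} - {i}. vs s j) = (\<Sum>j\<in>{0..n} - {n} - {i}. v j)"
   by (intro sum.cong) (auto simp: vs_def)
  also have "vs s n + (vs s i + (\<Sum>j\<in>{0..n} - {n} - {i}. v j)) = v n + (v i + (\<Sum>j\<in>{0..n} - {n} - {i}. v j))"
   using i by (simp add: vs_def)
  also have "\<dots> = (\<Sum>j=0..n. v j)"
   using i by (subst (2) sum.remove[of _ n], simp, simp, subst sum.remove[of "{0..n} - {n}" i]) auto
  finally show ?thesis using v i by (auto simp: V_def vs_def)
 qed
 have eq: "fundamental n k (u, vs s, tau) = exp (- 2 * of_real pi * \<i> * u) * (\<Sum>z\<in>J. H z q * num n (vs s) z q)" for s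
  using eventually_nhds_x_imp_x[OF ev] vsV[of s] tau i by (simp add: w_def q_def vs_def)
 have "(%s. num n (vs s) z q) holomorphic_on UNIV" for z
  unfolding num_def
 proof (intro holomorphic_on_prod holomorphic_on_th q)
  fix j assume "j \<in> {0..n}"
  then show "(%s. z - vs s j + vs s (n + 1)) holomorphic_on UNIV"
   using i by (cases "j = n"; cases "j = i") (auto simp: vs_def intro!: holomorphic_intros)
 qed
 then have "(%s. fundamental n k (u, vs s, tau)) holomorphic_on UNIV" unfolding eq by (intro holomorphic_intros) auto
 then show ?thesis by (simp only: vs_def)
qed

text \<open>At a point p of the divisor \<open>coef1\<close> has a pole of order at most n, from
  theta(- w)^n in its denominator, and \<open>bas 1\<close> contributes one more through
  theta'(w)/theta(w). The sample points are chosen for w = (n + 1) p; they keep the other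
  denominators away from 0 for s near p.\<close>

lemma fundamental_poles:
 assumes n: "n \<ge> 1" and k: "k \<le> n" and x: "(u, v, tau) \<in> Omega n"
 shows "poles_bounded (%s. fundamental n k (u, v(n+1 := s), tau)) {s. of_nat (n+1) * s \<in> Lat tau} (int n + 1)"
proof -
 define N where "N = (of_nat (n + 1) :: complex)"
 have N0: "N ~= 0" unfolding N_def by (rule of_nat_neq_0[of n, unfolded Suc_eq_plus1])
 define q where "q = nome tau"
 define e where "e = exp (- 2 * of_real pi * \<i> * u)"
 have tau: "tau \<in> uhp" and v: "v \<in> V n" using x by (auto simp: Omega_def)
 have q: "norm q < 1" using tau by (simp add: q_def)
 have T0: "th 0 z q = 0 \<longleftrightarrow> z \<in> Lat tau" for z using th_eq_0_iff[OF tau] by (simp add: q_def)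
 define D where "D = {s. N * s \<in> Lat tau}"
 have clD: "closed D" unfolding D_def
  using closed_vimage[OF closed_period_lattice[OF tau], of "%s. N * s"] by (simp add: vimage_def continuous_intros)
 define vs where "vs = (%s. v(n + 1 := s))"
 have vsV: "vs s \<in> V n" for s using v by (auto simp: V_def vs_def)
 have reg: "(u, vs s, tau) \<in> Omega_reg n" if "s ~: D" for s
  using that vsV tau by (simp add: Omega_reg_def Omega_def D_def N_def vs_def)
 define c1 where "c1 = (%s. coef1 n (vs s) (N * s) q)"
 have anum: "(%s. num n (vs s) (f s) q) analytic_on {p}" if "f analytic_on {p}" for f p
  unfolding num_def vs_def
 proof (intro analytic_on_prod analytic_on_th q)
  fix i assume "i \<in> {0..n}"
  then show "(%s. f s - (v(n + 1 := s)) i + (v(n + 1 := s)) (n + 1)) analytic_on {p}"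
   using that by (auto intro!: analytic_intros)
 qed
 have t1: "th 1 0 q ~= 0" using th_simple_zero[OF q, of 0] q by simp
 have aN: "(%s. th r (z + c * s) q) analytic_on {p}" for r z c p by (intro analytic_intros q)
 have notD: "eventually (%s. s ~: D) (at p)" for p
 proof -
  have "filterlim (%s. N * s) (at (N * p)) (at p)"
   using N0 by (intro filterlim_atI tendsto_intros) (auto simp: eventually_at_filter)
  then show ?thesis
   using eventually_notin_period_lattice[OF tau, of "N * p"] unfolding filterlim_iff D_def by auto
 qed
 have f1: "fundamental n 1 (u, vs s, tau) = e * c1 s" if "s ~: D" for s
  using fundamental_1[OF n reg[OF that], of "N * s"] by (simp add: N_def vs_def e_def c1_def q_def)
 have pole_inv: "pole_le (%s. 1 / th 0 (c * s) q) p 1" if p: "p \<in> D" and c: "c = N \<or> c = - N" for p c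
 proof -
  have "th 0 (c * p) q = 0" using p c by (auto simp: T0 D_def)
  then obtain U where U: "U holomorphic_on UNIV" "!!z. th 0 z q = (z - c * p) * U z" "U (c * p) ~= 0"
   "!!z. th 1 z q = U z + (z - c * p) * deriv U z"
   by (rule th_factor_zero[OF q]) (rule that, (assumption | blast)+)
  have "U analytic_on {c * p}" using U(1) by (auto simp: analytic_at)
  then have "(%s. U (c * s)) analytic_on {p}"
   using analytic_on_compose[of "%s. c * s" "{p}" U] by (simp add: o_def analytic_intros)
  then show ?thesis
   using c N0 U(3)
   by (intro pole_le_simple[of "%_. 1" p "%s. U (c * s)" c]) (auto simp: U(2) algebra_simps)
 qed
 have c1_pole: "pole_le c1 p (int n)" if p: "p \<in> D" for p
 proof -
  have "pole_le (%s. \<Prod>i<n. 1 / th 0 (- N * s) q) p (\<Sum>i<n. 1)"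
   by (intro pole_le_prod pole_inv p) auto
  moreover have "(%s. - num n (vs s) (- (N * s)) q / th 1 0 q) analytic_on {p}"
   using t1 by (intro analytic_intros anum)
  then have "pole_le (%s. - num n (vs s) (- (N * s)) q / th 1 0 q) p 0" by (rule pole_le_analytic)
  ultimately have "pole_le (%s. (\<Prod>i<n. 1 / th 0 (- N * s) q) * (- num n (vs s) (- (N * s)) q / th 1 0 q)) p ((\<Sum>i<n. 1) + 0)"
   by (rule pole_le_mult)
  then show ?thesis
   by (simp add: c1_def[abs_def] coef1_def power_one_over field_simps)
 qed
 have c1_an: "c1 analytic_on {p}" if p: "p ~: D" for p
 proof -
  have "th 0 (- (N * p)) q ~= 0" using p by (simp add: T0 D_def)
  then show ?thesis unfolding c1_def coef1_def using t1 by (intro analytic_intros anum q) auto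
 qed
 have c1_le: "pole_le (%s. e * c1 s) p (int n + 1)" if "p \<in> D" for p
  using pole_le_mono[OF pole_le_mult[OF pole_le_analytic c1_pole[OF that]], of "%_. e" "int n + 1"] by simp
 have "poles_bounded (%s. fundamental n k (u, vs s, tau)) D (int n + 1)"
 proof (rule pole_le_imp_poles_bounded[OF clD])
  fix p assume p: "p ~: D"
  have ev: "eventually (%s. s ~: D) (nhds p)"
   using eventually_nhds_in_open[of "- D" p] clD p by (auto simp: open_Compl)
  show "(%s. fundamental n k (u, vs s, tau)) analytic_on {p}"
  proof (cases "k = 1")
   case True
   have "eventually (%s. fundamental n k (u, vs s, tau) = e * c1 s) (nhds p)"
    using ev by eventually_elim (use f1 True in auto)
   moreover have "(%s. e * c1 s) analytic_on {p}" by (intro analytic_intros c1_an p)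
   ultimately show ?thesis by (rule analytic_at_transform)
  next
   case False
   obtain J A where J: "finite J" "!!z. z \<in> J ==> th 0 z q ~= 0 \<and> th 0 (z + N * p) q ~= 0"
    "!!k z. z \<in> J ==> k \<in> {..n} - {1} ==> A k z analytic_on {q}"
    and evA: "eventually (%q. \<forall>u v tau w k. (u, v, tau) \<in> Omega_reg n --> w = of_nat (n + 1) * v (n + 1) --> nome tau = q -->
     k \<in> {..n} - {1} --> (\<forall>z\<in>J. th 0 z q ~= 0 \<and> th 0 (z + w) q ~= 0) -->
     fundamental n k (u, v, tau) = exp (- 2 * of_real pi * \<i> * u) *
      (\<Sum>z\<in>J. A k z q * (num n v z q / den n z w q - coef1 n v w q * bas 1 z w q))) (nhds q)"
    by (rule fundamental_elimination[OF n q, of "N * p"]) (rule that, (assumption | blast)+)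
   have evJ: "eventually (%s. \<forall>z\<in>J. th 0 z q ~= 0 \<and> th 0 (z + N * s) q ~= 0) (nhds p)"
    using J by (intro eventually_ball_finite ballI eventually_conj analytic_eventually_nonzero aN) auto
   have "eventually (%s. fundamental n k (u, vs s, tau) =
     e * (\<Sum>z\<in>J. A k z q * (num n (vs s) z q / den n z (N * s) q - c1 s * bas 1 z (N * s) q))) (nhds p)"
    using ev evJ
    by eventually_elim
     (use eventually_nhds_x_imp_x[OF evA] reg k False in \<open>simp add: N_def vs_def e_def c1_def q_def\<close>)
   moreover have "(%s. e * (\<Sum>z\<in>J. A k z q * (num n (vs s) z q / den n z (N * s) q - c1 s * bas 1 z (N * s) q))) analytic_on {p}"
   proof (intro analytic_intros anum c1_an p)
    fix z assume z: "z \<in> J"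
    show "(%s. den n z (N * s) q) analytic_on {p}" unfolding den_def by (intro analytic_intros q)
    show "den n z (N * s) q ~= 0" if "s \<in> {p}" for s using J(2)[OF z] that by (simp add: den_def)
    have "th 0 (N * p) q ~= 0" using p by (simp add: T0 D_def)
    then show "(%s. bas 1 z (N * s) q) analytic_on {p}"
     unfolding bas_def theta_logderiv_def using J(2)[OF z]
     by (simp, intro analytic_intros q; simp)
   qed
   ultimately show ?thesis by (rule analytic_at_transform)
  qed
 next
  fix p assume p: "p \<in> D"
  show "pole_le (%s. fundamental n k (u, vs s, tau)) p (int n + 1)"
  proof (cases "k = 1")
   case True
   have "eventually (%s. fundamental n k (u, vs s, tau) = e * c1 s) (at p)"
    using notD[of p] by eventually_elim (use f1 True in auto)
   then show ?thesis by (rule pole_le_cong[OF c1_le[OF p]])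
  next
   case False
   obtain J A where J: "finite J" "!!z. z \<in> J ==> th 0 z q ~= 0 \<and> th 0 (z + N * p) q ~= 0"
    "!!k z. z \<in> J ==> k \<in> {..n} - {1} ==> A k z analytic_on {q}"
    and evA: "eventually (%q. \<forall>u v tau w k. (u, v, tau) \<in> Omega_reg n --> w = of_nat (n + 1) * v (n + 1) --> nome tau = q -->
     k \<in> {..n} - {1} --> (\<forall>z\<in>J. th 0 z q ~= 0 \<and> th 0 (z + w) q ~= 0) -->
     fundamental n k (u, v, tau) = exp (- 2 * of_real pi * \<i> * u) *
      (\<Sum>z\<in>J. A k z q * (num n v z q / den n z w q - coef1 n v w q * bas 1 z w q))) (nhds q)"
    by (rule fundamental_elimination[OF n q, of "N * p"]) (rule that, (assumption | blast)+)
   have "eventually (%s. \<forall>z\<in>J. th 0 z q ~= 0 \<and> th 0 (z + N * s) q ~= 0) (nhds p)"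
    using J by (intro eventually_ball_finite ballI eventually_conj analytic_eventually_nonzero aN) auto
   then have evJ: "eventually (%s. \<forall>z\<in>J. th 0 z q ~= 0 \<and> th 0 (z + N * s) q ~= 0) (at p)"
    unfolding eventually_nhds_conv_at by (rule conjunct1)
   have E: "eventually (%s. fundamental n k (u, vs s, tau) =
     (\<Sum>z\<in>J. e * A k z q * (num n (vs s) z q / den n z (N * s) q) + - (e * A k z q) * (c1 s * bas 1 z (N * s) q))) (at p)"
    using notD[of p] evJ
   proof eventually_elim
    case (elim s)
    have "fundamental n k (u, vs s, tau) =
     e * (\<Sum>z\<in>J. A k z q * (num n (vs s) z q / den n z (N * s) q - c1 s * bas 1 z (N * s) q))"
     using eventually_nhds_x_imp_x[OF evA] reg[OF elim(1)] k False elim(2)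
     by (simp add: N_def vs_def e_def c1_def q_def)
    then show ?case unfolding sum_distrib_left by (simp add: algebra_simps)
   qed
   have "pole_le (%s. e * A k z q * (num n (vs s) z q / den n z (N * s) q) + - (e * A k z q) * (c1 s * bas 1 z (N * s) q)) p (int n + 1)"
    if z: "z \<in> J" for z
   proof (rule pole_le_add)
    have "(%s. e * A k z q * (num n (vs s) z q / den n z (N * s) q)) analytic_on {p}"
     unfolding den_def using J(2)[OF z] by (intro analytic_intros anum q) auto
    then show "pole_le (%s. e * A k z q * (num n (vs s) z q / den n z (N * s) q)) p (int n + 1)"
     using pole_le_mono[OF pole_le_analytic] by simp
    have "(%s. theta_logderiv z q - theta_logderiv (z + N * s) q) analytic_on {p}"
     unfolding theta_logderiv_def using J(2)[OF z] by (intro analytic_intros q) auto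
    then have "pole_le (%s. theta_logderiv z q - theta_logderiv (z + N * s) q) p 1"
     using pole_le_mono[OF pole_le_analytic] by simp
    moreover have "(%s. th 1 (N * s) q) analytic_on {p}" by (intro analytic_intros q)
    then have "pole_le (%s. th 1 (N * s) q * (1 / th 0 (N * s) q)) p (0 + 1)"
     by (intro pole_le_mult pole_le_analytic pole_inv p) auto
    ultimately have "pole_le (%s. (theta_logderiv z q - theta_logderiv (z + N * s) q) + th 1 (N * s) q * (1 / th 0 (N * s) q)) p 1"
     by (intro pole_le_add) simp_all
    then have b1: "pole_le (%s. bas 1 z (N * s) q) p 1" by (simp add: bas_def theta_logderiv_def)
    have "pole_le (%s. - (e * A k z q) * (c1 s * bas 1 z (N * s) q)) p (0 + (int n + 1))"
     by (intro pole_le_mult c1_pole p b1 pole_le_analytic) auto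
    then show "pole_le (%s. - (e * A k z q) * (c1 s * bas 1 z (N * s) q)) p (int n + 1)" by simp
   qed
   then have "pole_le (%s. \<Sum>z\<in>J. e * A k z q * (num n (vs s) z q / den n z (N * s) q) + - (e * A k z q) * (c1 s * bas 1 z (N * s) q)) p (int n + 1)"
    using J(1) by (intro pole_le_sum) auto
   then show ?thesis using E by (rule pole_le_cong)
  qed
 qed
 then show ?thesis by (simp only: vs_def D_def N_def)
qed

text \<open>The order n - 1 is the pole bound n + 1 less twice the index 1.\<close>

lemma fundamental_Jacobi:
 assumes n: "n \<ge> 1" and k: "k \<le> n"
 shows "fundamental n k \<in> Jacobi n (- int k) (int n - 1) 1"
 unfolding Jacobi_def
proof (rule CollectI, intro conjI)
 show "\<forall>x. x ~: Omega_reg n --> fundamental n k x = 0" by (auto simp: fundamental_def)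
 show "\<forall>w. w permutes {0..n} --> (\<forall>x\<in>Omega n. fundamental n k (act_perm w x) = fundamental n k x)"
  using fundamental_perm[OF n] by auto
 show "\<forall>lam\<in>L n. \<forall>mu\<in>L n. \<forall>x\<in>Omega n. fundamental n k (act_trans n lam mu x) = fundamental n k x"
  using fundamental_trans[OF n] by auto
 show "\<forall>a b c d. a * d - b * c = 1 --> (\<forall>(u, v, tau)\<in>Omega n. fundamental n k (act_SL2 n a b c d (u, v, tau)) =
   (of_int c * tau + of_int d) powi (- int k) * fundamental n k (u, v, tau))"
 proof (intro allI impI ballI, clarify)
  fix a b c d :: int and u v tau
  assume *: "a * d - b * c = 1" "(u, v, tau) \<in> Omega n"
  then interpret modular_substitution a b c d tau by unfold_locales (auto simp: Omega_def)
  show "fundamental n k (act_SL2 n a b c d (u, v, tau)) =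
   (of_int c * tau + of_int d) powi (- int k) * fundamental n k (u, v, tau)"
   using fundamental_SL2[OF n k *(2)] by (simp only: j_def)
 qed
 show "\<forall>(u, v, tau)\<in>Omega n. ((%u'. fundamental n k (u', v, tau)) has_field_derivative
   - (2 * of_real pi * \<i>) * of_int 1 * fundamental n k (u, v, tau)) (at u)"
 proof clarify
  fix u v tau
  have "((%u'. exp (- 2 * of_real pi * \<i> * u') * fundamental n k (0, v, tau)) has_field_derivative
   - (2 * of_real pi * \<i>) * (exp (- 2 * of_real pi * \<i> * u) * fundamental n k (0, v, tau))) (at u)"
   by (auto intro!: derivative_eq_intros)
  then show "((%u'. fundamental n k (u', v, tau)) has_field_derivative
   - (2 * of_real pi * \<i>) * of_int 1 * fundamental n k (u, v, tau)) (at u)"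
   by (subst (1 2) fundamental_u[OF n k]) simp
 qed
 show "\<forall>u. \<forall>v\<in>V n. \<exists>\<epsilon>>0. \<exists>Y B. \<forall>v'\<in>V n. \<forall>tau. v' (n+1) = v (n+1) \<and> (\<forall>i<n. dist (v' i) (v i) < \<epsilon>) \<and>
  tau \<in> uhp \<and> Im tau > Y --> norm (fundamental n k (u, v', tau)) \<le> B"
  using fundamental_bounded[OF n k] by blast
 show "\<forall>(u, v, tau)\<in>Omega n. poles_bounded (%s. fundamental n k (u, v(n+1 := s), tau))
   {s. of_nat (n+1) * s \<in> Lat tau} (int n - 1 + 2 * 1)"
  using fundamental_poles[OF n k] by (auto simp: add.commute)
 show "\<forall>(u, v, tau)\<in>Omega_reg n. \<forall>i<n. (%s. fundamental n k (u, v(i := s, n := v n + v i - s), tau)) holomorphic_on UNIV"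
  using fundamental_holomorphic_v[OF n k] by blast
 show "\<forall>u. \<forall>v\<in>V n. (%tau. fundamental n k (u, v, tau)) holomorphic_on
   {tau \<in> uhp. of_nat (n+1) * v (n+1) ~: Lat tau}"
  using fundamental_holomorphic_tau[OF n k] by blast
qed

section \<open>The algebra of Jacobi forms\<close>

lemma JacobiD:
 assumes "f \<in> Jacobi n k l m"
 shows Jacobi_outside: "x ~: Omega_reg n ==> f x = 0"
  and Jacobi_perm: "p permutes {0..n} ==> x \<in> Omega n ==> f (act_perm p x) = f x"
  and Jacobi_trans: "lam \<in> L n ==> mu \<in> L n ==> x \<in> Omega n ==> f (act_trans n lam mu x) = f x"
  and Jacobi_SL2: "a * d - b * c = 1 ==> (u, v, tau) \<in> Omega n ==>
      f (act_SL2 n a b c d (u, v, tau)) = (of_int c * tau + of_int d) powi k * f (u, v, tau)"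
  and Jacobi_deriv_u: "(u, v, tau) \<in> Omega n ==> ((%u'. f (u', v, tau)) has_field_derivative
      - (2 * of_real pi * \<i>) * of_int m * f (u, v, tau)) (at u)"
  and Jacobi_bounded: "v \<in> V n ==> \<exists>\<epsilon>>0. \<exists>Y B. \<forall>v'\<in>V n. \<forall>tau.
    v' (n+1) = v (n+1) \<and> (\<forall>i<n. dist (v' i) (v i) < \<epsilon>) \<and> tau \<in> uhp \<and> Im tau > Y
     --> norm (f (u, v', tau)) \<le> B"
  and Jacobi_poles: "(u, v, tau) \<in> Omega n ==> poles_bounded (%s. f (u, v(n+1 := s), tau))
     {s. of_nat (n+1) * s \<in> Lat tau} (l + 2 * m)"
  and Jacobi_holomorphic_v: "(u, v, tau) \<in> Omega_reg n ==> i < n ==>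
    (%s. f (u, v(i := s, n := v n + v i - s), tau)) holomorphic_on UNIV"
  and Jacobi_holomorphic_tau: "v \<in> V n ==> (%tau. f (u, v, tau)) holomorphic_on
     {tau \<in> uhp. of_nat (n+1) * v (n+1) ~: Lat tau}"
proof -
 note J = assms[unfolded Jacobi_def mem_Collect_eq]
 show "x ~: Omega_reg n ==> f x = 0" using J[THEN conjunct1] by blast
 show "p permutes {0..n} ==> x \<in> Omega n ==> f (act_perm p x) = f x" using J[THEN conjunct2, THEN conjunct1] by blast
 show "lam \<in> L n ==> mu \<in> L n ==> x \<in> Omega n ==> f (act_trans n lam mu x) = f x" using J[THEN conjunct2, THEN conjunct2, THEN conjunct1] by blast
 show "f (act_SL2 n a b c d (u, v, tau)) = (of_int c * tau + of_int d) powi k * f (u, v, tau)"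
  if "a * d - b * c = 1" "(u, v, tau) \<in> Omega n"
  using J[THEN conjunct2, THEN conjunct2, THEN conjunct2, THEN conjunct1] that by fast
 show "((%u'. f (u', v, tau)) has_field_derivative
      - (2 * of_real pi * \<i>) * of_int m * f (u, v, tau)) (at u)" if "(u, v, tau) \<in> Omega n"
  using J[THEN conjunct2, THEN conjunct2, THEN conjunct2, THEN conjunct2, THEN conjunct1] that by fast
 show "\<exists>\<epsilon>>0. \<exists>Y B. \<forall>v'\<in>V n. \<forall>tau.
    v' (n+1) = v (n+1) \<and> (\<forall>i<n. dist (v' i) (v i) < \<epsilon>) \<and> tau \<in> uhp \<and> Im tau > Y
     --> norm (f (u, v', tau)) \<le> B" if "v \<in> V n"
  using J[THEN conjunct2, THEN conjunct2, THEN conjunct2, THEN conjunct2, THEN conjunct2, THEN conjunct1] that by blast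
 show "poles_bounded (%s. f (u, v(n+1 := s), tau))
     {s. of_nat (n+1) * s \<in> Lat tau} (l + 2 * m)" if "(u, v, tau) \<in> Omega n"
  using J[THEN conjunct2, THEN conjunct2, THEN conjunct2, THEN conjunct2, THEN conjunct2, THEN conjunct2, THEN conjunct1] that by fast
 show "(%s. f (u, v(i := s, n := v n + v i - s), tau)) holomorphic_on UNIV"
  if "(u, v, tau) \<in> Omega_reg n" "i < n"
  using J[THEN conjunct2, THEN conjunct2, THEN conjunct2, THEN conjunct2, THEN conjunct2, THEN conjunct2, THEN conjunct2, THEN conjunct1] that by fast
 show "(%tau. f (u, v, tau)) holomorphic_on
     {tau \<in> uhp. of_nat (n+1) * v (n+1) ~: Lat tau}" if "v \<in> V n"
  using J[THEN conjunct2, THEN conjunct2, THEN conjunct2, THEN conjunct2, THEN conjunct2, THEN conjunct2, THEN conjunct2, THEN conjunct2] that by blast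
qed

lemma closed_divisor:
 assumes "tau \<in> uhp"
 shows "closed {s. of_nat (n+1) * s \<in> Lat tau}"
 using closed_vimage[OF closed_period_lattice[OF assms], of "%s. of_nat (n+1) * s"]
 by (simp add: vimage_def continuous_intros)

lemma Jacobi_mult:
 assumes f: "f \<in> Jacobi n k l m" and g: "g \<in> Jacobi n k' l' m'"
 shows "(%x. f x * g x) \<in> Jacobi n (k + k') (l + l') (m + m')"
 unfolding Jacobi_def
proof (rule CollectI, intro conjI)
 show "\<forall>x. x ~: Omega_reg n --> f x * g x = 0" using Jacobi_outside[OF f] by simp
 show "\<forall>w. w permutes {0..n} --> (\<forall>x\<in>Omega n. f (act_perm w x) * g (act_perm w x) = f x * g x)"
  by (simp add: Jacobi_perm[OF f] Jacobi_perm[OF g])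
 show "\<forall>lam\<in>L n. \<forall>mu\<in>L n. \<forall>x\<in>Omega n. f (act_trans n lam mu x) * g (act_trans n lam mu x) = f x * g x"
  by (simp add: Jacobi_trans[OF f] Jacobi_trans[OF g])
 show "\<forall>a b c d. a * d - b * c = 1 --> (\<forall>(u, v, tau)\<in>Omega n.
   f (act_SL2 n a b c d (u, v, tau)) * g (act_SL2 n a b c d (u, v, tau)) =
   (of_int c * tau + of_int d) powi (k + k') * (f (u, v, tau) * g (u, v, tau)))"
 proof (intro allI impI ballI, clarify)
  fix a b c d :: int and u v tau
  assume *: "a * d - b * c = 1" "(u, v, tau) \<in> Omega n"
  then interpret modular_substitution a b c d tau by unfold_locales (auto simp: Omega_def)
  have "of_int c * tau + of_int d ~= 0" using j_nonzero unfolding j_def .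
  then show "f (act_SL2 n a b c d (u, v, tau)) * g (act_SL2 n a b c d (u, v, tau)) =
   (of_int c * tau + of_int d) powi (k + k') * (f (u, v, tau) * g (u, v, tau))"
   unfolding Jacobi_SL2[OF f *] Jacobi_SL2[OF g *] by (simp add: power_int_add)
 qed
 show "\<forall>(u, v, tau)\<in>Omega n. ((%u'. f (u', v, tau) * g (u', v, tau)) has_field_derivative
   - (2 * of_real pi * \<i>) * of_int (m + m') * (f (u, v, tau) * g (u, v, tau))) (at u)"
  by clarify
    (rule DERIV_cong[OF DERIV_mult[OF Jacobi_deriv_u[OF f] Jacobi_deriv_u[OF g]]], auto simp: algebra_simps)
 show "\<forall>u. \<forall>v\<in>V n. \<exists>\<epsilon>>0. \<exists>Y B. \<forall>v'\<in>V n. \<forall>tau. v' (n+1) = v (n+1) \<and> (\<forall>i<n. dist (v' i) (v i) < \<epsilon>) \<and>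
  tau \<in> uhp \<and> Im tau > Y --> norm (f (u, v', tau) * g (u, v', tau)) \<le> B"
 proof (intro allI ballI)
  fix u v assume v: "v \<in> V n"
  obtain e1 Y1 B1 where 1: "e1 > 0" "!!v' tau. v' \<in> V n ==> v' (n+1) = v (n+1) ==> (\<forall>i<n. dist (v' i) (v i) < e1) ==>
    tau \<in> uhp ==> Im tau > Y1 ==> norm (f (u, v', tau)) \<le> B1"
   using Jacobi_bounded[OF f v, of u] by blast
  obtain e2 Y2 B2 where 2: "e2 > 0" "!!v' tau. v' \<in> V n ==> v' (n+1) = v (n+1) ==> (\<forall>i<n. dist (v' i) (v i) < e2) ==>
    tau \<in> uhp ==> Im tau > Y2 ==> norm (g (u, v', tau)) \<le> B2"
   using Jacobi_bounded[OF g v, of u] by blast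
  have "norm (f (u, v', tau) * g (u, v', tau)) \<le> B1 * B2"
   if "v' \<in> V n" "v' (n+1) = v (n+1)" "\<forall>i<n. dist (v' i) (v i) < min e1 e2"
    "tau \<in> uhp" "Im tau > max Y1 Y2" for v' tau
  proof -
   have "norm (f (u, v', tau)) \<le> B1" "norm (g (u, v', tau)) \<le> B2" using 1(2)[of v' tau] 2(2)[of v' tau] that by auto
   then show ?thesis unfolding norm_mult by (intro mult_mono) (auto intro: order_trans[OF norm_ge_zero])
  qed
  then show "\<exists>\<epsilon>>0. \<exists>Y B. \<forall>v'\<in>V n. \<forall>tau. v' (n+1) = v (n+1) \<and> (\<forall>i<n. dist (v' i) (v i) < \<epsilon>) \<and>
   tau \<in> uhp \<and> Im tau > Y --> norm (f (u, v', tau) * g (u, v', tau)) \<le> B"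
   using 1(1) 2(1)
   by (intro exI[of _ "min e1 e2"] conjI exI[of _ "max Y1 Y2"] exI[of _ "B1 * B2"]) auto
 qed
 show "\<forall>(u, v, tau)\<in>Omega n. poles_bounded (%s. f (u, v(n+1 := s), tau) * g (u, v(n+1 := s), tau))
   {s. of_nat (n+1) * s \<in> Lat tau} (l + l' + 2 * (m + m'))"
 proof clarify
  fix u v tau assume x: "(u, v, tau) \<in> Omega n"
  then have cl: "closed {s. of_nat (n+1) * s \<in> Lat tau}" by (intro closed_divisor) (auto simp: Omega_def)
  have e: "l + l' + 2 * (m + m') = (l + 2 * m) + (l' + 2 * m')" by simp
  show "poles_bounded (%s. f (u, v(n+1 := s), tau) * g (u, v(n+1 := s), tau))
   {s. of_nat (n+1) * s \<in> Lat tau} (l + l' + 2 * (m + m'))"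
   unfolding e
   by (intro pole_le_imp_poles_bounded cl analytic_on_mult pole_le_mult
     poles_bounded_imp_analytic[OF Jacobi_poles[OF f x] cl] poles_bounded_imp_analytic[OF Jacobi_poles[OF g x] cl]
     poles_bounded_imp_pole_le[OF Jacobi_poles[OF f x]] poles_bounded_imp_pole_le[OF Jacobi_poles[OF g x]])
 qed
 show "\<forall>(u, v, tau)\<in>Omega_reg n. \<forall>i<n.
   (%s. f (u, v(i := s, n := v n + v i - s), tau) * g (u, v(i := s, n := v n + v i - s), tau)) holomorphic_on UNIV"
  by clarify (intro holomorphic_on_mult Jacobi_holomorphic_v[OF f] Jacobi_holomorphic_v[OF g])
 show "\<forall>u. \<forall>v\<in>V n. (%tau. f (u, v, tau) * g (u, v, tau)) holomorphic_on
   {tau \<in> uhp. of_nat (n+1) * v (n+1) ~: Lat tau}"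
  by (intro allI ballI holomorphic_on_mult Jacobi_holomorphic_tau[OF f] Jacobi_holomorphic_tau[OF g])
qed

lemma Jacobi_add:
 assumes f: "f \<in> Jacobi n k l m" and g: "g \<in> Jacobi n k l m"
 shows "(%x. f x + g x) \<in> Jacobi n k l m"
 unfolding Jacobi_def
proof (rule CollectI, intro conjI)
 show "\<forall>x. x ~: Omega_reg n --> f x + g x = 0" using Jacobi_outside[OF f] Jacobi_outside[OF g] by simp
 show "\<forall>w. w permutes {0..n} --> (\<forall>x\<in>Omega n. f (act_perm w x) + g (act_perm w x) = f x + g x)"
  by (simp add: Jacobi_perm[OF f] Jacobi_perm[OF g])
 show "\<forall>lam\<in>L n. \<forall>mu\<in>L n. \<forall>x\<in>Omega n. f (act_trans n lam mu x) + g (act_trans n lam mu x) = f x + g x"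
  by (simp add: Jacobi_trans[OF f] Jacobi_trans[OF g])
 show "\<forall>a b c d. a * d - b * c = 1 --> (\<forall>(u, v, tau)\<in>Omega n.
   f (act_SL2 n a b c d (u, v, tau)) + g (act_SL2 n a b c d (u, v, tau)) =
   (of_int c * tau + of_int d) powi k * (f (u, v, tau) + g (u, v, tau)))"
  using Jacobi_SL2[OF f] Jacobi_SL2[OF g] by (auto simp: distrib_left simp del: act_SL2.simps)
 show "\<forall>(u, v, tau)\<in>Omega n. ((%u'. f (u', v, tau) + g (u', v, tau)) has_field_derivative
   - (2 * of_real pi * \<i>) * of_int m * (f (u, v, tau) + g (u, v, tau))) (at u)"
  by clarify
    (rule DERIV_cong[OF DERIV_add[OF Jacobi_deriv_u[OF f] Jacobi_deriv_u[OF g]]], auto simp: algebra_simps)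
 show "\<forall>u. \<forall>v\<in>V n. \<exists>\<epsilon>>0. \<exists>Y B. \<forall>v'\<in>V n. \<forall>tau. v' (n+1) = v (n+1) \<and> (\<forall>i<n. dist (v' i) (v i) < \<epsilon>) \<and>
  tau \<in> uhp \<and> Im tau > Y --> norm (f (u, v', tau) + g (u, v', tau)) \<le> B"
 proof (intro allI ballI)
  fix u v assume v: "v \<in> V n"
  obtain e1 Y1 B1 where 1: "e1 > 0" "!!v' tau. v' \<in> V n ==> v' (n+1) = v (n+1) ==> (\<forall>i<n. dist (v' i) (v i) < e1) ==>
    tau \<in> uhp ==> Im tau > Y1 ==> norm (f (u, v', tau)) \<le> B1"
   using Jacobi_bounded[OF f v, of u] by blast
  obtain e2 Y2 B2 where 2: "e2 > 0" "!!v' tau. v' \<in> V n ==> v' (n+1) = v (n+1) ==> (\<forall>i<n. dist (v' i) (v i) < e2) ==>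
    tau \<in> uhp ==> Im tau > Y2 ==> norm (g (u, v', tau)) \<le> B2"
   using Jacobi_bounded[OF g v, of u] by blast
  have "norm (f (u, v', tau) + g (u, v', tau)) \<le> B1 + B2"
   if "v' \<in> V n" "v' (n+1) = v (n+1)" "\<forall>i<n. dist (v' i) (v i) < min e1 e2"
    "tau \<in> uhp" "Im tau > max Y1 Y2" for v' tau
   using 1(2)[of v' tau] 2(2)[of v' tau] that by (intro norm_triangle_mono) auto
  then show "\<exists>\<epsilon>>0. \<exists>Y B. \<forall>v'\<in>V n. \<forall>tau. v' (n+1) = v (n+1) \<and> (\<forall>i<n. dist (v' i) (v i) < \<epsilon>) \<and>
   tau \<in> uhp \<and> Im tau > Y --> norm (f (u, v', tau) + g (u, v', tau)) \<le> B"
   using 1(1) 2(1)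
   by (intro exI[of _ "min e1 e2"] conjI exI[of _ "max Y1 Y2"] exI[of _ "B1 + B2"]) auto
 qed
 show "\<forall>(u, v, tau)\<in>Omega n. poles_bounded (%s. f (u, v(n+1 := s), tau) + g (u, v(n+1 := s), tau))
   {s. of_nat (n+1) * s \<in> Lat tau} (l + 2 * m)"
 proof clarify
  fix u v tau assume x: "(u, v, tau) \<in> Omega n"
  then have cl: "closed {s. of_nat (n+1) * s \<in> Lat tau}" by (intro closed_divisor) (auto simp: Omega_def)
  show "poles_bounded (%s. f (u, v(n+1 := s), tau) + g (u, v(n+1 := s), tau))
   {s. of_nat (n+1) * s \<in> Lat tau} (l + 2 * m)"
   by (intro pole_le_imp_poles_bounded cl analytic_on_add pole_le_add
     poles_bounded_imp_analytic[OF Jacobi_poles[OF f x] cl] poles_bounded_imp_analytic[OF Jacobi_poles[OF g x] cl]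
     poles_bounded_imp_pole_le[OF Jacobi_poles[OF f x]] poles_bounded_imp_pole_le[OF Jacobi_poles[OF g x]])
 qed
 show "\<forall>(u, v, tau)\<in>Omega_reg n. \<forall>i<n.
   (%s. f (u, v(i := s, n := v n + v i - s), tau) + g (u, v(i := s, n := v n + v i - s), tau)) holomorphic_on UNIV"
  by clarify (intro holomorphic_on_add Jacobi_holomorphic_v[OF f] Jacobi_holomorphic_v[OF g])
 show "\<forall>u. \<forall>v\<in>V n. (%tau. f (u, v, tau) + g (u, v, tau)) holomorphic_on
   {tau \<in> uhp. of_nat (n+1) * v (n+1) ~: Lat tau}"
  by (intro allI ballI holomorphic_on_add Jacobi_holomorphic_tau[OF f] Jacobi_holomorphic_tau[OF g])
qed

text \<open>Integration of the differential equation in u: f times the inverse exponential E has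
  derivative 0.\<close>

lemma Jacobi_u:
 assumes f: "f \<in> Jacobi n k l m" and x: "(0, v, tau) \<in> Omega n"
 shows "f (u, v, tau) = exp (- 2 * of_real pi * \<i> * of_int m * u) * f (0, v, tau)"
proof -
 define E where "E = (%u. exp (2 * of_real pi * \<i> * of_int m * u))"
 have "(E has_field_derivative 2 * of_real pi * \<i> * of_int m * E u) (at u)" for u
  unfolding E_def by (auto intro!: derivative_eq_intros)
 moreover have "((%u'. f (u', v, tau)) has_field_derivative - (2 * of_real pi * \<i>) * of_int m * f (u, v, tau)) (at u)" for u
  using Jacobi_deriv_u[OF f, of u v tau] x by (simp add: Omega_def)
 ultimately have "((%u. E u * f (u, v, tau)) has_field_derivative 0) (at u within UNIV)" for u
  by (rule DERIV_cong[OF DERIV_mult]) (simp add: algebra_simps)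
 then obtain c where c: "!!u. E u * f (u, v, tau) = c"
  using has_field_derivative_zero_constant[of UNIV "%u. E u * f (u, v, tau)"] by auto
 have "E u * f (u, v, tau) = f (0, v, tau)" using c[of u] c[of 0] by (simp add: E_def)
 moreover have "exp (- 2 * of_real pi * \<i> * of_int m * u) * E u = 1"
  unfolding E_def exp_add[symmetric] by simp
 ultimately show ?thesis by (metis mult.assoc mult.left_neutral)
qed

lemma reg_perm:
 assumes "p permutes {0..n}" "x \<in> Omega n"
 shows "act_perm p x \<in> Omega n" "act_perm p x \<in> Omega_reg n \<longleftrightarrow> x \<in> Omega_reg n"
  "fst (snd (act_perm p x)) (n + 1) = fst (snd x) (n + 1)" "snd (snd (act_perm p x)) = snd (snd x)"
proof -
 obtain u v tau where x: "x = (u, v, tau)" by (cases x)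
 have pn: "p i = i" if "i > n" for i using assms(1) that by (simp add: permutes_not_in)
 have "(\<Sum>i=0..n. (v \<circ> p) i) = (\<Sum>i=0..n. v i)" using sum.permute[OF assms(1), of v] by (simp add: o_def)
 then have "v \<circ> p \<in> V n" using pn assms(2) by (auto simp: V_def x Omega_def)
 then show "act_perm p x \<in> Omega n" "act_perm p x \<in> Omega_reg n \<longleftrightarrow> x \<in> Omega_reg n"
  "fst (snd (act_perm p x)) (n + 1) = fst (snd x) (n + 1)" "snd (snd (act_perm p x)) = snd (snd x)"
  using assms(2) pn by (auto simp: x Omega_def Omega_reg_def)
qed

lemma reg_trans:
 assumes "lam \<in> L n" "mu \<in> L n" "(u, v, tau) \<in> Omega n"
 shows "act_trans n lam mu (u, v, tau) \<in> Omega n"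
  "act_trans n lam mu (u, v, tau) \<in> Omega_reg n \<longleftrightarrow> (u, v, tau) \<in> Omega_reg n"
proof -
 have lamV: "lam \<in> V n" "!!i. lam i \<in> \<int>" and muV: "mu \<in> V n" "!!i. mu i \<in> \<int>"
  using assms L_subset by auto
 have V: "(%i. v i + lam i * tau + mu i) \<in> V n"
  using assms(3) lamV(1) muV(1) by (auto simp: V_def Omega_def sum.distrib sum_distrib_right[symmetric])
 then show "act_trans n lam mu (u, v, tau) \<in> Omega n" using assms(3) by (simp add: Omega_def)
 have "of_nat (n + 1) * (v (n + 1) + lam (n + 1) * tau + mu (n + 1)) =
   of_nat (n + 1) * v (n + 1) + (of_nat (n + 1) * mu (n + 1) + of_nat (n + 1) * lam (n + 1) * tau)"
  by (simp add: algebra_simps)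
 moreover have "of_nat (n + 1) * mu (n + 1) + of_nat (n + 1) * lam (n + 1) * tau \<in> Lat tau"
  using lamV muV by (intro Ints_lattice_mem Ints_mult) auto
 ultimately have "of_nat (n + 1) * (v (n + 1) + lam (n + 1) * tau + mu (n + 1)) \<in> Lat tau \<longleftrightarrow>
   of_nat (n + 1) * v (n + 1) \<in> Lat tau"
  using period_lattice_add_iff by simp
 then show "act_trans n lam mu (u, v, tau) \<in> Omega_reg n \<longleftrightarrow> (u, v, tau) \<in> Omega_reg n"
  using V assms(3) by (simp add: Omega_reg_def Omega_def)
qed

lemma (in modular_substitution) reg_SL2:
 assumes "(u, v, tau) \<in> Omega n"
 shows "act_SL2 n a b c d (u, v, tau) \<in> Omega n"
  "act_SL2 n a b c d (u, v, tau) \<in> Omega_reg n \<longleftrightarrow> (u, v, tau) \<in> Omega_reg n"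
proof -
 have act: "act_SL2 n a b c d (u, v, tau) = (u + of_int c * form n v v / (2 * j), %i. v i / j, tau')"
  by (simp add: tau'_def j_def)
 have V: "(%i. v i / j) \<in> V n" using assms by (simp add: V_def Omega_def sum_divide_distrib[symmetric])
 then show "act_SL2 n a b c d (u, v, tau) \<in> Omega n" unfolding act using tau'_uhp by (simp add: Omega_def)
 show "act_SL2 n a b c d (u, v, tau) \<in> Omega_reg n \<longleftrightarrow> (u, v, tau) \<in> Omega_reg n"
  unfolding act using V assms tau'_uhp lattice_iff[of "of_nat (n + 1) * v (n + 1)"]
  by (simp add: Omega_reg_def Omega_def)
qed

section \<open>Forms of index 0 from functions of the last coordinate and tau\<close>

definition index0_form :: "nat => (complex => complex => complex) => point => complex" where
 "index0_form n C = (%(u, v, tau). if (u, v, tau) \<in> Omega_reg n then C (v (n + 1)) tau else 0)"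

text \<open>In index 0 all conditions reduce to the pair (v (n + 1), tau). Boundedness is asked only
  for non-integral (n + 1) s, and only at those tau for which s is off the divisor; at all other
  points the form is 0 by its definition.\<close>

lemma index0_form_Jacobi:
 fixes C :: "complex => complex => complex"
 assumes T: "!!tau s a b. tau \<in> uhp ==> of_nat (n+1) * s ~: Lat tau ==> a \<in> \<int> ==> b \<in> \<int> ==>
   C (s + b * tau + a) tau = C s tau"
  and M: "!!tau s a b c d. tau \<in> uhp ==> of_nat (n+1) * s ~: Lat tau ==> a * d - b * c = 1 ==>
   C (s / (of_int c * tau + of_int d)) ((of_int a * tau + of_int b) / (of_int c * tau + of_int d)) =
   (of_int c * tau + of_int d) powi k * C s tau"
  and B: "!!s. of_nat (n+1) * s ~: \<int> ==> \<exists>Y B. \<forall>tau. tau \<in> uhp -->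
   of_nat (n+1) * s ~: Lat tau --> Im tau > Y --> norm (C s tau) \<le> B"
  and P: "!!tau p. tau \<in> uhp ==> of_nat (n+1) * p ~: Lat tau ==> (%s. C s tau) analytic_on {p}"
   "!!tau p. tau \<in> uhp ==> of_nat (n+1) * p \<in> Lat tau ==> pole_le (%s. C s tau) p l"
  and H: "!!tau s. tau \<in> uhp ==> of_nat (n+1) * s ~: Lat tau ==> C s analytic_on {tau}"
 shows "index0_form n C \<in> Jacobi n k l 0"
proof -
 define f where "f = index0_form n C"
 have f: "f (u, v, tau) = C (v (n + 1)) tau" if "(u, v, tau) \<in> Omega_reg n" for u v tau
  using that by (simp add: f_def index0_form_def)
 have f0: "f x = 0" if "x ~: Omega_reg n" for x using that by (cases x) (simp add: f_def index0_form_def)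
 have f0': "f (u, v, tau) = 0" if "of_nat (n+1) * v (n+1) \<in> Lat tau" for u v tau
  using that by (intro f0) (simp add: Omega_reg_def)
 have reg: "(u, v, tau) \<in> Omega_reg n" if "v \<in> V n" "tau \<in> uhp" "of_nat (n+1) * v (n+1) ~: Lat tau" for u v tau
  using that by (simp add: Omega_reg_def Omega_def)
 have regD: "v \<in> V n" "tau \<in> uhp" "of_nat (n+1) * v (n+1) ~: Lat tau" if "(u, v, tau) \<in> Omega_reg n" for u v tau
  using that by (simp_all add: Omega_reg_def Omega_def)
 have "f \<in> Jacobi n k l 0"
  unfolding Jacobi_def
 proof (rule CollectI, intro conjI)
  show "\<forall>x. x ~: Omega_reg n --> f x = 0" using f0 by blast
  show "\<forall>w. w permutes {0..n} --> (\<forall>x\<in>Omega n. f (act_perm w x) = f x)"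
  proof (intro allI impI ballI)
   fix p x assume *: "p permutes {0..n}" "x \<in> Omega n"
   obtain u v tau where x: "x = (u, v, tau)" by (cases x)
   show "f (act_perm p x) = f x"
    using reg_perm[OF *] f f0 unfolding x by (cases "(u, v, tau) \<in> Omega_reg n") (simp_all add: f_def index0_form_def)
  qed
  show "\<forall>lam\<in>L n. \<forall>mu\<in>L n. \<forall>x\<in>Omega n. f (act_trans n lam mu x) = f x"
  proof (intro ballI)
   fix lam mu x assume *: "lam \<in> L n" "mu \<in> L n" "x \<in> Omega n"
   obtain u v tau where x: "x = (u, v, tau)" by (cases x)
   show "f (act_trans n lam mu x) = f x"
   proof (cases "(u, v, tau) \<in> Omega_reg n")
    case True
    have "C (v (n+1) + lam (n+1) * tau + mu (n+1)) tau = C (v (n+1)) tau"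
     using True * L_subset by (intro T) (auto simp: Omega_reg_def Omega_def)
    then show ?thesis using reg_trans(2)[OF *[unfolded x]] True by (simp add: x f_def index0_form_def)
   qed (use reg_trans(2)[OF *[unfolded x]] f0 in \<open>simp add: x del: act_trans.simps\<close>)
  qed
  show "\<forall>a b c d. a * d - b * c = 1 --> (\<forall>(u, v, tau)\<in>Omega n. f (act_SL2 n a b c d (u, v, tau)) =
    (of_int c * tau + of_int d) powi k * f (u, v, tau))"
  proof (intro allI impI ballI, clarify)
   fix a b c d :: int and u v tau
   assume *: "a * d - b * c = 1" "(u, v, tau) \<in> Omega n"
   then interpret modular_substitution a b c d tau by unfold_locales (auto simp: Omega_def)
   show "f (act_SL2 n a b c d (u, v, tau)) = (of_int c * tau + of_int d) powi k * f (u, v, tau)"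
   proof (cases "(u, v, tau) \<in> Omega_reg n")
    case True
    then show ?thesis using reg_SL2(2)[OF *(2)] M[OF regD(2,3)[OF True] *(1)] by (simp add: f_def index0_form_def)
   qed (use reg_SL2(2)[OF *(2)] f0 in \<open>simp del: act_SL2.simps\<close>)
  qed
  show "\<forall>(u, v, tau)\<in>Omega n. ((%u'. f (u', v, tau)) has_field_derivative
    - (2 * of_real pi * \<i>) * of_int 0 * f (u, v, tau)) (at u)"
  proof clarify
   fix u v tau
   have "(%u'. f (u', v, tau)) = (%_. f (u, v, tau))"
    by (rule ext) (simp add: f_def index0_form_def Omega_reg_def Omega_def)
   then show "((%u'. f (u', v, tau)) has_field_derivative - (2 * of_real pi * \<i>) * of_int 0 * f (u, v, tau)) (at u)"
    by simp
  qed
  show "\<forall>u. \<forall>v\<in>V n. \<exists>\<epsilon>>0. \<exists>Y B. \<forall>v'\<in>V n. \<forall>tau. v' (n+1) = v (n+1) \<and> (\<forall>i<n. dist (v' i) (v i) < \<epsilon>) \<and>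
   tau \<in> uhp \<and> Im tau > Y --> norm (f (u, v', tau)) \<le> B"
  proof (intro allI ballI)
   fix u v assume v: "v \<in> V n"
   show "\<exists>\<epsilon>>0. \<exists>Y B. \<forall>v'\<in>V n. \<forall>tau. v' (n+1) = v (n+1) \<and> (\<forall>i<n. dist (v' i) (v i) < \<epsilon>) \<and>
    tau \<in> uhp \<and> Im tau > Y --> norm (f (u, v', tau)) \<le> B"
   proof (cases "of_nat (n+1) * v (n+1) \<in> \<int>")
    case True
    then obtain a where "of_nat (n+1) * v (n+1) = of_int a" by (auto elim: Ints_cases)
    then have "of_nat (n+1) * v (n+1) \<in> Lat tau" for tau using period_latticeI[of a 0 tau] by simp
    then have "f (u, v', tau) = 0" if "v' (n + 1) = v (n + 1)" for v' tau using f0'[of v' tau] that by simp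
    then show ?thesis by (intro exI[of _ 1] conjI exI[of _ 0]) auto
   next
    case False
    obtain Y B where YB: "!!tau. tau \<in> uhp ==> of_nat (n+1) * v (n+1) ~: Lat tau ==> Im tau > Y ==>
      norm (C (v (n+1)) tau) \<le> B" using B[OF False] by blast
    have "norm (f (u, v', tau)) \<le> max B 0"
     if *: "v' \<in> V n" "v' (n+1) = v (n+1)" "tau \<in> uhp" "Im tau > Y" for v' tau
    proof (cases "(u, v', tau) \<in> Omega_reg n")
     case True
     then have "norm (C (v (n+1)) tau) \<le> B" using YB[OF *(3) _ *(4)] regD(3)[OF True] *(2) by simp
     then show ?thesis using f[OF True] *(2) by simp
    qed (simp add: f0)
    then show ?thesis by (intro exI[of _ 1] conjI exI[of _ Y] exI[of _ "max B 0"]) auto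
   qed
  qed
  show "\<forall>(u, v, tau)\<in>Omega n. poles_bounded (%s. f (u, v(n+1 := s), tau))
    {s. of_nat (n+1) * s \<in> Lat tau} (l + 2 * 0)"
  proof clarify
   fix u v tau assume x: "(u, v, tau) \<in> Omega n"
   then have tau: "tau \<in> uhp" and v: "v \<in> V n" by (auto simp: Omega_def)
   define D where "D = {s. of_nat (n+1) * s \<in> Lat tau}"
   have cl: "closed D" unfolding D_def by (rule closed_divisor[OF tau])
   have vs: "v(n+1 := s) \<in> V n" for s using v by (auto simp: V_def)
   have fs: "f (u, v(n+1 := s), tau) = C s tau" if "s ~: D" for s
    using f[OF reg[OF vs tau], of s u] that by (simp add: D_def)
   have "poles_bounded (%s. f (u, v(n+1 := s), tau)) D l"
   proof (rule pole_le_imp_poles_bounded[OF cl])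
    fix p assume p: "p ~: D"
    have "eventually (%s. s ~: D) (nhds p)" using eventually_nhds_in_open[of "- D" p] cl p by (auto simp: open_Compl)
    then have "eventually (%s. f (u, v(n+1 := s), tau) = C s tau) (nhds p)" by eventually_elim (use fs in auto)
    then show "(%s. f (u, v(n+1 := s), tau)) analytic_on {p}"
     by (rule analytic_at_transform) (rule P(1)[OF tau], use p D_def in simp)
   next
    fix p assume p: "p \<in> D"
    define N where "N = (of_nat (n + 1) :: complex)"
    have N0: "N ~= 0" unfolding N_def by (rule of_nat_neq_0[of n, unfolded Suc_eq_plus1])
    have "filterlim (%s. N * s) (at (N * p)) (at p)"
     using N0 by (intro filterlim_atI tendsto_intros) (auto simp: eventually_at_filter)
    then have "eventually (%s. s ~: D) (at p)"
     using eventually_notin_period_lattice[OF tau, of "N * p"] unfolding filterlim_iff D_def N_def by auto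
    then have "eventually (%s. f (u, v(n+1 := s), tau) = C s tau) (at p)" by eventually_elim (use fs in auto)
    then show "pole_le (%s. f (u, v(n+1 := s), tau)) p l"
     by (rule pole_le_cong[rotated]) (rule P(2)[OF tau], use p D_def in simp)
   qed
   then show "poles_bounded (%s. f (u, v(n+1 := s), tau)) {s. of_nat (n+1) * s \<in> Lat tau} (l + 2 * 0)"
    by (simp add: D_def)
  qed
  show "\<forall>(u, v, tau)\<in>Omega_reg n. \<forall>i<n. (%s. f (u, v(i := s, n := v n + v i - s), tau)) holomorphic_on UNIV"
  proof clarify
   fix u v tau i assume x: "(u, v, tau) \<in> Omega_reg n" and i: "i < n"
   have "v(i := s, n := v n + v i - s) \<in> V n" for s
   proof -
    have "(\<Sum>j=0..n. (v(i := s, n := v n + v i - s)) j) = (\<Sum>j=0..n. v j + (if j = i then s - v i else 0) + (if j = n then v i - s else 0))"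
     using i by (intro sum.cong) auto
    also have "\<dots> = (\<Sum>j=0..n. v j)" using i by (simp add: sum.distrib)
    finally show ?thesis using regD(1)[OF x] i by (auto simp: V_def)
   qed
   then have "f (u, v(i := s, n := v n + v i - s), tau) = C (v (n+1)) tau" for s
    using f[OF reg[OF _ regD(2)[OF x]], of "v(i := s, n := v n + v i - s)" u] regD(3)[OF x] i by simp
   then show "(%s. f (u, v(i := s, n := v n + v i - s), tau)) holomorphic_on UNIV" by simp
  qed
  show "\<forall>u. \<forall>v\<in>V n. (%tau. f (u, v, tau)) holomorphic_on
    {tau \<in> uhp. of_nat (n+1) * v (n+1) ~: Lat tau}"
  proof (intro allI ballI)
   fix u v assume v: "v \<in> V n"
   let ?S = "{tau \<in> uhp. of_nat (n+1) * v (n+1) ~: Lat tau}"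
   have "C (v (n+1)) analytic_on ?S" by (subst analytic_on_analytic_at) (use H in auto)
   then have "C (v (n+1)) holomorphic_on ?S" by (rule analytic_imp_holomorphic)
   then show "(%tau. f (u, v, tau)) holomorphic_on ?S"
    by (rule holomorphic_transform) (use f[OF reg[OF v]] in auto)
  qed
 qed
 then show ?thesis by (simp add: f_def)
qed

lemma Jacobi_one: "Jacobi_one n \<in> Jacobi n 0 0 0"
proof -
 have "Jacobi_one n = index0_form n (%_ _. 1)"
  by (auto simp: Jacobi_one_def index0_form_def fun_eq_iff)
 then show ?thesis
  by (simp only:) (rule index0_form_Jacobi, auto intro: pole_le_analytic)
qed

lemma Jacobi_zero: "(%_. 0) \<in> Jacobi n k l 0"
proof -
 have "(%_. 0) = index0_form n (%_ _. 0)" by (auto simp: index0_form_def fun_eq_iff)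
 then show ?thesis
  by (simp only:) (rule index0_form_Jacobi, auto intro: pole_le_sum[of "{}", simplified])
qed

section \<open>Algebraic independence of the fundamental forms\<close>

text \<open>Times \<open>den\<close>, every basis function is entire with the multipliers of
  \<open>num\<close>. So a linear combination of basis functions comes from a theta function of
  degree n + 1, just as the left-hand side of the defining identity does.\<close>

lemma bas_numerator:
 assumes tau: "tau \<in> uhp" and w: "w ~: Lat tau" and n: "n \<ge> 1" and k: "k \<le> n"
 shows "\<exists>e. qper tau (int (n + 1)) ((-1) ^ (n + 1)) (theta_mult tau ^ (n + 1) * exp (- 2 * of_real pi * \<i> * w)) e \<and>
  (\<forall>z. z ~: Lat tau --> z + w ~: Lat tau --> e z = den n z w (nome tau) * bas k z w (nome tau))"
proof -
 define q where "q = nome tau"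
 have q: "norm q < 1" using tau by (simp add: q_def)
 define X where "X = exp (- 2 * of_real pi * \<i> * w)"
 have qT: "qper tau 1 (-1) (theta_mult tau) (%z. th 0 z q)" using qper_theta[OF tau, of 0] by (simp add: q_def)
 have qTw: "qper tau 1 (-1) (theta_mult tau * X) (%z. th 0 (z + w) q)"
  using qper_theta[OF tau, of "- w"] by (simp add: q_def X_def)
 have qTp: "qper tau (int m) ((-1) ^ m) (theta_mult tau ^ m) (%z. th 0 z q ^ m)" for m
  using qper_power[OF qT, of m] by simp
 consider "k = 0" | "k = 1" | "k \<ge> 2" by linarith
 then show ?thesis
 proof cases
  case 1
  have "qper tau (int n + 1) ((-1) ^ n * -1) (theta_mult tau ^ n * (theta_mult tau * X)) (%z. th 0 z q ^ n * th 0 (z + w) q)"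
   by (intro qper_mult qTp qTw)
  then have "qper tau (int (n + 1)) ((-1) ^ (n + 1)) (theta_mult tau ^ (n + 1) * X) (%z. th 0 z q ^ n * th 0 (z + w) q)"
   by (simp add: mult_ac add.commute)
  then show ?thesis
   by (intro exI[of _ "%z. th 0 z q ^ n * th 0 (z + w) q"]) (simp add: X_def 1 den_def bas_simps q_def)
 next
  case 2
  obtain e where e: "qper tau 2 1 (theta_mult tau ^ 2 * X) e"
   "!!z. z ~: Lat tau ==> z + w ~: Lat tau ==> e z = den 1 z w (nome tau) * bas 1 z w (nome tau)"
   using bas_1_numerator[OF tau w] unfolding X_def by metis
  have "qper tau (int (n - 1) + 2) ((-1) ^ (n - 1) * 1) (theta_mult tau ^ (n - 1) * (theta_mult tau ^ 2 * X)) (%z. th 0 z q ^ (n - 1) * e z)"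
   by (intro qper_mult qTp e)
  moreover have "int (n - 1) + 2 = int (n + 1)" "(-1) ^ (n - 1) * 1 = (-1 :: complex) ^ (n + 1)"
   "theta_mult tau ^ (n - 1) * (theta_mult tau ^ 2 * X) = theta_mult tau ^ (n + 1) * X"
   using n by (cases n; simp add: power2_eq_square)+
  ultimately have "qper tau (int (n + 1)) ((-1) ^ (n + 1)) (theta_mult tau ^ (n + 1) * X) (%z. th 0 z q ^ (n - 1) * e z)" by metis
  moreover have "th 0 z q ^ (n - 1) * e z = den n z w (nome tau) * bas k z w (nome tau)"
   if "z ~: Lat tau" "z + w ~: Lat tau" for z
   using e(2)[OF that] n by (cases n) (simp_all add: 2 den_def q_def)
  ultimately show ?thesis unfolding X_def by blast
 next
  case 3
  define e where "e = (%z. th 0 z q ^ (n - k) * (wnum (k - 2) z q * th 0 (z + w) q))"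
  have k2: "k - 2 + 2 = k" using 3 by simp
  have "qper tau (int (n - k) + (int (k - 2 + 2) + 1)) ((-1) ^ (n - k) * ((-1) ^ (k - 2 + 2) * -1))
    (theta_mult tau ^ (n - k) * (theta_mult tau ^ (k - 2 + 2) * (theta_mult tau * X))) e"
   unfolding e_def q_def by (intro qper_mult qTp[unfolded q_def] qper_wnum tau qTw[unfolded q_def])
  moreover have "int (n - k) + (int (k - 2 + 2) + 1) = int (n + 1)" unfolding k2 using k by simp
  moreover have "(-1) ^ (n - k) * ((-1) ^ (k - 2 + 2) * -1) = (-1 :: complex) ^ (n + 1)"
  proof -
   have "(-1 :: complex) ^ (n + 1) = (-1) ^ (n - k) * ((-1) ^ k * -1)"
    using k by (simp add: power_add[symmetric])
   then show ?thesis unfolding k2 by simp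
  qed
  moreover have "theta_mult tau ^ (n - k) * (theta_mult tau ^ (k - 2 + 2) * (theta_mult tau * X)) = theta_mult tau ^ (n + 1) * X"
  proof -
   have "theta_mult tau ^ n = theta_mult tau ^ (n - k) * theta_mult tau ^ k" using k by (simp add: power_add[symmetric])
   then show ?thesis unfolding k2 by simp
  qed
  ultimately have "qper tau (int (n + 1)) ((-1) ^ (n + 1)) (theta_mult tau ^ (n + 1) * X) e" by metis
  moreover have "e z = den n z w (nome tau) * bas k z w (nome tau)" if "z ~: Lat tau" for z
  proof -
   have t: "th 0 z q ~= 0" using that th_eq_0_iff[OF tau] by (simp add: q_def)
   have "th 0 z q ^ n = th 0 z q ^ (n - k) * th 0 z q ^ k" using k by (simp add: power_add[symmetric])
   moreover have "wnum (k - 2) z q = th 0 z q ^ k * wpq (k - 2) z q"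
    using wnum(2)[OF q t, of "k - 2"] t unfolding k2 by (simp add: field_simps)
   ultimately show ?thesis by (simp add: e_def den_def bas_simps(3)[OF 3] q_def)
  qed
  ultimately show ?thesis unfolding X_def by blast
 qed
qed

lemma qper_unique_multipliers:
 assumes "qper tau N \<epsilon> C h" "qper tau N \<epsilon>' C' h" "h z ~= 0"
 shows "\<epsilon> = \<epsilon>'" "C = C'"
proof -
 have "\<epsilon> * h z = \<epsilon>' * h z" using assms unfolding qper_def by metis
 then show "\<epsilon> = \<epsilon>'" using assms(3) by simp
 have "C * exp (- 2 * of_real pi * \<i> * of_int N * z) * h z = C' * exp (- 2 * of_real pi * \<i> * of_int N * z) * h z"
  using assms unfolding qper_def by metis
 then show "C = C'" using assms(3) by simp
qed

text \<open>The combination with coefficients y, times \<open>den\<close>, is a non-zero theta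
  function of degree n + 1, hence K exp (b z) times n + 1 theta factors. Comparing multipliers gives
  b = 2 pi i r with r an integer, and a sum of zeros congruent to - w. Moving one zero by a lattice
  vector absorbs exp (b z) and makes the sum equal to - w. The zeros, shifted by s, are the
  coordinates v 0, ..., v n, and u takes up the constant.\<close>

lemma fundamental_surj:
 assumes n: "n \<ge> 1" and tau: "tau \<in> uhp" and s: "of_nat (n + 1) * s ~: Lat tau"
  and k0: "k0 \<le> n" "y k0 ~= 0"
 obtains u v where "v \<in> V n" "v (n + 1) = s" "!!k. k \<le> n ==> fundamental n k (u, v, tau) = y k"
proof -
 define q where "q = nome tau"
 define w where "w = of_nat (n + 1) * s"
 have w: "w ~: Lat tau" using s by (simp add: w_def)
 define \<epsilon> where "\<epsilon> = (-1 :: complex) ^ (n + 1)"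
 define C where "C = theta_mult tau ^ (n + 1) * exp (- 2 * of_real pi * \<i> * w)"
 have "\<forall>k\<in>{..n}. \<exists>e. qper tau (int (n + 1)) \<epsilon> C e \<and>
   (\<forall>z. z ~: Lat tau --> z + w ~: Lat tau --> e z = den n z w q * bas k z w q)"
  using bas_numerator[OF tau w n] unfolding \<epsilon>_def C_def q_def by simp
 then obtain e where e: "!!k. k \<le> n ==> qper tau (int (n + 1)) \<epsilon> C (e k)"
  "!!k z. k \<le> n ==> z ~: Lat tau ==> z + w ~: Lat tau ==> e k z = den n z w q * bas k z w q"
  unfolding bchoice_iff by auto
 define h where "h = (%z. \<Sum>k\<le>n. y k * e k z)"
 have q0: "qper tau (int (n + 1)) \<epsilon> C (%_. 0)" using qper_cmult[OF e(1)[of 0], of 0] by simp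
 have qh: "qper tau (int (n + 1)) \<epsilon> C h" unfolding h_def
  by (intro qper_sum q0 qper_cmult e) auto
 have hb: "h z = den n z w q * (\<Sum>k\<le>n. y k * bas k z w q)" if "z ~: Lat tau" "z + w ~: Lat tau" for z
  using e(2)[OF _ that] by (simp add: h_def sum_distrib_left mult.left_commute)
 have "\<exists>z. h z ~= 0"
 proof (rule ccontr)
  assume H: "\<not> (\<exists>z. h z ~= 0)"
  have "y k0 = 0"
  proof (rule bas_independent[OF tau w n _ k0(1), of y])
   fix z assume z: "z ~: Lat tau" "z + w ~: Lat tau"
   have "den n z w q * (\<Sum>k\<le>n. y k * bas k z w q) = 0" using hb[OF z] H by metis
   then show "(\<Sum>k\<le>n. y k * bas k z w (nome tau)) = 0" using den_nonzero[OF tau z, of n] by (simp add: q_def)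
  qed
  then show False using k0(2) by simp
 qed
 then obtain z0 where z0: "h z0 ~= 0" by blast
 obtain b K a where K: "K ~= 0" and fac: "!!z. h z = K * exp (b * z) * (\<Prod>i<nat (int (n + 1)). th 0 (z - a i) (nome tau))"
  using qper_factor[OF tau qh z0] by metis
 have fac: "h z = K * exp (b * z) * (\<Prod>i<Suc n. th 0 (z - a i) q)" for z using fac[of z] by (simp only: nat_int q_def Suc_eq_plus1)
 have "qper tau (0 + (\<Sum>i<Suc n. 1)) (exp b * (\<Prod>i<Suc n. -1)) (exp (b * tau) * (\<Prod>i<Suc n. theta_mult tau * exp (2 * of_real pi * \<i> * a i)))
   (%z. exp (b * z) * (\<Prod>i<Suc n. th 0 (z - a i) q))"
  unfolding q_def by (intro qper_mult qper_exp qper_prod qper_theta tau) auto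
 then have "qper tau (0 + (\<Sum>i<Suc n. 1)) (exp b * (\<Prod>i<Suc n. -1)) (exp (b * tau) * (\<Prod>i<Suc n. theta_mult tau * exp (2 * of_real pi * \<i> * a i)))
   (%z. K * (exp (b * z) * (\<Prod>i<Suc n. th 0 (z - a i) q)))" by (rule qper_cmult)
 moreover have "(%z. K * (exp (b * z) * (\<Prod>i<Suc n. th 0 (z - a i) q))) = h" by (rule ext) (simp only: fac mult.assoc)
 moreover have "(\<Prod>i<Suc n. theta_mult tau * exp (2 * of_real pi * \<i> * a i)) = theta_mult tau ^ (n + 1) * exp (2 * of_real pi * \<i> * (\<Sum>i<Suc n. a i))"
  by (simp only: prod.distrib exp_sum finite_lessThan sum_distrib_left) simp
 moreover have "(0 + (\<Sum>i<Suc n. 1)) = int (n + 1)" by simp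
 moreover have "(\<Prod>i<Suc n. -1) = \<epsilon>" by (simp add: \<epsilon>_def)
 ultimately have "qper tau (int (n + 1)) (exp b * \<epsilon>) (exp (b * tau) * (theta_mult tau ^ (n + 1) * exp (2 * of_real pi * \<i> * (\<Sum>i<Suc n. a i)))) h"
  by metis
 from qper_unique_multipliers[OF this qh z0] have mult: "exp b * \<epsilon> = \<epsilon>"
  "exp (b * tau) * (theta_mult tau ^ (n + 1) * exp (2 * of_real pi * \<i> * (\<Sum>i<Suc n. a i))) = C" .
 have "exp b = 1" using mult(1) by (simp add: \<epsilon>_def)
 moreover have "b = 2 * of_real pi * \<i> * (b / (2 * of_real pi * \<i>))" by simp
 ultimately obtain r where r: "b / (2 * of_real pi * \<i>) = of_int r"
  using exp_2pi_eq_1_iff[of "b / (2 * of_real pi * \<i>)"] by (auto elim: Ints_cases)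
 then have b: "b = 2 * of_real pi * \<i> * of_int r" by (simp add: field_simps)
 define S where "S = (\<Sum>i<Suc n. a i)"
 have "theta_mult tau ^ (n + 1) * (exp (b * tau) * exp (2 * of_real pi * \<i> * S)) = theta_mult tau ^ (n + 1) * exp (- 2 * of_real pi * \<i> * w)"
  using mult(2) by (simp only: C_def S_def mult_ac)
 then have "exp (b * tau) * exp (2 * of_real pi * \<i> * S) = exp (- 2 * of_real pi * \<i> * w)" by simp
 then have "exp (2 * of_real pi * \<i> * (of_int r * tau + S + w)) = 1"
  by (simp add: b distrib_left distrib_right exp_add exp_minus mult_ac field_simps)
 then obtain p where p: "of_int r * tau + S + w = of_int p" unfolding exp_2pi_eq_1_iff by (auto elim: Ints_cases)
 \<comment> \<open>The relation for S shows which lattice vector is needed: r tau - p. The constant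
   \<kappa> is what this shift leaves beside exp (b z).\<close>
 define a' where "a' = a(0 := a 0 + of_int r * tau - of_int p)"
 define \<kappa> where "\<kappa> = exp (- of_real pi * \<i> * (of_int p - of_int r - (of_int r)\<^sup>2 * tau - 2 * of_int r * a 0))"
 have t0: "exp (b * z) * th 0 (z - a 0) q = \<kappa> * th 0 (z - a' 0) q" for z
 proof -
  have eq: "z - a' 0 = (z - a 0) + of_int p + of_int (- r) * tau" by (simp add: a'_def)
  have "th 0 (z - a' 0) q = exp (of_real pi * \<i> * (of_int p + of_int (- r) - (of_int (- r))\<^sup>2 * tau - 2 * of_int (- r) * (z - a 0))) * th 0 (z - a 0) q"
   unfolding eq q_def by (rule th_shift[OF tau]) auto
  then have "\<kappa> * th 0 (z - a' 0) q = exp (- of_real pi * \<i> * (of_int p - of_int r - (of_int r)\<^sup>2 * tau - 2 * of_int r * a 0) +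
    of_real pi * \<i> * (of_int p + of_int (- r) - (of_int (- r))\<^sup>2 * tau - 2 * of_int (- r) * (z - a 0))) * th 0 (z - a 0) q"
   by (simp only: \<kappa>_def exp_add mult.assoc)
  also have "- of_real pi * \<i> * (of_int p - of_int r - (of_int r)\<^sup>2 * tau - 2 * of_int r * a 0) +
    of_real pi * \<i> * (of_int p + of_int (- r) - (of_int (- r))\<^sup>2 * tau - 2 * of_int (- r) * (z - a 0)) = b * z"
   by (simp add: b algebra_simps)
  finally show ?thesis ..
 qed
 have hz: "h z = K * \<kappa> * (\<Prod>i<Suc n. th 0 (z - a' i) q)" for z
 proof -
  have "h z = K * (exp (b * z) * th 0 (z - a 0) q) * (\<Prod>i<n. th 0 (z - a (Suc i)) q)"
   unfolding fac prod.lessThan_Suc_shift by (simp only: mult_ac)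
  also have "\<dots> = K * \<kappa> * (\<Prod>i<Suc n. th 0 (z - a' i) q)"
   unfolding t0 prod.lessThan_Suc_shift by (simp add: a'_def mult_ac)
  finally show ?thesis .
 qed
 define v where "v = (%i. if i \<le> n then a' i + s else if i = n + 1 then s else 0)"
 define u where "u = - Ln (K * \<kappa>) / (2 * of_real pi * \<i>)"
 have K\<kappa>: "K * \<kappa> ~= 0" using K by (simp add: \<kappa>_def)
 have u: "exp (- 2 * of_real pi * \<i> * u) = K * \<kappa>" using K\<kappa> by (simp add: u_def)
 have vV: "v \<in> V n"
 proof -
  have "(\<Sum>i=0..n. v i) = (\<Sum>i<Suc n. a' i + s)" by (intro sum.cong) (auto simp: v_def)
  also have "\<dots> = (\<Sum>i<Suc n. a' i) + w" by (simp add: sum.distrib w_def algebra_simps)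
  also have "(\<Sum>i<Suc n. a' i) = S + (of_int r * tau - of_int p)"
   unfolding S_def sum.lessThan_Suc_shift by (simp add: a'_def)
  also have "S + (of_int r * tau - of_int p) + w = 0" by (simp add: p[symmetric])
  finally show ?thesis by (simp add: V_def v_def)
 qed
 have num: "num n v z q = (\<Prod>i<Suc n. th 0 (z - a' i) q)" for z
  unfolding num_def by (intro prod.cong) (auto simp: v_def)
 have x: "(u, v, tau) \<in> Omega_reg n" using vV tau s by (simp add: Omega_reg_def Omega_def v_def)
 have wv: "w = of_nat (n + 1) * v (n + 1)" by (simp add: w_def v_def)
 have "generating_identity n u v tau y"
  unfolding generating_identity_iff[OF n x wv] u
 proof (intro allI impI)
  fix z assume z: "z ~: Lat tau" "z + w ~: Lat tau"
  show "K * \<kappa> * (num n v z (nome tau) / den n z w (nome tau)) = (\<Sum>k\<le>n. y k * bas k z w (nome tau))"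
   using hb[OF z] hz[of z] num[of z] den_nonzero[OF tau z, of n] unfolding q_def by simp
 qed
 then have "fundamental n k (u, v, tau) = y k" if "k \<le> n" for k
  using fundamental_eqI[OF n x _ that] by blast
 then show ?thesis using that[of v u] vV by (simp add: v_def)
qed

section \<open>Linear independence of powers and monomials\<close>

lemma digits_unique:
 fixes a b :: "nat => nat"
 assumes "!!i. i < n ==> a i < B" "!!i. i < n ==> b i < B" "(\<Sum>i<n. a i * B ^ i) = (\<Sum>i<n. b i * B ^ i)" "i < n"
 shows "a i = b i"
 using assms
proof (induction n arbitrary: a b i)
 case (Suc n)
 have shift: "(\<Sum>i<Suc n. c i * B ^ i) = c 0 + B * (\<Sum>i<n. c (Suc i) * B ^ i)" for c
  unfolding sum.lessThan_Suc_shift by (simp add: sum_distrib_left mult_ac)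
 have B: "B > 0" "a 0 < B" "b 0 < B" using Suc.prems(1)[of 0] Suc.prems(2)[of 0] by auto
 have eq: "a 0 + B * (\<Sum>i<n. a (Suc i) * B ^ i) = b 0 + B * (\<Sum>i<n. b (Suc i) * B ^ i)"
  using Suc.prems(3) unfolding shift .
 have "a 0 = b 0" using arg_cong[OF eq, of "%x. x mod B"] B by simp
 moreover from this have "(\<Sum>i<n. a (Suc i) * B ^ i) = (\<Sum>i<n. b (Suc i) * B ^ i)" using eq B by simp
 then have "a (Suc i) = b (Suc i)" if "i < n" for i
  using Suc.IH[of "%i. a (Suc i)" "%i. b (Suc i)" i] Suc.prems(1,2) that by auto
 ultimately show ?case using Suc.prems(4) by (cases i) auto
qed simp

lemma powers_independent:
 fixes c :: "'a => complex"
 assumes "finite A" "inj_on e A" "infinite X" "!!x. x \<in> X ==> (\<Sum>\<alpha>\<in>A. c \<alpha> * x ^ e \<alpha>) = 0" "\<alpha> \<in> A"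
 shows "c \<alpha> = 0"
proof -
 define p where "p = (\<Sum>\<alpha>\<in>A. monom (c \<alpha>) (e \<alpha>))"
 have "X \<subseteq> {x. poly p x = 0}" using assms(4) by (auto simp: p_def poly_sum poly_monom)
 then have "p = 0" using assms(3) poly_roots_finite[of p] finite_subset by blast
 moreover have "coeff p (e \<alpha>) = (\<Sum>\<beta>\<in>A. if \<beta> = \<alpha> then c \<beta> else 0)"
  unfolding p_def coeff_sum by (intro sum.cong) (use assms(2,5) in \<open>auto simp: inj_on_eq_iff\<close>)
 ultimately show ?thesis using assms(1,5) by simp
qed

lemma int_powers_independent:
 fixes c :: "int => complex"
 assumes "finite K" "infinite X" "0 ~: X" "!!x. x \<in> X ==> (\<Sum>k\<in>K. c k * x powi k) = 0" "k \<in> K"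
 shows "c k = 0"
proof -
 define M where "M = Max (abs ` K)"
 have M: "\<bar>k\<bar> \<le> M" if "k \<in> K" for k unfolding M_def using assms(1) that by (intro Max_ge) auto
 have "inj_on (%k. nat (k + M)) K"
 proof (rule inj_onI)
  fix a b assume "a \<in> K" "b \<in> K" "nat (a + M) = nat (b + M)"
  then show "a = b" using M[of a] M[of b] by linarith
 qed
 moreover have "(\<Sum>k\<in>K. c k * x ^ nat (k + M)) = 0" if x: "x \<in> X" for x
 proof -
  have x0: "x ~= 0" using x assms(3) by auto
  have "x ^ nat (k + M) = x powi M * x powi k" if "k \<in> K" for k
  proof -
   have "x ^ nat (k + M) = x powi (k + M)" using M[OF that] by (simp add: power_int_def)
   then show ?thesis using x0 by (simp add: power_int_add mult.commute)
  qed
  then have "(\<Sum>k\<in>K. c k * x ^ nat (k + M)) = (\<Sum>k\<in>K. x powi M * (c k * x powi k))"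
   by (intro sum.cong) (auto simp: mult_ac)
  also have "\<dots> = 0" unfolding sum_distrib_left[symmetric] using assms(4)[OF x] by simp
  finally show ?thesis .
 qed
 ultimately show ?thesis by (rule powers_independent[OF assms(1) _ assms(2) _ assms(5)])
qed

text \<open>Kronecker's substitution \<open>y\<^sub>i = x ^ (B ^ i)\<close> reduces polynomials in several variables to one.\<close>

lemma monomials_independent:
 fixes c :: "(nat \<Rightarrow>\<^sub>0 nat) => complex"
 assumes A: "finite A" "!!\<alpha>. \<alpha> \<in> A ==> keys \<alpha> \<subseteq> {0..n}"
  and H: "!!y. (\<exists>k\<le>n. y k ~= 0) ==> (\<Sum>\<alpha>\<in>A. c \<alpha> * (\<Prod>i=0..n. y i ^ lookup \<alpha> i)) = 0"
  and \<alpha>: "\<alpha> \<in> A"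
 shows "c \<alpha> = 0"
proof -
 define B where "B = Suc (Max ((%(\<alpha>, i). lookup \<alpha> i) ` (A \<times> {..n})))"
 have B: "lookup \<beta> i < B" if "\<beta> \<in> A" "i < Suc n" for \<beta> i
 proof -
  have "lookup \<beta> i \<le> Max ((%(\<alpha>, i). lookup \<alpha> i) ` (A \<times> {..n}))"
   using A(1) that by (intro Max_ge) force+
  then show ?thesis by (simp add: B_def)
 qed
 define e where "e = (%\<beta>. \<Sum>i<Suc n. lookup \<beta> i * B ^ i)"
 have "inj_on e A"
 proof (rule inj_onI)
  fix \<beta> \<gamma> assume *: "\<beta> \<in> A" "\<gamma> \<in> A" "e \<beta> = e \<gamma>"
  show "\<beta> = \<gamma>"
  proof (rule poly_mapping_eqI)
   fix i
   show "lookup \<beta> i = lookup \<gamma> i"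
   proof (cases "i < Suc n")
    case True
    show ?thesis
     by (rule digits_unique[of "Suc n" "lookup \<beta>" B "lookup \<gamma>", OF B[OF *(1)] B[OF *(2)] _ True])
       (use *(3) in \<open>simp_all add: e_def\<close>)
   next
    case False
    then have "i ~: keys \<beta>" "i ~: keys \<gamma>" using A(2)[OF *(1)] A(2)[OF *(2)] by auto
    then show ?thesis by (simp add: in_keys_iff)
   qed
  qed
 qed
 moreover have "infinite (UNIV - {0 :: complex})" by (simp add: infinite_UNIV_char_0)
 moreover have "(\<Sum>\<alpha>\<in>A. c \<alpha> * x ^ e \<alpha>) = 0" if "x \<in> UNIV - {0}" for x
 proof -
  have "(\<Sum>\<alpha>\<in>A. c \<alpha> * (\<Prod>i=0..n. (x ^ (B ^ i)) ^ lookup \<alpha> i)) = 0"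
   by (rule H) (use that in auto)
  moreover have "(\<Prod>i=0..n. (x ^ (B ^ i)) ^ lookup \<beta> i) = x ^ e \<beta>" for \<beta>
  proof -
   have "(\<Prod>i=0..n. (x ^ (B ^ i)) ^ lookup \<beta> i) = (\<Prod>i<Suc n. x ^ (lookup \<beta> i * B ^ i))"
    by (intro prod.cong) (auto simp: power_mult[symmetric] mult.commute)
   then show ?thesis by (simp only: power_sum e_def)
  qed
  ultimately show ?thesis by simp
 qed
 ultimately show ?thesis using powers_independent[OF A(1) _ _ _ \<alpha>] by blast
qed

lemma fundamental_independent:
 assumes n: "n \<ge> 1" and tau: "tau \<in> uhp" and s: "of_nat (n + 1) * s ~: Lat tau"
  and A: "finite A" "!!\<alpha>. \<alpha> \<in> A ==> keys \<alpha> \<subseteq> {0..n}"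
  and H: "!!u v. v \<in> V n ==> v (n + 1) = s ==>
   (\<Sum>\<alpha>\<in>A. c \<alpha> * (\<Prod>i=0..n. fundamental n i (u, v, tau) ^ lookup \<alpha> i)) = 0"
  and \<alpha>: "\<alpha> \<in> A"
 shows "c \<alpha> = 0"
proof (rule monomials_independent[OF A _ \<alpha>])
 fix y :: "nat => complex" assume "\<exists>k\<le>n. y k ~= 0"
 then obtain k where k: "k \<le> n" "y k ~= 0" by blast
 obtain u v where uv: "v \<in> V n" "v (n + 1) = s" "!!k. k \<le> n ==> fundamental n k (u, v, tau) = y k"
  using fundamental_surj[where y = y, OF n tau s k] by metis
 have "(\<Prod>i=0..n. fundamental n i (u, v, tau) ^ lookup \<alpha> i) = (\<Prod>i=0..n. y i ^ lookup \<alpha> i)" for \<alpha>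
  using uv(3) by (intro prod.cong) auto
 then show "(\<Sum>\<alpha>\<in>A. c \<alpha> * (\<Prod>i=0..n. y i ^ lookup \<alpha> i)) = 0" using H[OF uv(1,2), of u] by simp
qed

text \<open>Indices are separated by translations of u, which multiply a summand of index m by y^m,
  where y may be any non-zero number. Weights are then separated by the matrices with rows (1, 0)
  and (c, 1), whose automorphy factor c tau + 1 takes infinitely many values at the given
  tau.\<close>

lemma Jacobi_direct_sum:
 fixes g :: "int \<times> int => point => complex"
 assumes K: "finite K" and g: "!!k m. (k, m) \<in> K ==> \<exists>l. g (k, m) \<in> Jacobi n k l m"
  and sum0: "!!x. (\<Sum>d\<in>K. g d x) = 0" and km: "(k, m) \<in> K"
 shows "g (k, m) x = 0"
proof (cases "x \<in> Omega n")
 case False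
 then have "x ~: Omega_reg n" by (auto simp: Omega_reg_def)
 then show ?thesis using g[OF km] Jacobi_outside by blast
next
 case True
 define Km where "Km = (%m. {k. (k, m) \<in> K})"
 have finKm: "finite (Km m)" for m
  by (rule finite_subset[of _ "fst ` K"]) (use K in \<open>force simp: Km_def image_iff\<close>)+
 have Gm: "(\<Sum>k\<in>Km m. g (k, m) x) = 0" if m: "m \<in> snd ` K" and x: "x \<in> Omega n" for m x
 proof -
  obtain u v tau where xx: "x = (u, v, tau)" by (cases x)
  show ?thesis
  proof (rule int_powers_independent[where K = "snd ` K" and X = "UNIV - {0}" and k = m])
   show "infinite (UNIV - {0 :: complex})" by (simp add: infinite_UNIV_char_0)
   fix y :: complex assume y: "y \<in> UNIV - {0}"
   define t where "t = - Ln y / (2 * of_real pi * \<i>)"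
   have ty: "exp (- 2 * of_real pi * \<i> * t) = y" using y by (simp add: t_def)
   have sh: "g (k, m) (u + t, v, tau) = y powi m * g (k, m) (u, v, tau)" if "(k, m) \<in> K" for k m
   proof -
    obtain l where l: "g (k, m) \<in> Jacobi n k l m" using g \<open>(k, m) \<in> K\<close> by blast
    have O: "(0, v, tau) \<in> Omega n" using x xx by (simp add: Omega_def)
    have "exp (- 2 * of_real pi * \<i> * of_int m * (u + t)) = y powi m * exp (- 2 * of_real pi * \<i> * of_int m * u)"
     unfolding ty[symmetric] exp_power_int exp_add[symmetric] by (simp add: algebra_simps)
    then show ?thesis using Jacobi_u[OF l O, of "u + t"] Jacobi_u[OF l O, of u] by simp
   qed
   have "(\<Sum>m\<in>snd ` K. (\<Sum>k\<in>Km m. g (k, m) x) * y powi m) = (\<Sum>m\<in>snd ` K. \<Sum>k\<in>Km m. g (k, m) (u + t, v, tau))"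
    by (intro sum.cong refl) (simp add: sum_distrib_left sh Km_def xx mult.commute)
   also have "\<dots> = (\<Sum>(m, k)\<in>Sigma (snd ` K) Km. g (k, m) (u + t, v, tau))"
    using K finKm by (subst sum.Sigma) auto
   also have "\<dots> = (\<Sum>d\<in>K. g d (u + t, v, tau))"
    by (rule sum.reindex_bij_witness[of _ "%(k, m). (m, k)" "%(m, k). (k, m)"]) (force simp: Km_def)+
   also have "\<dots> = 0" by (rule sum0)
   finally show "(\<Sum>m\<in>snd ` K. (\<Sum>k\<in>Km m. g (k, m) x) * y powi m) = 0" .
  qed (use K m in auto)
 qed
 obtain u v tau where x: "x = (u, v, tau)" by (cases x)
 have tau: "tau \<in> uhp" using True x by (auto simp: Omega_def)
 then have tau0: "tau ~= 0" by (auto simp: upper_half_plane_iff)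
 define X where "X = range (%c :: int. of_int c * tau + 1)"
 have "inj (%c :: int. of_int c * tau + 1)" using tau0 by (intro injI) auto
 then have infX: "infinite X" unfolding X_def by (simp add: finite_image_iff infinite_UNIV_int)
 show ?thesis
 proof (rule int_powers_independent[where K = "Km m" and X = X and k = k and c = "%k. g (k, m) x", OF finKm infX])
  show "0 ~: X"
  proof
   assume "0 \<in> X"
   then obtain c where "of_int c * tau + 1 = 0" by (auto simp: X_def)
   then have "Im (of_int c * tau + 1) = 0" "Re (of_int c * tau + 1) = 0" by simp_all
   then show False using tau by (auto simp: upper_half_plane_iff)
  qed
  show "k \<in> Km m" using km by (simp add: Km_def)
  fix y assume "y \<in> X"
  then obtain c where y: "y = of_int c * tau + 1" by (auto simp: X_def)
  interpret modular_substitution 1 0 c 1 tau by unfold_locales (use tau in auto)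
  have O: "(u, v, tau) \<in> Omega n" using True x by simp
  have "g (k, m) (act_SL2 n 1 0 c 1 (u, v, tau)) = y powi k * g (k, m) x" if "k \<in> Km m" for k
  proof -
   obtain l where l: "g (k, m) \<in> Jacobi n k l m" using g[of k m] \<open>k \<in> Km m\<close> unfolding Km_def by blast
   show ?thesis using Jacobi_SL2[OF l _ O, of 1 1 0 c] by (simp add: x y del: act_SL2.simps)
  qed
  then have "(\<Sum>k\<in>Km m. g (k, m) x * y powi k) = (\<Sum>k\<in>Km m. g (k, m) (act_SL2 n 1 0 c 1 (u, v, tau)))"
   by (intro sum.cong) (auto simp: mult.commute)
  also have "\<dots> = 0" by (rule Gm[OF _ reg_SL2(1)[OF O]]) (use km in force)
  finally show "(\<Sum>k\<in>Km m. g (k, m) x * y powi k) = 0" .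
 qed
qed

section \<open>Interpolation\<close>

definition V_slice :: "nat => complex => (nat => complex) set" where
 "V_slice n s = {v \<in> V n. v (n + 1) = s}"

text \<open>What is kept of a Jacobi form of index m at fixed s and tau. The degree along the lines
  is 2 m because the vector e_i - e_n has norm 2. Levels add under multiplication, so the terms of
  the interpolation formula belong to the same class.\<close>

definition theta_level :: "nat => int => complex => complex => ((nat => complex) => complex) => bool" where
 "theta_level n m s tau g \<longleftrightarrow>
   (\<forall>v\<in>V_slice n s. \<forall>p. p permutes {0..n} --> g (v \<circ> p) = g v) \<and>
   (\<forall>v\<in>V_slice n s. \<forall>i<n. qper tau (2 * m) 1 (exp (2 * of_real pi * \<i> * of_int m * (v n + v i - tau)))
    (%t. g (v(i := t, n := v n + v i - t))))"

lemma theta_level_mult: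
 "theta_level n m s tau f ==> theta_level n m' s tau g ==> theta_level n (m + m') s tau (%v. f v * g v)"
 unfolding theta_level_def
 by (auto dest!: bspec intro!: qper_mult[of _ "2 * m" 1 _ _ "2 * m'" 1, simplified, THEN back_subst[of "%C. qper tau _ 1 C _"]]
  simp: distrib_left distrib_right exp_add)

lemma theta_level_const: "theta_level n 0 s tau (%_. c)"
 using qper_const[of tau c] by (simp add: theta_level_def)

lemma theta_level_diff:
 "theta_level n m s tau f ==> theta_level n m s tau g ==> theta_level n m s tau (%v. f v - g v)"
 by (auto simp: theta_level_def intro!: qper_diff)

lemma theta_level_sum:
 assumes "finite I" "!!i. i \<in> I ==> theta_level n m s tau (f i)"
 shows "theta_level n m s tau (%v. \<Sum>i\<in>I. f i v)"
proof -
 have "qper tau (2 * m) 1 (exp z) (%_. 0)" for z by (simp add: qper_def)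
 with assms show ?thesis by (auto simp: theta_level_def intro!: qper_sum)
qed

lemma theta_level_prod:
 assumes "finite I" "!!i. i \<in> I ==> theta_level n 1 s tau (f i)"
 shows "theta_level n (int (card I)) s tau (%v. \<Prod>i\<in>I. f i v)"
 using assms
proof (induction rule: finite_induct)
 case (insert x I)
 show ?case using theta_level_mult[OF insert.prems[of x] insert.IH] insert by simp
qed (use theta_level_const in simp)

lemma atLeastAtMost_split_two:
 fixes i n :: nat
 assumes "i < n"
 obtains R where "{0..n} = insert i (insert n R)" "finite R" "i ~: R" "n ~: R" "i ~= n"
 by (rule that[of "{0..n} - {i, n}"]) (use assms in auto)

lemma V_move: "v \<in> V n ==> i < n ==> v(i := t, n := v n + v i - t) \<in> V n"
proof -
 assume v: "v \<in> V n" and i: "i < n"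
 obtain R where R: "{0..n} = insert i (insert n R)" "finite R" "i ~: R" "n ~: R" "i ~= n"
  using atLeastAtMost_split_two[OF i] .
 have "(\<Sum>k\<in>R. (v(i := t, n := v n + v i - t)) k) = (\<Sum>k\<in>R. v k)" using R by (intro sum.cong) auto
 then have "(\<Sum>k=0..n. (v(i := t, n := v n + v i - t)) k) = (\<Sum>k=0..n. v k)" unfolding R(1) using R(2-5) by simp
 then show ?thesis using v i by (auto simp: V_def)
qed

lemma V_slice_move: "v \<in> V_slice n s ==> i < n ==> v(i := t, n := v n + v i - t) \<in> V_slice n s"
 using V_move[of v n i t] by (auto simp: V_slice_def)

lemma subset_image_eq: "A \<subseteq> f ` Q ==> A = f ` {x \<in> Q. f x \<in> A}"
 by blast

lemma eq_mult_inverse: "b * x = y ==> a * b = 1 ==> x = a * (y :: complex)"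
 by (metis mult.assoc mult.left_neutral)

text \<open>Only the translation by \<open>\<tau>(e\<^sub>i - e\<^sub>n)\<close> and that by \<open>e\<^sub>i - e\<^sub>n\<close> are needed.\<close>

lemma Jacobi_theta_level:
 assumes f: "f \<in> Jacobi n k l m" and tau: "tau \<in> uhp" and s: "of_nat (n + 1) * s ~: Lat tau"
 shows "theta_level n m s tau (%v. f (0, v, tau))"
 unfolding theta_level_def
proof (intro conjI ballI allI impI)
 fix v p assume v: "v \<in> V_slice n s" and p: "p permutes {0..n}"
 show "f (0, v \<circ> p, tau) = f (0, v, tau)"
  using Jacobi_perm[OF f p, of "(0, v, tau)"] v tau by (simp add: Omega_def V_slice_def)
next
 fix v i assume v: "v \<in> V_slice n s" and i: "i < n"
 define \<rho> where "\<rho> = v n + v i"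
 define W where "W = (%t. v(i := t, n := \<rho> - t))"
 have W: "W t \<in> V_slice n s" for t using V_slice_move[OF v i] by (simp add: W_def \<rho>_def)
 then have WO: "(u, W t, tau) \<in> Omega n" for u t using tau by (simp add: Omega_def V_slice_def)
 define \<mu> where "\<mu> = (%j. if j = i then 1 else if j = n then -1 else 0 :: complex)"
 have sum\<mu>: "(\<Sum>j=0..n. \<mu> j * g j) = g i - g n" for g
 proof -
  have "(\<Sum>j=0..n. \<mu> j * g j) = (\<Sum>j=0..n. (if j = i then g j else 0) - (if j = n then g j else 0))"
   by (intro sum.cong) (use i in \<open>auto simp: \<mu>_def\<close>)
  also have "\<dots> = g i - g n" using i by (simp add: sum_subtractf)
  finally show ?thesis .
 qed
 have \<mu>L: "\<mu> \<in> L n" "(%_. 0) \<in> L n"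
  using sum\<mu>[of "%_. 1"] i by (auto simp: L_def V_def \<mu>_def)
 have \<mu>1: "\<mu> (n + 1) = 0" using i by (simp add: \<mu>_def)
 have fm: "form n \<mu> g = g i - g n" for g using sum\<mu>[of g] \<mu>1 by (simp add: form_def)
 have shift: "(%j. W t j + c * \<mu> j) = W (t + c)" for t c using i by (auto simp: W_def \<mu>_def fun_eq_iff)
 have "(%t. f (0, W t, tau)) holomorphic_on UNIV"
  using Jacobi_holomorphic_v[OF f _ i, of 0 v tau] v s tau
  by (simp add: W_def \<rho>_def Omega_reg_def Omega_def V_slice_def)
 moreover have "f (0, W (t + 1), tau) = f (0, W t, tau)" for t
  using Jacobi_trans[OF f \<mu>L(2,1) WO, of 0 t] shift[of t 1] by (simp add: form_def)
 moreover have "f (0, W (t + tau), tau) = exp (2 * of_real pi * \<i> * of_int m * (\<rho> - tau)) *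
   exp (- 2 * of_real pi * \<i> * of_int (2 * m) * t) * f (0, W t, tau)" for t
 proof -
  have Wv: "W t i = t" "W t n = \<rho> - t" using i by (auto simp: W_def)
  have "\<mu> i - \<mu> n = 2" using i by (simp add: \<mu>_def)
  then have "f (- (t - (\<rho> - t)) - tau, W (t + tau), tau) = f (0, W t, tau)"
   using Jacobi_trans[OF f \<mu>L WO, of 0 t] shift[of t tau] by (simp add: fm Wv mult.commute)
  then have "exp (- 2 * of_real pi * \<i> * of_int m * (- (t - (\<rho> - t)) - tau)) * f (0, W (t + tau), tau) = f (0, W t, tau)"
   using Jacobi_u[OF f WO, of "- (t - (\<rho> - t)) - tau" "t + tau"] by simp
  moreover have "exp (2 * of_real pi * \<i> * of_int m * (\<rho> - tau)) * exp (- 2 * of_real pi * \<i> * of_int (2 * m) * t) *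
    exp (- 2 * of_real pi * \<i> * of_int m * (- (t - (\<rho> - t)) - tau)) = 1"
   unfolding exp_add[symmetric] exp_eq_1 by (simp add: algebra_simps)
  ultimately show ?thesis by (rule eq_mult_inverse)
 qed
 ultimately show "qper tau (2 * m) 1 (exp (2 * of_real pi * \<i> * of_int m * (v n + v i - tau)))
   (%t. f (0, v(i := t, n := v n + v i - t), tau))"
  unfolding qper_def W_def[symmetric] \<rho>_def[symmetric] by (simp add: W_def)
qed

text \<open>As n >= 1, there is a line with v 0 + v n constant; along it the form is a theta
  function of negative degree 2 m.\<close>

lemma Jacobi_negative_index:
 assumes n: "n \<ge> 1" and f: "f \<in> Jacobi n k l m" and m: "m < 0"
 shows "f x = 0"
proof (cases "x \<in> Omega_reg n")
 case True
 obtain u v tau where x: "x = (u, v, tau)" by (cases x)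
 have tau: "tau \<in> uhp" and v: "v \<in> V_slice n (v (n + 1))" and s: "of_nat (n + 1) * v (n + 1) ~: Lat tau"
  using True by (auto simp: x Omega_reg_def Omega_def V_slice_def)
 have "qper tau (2 * m) 1 (exp (2 * of_real pi * \<i> * of_int m * (v n + v 0 - tau))) (%t. f (0, v(0 := t, n := v n + v 0 - t), tau))"
  using Jacobi_theta_level[OF f tau s] v n by (auto simp: theta_level_def)
 from qper_negative[OF tau this, of "v 0"] m have "f (0, v, tau) = 0" by simp
 then show ?thesis using Jacobi_u[OF f, of v tau u] True by (simp add: x Omega_reg_def Omega_def)
qed (use Jacobi_outside[OF f] in simp)

text \<open>On the slice v (n + 1) = s this is \<open>num\<close> at z = x - s. It vanishes as soon
  as some coordinate v i with i <= n equals x.\<close>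

definition theta_node :: "nat => complex => real => (nat => complex) => complex" where
 "theta_node n q x v = (\<Prod>i=0..n. th 0 (of_real x - v i) q)"

lemma theta_node_perm: "p permutes {0..n} ==> theta_node n q x (v \<circ> p) = theta_node n q x v"
 unfolding theta_node_def o_def by (rule prod.permute[symmetric, of p "{0..n}" "%i. th 0 (of_real x - v i) q", unfolded o_def])

lemma theta_level_node:
 assumes tau: "tau \<in> uhp"
 shows "theta_level n 1 s tau (theta_node n (nome tau) x)"
 unfolding theta_level_def
proof (intro conjI ballI allI impI)
 fix v :: "nat => complex" and i assume i: "i < n"
 define \<rho> where "\<rho> = v n + v i"
 obtain R where R: "{0..n} = insert i (insert n R)" "finite R" "i ~: R" "n ~: R" "i ~= n"
  using atLeastAtMost_split_two[OF i] .
 define c where "c = (\<Prod>k\<in>R. th 0 (of_real x - v k) (nome tau))"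
 have nd: "theta_node n (nome tau) x (v(i := t, n := \<rho> - t)) =
   - c * (th 0 (t - of_real x) (nome tau) * th 0 (t - (\<rho> - of_real x)) (nome tau))" for t
 proof -
  have "theta_node n (nome tau) x (v(i := t, n := \<rho> - t)) =
    c * (th 0 (of_real x - t) (nome tau) * th 0 (of_real x - (\<rho> - t)) (nome tau))"
  proof -
   have "(\<Prod>k\<in>R. th 0 (of_real x - (v(i := t, n := \<rho> - t)) k) (nome tau)) = c"
    unfolding c_def using R by (intro prod.cong) auto
   then show ?thesis unfolding theta_node_def R(1) using R(2-5) by simp
  qed
  moreover have "th 0 (of_real x - t) (nome tau) = - th 0 (t - of_real x) (nome tau)"
   using th_minus[of "nome tau" 0 "t - of_real x"] tau by simp
  ultimately show ?thesis by (simp add: algebra_simps)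
 qed
 have "qper tau (1 + 1) (-1 * -1) (theta_mult tau * exp (2 * of_real pi * \<i> * of_real x) * (theta_mult tau * exp (2 * of_real pi * \<i> * (\<rho> - of_real x))))
   (%t. - c * (th 0 (t - of_real x) (nome tau) * th 0 (t - (\<rho> - of_real x)) (nome tau)))"
  by (intro qper_cmult qper_mult qper_theta tau)
 moreover have "theta_mult tau * exp (2 * of_real pi * \<i> * of_real x) * (theta_mult tau * exp (2 * of_real pi * \<i> * (\<rho> - of_real x))) =
   exp (2 * of_real pi * \<i> * of_int 1 * (\<rho> - tau))"
  by (simp add: theta_mult_def exp_add[symmetric] algebra_simps)
 ultimately show "qper tau (2 * 1) 1 (exp (2 * of_real pi * \<i> * of_int 1 * (v n + v i - tau)))
   (%t. theta_node n (nome tau) x (v(i := t, n := v n + v i - t)))"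
  unfolding \<rho>_def[symmetric] nd by simp
qed (rule theta_node_perm)

section \<open>Real nodes and zeros at nodes\<close>

lemma real_period_lattice:
 assumes "tau \<in> uhp" "of_real x \<in> Lat tau"
 shows "x \<in> \<int>"
proof -
 obtain a b where ab: "of_real x = of_int a + of_int b * tau" using assms(2) by (auto simp: period_lattice_def)
 have "of_int b * Im tau = 0" using arg_cong[OF ab, of Im] by simp
 then have "b = 0" using assms(1) by (auto simp: upper_half_plane_iff)
 then show ?thesis using arg_cong[OF ab, of Re] by simp
qed

lemma small_notin_Ints: "0 < \<bar>x\<bar> ==> \<bar>x\<bar> < 1 ==> (x :: real) ~: \<int>"
 by (auto elim!: Ints_cases)

lemma node_less_1:
 fixes n :: nat
 shows "Q \<subseteq> {0<..<1 / (real n + 2)} ==> x \<in> Q ==> 0 < x \<and> x < (1 :: real)"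
proof -
 assume "Q \<subseteq> {0<..<1 / (real n + 2)}" "x \<in> Q"
 then have x: "x \<in> {0<..<1 / (real n + 2)}" by (auto simp: add.commute)
 have "1 / (real n + 2) \<le> 1" by simp
 with x show ?thesis unfolding greaterThanLessThan_iff by linarith
qed

text \<open>The sum of n + 2 numbers below 1/(n + 2) is below 1; the interval for the nodes is
  chosen for this purpose.\<close>

lemma sum_nodes:
 assumes "finite S" "card S \<le> n" "S \<subseteq> {0<..<1 / (real n + 2)}" "x \<in> {0<..<1 / (real n + 2)}" "y \<in> {0<..<1 / (real n + 2)}" "n \<ge> 1"
 shows "0 < sum (%x. x) S + x" "sum (%x. x) S + x + y < (1 :: real)"
proof -
 have p: "sum (%x. x) S \<ge> 0" by (rule sum_nonneg) (use assms in auto)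
 then show "0 < sum (%x. x) S + x" using assms(4) by auto
 have "sum (%x. x) S \<le> of_nat (card S) * (1 / (real n + 2))" by (rule sum_bounded_above) (use subsetD[OF assms(3)] in \<open>force simp: add.commute intro: less_imp_le\<close>)
 also have "\<dots> \<le> real n * (1 / (real n + 2))" using assms(2) by (intro mult_right_mono) auto
 finally have "sum (%x. x) S + x + y < real n * (1 / (real n + 2)) + 1 / (real n + 2) + 1 / (real n + 2)" using assms(4,5) by auto
 also have "\<dots> = 1" by (simp add: field_simps)
 finally show "sum (%x. x) S + x + y < 1" .
qed

text \<open>A form of level \<open>m\<close> is of degree \<open>2m\<close> in each coordinate. When one more coordinate is set free
  there are enough nodes left to give more than \<open>2m\<close> zeros, in pairs because of the symmetry.\<close>

lemma theta_level_zero: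
 fixes Q :: "real set"
 assumes tau: "tau \<in> uhp" and g: "theta_level n m s tau g" and Q: "finite Q" "Q \<subseteq> {0<..<1 / (real n + 2)}" "int (card Q) \<ge> m + int n"
  and van: "!!v. v \<in> V_slice n s ==> inj_on v {..<n} ==> v ` {..<n} \<subseteq> of_real ` Q ==> g v = 0"
  and I: "I \<subseteq> {..<n}" "card I + r = n" and v: "v \<in> V_slice n s" "inj_on v I" "v ` I \<subseteq> of_real ` Q"
 shows "g v = 0"
 using I v
proof (induction r arbitrary: I v)
 case 0
 then have "I = {..<n}" using card_subset_eq[of "{..<n}" I] by simp
 then show ?case using van 0 by simp
next
 case (Suc r)
 have finI: "finite I" using Suc.prems(1) finite_subset by blast
 have "I ~= {..<n}" using Suc.prems(2) card_lessThan[of n] by (metis add_cancel_right_right nat.simps(3))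
 then obtain i where i: "i < n" "i ~: I" using Suc.prems(1) by blast
 \<comment> \<open>The nodes not yet taken by the coordinates in I; there are at least m + r + 1 of
   them.\<close>
 define Q' where "Q' = {x \<in> Q. of_real x ~: v ` I}"
 have finQ': "finite Q'" and Q'Q: "Q' \<subseteq> Q" using Q(1) by (auto simp: Q'_def)
 have "v ` I = (of_real :: real => complex) ` {x \<in> Q. of_real x \<in> v ` I}" by (rule subset_image_eq[OF Suc.prems(5)])
 then have "card {x \<in> Q. of_real x \<in> v ` I} = card I"
  using card_image[OF Suc.prems(4)] card_image[of "of_real :: real => complex" "{x \<in> Q. of_real x \<in> v ` I}"]
  by (simp add: inj_on_def)
 moreover have "Q = Q' \<union> {x \<in> Q. of_real x \<in> v ` I}" "Q' \<inter> {x \<in> Q. of_real x \<in> v ` I} = {}" by (auto simp: Q'_def)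
 ultimately have cQ: "card Q = card Q' + card I" using card_Un_disjoint[OF finQ', of "{x \<in> Q. of_real x \<in> v ` I}"] Q(1) by simp
 have cQ': "int (card Q') > m + int r" using cQ Q(3) Suc.prems(2) by linarith
 have generic: "g w = 0" if w: "w \<in> V_slice n s" "!!k. k \<in> I ==> w k = v k"
  and inc: "!!x y. x \<in> Q' ==> y \<in> Q' ==> of_real x + of_real y - (w n + w i) ~: Lat tau" for w
 proof -
  define \<rho> where "\<rho> = w n + w i"
  define W where "W = (%t. w(i := t, n := \<rho> - t))"
  have W: "W t \<in> V_slice n s" for t using V_slice_move[OF w(1) i(1)] by (simp add: W_def \<rho>_def)
  have qh: "qper tau (2 * m) 1 (exp (2 * of_real pi * \<i> * of_int m * (w n + w i - tau))) (%t. g (W t))"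
   using g w(1) i(1) unfolding theta_level_def W_def \<rho>_def by blast
  have z1: "g (W (of_real x)) = 0" if x: "x \<in> Q'" for x
  proof (rule Suc.IH[of "insert i I"])
   have WI: "W (of_real x) k = v k" if "k \<in> I" for k using that w(2) i Suc.prems(1) by (auto simp: W_def)
   have Wi: "W (of_real x) i = of_real x" using i by (simp add: W_def)
   show "inj_on (W (of_real x)) (insert i I)" using Suc.prems(4) WI Wi x i
    by (auto simp: Q'_def inj_on_def image_iff)
   show "W (of_real x) ` insert i I \<subseteq> of_real ` Q" using Suc.prems(5) WI Wi x Q'Q by auto
   show "insert i I \<subseteq> {..<n}" using Suc.prems(1) i by simp
   show "card (insert i I) + r = n" using Suc.prems(2) i finI by simp
  qed (rule W)
  \<comment> \<open>Exchanging the coordinates i and n replaces t = x by t = \<rho> - x.\<close>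
  have z2: "g (W (\<rho> - of_real x)) = 0" if x: "x \<in> Q'" for x
  proof -
   have p: "Transposition.transpose i n permutes {0..n}" using i by (intro permutes_swap_id) auto
   have "g (W (of_real x) \<circ> Transposition.transpose i n) = g (W (of_real x))" using g W p by (simp add: theta_level_def)
   moreover have "W (of_real x) \<circ> Transposition.transpose i n = W (\<rho> - of_real x)"
    using i by (auto simp: fun_eq_iff W_def transpose_def)
   ultimately show ?thesis using z1[OF x] by simp
  qed
  define R where "R = (of_real ` Q' :: complex set)"
  define A where "A = R \<union> (%x. \<rho> - x) ` R"
  have cR: "card R = card Q'" unfolding R_def by (intro card_image inj_onI) simp
  have finR: "finite R" using finQ' by (simp add: R_def)
  have Rinc: "x + y - \<rho> ~: Lat tau" if "x \<in> R" "y \<in> R" for x y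
   using inc that by (auto simp: R_def \<rho>_def)
  have Rdiff: "x - y ~: Lat tau" if xy: "x \<in> R" "y \<in> R" "x ~= y" for x y
  proof -
   obtain a b where ab: "x = of_real a" "y = of_real b" "a \<in> Q'" "b \<in> Q'" using xy by (auto simp: R_def)
   have "0 < a \<and> a < 1 \<and> 0 < b \<and> b < 1" using node_less_1[OF Q(2) subsetD[OF Q'Q ab(3)]] node_less_1[OF Q(2) subsetD[OF Q'Q ab(4)]] by simp
   then have "a - b ~: \<int>" using xy ab by (intro small_notin_Ints) auto
   then show ?thesis using real_period_lattice[OF tau, of "a - b"] ab by auto
  qed
  have "R \<inter> (%x. \<rho> - x) ` R = {}"
  proof (rule ccontr)
   assume "R \<inter> (%x. \<rho> - x) ` R ~= {}"
   then obtain x where "x \<in> R" "\<rho> - x \<in> R" by auto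
   then show False using Rinc[of "\<rho> - x" x] by simp
  qed
  moreover have "card ((%x. \<rho> - x) ` R) = card Q'" using cR by (subst card_image) (auto simp: inj_on_def)
  ultimately have cA: "card A = 2 * card Q'" unfolding A_def using finR cR by (subst card_Un_disjoint) auto
  have "(%t. g (W t)) (w i) = 0"
  proof (rule qper_too_many_zeros[OF tau _ qh])
   show "finite A" using finR by (simp add: A_def)
   show "2 * m < int (card A)" using cA cQ' by linarith
   show "g (W a) = 0" if "a \<in> A" for a using that z1 z2 by (auto simp: A_def R_def)
   show "a - b ~: Lat tau" if ab: "a \<in> A" "b \<in> A" "a ~= b" for a b
    using ab unfolding A_def
   proof (elim UnE imageE)
    fix x y assume "a = \<rho> - x" "b = \<rho> - y" "x \<in> R" "y \<in> R"
    then show ?thesis using Rdiff[of y x] ab by auto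
   next
    fix y assume "a \<in> R" "b = \<rho> - y" "y \<in> R"
    then show ?thesis using Rinc[of a y] by (simp add: diff_diff_eq2)
   next
    fix x assume "a = \<rho> - x" "x \<in> R" "b \<in> R"
    then show ?thesis using Rinc[of b x] period_lattice_uminus_iff[of "b + x - \<rho>" tau] by (simp add: diff_diff_eq add.commute)
   qed (use Rdiff in auto)
  qed
  moreover have "W (w i) = w" by (auto simp: W_def \<rho>_def)
  ultimately show ?thesis by simp
 qed
 show ?case
 \<comment> \<open>If i is the last free coordinate, v n + v i is minus a sum of n - 1 nodes, and
   \<open>inc\<close> holds because the sum of n + 1 nodes is in (0, 1). Otherwise a second free
   coordinate j is varied: \<open>inc\<close> holds when it is close to v j but different from it,
   and the claim at v j follows by continuity.\<close>
 proof (cases "r = 0")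
  case True
  have "I = {..<n} - {i}" using i Suc.prems(1,2) True by (intro card_subset_eq) auto
  then have "{..<n} = insert i I" using i by auto
  then have \<rho>: "v n + v i = - (\<Sum>k\<in>I. v k)"
   using V_last[of v n] Suc.prems(3) finI i by (simp add: V_slice_def)
  define S where "S = {x \<in> Q. of_real x \<in> v ` I}"
  have vS: "v ` I = of_real ` S" unfolding S_def by (rule subset_image_eq[OF Suc.prems(5)])
  have cS: "card S = card I" using \<open>card {x \<in> Q. of_real x \<in> v ` I} = card I\<close> by (simp add: S_def)
  have "(\<Sum>k\<in>I. v k) = (\<Sum>y\<in>v ` I. y)" using Suc.prems(4) by (simp add: sum.reindex)
  also have "\<dots> = (\<Sum>x\<in>S. of_real x)" unfolding vS by (subst sum.reindex) (auto simp: inj_on_def)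
  finally have sumI: "(\<Sum>k\<in>I. v k) = of_real (\<Sum>x\<in>S. x)" by simp
  show ?thesis
  proof (rule generic[OF Suc.prems(3)])
   fix x y assume "x \<in> Q'" "y \<in> Q'"
   then have "x \<in> {0<..<1 / (real n + 2)}" "y \<in> {0<..<1 / (real n + 2)}" using Q'Q Q(2) by auto
   moreover have "S \<subseteq> {0<..<1 / (real n + 2)}" "finite S" "card S \<le> n" "n \<ge> 1" using Q cS Suc.prems(2) by (auto simp: S_def)
   ultimately have "0 < sum (%x. x) S + x" "sum (%x. x) S + x + y < 1" "y > 0" using sum_nodes[of S n x y] by auto
   then have "x + y + sum (%x. x) S ~: \<int>" by (intro small_notin_Ints) auto
   then have "of_real (x + y + sum (%x. x) S) ~: Lat tau" using real_period_lattice[OF tau] by blast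
   then show "of_real x + of_real y - (v n + v i) ~: Lat tau" by (simp add: \<rho> sumI)
  qed simp
 next
  case False
  have "card (insert i I) < n" using Suc.prems(2) False i finI by simp
  then have "\<not> {..<n} \<subseteq> insert i I" using card_mono[of "insert i I" "{..<n}"] finI by auto
  then obtain j where j: "j < n" "j ~: I" "j ~= i" by auto
  define W where "W = (%t. v(j := t, n := v n + v j - t))"
  have W: "W t \<in> V_slice n s" for t using V_slice_move[OF Suc.prems(3) j(1)] by (simp add: W_def)
  have "qper tau (2 * m) 1 (exp (2 * of_real pi * \<i> * of_int m * (v n + v j - tau))) (%t. g (W t))"
   using g Suc.prems(3) j(1) unfolding theta_level_def W_def by blast
  then have "(%t. g (W t)) holomorphic_on UNIV" by (simp add: qper_def)
  then have "isCont (%t. g (W t)) (v j)" using holomorphic_on_imp_continuous_on continuous_on_eq_continuous_at open_UNIV by blast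
  then have lim: "((%t. g (W t)) \<longlongrightarrow> g (W (v j))) (at (v j))" by (simp add: isCont_def)
  have "eventually (%t. \<forall>x\<in>Q'. \<forall>y\<in>Q'. t - (v n + v j + v i - of_real x - of_real y) ~: Lat tau) (at (v j))"
  proof (intro eventually_ball_finite finQ' ballI)
   fix x y
   have "filterlim (%t. t - c) (at (v j - c)) (at (v j))" for c
    by (intro filterlim_atI tendsto_intros) (auto simp: eventually_at_filter)
   then show "eventually (%t. t - (v n + v j + v i - of_real x - of_real y) ~: Lat tau) (at (v j))"
    using eventually_notin_period_lattice[OF tau] eventually_compose_filterlim by blast
  qed
  then have "eventually (%t. g (W t) = 0) (at (v j))"
  proof eventually_elim
   case (elim t)
   show ?case
   proof (rule generic[OF W])
    show "W t k = v k" if "k \<in> I" for k using that j Suc.prems(1) by (auto simp: W_def)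
    fix x y assume "x \<in> Q'" "y \<in> Q'"
    then show "of_real x + of_real y - (W t n + W t i) ~: Lat tau"
     using elim j i by (auto simp: W_def algebra_simps)
   qed
  qed
  then have "((%t. g (W t)) \<longlongrightarrow> 0) (at (v j))" by (rule tendsto_eventually)
  then have "g (W (v j)) = 0" using lim tendsto_unique at_neq_bot by blast
  moreover have "W (v j) = v" by (auto simp: W_def)
  ultimately show ?thesis by simp
 qed
qed

text \<open>The point of the slice whose coordinates 0, ..., n - 1 run through S. Which enumeration
  is picked does not affect symmetric functions. Only coordinate n + 1 depends on s, and no
  coordinate on tau.\<close>

definition node_point :: "nat => complex => real set => nat => complex" where
 "node_point n s S i = (if i < n then of_real ((SOME e. bij_betw e {..<n} S) i)
   else if i = n then - (\<Sum>x\<in>S. of_real x) else if i = n + 1 then s else 0)"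

lemma node_point_bij:
 assumes "finite S" "card S = n"
 shows "bij_betw (SOME e. bij_betw e {..<n} S) {..<n} S"
proof -
 have "\<exists>e. bij_betw e {..<n} S" using ex_bij_betw_nat_finite[OF assms(1)] assms(2) by (simp add: atLeast0LessThan)
 then show ?thesis by (rule someI_ex)
qed

lemma node_point_inj:
 assumes "finite S" "card S = n"
 shows "bij_betw (node_point n s S) {..<n} (of_real ` S)"
proof -
 have "bij_betw (of_real \<circ> (SOME e. bij_betw e {..<n} S)) {..<n} ((of_real :: real => complex) ` S)"
  by (rule bij_betw_trans[OF node_point_bij[OF assms]]) (auto simp: bij_betw_def inj_on_def)
 then show ?thesis by (rule bij_betw_cong[THEN iffD1, rotated]) (simp add: node_point_def)
qed

lemma node_point_V:
 assumes "finite S" "card S = n"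
 shows "node_point n s S \<in> V_slice n s"
proof -
 have "(\<Sum>i<n. node_point n s S i) = (\<Sum>y\<in>of_real ` S. y)" by (rule sum.reindex_bij_betw[OF node_point_inj[OF assms]])
 also have "\<dots> = (\<Sum>x\<in>S. of_real x)" by (subst sum.reindex) (auto simp: inj_on_def)
 finally have "(\<Sum>i\<in>{..<Suc n}. node_point n s S i) = 0" by (simp add: node_point_def)
 then show ?thesis by (simp add: V_slice_def V_def node_point_def atLeast0AtMost lessThan_Suc_atMost)
qed

lemma node_point_update: "node_point n s S = (node_point n 0 S)(n + 1 := s)"
 by (auto simp: node_point_def fun_eq_iff)

text \<open>The coordinates up to n are the nodes in S and minus their sum. Subtracting them from x
  gives differences of distinct nodes, and x plus the sum of S, all of modulus strictly between 0
  and 1. The property G is stated for a nome in order to cover the nome 0.\<close>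

lemma node_point_nonzero:
 assumes G: "!!x. th 0 (of_real x) q = 0 ==> x \<in> \<int>" and n: "n \<ge> 1"
  and Q: "finite S" "card S = n" "S \<subseteq> {0<..<1 / (real n + 2)}" "x \<in> {0<..<1 / (real n + 2)}" "x ~: S"
 shows "theta_node n q x (node_point n s S) ~= 0"
proof -
 have "th 0 (of_real x - node_point n s S i) q ~= 0" if i: "i \<le> n" for i
 proof (cases "i = n")
  case True
  have "x + (\<Sum>y\<in>S. y) ~: \<int>" using sum_nodes[of S n x x] Q n by (intro small_notin_Ints) auto
  then show ?thesis using G[of "x + (\<Sum>y\<in>S. y)"] True by (auto simp: node_point_def)
 next
  case False
  then have "node_point n s S i \<in> of_real ` S" using node_point_inj[OF Q(1,2), of s] i by (auto simp: bij_betw_def)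
  then obtain y where y: "node_point n s S i = of_real y" "y \<in> S" by auto
  have "0 < x \<and> x < 1 \<and> 0 < y \<and> y < 1" using node_less_1[OF Q(3) y(2)] node_less_1[of "{x}" n x] Q(4) by auto
  then have "x - y ~: \<int>" using y Q(5) by (intro small_notin_Ints) auto
  then show ?thesis using G[of "x - y"] y by auto
 qed
 then show ?thesis unfolding theta_node_def by simp
qed

text \<open>The product belonging to S has m factors, hence level m. It is 1 at its own node point
  and 0 at that of any other set S0, since S0 contains a node outside S. The difference of the two
  sides therefore vanishes at all points with n distinct nodes, and \<open>theta_level_zero\<close>
  applies with no coordinate fixed.\<close>

lemma theta_interpolation:
 fixes Q :: "real set"
 assumes n: "n \<ge> 1" and tau: "tau \<in> uhp" and f: "theta_level n (int m) s tau f"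
  and Q: "finite Q" "Q \<subseteq> {0<..<1 / (real n + 2)}" "card Q = m + n" and v: "v \<in> V_slice n s"
 shows "f v = (\<Sum>S | S \<subseteq> Q \<and> card S = n. f (node_point n s S) *
  (\<Prod>x\<in>Q - S. theta_node n (nome tau) x v / theta_node n (nome tau) x (node_point n s S)))"
proof -
 define P where "P = (%S v. \<Prod>x\<in>Q - S. theta_node n (nome tau) x v / theta_node n (nome tau) x (node_point n s S))"
 define g where "g = (%v. f v - (\<Sum>S | S \<subseteq> Q \<and> card S = n. f (node_point n s S) * P S v))"
 have finS: "finite S" if "S \<subseteq> Q" for S using that Q(1) finite_subset by blast
 have fin: "finite {S. S \<subseteq> Q \<and> card S = n}" using Q(1) by simp
 have lP: "theta_level n (0 + int m) s tau (%v. f (node_point n s S) * P S v)" if S: "S \<subseteq> Q" "card S = n" for S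
 proof -
  have c: "card (Q - S) = m" using card_Diff_subset[OF finS[OF S(1)] S(1)] S Q by simp
  have "theta_level n (1 + 0) s tau (%v. theta_node n (nome tau) x v * (1 / theta_node n (nome tau) x (node_point n s S)))" for x
   by (rule theta_level_mult[OF theta_level_node[OF tau] theta_level_const])
  then have "theta_level n (int (card (Q - S))) s tau (P S)"
   unfolding P_def using Q(1) by (intro theta_level_prod) auto
  then show ?thesis using c by (intro theta_level_mult theta_level_const) simp
 qed
 have gl: "theta_level n (int m) s tau g" unfolding g_def
  by (intro theta_level_diff f theta_level_sum fin) (use lP in auto)
 have "g w = 0" if w: "w \<in> V_slice n s" "inj_on w {..<n}" "w ` {..<n} \<subseteq> of_real ` Q" for w
 proof -
  define S0 where "S0 = {x \<in> Q. of_real x \<in> w ` {..<n}}"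
  have im: "w ` {..<n} = of_real ` S0" unfolding S0_def by (rule subset_image_eq[OF w(3)])
  have S0: "S0 \<subseteq> Q" "finite S0" using Q(1) by (auto simp: S0_def)
  have "card S0 = card ((of_real :: real => complex) ` S0)" by (subst card_image) (auto simp: inj_on_def)
  then have c0: "card S0 = n" using card_image[OF w(2)] im by simp
  have "P S w = 0" if S: "S \<subseteq> Q" "card S = n" "S ~= S0" for S
  proof -
   have "\<not> S0 \<subseteq> S" using card_subset_eq[OF finS[OF S(1)], of S0] S c0 by auto
   then obtain x where x: "x \<in> S0" "x ~: S" by blast
   then have "of_real x \<in> w ` {..<n}" by (auto simp: S0_def)
   then obtain i where "i < n" "w i = of_real x" by auto
   then have "theta_node n (nome tau) x w = 0" unfolding theta_node_def using tau by (intro prod_zero) (auto intro!: bexI[of _ i])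
   then show ?thesis unfolding P_def using x S0 Q(1) by (intro prod_zero) auto
  qed
  then have sum: "(\<Sum>S | S \<subseteq> Q \<and> card S = n. f (node_point n s S) * P S w) = f (node_point n s S0) * P S0 w"
   using S0 c0 by (subst sum.remove[OF fin, of S0]) (auto intro!: sum.neutral)
  \<comment> \<open>The first n coordinates of w and of the node point enumerate the same set; p is
    the permutation between the two enumerations.\<close>
  define p where "p = (%i. if i < n then inv_into {..<n} (node_point n s S0) (w i) else i)"
  have b: "bij_betw (node_point n s S0) {..<n} (of_real ` S0)" by (rule node_point_inj[OF S0(2) c0])
  have "bij_betw w {..<n} (of_real ` S0)" using w(2) im by (simp add: bij_betw_def)
  from bij_betw_trans[OF this bij_betw_inv_into[OF b]] have "bij_betw p {..<n} {..<n}"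
   by (rule bij_betw_cong[THEN iffD1, rotated]) (simp add: p_def)
  then have "p permutes {..<n}" by (rule bij_imp_permutes) (simp add: p_def)
  then have p: "p permutes {0..n}" by (rule permutes_subset) auto
  have "node_point n s S0 (p i) = w i" if "i < n" for i
  proof -
   have "w i \<in> node_point n s S0 ` {..<n}" using that b im unfolding bij_betw_def by blast
   then show ?thesis using that by (simp add: p_def f_inv_into_f)
  qed
  moreover have "w n = - (\<Sum>x\<in>S0. of_real x)"
  proof -
   have "(\<Sum>i<n. w i) = (\<Sum>y\<in>w ` {..<n}. y)" using w(2) by (simp add: sum.reindex)
   also have "\<dots> = (\<Sum>x\<in>S0. of_real x)" unfolding im by (subst sum.reindex) (auto simp: inj_on_def)
   finally show ?thesis using V_last[of w n] w(1) by (simp add: V_slice_def)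
  qed
  ultimately have wp: "w = node_point n s S0 \<circ> p"
  proof (intro ext)
   fix i
   assume *: "!!i. i < n ==> node_point n s S0 (p i) = w i" "w n = - (\<Sum>x\<in>S0. of_real x)"
   consider "i < n" | "i = n" | "i = n + 1" | "i > n + 1" by linarith
   then show "w i = (node_point n s S0 \<circ> p) i"
    by cases (use w(1) * in \<open>auto simp: p_def node_point_def V_slice_def V_def\<close>)
  qed
  have NV: "node_point n s S0 \<in> V_slice n s" by (rule node_point_V[OF S0(2) c0])
  have "P S0 w = 1" unfolding P_def
  proof (intro prod.neutral ballI)
   fix x assume x: "x \<in> Q - S0"
   have "theta_node n (nome tau) x (node_point n s S0) ~= 0"
   proof (rule node_point_nonzero[OF _ n S0(2) c0])
    show "x \<in> {0<..<1 / (real n + 2)}" using subsetD[OF Q(2), of x] x by simp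
   qed (use x Q(2) S0 real_period_lattice[OF tau] th_eq_0_iff[OF tau] in auto)
   then show "theta_node n (nome tau) x w / theta_node n (nome tau) x (node_point n s S0) = 1"
    unfolding wp theta_node_perm[OF p] by simp
  qed
  moreover have "f w = f (node_point n s S0)" using f NV p unfolding wp theta_level_def by blast
  ultimately show ?thesis by (simp add: g_def sum)
 qed
 then have "g v = 0"
  using theta_level_zero[OF tau gl Q(1,2) _ _ _ _ v, of "{}" n] Q(3) by simp
 then show ?thesis by (simp add: g_def P_def)
qed

section \<open>The coefficients of a Jacobi form\<close>

definition monomials :: "nat => nat => (nat \<Rightarrow>\<^sub>0 nat) set" where
 "monomials n m = {\<alpha>. keys \<alpha> \<subseteq> {0..n} \<and> (\<Sum>i=0..n. lookup \<alpha> i) = m}"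

lemma finite_monomials: "finite (monomials n m)"
proof (rule inj_on_finite)
 show "finite ({0..n} \<rightarrow>\<^sub>E {0..m})" by (intro finite_PiE) auto
 show "(%\<alpha>. restrict (lookup \<alpha>) {0..n}) ` monomials n m \<subseteq> {0..n} \<rightarrow>\<^sub>E {0..m}"
  by (auto simp: monomials_def intro!: member_le_sum)
 show "inj_on (%\<alpha>. restrict (lookup \<alpha>) {0..n}) (monomials n m)"
 proof (rule inj_onI, rule poly_mapping_eqI)
  fix \<alpha> \<beta> i assume *: "\<alpha> \<in> monomials n m" "\<beta> \<in> monomials n m"
   "restrict (lookup \<alpha>) {0..n} = restrict (lookup \<beta>) {0..n}"
  show "lookup \<alpha> i = lookup \<beta> i"
  proof (cases "i \<in> {0..n}")
   case True
   then show ?thesis using fun_cong[OF *(3), of i] by simp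
  next
   case False
   then have "i ~: keys \<alpha>" "i ~: keys \<beta>" using * by (auto simp: monomials_def)
   then show ?thesis by (simp add: in_keys_iff)
  qed
 qed
qed

text \<open>The exponent vector of the monomial that arises when the variable \<kappa> x is picked
  from the factor belonging to the node x.\<close>

definition exponents :: "real set => (real => nat) => (nat \<Rightarrow>\<^sub>0 nat)" where
 "exponents R \<kappa> = (\<Sum>x\<in>R. Poly_Mapping.single (\<kappa> x) 1)"

lemma exponents:
 assumes "finite R" "!!x. x \<in> R ==> \<kappa> x \<le> n"
 shows "exponents R \<kappa> \<in> monomials n (card R)"
  and "(\<Prod>i=0..n. (y i :: complex) ^ lookup (exponents R \<kappa>) i) = (\<Prod>x\<in>R. y (\<kappa> x))"
proof -
 have "exponents R \<kappa> \<in> monomials n (card R) \<and>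
  (\<Prod>i=0..n. y i ^ lookup (exponents R \<kappa>) i) = (\<Prod>x\<in>R. y (\<kappa> x))"
  using assms
 proof (induction rule: finite_induct)
  case (insert x R)
  have x: "\<kappa> x \<in> {0..n}" using insert.prems by simp
  have e: "exponents (insert x R) \<kappa> = Poly_Mapping.single (\<kappa> x) 1 + exponents R \<kappa>"
   using insert by (simp add: exponents_def)
  have l: "lookup (exponents (insert x R) \<kappa>) i =
    (if i = \<kappa> x then 1 else 0) + lookup (exponents R \<kappa>) i" for i
   by (auto simp: e lookup_add lookup_single when_def)
  have IH: "exponents R \<kappa> \<in> monomials n (card R)"
   "(\<Prod>i=0..n. y i ^ lookup (exponents R \<kappa>) i) = (\<Prod>x\<in>R. y (\<kappa> x))" using insert by auto
  have "keys (exponents (insert x R) \<kappa>) \<subseteq> {0..n}"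
  proof
   fix i assume "i \<in> keys (exponents (insert x R) \<kappa>)"
   then have "i = \<kappa> x \<or> i \<in> keys (exponents R \<kappa>)" by (auto simp: in_keys_iff l split: if_splits)
   then show "i \<in> {0..n}" using x IH(1) by (auto simp: monomials_def)
  qed
  moreover have "(\<Sum>i=0..n. lookup (exponents (insert x R) \<kappa>) i) = card (insert x R)"
   using IH(1) x insert.hyps by (simp add: l sum.distrib monomials_def)
  moreover have "(\<Prod>i=0..n. y i ^ lookup (exponents (insert x R) \<kappa>) i) = (\<Prod>x\<in>insert x R. y (\<kappa> x))"
  proof -
   have "(\<Prod>i=0..n. y i ^ (if i = \<kappa> x then 1 else 0)) = (\<Prod>i=0..n. if i = \<kappa> x then y i else 1)"
    by (intro prod.cong) auto
   also have "\<dots> = y (\<kappa> x)" using x by simp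
   finally show ?thesis using insert.hyps IH(2) by (simp add: l power_add prod.distrib)
  qed
  ultimately show ?case by (simp add: monomials_def)
 qed (simp add: exponents_def monomials_def)
 then show "exponents R \<kappa> \<in> monomials n (card R)"
  "(\<Prod>i=0..n. y i ^ lookup (exponents R \<kappa>) i) = (\<Prod>x\<in>R. y (\<kappa> x))" by blast+
qed

text \<open>The product is expanded over the choices \<kappa> of one variable per factor, and the
  choices are collected by the monomial they produce.\<close>

lemma prod_linear_forms:
 fixes a :: "real => nat => complex"
 assumes R: "finite R" "card R = m"
 shows "(\<Prod>x\<in>R. \<Sum>k=0..n. a x k * y k) = (\<Sum>\<alpha>\<in>monomials n m.
  (\<Sum>\<kappa> | \<kappa> \<in> R \<rightarrow>\<^sub>E {0..n} \<and> exponents R \<kappa> = \<alpha>. \<Prod>x\<in>R. a x (\<kappa> x)) * (\<Prod>i=0..n. y i ^ lookup \<alpha> i))"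
proof -
 have E: "exponents R \<kappa> \<in> monomials n m"
   "(\<Prod>i=0..n. y i ^ lookup (exponents R \<kappa>) i) = (\<Prod>x\<in>R. y (\<kappa> x))" if "\<kappa> \<in> R \<rightarrow>\<^sub>E {0..n}" for \<kappa>
 proof -
  have "\<kappa> x \<le> n" if "x \<in> R" for x using PiE_mem[OF \<open>\<kappa> \<in> R \<rightarrow>\<^sub>E {0..n}\<close> that] by simp
  then show "exponents R \<kappa> \<in> monomials n m"
   "(\<Prod>i=0..n. y i ^ lookup (exponents R \<kappa>) i) = (\<Prod>x\<in>R. y (\<kappa> x))"
   using exponents[OF R(1), of \<kappa> n] R(2) by auto
 qed
 have fin: "finite (R \<rightarrow>\<^sub>E {0..n})" using R by (intro finite_PiE) auto
 have "(\<Prod>x\<in>R. \<Sum>k=0..n. a x k * y k) = (\<Sum>\<kappa>\<in>R \<rightarrow>\<^sub>E {0..n}. (\<Prod>x\<in>R. a x (\<kappa> x)) * (\<Prod>x\<in>R. y (\<kappa> x)))"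
  using prod_sum_PiE[OF R(1), of "%_. {0..n}" "%x k. a x k * y k"] by (simp add: prod.distrib)
 also have "\<dots> = (\<Sum>\<alpha>\<in>monomials n m. \<Sum>\<kappa> | \<kappa> \<in> R \<rightarrow>\<^sub>E {0..n} \<and> exponents R \<kappa> = \<alpha>. (\<Prod>x\<in>R. a x (\<kappa> x)) * (\<Prod>x\<in>R. y (\<kappa> x)))"
  by (rule sum.group[symmetric, OF fin finite_monomials]) (use E(1) in auto)
 also have "\<dots> = (\<Sum>\<alpha>\<in>monomials n m.
  (\<Sum>\<kappa> | \<kappa> \<in> R \<rightarrow>\<^sub>E {0..n} \<and> exponents R \<kappa> = \<alpha>. \<Prod>x\<in>R. a x (\<kappa> x)) * (\<Prod>i=0..n. y i ^ lookup \<alpha> i))"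
  unfolding sum_distrib_right using E(2) by (intro sum.cong refl) auto
 finally show ?thesis .
qed

text \<open>The coefficient of the k-th fundamental form in \<open>theta_node\<close> at x and u =
  0: the defining identity at z = x - s, cleared of its denominator.\<close>

definition node_factor :: "nat => complex => real => nat => complex => complex" where
 "node_factor n s x k q = den n (of_real x - s) (of_nat (n + 1) * s) q * bas k (of_real x - s) (of_nat (n + 1) * s) q"

lemma analytic_th_nome: "norm q < 1 ==> (%q. th r z q) analytic_on {q}"
 by (intro analytic_intros) auto

text \<open>The factor \<open>1 / th 0 w q\<close> is kept apart because it is the one that becomes
  singular on the divisor.\<close>

lemma bas_cases: "bas k z w q = (if k = 0 then 1
  else if k = 1 then th 1 z q / th 0 z q - th 1 (z + w) q / th 0 (z + w) q + th 1 w q * (1 / th 0 w q) else wpq (k - 2) z q)"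
 by (simp add: bas_def theta_logderiv_def)

lemma analytic_node_factor_nome:
 assumes q: "norm q < 1" and nz: "th 0 (of_real x - s) q ~= 0" "th 0 (of_real x - s + of_nat (n + 1) * s) q ~= 0"
  "th 0 (of_nat (n + 1) * s) q ~= 0"
 shows "(%q. node_factor n s x k q) analytic_on {q}"
proof -
 have "(%q. bas k (of_real x - s) (of_nat (n + 1) * s) q) analytic_on {q}"
  unfolding bas_cases using nz
  by (cases "k = 0"; cases "k = 1")
    (auto simp del: of_nat_Suc of_nat_add intro!: analytic_intros analytic_th_nome analytic_wpq_nome q)
 then show ?thesis unfolding node_factor_def den_def by (intro analytic_intros analytic_th_nome q)
qed

text \<open>On the divisor theta'(w)/theta(w) in \<open>bas 1\<close> has a simple pole; everything
  else is regular by the choice of the node.\<close>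

lemma pole_le_node_factor:
 assumes q: "norm q < 1" and nz: "th 0 (of_real x - p) q ~= 0" "th 0 (of_real x - p + of_nat (n + 1) * p) q ~= 0"
 shows "th 0 (of_nat (n + 1) * p) q ~= 0 ==> (%s. node_factor n s x k q) analytic_on {p}"
  and "pole_le (%s. node_factor n s x k q) p 1"
proof -
 define N where "N = (of_nat (n + 1) :: complex)"
 have N0: "N ~= 0" unfolding N_def of_nat_eq_0_iff by simp
 have aF: "(%s. bas k (of_real x - s) (N * s) q) analytic_on {p}" if "k ~= 1 \<or> th 0 (N * p) q ~= 0"
  unfolding bas_cases using nz[folded N_def] that
  by (cases "k = 0"; cases "k = 1") (auto intro!: analytic_intros analytic_wpq q)
 have aD: "(%s. den n (of_real x - s) (N * s) q) analytic_on {p}"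
  unfolding den_def by (intro analytic_intros q)
 show "(%s. node_factor n s x k q) analytic_on {p}" if "th 0 (of_nat (n + 1) * p) q ~= 0"
  unfolding node_factor_def N_def[symmetric] using aF aD that by (intro analytic_intros) (auto simp: N_def)
 have "pole_le (%s. bas k (of_real x - s) (N * s) q) p 1"
 proof (cases "k ~= 1 \<or> th 0 (N * p) q ~= 0")
  case True
  then show ?thesis using pole_le_mono[OF pole_le_analytic[OF aF]] by simp
 next
  case False
  then obtain U where U: "U holomorphic_on UNIV" "!!z. th 0 z q = (z - N * p) * U z" "U (N * p) ~= 0"
   "!!z. th 1 z q = U z + (z - N * p) * deriv U z"
   by (rule_tac th_factor_zero[OF q, of "N * p"]) (blast, rule that, (assumption | blast)+)
  have "U analytic_on {N * p}" using U(1) by (auto simp: analytic_at)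
  then have "(%s. U (N * s)) analytic_on {p}"
   using analytic_on_compose[of "%s. N * s" "{p}" U] by (simp add: o_def analytic_intros)
  then have "pole_le (%s. 1 / th 0 (N * s) q) p 1"
   using N0 U(3) by (intro pole_le_simple[of "%_. 1" p "%s. U (N * s)" N]) (auto simp: U(2) algebra_simps)
  then have "pole_le (%s. th 1 (N * s) q * (1 / th 0 (N * s) q)) p (0 + 1)"
   by (intro pole_le_mult pole_le_analytic) (auto intro!: analytic_intros q)
  moreover have "(%s. th 1 (of_real x - s) q / th 0 (of_real x - s) q - th 1 (of_real x - s + N * s) q / th 0 (of_real x - s + N * s) q) analytic_on {p}"
   using nz by (auto simp: N_def intro!: analytic_intros q)
  ultimately have "pole_le (%s. (th 1 (of_real x - s) q / th 0 (of_real x - s) q - th 1 (of_real x - s + N * s) q / th 0 (of_real x - s + N * s) q)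
    + th 1 (N * s) q * (1 / th 0 (N * s) q)) p 1"
   using pole_le_mono[OF pole_le_analytic] by (intro pole_le_add) auto
  then show ?thesis unfolding bas_cases using False by simp
 qed
 from pole_le_mult[OF pole_le_analytic[OF aD] this]
 show "pole_le (%s. node_factor n s x k q) p 1" by (simp add: node_factor_def N_def)
qed

text \<open>\<open>theta_node\<close> does not see coordinate n + 1, so s can be replaced by 0 and
  the weight is a function of the nome alone.\<close>

definition node_weight :: "nat => real set => real set => complex => complex" where
 "node_weight n R S q = (\<Prod>x\<in>R. theta_node n q x (node_point n 0 S))"

definition node_coefficient :: "nat => real set => (nat \<Rightarrow>\<^sub>0 nat) => complex => complex => complex" where
 "node_coefficient n R \<alpha> s q =
   (\<Sum>\<kappa> | \<kappa> \<in> R \<rightarrow>\<^sub>E {0..n} \<and> exponents R \<kappa> = \<alpha>. \<Prod>x\<in>R. node_factor n s x (\<kappa> x) q)"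

definition interpolated_coefficient :: "nat => (point => complex) => real set => (nat \<Rightarrow>\<^sub>0 nat) => complex => complex => complex" where
 "interpolated_coefficient n f Q \<alpha> s tau = (\<Sum>S | S \<subseteq> Q \<and> card S = n. f (0, node_point n s S, tau) *
   (1 / node_weight n (Q - S) S (nome tau) * node_coefficient n (Q - S) \<alpha> s (nome tau)))"

text \<open>The last condition keeps both z = x - s and z + w off the zeros of theta, so that the
  defining identity can be used there. It refers to a nome and not to tau in order to make sense at
  the cusp.\<close>

definition nodes :: "nat => nat => complex => complex => real set => bool" where
 "nodes n m s q Q \<longleftrightarrow> finite Q \<and> Q \<subseteq> {0<..<1 / (real n + 2)} \<and> card Q = m + n \<and>
   (\<forall>x\<in>Q. th 0 (of_real x - s) q ~= 0 \<and> th 0 (of_real x - s + of_nat (n + 1) * s) q ~= 0)"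

lemma th_real_difference:
 assumes q: "norm q < 1" and "th 0 z q = 0" "th 0 (z + of_real d) q = 0"
 shows "d \<in> \<int>"
proof (cases "q = 0")
 case True
 then have "z \<in> \<int>" "z + of_real d \<in> \<int>" using assms by (simp_all add: th_nome_0_eq_0_iff)
 then have "of_real d \<in> (\<int> :: complex set)" using Ints_diff[of "z + of_real d" z] by simp
 then show ?thesis by (auto elim!: Ints_cases simp: complex_eq_iff)
next
 case False
 then obtain tau where tau: "tau \<in> uhp" "nome tau = q" using nome_surj q by metis
 then have "z \<in> Lat tau" "z + of_real d \<in> Lat tau" using assms th_eq_0_iff by auto
 then have "of_real d \<in> Lat tau" using period_lattice_add[of "- z" tau "z + of_real d"] by simp
 then show ?thesis using real_period_lattice tau by blast
qed

text \<open>Two points of the interval that violate the same condition would differ by an integer,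
  so each condition excludes at most one point.\<close>

lemma nodes_exist:
 assumes q: "norm q < 1"
 obtains Q where "nodes n m s q Q"
proof -
 define I where "I = {0<..<1 / (real n + 2)}"
 define B where "B = (%z. {x \<in> I. th 0 (of_real x + z) q = 0})"
 have fB: "finite (B z)" for z
 proof -
  have "x = y" if "x \<in> B z" "y \<in> B z" for x y
  proof -
   have "0 < x \<and> x < 1 \<and> 0 < y \<and> y < 1" using that node_less_1[of I n] by (auto simp: I_def B_def)
   moreover have "y - x \<in> \<int>"
    by (rule th_real_difference[OF q, of "of_real x + z"]) (use that in \<open>auto simp: B_def algebra_simps\<close>)
   ultimately show ?thesis using small_notin_Ints[of "y - x"] by argo
  qed
  then have "B z \<subseteq> {SOME x. x \<in> B z}" by (metis singletonI someI subsetI)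
  then show ?thesis using finite_subset by blast
 qed
 have "infinite I" unfolding I_def by (intro infinite_Ioo) simp
 then have "infinite (I - (B (- s) \<union> B (- s + of_nat (n + 1) * s)))" using fB by (simp add: Diff_infinite_finite)
 then obtain Q where Q: "finite Q" "card Q = m + n" "Q \<subseteq> I - (B (- s) \<union> B (- s + of_nat (n + 1) * s))"
  using infinite_arbitrarily_large by metis
 have "nodes n m s q Q" unfolding nodes_def
 proof (intro conjI ballI Q(1,2))
  show "Q \<subseteq> {0<..<1 / (real n + 2)}" using Q(3) by (auto simp: I_def)
  fix x assume "x \<in> Q"
  then have "x \<in> I" "x ~: B (- s)" "x ~: B (- s + of_nat (n + 1) * s)" using Q(3) by auto
  then show "th 0 (of_real x - s) q ~= 0" "th 0 (of_real x - s + of_nat (n + 1) * s) q ~= 0"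
   unfolding B_def by (simp_all only: mem_Collect_eq diff_conv_add_uminus add.assoc[symmetric] simp_thms)
 qed
 then show ?thesis by (rule that)
qed

lemma nodes_eventually:
 assumes q: "norm q < 1" and Q: "nodes n m s q Q"
 shows "eventually (%s. nodes n m s q Q) (nhds s)" "eventually (%q. nodes n m s q Q) (nhds q)"
proof -
 note Q' = Q[unfolded nodes_def]
 have "eventually (%s. \<forall>x\<in>Q. th 0 (of_real x - s) q ~= 0 \<and> th 0 (of_real x - s + of_nat (n + 1) * s) q ~= 0) (nhds s)"
  using Q' by (intro eventually_ball_finite ballI eventually_conj analytic_eventually_nonzero analytic_intros q) auto
 then show "eventually (%s. nodes n m s q Q) (nhds s)" by eventually_elim (use Q' in \<open>simp add: nodes_def\<close>)
 have "eventually (%q. \<forall>x\<in>Q. th 0 (of_real x - s) q ~= 0 \<and> th 0 (of_real x - s + of_nat (n + 1) * s) q ~= 0) (nhds q)"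
  using Q' by (intro eventually_ball_finite ballI eventually_conj analytic_eventually_nonzero analytic_th_nome q) auto
 then show "eventually (%q. nodes n m s q Q) (nhds q)" by eventually_elim (use Q' in \<open>simp add: nodes_def\<close>)
qed

lemma node_weight:
 assumes n: "n \<ge> 1" and q: "norm q < 1" and Q: "nodes n m s q Q" and S: "S \<subseteq> Q" "card S = n"
 shows "(%q. 1 / node_weight n (Q - S) S q) analytic_on {q}"
proof -
 have fS: "finite S" and SI: "S \<subseteq> {0<..<1 / (real n + 2)}" using Q S(1) finite_subset by (auto simp: nodes_def)
 have "theta_node n q x (node_point n 0 S) ~= 0" if x: "x \<in> Q - S" for x
 proof (rule node_point_nonzero[OF _ n fS S(2) SI])
  show "x \<in> \<int>" if "th 0 (of_real x) q = 0" for x using th_real_difference[OF q, of 0 x] that q by simp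
 qed (use x Q in \<open>auto simp: nodes_def\<close>)
 then have "node_weight n (Q - S) S q ~= 0" using Q by (simp add: node_weight_def nodes_def)
 moreover have "(%q. node_weight n (Q - S) S q) analytic_on {q}"
  unfolding node_weight_def theta_node_def by (intro analytic_intros analytic_th_nome q)
 ultimately show ?thesis by (intro analytic_intros) auto
qed

section \<open>Expansion of a form in the fundamental forms\<close>

definition expansion :: "nat => nat => (point => complex) => complex => complex => ((nat \<Rightarrow>\<^sub>0 nat) => complex) => bool" where
 "expansion n m f s tau c \<longleftrightarrow> (\<forall>u v. v \<in> V n --> v (n + 1) = s -->
   f (u, v, tau) = (\<Sum>\<alpha>\<in>monomials n m. c \<alpha> * (\<Prod>i=0..n. fundamental n i (u, v, tau) ^ lookup \<alpha> i)))"

lemma expansion_unique: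
 assumes n: "n \<ge> 1" and tau: "tau \<in> uhp" and s: "of_nat (n + 1) * s ~: Lat tau"
  and c: "expansion n m f s tau c" "expansion n m f s tau c'" and \<alpha>: "\<alpha> \<in> monomials n m"
 shows "c \<alpha> = c' \<alpha>"
proof -
 have "c \<alpha> - c' \<alpha> = 0"
 proof (rule fundamental_independent[OF n tau s finite_monomials _ _ \<alpha>, where c = "%\<alpha>. c \<alpha> - c' \<alpha>"])
  fix u v assume "v \<in> V n" "v (n + 1) = s"
  then show "(\<Sum>\<alpha>\<in>monomials n m. (c \<alpha> - c' \<alpha>) * (\<Prod>i=0..n. fundamental n i (u, v, tau) ^ lookup \<alpha> i)) = 0"
   using c[unfolded expansion_def, rule_format, of v u] by (simp add: left_diff_distrib sum_subtractf)
 qed (auto simp: monomials_def)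
 then show ?thesis by simp
qed

text \<open>The computation is made at u = 0. For general u both sides acquire the same factor exp
  (- 2 pi i u)^m, the right-hand side because it is homogeneous of degree m.\<close>

lemma interpolated_coefficient_expansion:
 assumes n: "n \<ge> 1" and f: "f \<in> Jacobi n k l (int m)" and tau: "tau \<in> uhp"
  and s: "of_nat (n + 1) * s ~: Lat tau" and Q: "nodes n m s (nome tau) Q"
 shows "expansion n m f s tau (%\<alpha>. interpolated_coefficient n f Q \<alpha> s tau)"
 unfolding expansion_def
proof (intro allI impI)
 fix u v assume v: "v \<in> V n" "v (n + 1) = s"
 define q where "q = nome tau"
 define w where "w = of_nat (n + 1) * s"
 define y where "y = (%k. fundamental n k (0, v, tau))"
 have Qf: "finite Q" "Q \<subseteq> {0<..<1 / (real n + 2)}" "card Q = m + n" using Q by (auto simp: nodes_def)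
 have x0: "(0, v, tau) \<in> Omega_reg n" using v s tau by (simp add: Omega_reg_def Omega_def)
 have wv: "w = of_nat (n + 1) * v (n + 1)" using v(2) by (simp add: w_def)
 have nd: "theta_node n q x v = (\<Sum>k=0..n. node_factor n s x k q * y k)" if x: "x \<in> Q" for x
 proof -
  define z where "z = of_real x - s"
  have z: "z ~: Lat tau" "z + w ~: Lat tau"
   using Q x by (auto simp: nodes_def th_eq_0_iff[OF tau] z_def w_def)
  have "num n v z q / den n z w q = (\<Sum>k\<le>n. y k * bas k z w q)"
   using fundamental_identity[OF n x0] z unfolding generating_identity_iff[OF n x0 wv] by (simp add: y_def q_def)
  then have "num n v z q = den n z w q * (\<Sum>k=0..n. y k * bas k z w q)"
   using den_nonzero[OF tau z, of n] by (simp add: field_simps q_def atLeast0AtMost)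
  moreover have "theta_node n q x v = num n v z q" by (simp add: theta_node_def num_def z_def v(2)[unfolded One_nat_def add_Suc_right add_0_right])
  ultimately show ?thesis by (simp add: node_factor_def sum_distrib_left z_def w_def mult_ac)
 qed
 have "f (0, v, tau) = (\<Sum>S | S \<subseteq> Q \<and> card S = n. f (0, node_point n s S, tau) *
  (\<Prod>x\<in>Q - S. theta_node n q x v / theta_node n q x (node_point n s S)))"
  unfolding q_def by (rule theta_interpolation[OF n tau Jacobi_theta_level[OF f tau s] Qf]) (use v in \<open>simp add: V_slice_def\<close>)
 also have "\<dots> = (\<Sum>S | S \<subseteq> Q \<and> card S = n. \<Sum>\<alpha>\<in>monomials n m. f (0, node_point n s S, tau) *
   (1 / node_weight n (Q - S) S q * node_coefficient n (Q - S) \<alpha> s q) * (\<Prod>i=0..n. y i ^ lookup \<alpha> i))"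
 proof (intro sum.cong refl)
  fix S assume "S \<in> {S. S \<subseteq> Q \<and> card S = n}"
  then have S: "S \<subseteq> Q" "card S = n" "finite S" using Qf(1) finite_subset by auto
  have c: "finite (Q - S)" "card (Q - S) = m" using card_Diff_subset[OF S(3,1)] S Qf by auto
  have "(\<Prod>x\<in>Q - S. theta_node n q x (node_point n s S)) = node_weight n (Q - S) S q"
   unfolding node_weight_def theta_node_def by (intro prod.cong refl) (auto simp: node_point_def)
  moreover have "(\<Prod>x\<in>Q - S. theta_node n q x v) = (\<Sum>\<alpha>\<in>monomials n m. node_coefficient n (Q - S) \<alpha> s q * (\<Prod>i=0..n. y i ^ lookup \<alpha> i))"
  proof -
   have "(\<Prod>x\<in>Q - S. theta_node n q x v) = (\<Prod>x\<in>Q - S. \<Sum>k=0..n. node_factor n s x k q * y k)"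
    by (intro prod.cong refl nd) auto
   then show ?thesis unfolding node_coefficient_def prod_linear_forms[OF c] .
  qed
  ultimately show "f (0, node_point n s S, tau) * (\<Prod>x\<in>Q - S. theta_node n q x v / theta_node n q x (node_point n s S)) =
    (\<Sum>\<alpha>\<in>monomials n m. f (0, node_point n s S, tau) *
   (1 / node_weight n (Q - S) S q * node_coefficient n (Q - S) \<alpha> s q) * (\<Prod>i=0..n. y i ^ lookup \<alpha> i))"
   by (simp add: prod_dividef sum_distrib_left sum_divide_distrib mult_ac)
 qed
 also have "\<dots> = (\<Sum>\<alpha>\<in>monomials n m. interpolated_coefficient n f Q \<alpha> s tau * (\<Prod>i=0..n. y i ^ lookup \<alpha> i))"
  by (subst sum.swap) (simp add: interpolated_coefficient_def sum_distrib_right q_def)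
 finally have f0: "f (0, v, tau) = (\<Sum>\<alpha>\<in>monomials n m. interpolated_coefficient n f Q \<alpha> s tau * (\<Prod>i=0..n. y i ^ lookup \<alpha> i))" .
 define E where "E = exp (- 2 * of_real pi * \<i> * u)"
 have "f (u, v, tau) = E ^ m * f (0, v, tau)"
 proof -
  have "exp (- 2 * of_real pi * \<i> * of_int (int m) * u) = E ^ m" by (simp add: E_def exp_of_nat_mult[symmetric] mult_ac)
  then show ?thesis using Jacobi_u[OF f, of v tau u] x0 by (simp add: Omega_reg_def)
 qed
 moreover have "(\<Prod>i=0..n. fundamental n i (u, v, tau) ^ lookup \<alpha> i) = E ^ m * (\<Prod>i=0..n. y i ^ lookup \<alpha> i)"
  if \<alpha>: "\<alpha> \<in> monomials n m" for \<alpha>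
 proof -
  have "(\<Prod>i=0..n. fundamental n i (u, v, tau) ^ lookup \<alpha> i) =
    (\<Prod>i=0..n. E ^ lookup \<alpha> i * y i ^ lookup \<alpha> i)"
   by (intro prod.cong refl) (use fundamental_u[OF n, of _ u v tau] in \<open>auto simp: y_def E_def power_mult_distrib[symmetric]\<close>)
  also have "\<dots> = E ^ m * (\<Prod>i=0..n. y i ^ lookup \<alpha> i)"
   using \<alpha> by (simp add: prod.distrib power_sum[symmetric] monomials_def)
  finally show ?thesis .
 qed
 ultimately show "f (u, v, tau) = (\<Sum>\<alpha>\<in>monomials n m. interpolated_coefficient n f Q \<alpha> s tau *
   (\<Prod>i=0..n. fundamental n i (u, v, tau) ^ lookup \<alpha> i))"
  by (simp add: f0 sum_distrib_left mult_ac)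
qed

text \<open>Chosen without reference to nodes. By uniqueness every admissible node set computes it,
  which is what allows the nodes to change from point to point.\<close>

definition Jacobi_coefficient :: "nat => nat => (point => complex) => (nat \<Rightarrow>\<^sub>0 nat) => complex => complex => complex" where
 "Jacobi_coefficient n m f \<alpha> s tau = (SOME c. expansion n m f s tau c) \<alpha>"

lemma Jacobi_expansion:
 assumes "n \<ge> 1" "f \<in> Jacobi n k l (int m)" "tau \<in> uhp" "of_nat (n + 1) * s ~: Lat tau"
 shows "expansion n m f s tau (%\<alpha>. Jacobi_coefficient n m f \<alpha> s tau)"
proof -
 obtain Q where "nodes n m s (nome tau) Q" using nodes_exist[OF norm_nome_less_1[OF assms(3)]] .
 from interpolated_coefficient_expansion[OF assms this] show ?thesis
  unfolding Jacobi_coefficient_def by (rule someI[of "expansion n m f s tau"])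
qed

lemma Jacobi_coefficient_eq:
 assumes "n \<ge> 1" "f \<in> Jacobi n k l (int m)" "tau \<in> uhp" "of_nat (n + 1) * s ~: Lat tau"
  "expansion n m f s tau c" "\<alpha> \<in> monomials n m"
 shows "Jacobi_coefficient n m f \<alpha> s tau = c \<alpha>"
 using expansion_unique[OF assms(1,3,4) Jacobi_expansion[OF assms(1-4)] assms(5,6)] .

lemma Jacobi_coefficient_interpolated:
 assumes "n \<ge> 1" "f \<in> Jacobi n k l (int m)" "tau \<in> uhp" "of_nat (n + 1) * s ~: Lat tau"
  "nodes n m s (nome tau) Q" "\<alpha> \<in> monomials n m"
 shows "Jacobi_coefficient n m f \<alpha> s tau = interpolated_coefficient n f Q \<alpha> s tau"
 by (rule Jacobi_coefficient_eq[OF assms(1-4) interpolated_coefficient_expansion[OF assms(1-5)] assms(6)])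

section \<open>The coefficients are Jacobi forms of index 0\<close>

lemma eventually_bounded_sum:
 fixes g :: "'a => 'b => complex"
 assumes "finite I" "!!i. i \<in> I ==> \<exists>B. eventually (%x. norm (g i x) \<le> B) F"
 shows "\<exists>B. eventually (%x. norm (\<Sum>i\<in>I. g i x) \<le> B) F"
proof -
 obtain B where B: "!!i. i \<in> I ==> eventually (%x. norm (g i x) \<le> B i) F" using assms(2) by metis
 have "eventually (%x. \<forall>i\<in>I. norm (g i x) \<le> B i) F" using assms(1) B by (simp add: eventually_ball_finite)
 then have "eventually (%x. norm (\<Sum>i\<in>I. g i x) \<le> sum B I) F"
  by eventually_elim (rule order.trans[OF norm_sum sum_mono], simp)
 then show ?thesis ..
qed

lemma power_int_sum: "x ~= 0 ==> (\<Prod>i\<in>I. x powi g i) = (x :: complex) powi (\<Sum>i\<in>I. g i)"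
 by (induction I rule: infinite_finite_induct) (auto simp: power_int_add)

lemma node_coefficient_nome:
 assumes n: "n \<ge> 1" and q: "norm q < 1" and Q: "nodes n m s q Q" and s: "th 0 (of_nat (n + 1) * s) q ~= 0"
  and S: "S \<subseteq> Q" "card S = n"
 shows "(%q. 1 / node_weight n (Q - S) S q * node_coefficient n (Q - S) \<alpha> s q) analytic_on {q}"
 unfolding node_coefficient_def
 by (intro analytic_on_mult node_weight[OF n q Q S] analytic_on_sum analytic_on_prod analytic_node_factor_nome q s)
   (use Q in \<open>auto simp: nodes_def\<close>)

text \<open>A translation by vectors supported on coordinate n + 1 carries the slice of s to that of
  s + b tau + a and preserves f and the fundamental forms. So the coefficients of the second slice
  also expand f on the first one, and uniqueness applies.\<close>

lemma Jacobi_coefficient_trans: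
 assumes n: "n \<ge> 1" and f: "f \<in> Jacobi n k l (int m)" and \<alpha>: "\<alpha> \<in> monomials n m"
  and tau: "tau \<in> uhp" and s: "of_nat (n + 1) * s ~: Lat tau" and ab: "a \<in> \<int>" "b \<in> \<int>"
 shows "Jacobi_coefficient n m f \<alpha> (s + b * tau + a) tau = Jacobi_coefficient n m f \<alpha> s tau"
proof (rule Jacobi_coefficient_eq[OF n f tau s _ \<alpha>, symmetric])
 define e :: "complex => nat => complex" where "e = (%t i. if i = n + 1 then t else 0)"
 have eL: "e t \<in> L n" if "t \<in> \<int>" for t using that by (simp add: L_def V_def e_def)
 have "of_nat (n + 1) * (s + b * tau + a) = of_nat (n + 1) * s + (of_nat (n + 1) * a + of_nat (n + 1) * b * tau)"
  by (simp add: algebra_simps)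
 moreover have "of_nat (n + 1) * a + of_nat (n + 1) * b * tau \<in> Lat tau"
  by (intro Ints_lattice_mem Ints_mult ab Ints_of_nat)
 ultimately have s': "of_nat (n + 1) * (s + b * tau + a) ~: Lat tau" using s period_lattice_add_iff by metis
 show "expansion n m f s tau (%\<alpha>. Jacobi_coefficient n m f \<alpha> (s + b * tau + a) tau)"
  unfolding expansion_def
 proof (intro allI impI)
  fix u v assume v: "v \<in> V n" "v (n + 1) = s"
  then have x: "(u, v, tau) \<in> Omega n" using tau by (simp add: Omega_def)
  obtain u' v' where act: "act_trans n (e b) (e a) (u, v, tau) = (u', v', tau)" by simp
  have "(u', v', tau) \<in> Omega n" using reg_trans(1)[OF eL[OF ab(2)] eL[OF ab(1)] x] act by simp
  then have v': "v' \<in> V n" by (simp add: Omega_def)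
  have "v' (n + 1) = s + b * tau + a" using act v(2) by (auto simp: e_def)
  then show "f (u, v, tau) = (\<Sum>\<alpha>\<in>monomials n m. Jacobi_coefficient n m f \<alpha> (s + b * tau + a) tau *
    (\<Prod>i=0..n. fundamental n i (u, v, tau) ^ lookup \<alpha> i))"
   using Jacobi_expansion[OF n f tau s', unfolded expansion_def, rule_format, OF v', of u']
    Jacobi_trans[OF f eL[OF ab(2)] eL[OF ab(1)] x] fundamental_trans[OF n eL[OF ab(2)] eL[OF ab(1)] x]
   unfolding act by simp
 qed
qed

text \<open>Uniqueness again. The i-th fundamental form has weight - i, so the coefficient of a
  monomial makes up for the weight of the monomial.\<close>

lemma Jacobi_coefficient_SL2:
 assumes n: "n \<ge> 1" and f: "f \<in> Jacobi n k l (int m)" and \<alpha>: "\<alpha> \<in> monomials n m"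
  and tau: "tau \<in> uhp" and s: "of_nat (n + 1) * s ~: Lat tau" and det: "a * d - b * c = 1"
 shows "Jacobi_coefficient n m f \<alpha> (s / (of_int c * tau + of_int d)) ((of_int a * tau + of_int b) / (of_int c * tau + of_int d)) =
  (of_int c * tau + of_int d) powi (k + (\<Sum>i=0..n. int i * int (lookup \<alpha> i))) * Jacobi_coefficient n m f \<alpha> s tau"
proof -
 interpret modular_substitution a b c d tau using tau det by unfold_locales
 define wt where "wt = (%\<alpha>. \<Sum>i=0..n. int i * int (lookup \<alpha> i))"
 define C where "C = (%\<alpha>. Jacobi_coefficient n m f \<alpha> (s / j) tau')"
 have s': "of_nat (n + 1) * (s / j) ~: Lat tau'" using lattice_iff[of "of_nat (n + 1) * s"] s by simp
 have "expansion n m f s tau (%\<alpha>. j powi (- k - wt \<alpha>) * C \<alpha>)"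
  unfolding expansion_def
 proof (intro allI impI)
  fix u v assume v: "v \<in> V n" "v (n + 1) = s"
  then have x: "(u, v, tau) \<in> Omega n" using tau by (simp add: Omega_def)
  obtain u' v' where act: "act_SL2 n a b c d (u, v, tau) = (u', v', tau')" by (simp add: tau'_def j_def)
  have "(u', v', tau') \<in> Omega n" using reg_SL2(1)[OF x] act by simp
  then have v': "v' \<in> V n" by (simp add: Omega_def)
  have v's: "v' (n + 1) = s / j" using act v(2) by (auto simp: j_def)
  have "f (u', v', tau') = (\<Sum>\<alpha>\<in>monomials n m. C \<alpha> * (\<Prod>i=0..n. fundamental n i (u', v', tau') ^ lookup \<alpha> i))"
   using Jacobi_expansion[OF n f tau'_uhp s', unfolded expansion_def, rule_format, OF v' v's, of u'] by (simp add: C_def)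
  moreover have "(\<Prod>i=0..n. fundamental n i (u', v', tau') ^ lookup \<alpha> i) =
    j powi (- wt \<alpha>) * (\<Prod>i=0..n. fundamental n i (u, v, tau) ^ lookup \<alpha> i)" for \<alpha>
  proof -
   have "(\<Prod>i=0..n. fundamental n i (u', v', tau') ^ lookup \<alpha> i) =
     (\<Prod>i=0..n. j powi (- (int i * int (lookup \<alpha> i))) * fundamental n i (u, v, tau) ^ lookup \<alpha> i)"
   proof (intro prod.cong refl)
    fix i assume "i \<in> {0..n}"
    then have "fundamental n i (u', v', tau') = j powi (- int i) * fundamental n i (u, v, tau)"
     using fundamental_SL2[OF n _ x, of i] act by simp
    moreover have "(j powi (- int i)) ^ e = j powi (- (int i * int e))" for e
     using power_int_mult[of j "- int i" "int e"] by simp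
    ultimately show "fundamental n i (u', v', tau') ^ lookup \<alpha> i =
      j powi (- (int i * int (lookup \<alpha> i))) * fundamental n i (u, v, tau) ^ lookup \<alpha> i"
     by (simp add: power_mult_distrib)
   qed
   then show ?thesis by (simp add: prod.distrib power_int_sum wt_def sum_negf)
  qed
  moreover have "f (u, v, tau) = j powi (- k) * f (u', v', tau')"
   using Jacobi_SL2[OF f det x] unfolding act by (simp add: j_def[symmetric] power_int_minus)
  ultimately show "f (u, v, tau) = (\<Sum>\<alpha>\<in>monomials n m. j powi (- k - wt \<alpha>) * C \<alpha> *
    (\<Prod>i=0..n. fundamental n i (u, v, tau) ^ lookup \<alpha> i))"
   by (simp add: sum_distrib_left power_int_add[of j "- k" "- wt _", simplified] mult_ac)
 qed
 from Jacobi_coefficient_eq[OF n f tau s this \<alpha>]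
 have "Jacobi_coefficient n m f \<alpha> s tau = j powi (- k - wt \<alpha>) * C \<alpha>" .
 then have "j powi (k + wt \<alpha>) * Jacobi_coefficient n m f \<alpha> s tau = (j powi (k + wt \<alpha>) * j powi (- k - wt \<alpha>)) * C \<alpha>" by simp
 also have "j powi (k + wt \<alpha>) * j powi (- k - wt \<alpha>) = 1" by (simp add: power_int_add[symmetric])
 finally show ?thesis by (simp add: C_def j_def tau'_def wt_def)
qed

text \<open>The values of f at the node points have poles of order at most l + 2 m, and each of the
  m factors \<open>node_factor\<close> adds at most one; this gives l + 3 m. For each regularity
  statement nodes are chosen at the point in question, the nome 0 in the case of the cusp, and used
  in a neighbourhood of it.\<close>

lemma Jacobi_coefficient_Jacobi:
 assumes n: "n \<ge> 1" and f: "f \<in> Jacobi n k l (int m)" and \<alpha>: "\<alpha> \<in> monomials n m"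
 shows "index0_form n (Jacobi_coefficient n m f \<alpha>) \<in>
  Jacobi n (k + (\<Sum>i=0..n. int i * int (lookup \<alpha> i))) (l + 3 * int m) 0"
proof (rule index0_form_Jacobi[OF Jacobi_coefficient_trans[OF n f \<alpha>] Jacobi_coefficient_SL2[OF n f \<alpha>]])
 define N where "N = (of_nat (n + 1) :: complex)"
 have N0: "N ~= 0" unfolding N_def of_nat_eq_0_iff by simp
 have fin: "finite {S. S \<subseteq> Q \<and> card S = n}" if "nodes n m s q Q" for s q Q using that by (simp add: nodes_def)
 have NV: "node_point n s S \<in> V n" if "nodes n m s' q Q" "S \<subseteq> Q" "card S = n" for s s' q S Q
  using node_point_V[of S n s] that finite_subset[of S Q] by (simp add: nodes_def V_slice_def)
 {
  fix s assume s: "of_nat (n + 1) * s ~: (\<int> :: complex set)"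
  \<comment> \<open>The filter Im tau -> infinity; properties that hold near the nome 0 hold
    eventually along it.\<close>
  define F where "F = filtercomap Im at_top"
  have uhp: "eventually (%tau. tau \<in> uhp) F"
   unfolding F_def eventually_filtercomap_at_top_dense upper_half_plane_iff by blast
  have nm: "eventually (%tau. P (nome tau)) F" if "eventually P (nhds 0)" for P
   using eventually_nome_near_0[OF that] unfolding F_def eventually_filtercomap_at_top_dense by metis
  obtain Q where Q: "nodes n m s 0 Q" using nodes_exist[of "0 :: complex", unfolded norm_zero, OF zero_less_one] .
  have s0: "th 0 (of_nat (n + 1) * s) 0 ~= 0" using s by (simp add: th_nome_0_eq_0_iff)
  have "\<exists>B. eventually (%tau. norm (interpolated_coefficient n f Q \<alpha> s tau) \<le> B) F"
   unfolding interpolated_coefficient_def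
  proof (rule eventually_bounded_sum[OF fin[OF Q]])
   fix S assume "S \<in> {S. S \<subseteq> Q \<and> card S = n}"
   then have S: "S \<subseteq> Q" "card S = n" by auto
   define G where "G = (%q. 1 / node_weight n (Q - S) S q * node_coefficient n (Q - S) \<alpha> s q)"
   have "G analytic_on {0}" unfolding G_def by (rule node_coefficient_nome[OF n _ Q s0 S]) simp
   from nm[OF analytic_locally_bounded[OF this]] have 1: "eventually (%tau. norm (G (nome tau)) \<le> norm (G 0) + 1) F" .
   have nV: "node_point n s S \<in> V n" by (rule NV[OF Q S])
   obtain \<epsilon> Y B where *: "\<epsilon> > 0" "\<forall>v'\<in>V n. \<forall>tau. v' (n+1) = node_point n s S (n+1) \<and> (\<forall>i<n. dist (v' i) (node_point n s S i) < \<epsilon>) \<and>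
     tau \<in> uhp \<and> Im tau > Y --> norm (f (0, v', tau)) \<le> B"
    using Jacobi_bounded[OF f nV, of 0] by blast
   then have "tau \<in> uhp ==> Im tau > Y ==> norm (f (0, node_point n s S, tau)) \<le> B" for tau
    using nV by simp
   then have "eventually (%tau. tau \<in> uhp --> norm (f (0, node_point n s S, tau)) \<le> B) F"
    unfolding F_def eventually_filtercomap_at_top_dense by blast
   with 1 uhp have "eventually (%tau. norm (f (0, node_point n s S, tau) * G (nome tau)) \<le> \<bar>B\<bar> * (norm (G 0) + 1)) F"
    by eventually_elim (auto simp: norm_mult intro!: mult_mono)
   then show "\<exists>B. eventually (%tau. norm (f (0, node_point n s S, tau) *
     (1 / node_weight n (Q - S) S (nome tau) * node_coefficient n (Q - S) \<alpha> s (nome tau))) \<le> B) F"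
    unfolding G_def by blast
  qed
  then obtain B where "eventually (%tau. norm (interpolated_coefficient n f Q \<alpha> s tau) \<le> B) F" by blast
  moreover have "eventually (%tau. nodes n m s (nome tau) Q) F" using nm[OF nodes_eventually(2)[OF _ Q]] by simp
  ultimately have "eventually (%tau. tau \<in> uhp --> of_nat (n+1) * s ~: Lat tau -->
    norm (Jacobi_coefficient n m f \<alpha> s tau) \<le> B) F"
   by eventually_elim (simp add: Jacobi_coefficient_interpolated[OF n f _ _ _ \<alpha>])
  then show "\<exists>Y B. \<forall>tau. tau \<in> uhp --> of_nat (n+1) * s ~: Lat tau --> Im tau > Y -->
    norm (Jacobi_coefficient n m f \<alpha> s tau) \<le> B"
   unfolding F_def eventually_filtercomap_at_top_dense by blast
 next
  fix tau p assume tau: "tau \<in> uhp"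
  define D where "D = {s. of_nat (n + 1) * s \<in> Lat tau}"
  have clD: "closed D" unfolding D_def by (rule closed_divisor[OF tau])
  have q: "norm (nome tau) < 1" using tau by simp
  obtain Q where Q: "nodes n m p (nome tau) Q" using nodes_exist[OF q] .
  have Qf: "finite Q" "card Q = m + n" using Q by (auto simp: nodes_def)
  have eq: "Jacobi_coefficient n m f \<alpha> s tau = interpolated_coefficient n f Q \<alpha> s tau"
   if "s ~: D" "nodes n m s (nome tau) Q" for s
   using Jacobi_coefficient_interpolated[OF n f tau _ that(2) \<alpha>] that(1) by (simp add: D_def)
  have nf: "th 0 (of_real x - p) (nome tau) ~= 0" "th 0 (of_real x - p + of_nat (n + 1) * p) (nome tau) ~= 0" if "x \<in> Q" for x
   using Q that by (auto simp: nodes_def)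
  have pb: "poles_bounded (%s. f (0, node_point n s S, tau)) D (l + 2 * int m)" if "S \<subseteq> Q" "card S = n" for S
   using Jacobi_poles[OF f, of 0 "node_point n 0 S" tau] NV[OF Q that] tau
   by (simp only: node_point_update[symmetric]) (simp add: Omega_def D_def)
  {
   assume "of_nat (n + 1) * p ~: Lat tau"
   then have p: "p ~: D" "th 0 (of_nat (n + 1) * p) (nome tau) ~= 0" by (auto simp: D_def th_eq_0_iff[OF tau])
   have "eventually (%s. s \<in> - D) (nhds p)" using clD p by (intro eventually_nhds_in_open) auto
   then have "eventually (%s. Jacobi_coefficient n m f \<alpha> s tau = interpolated_coefficient n f Q \<alpha> s tau) (nhds p)"
    using nodes_eventually(1)[OF q Q] by eventually_elim (simp add: eq)
   moreover have "(%s. interpolated_coefficient n f Q \<alpha> s tau) analytic_on {p}"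
    unfolding interpolated_coefficient_def node_coefficient_def
    by (intro analytic_on_sum analytic_on_mult analytic_on_prod analytic_on_const
      poles_bounded_imp_analytic[OF pb clD p(1)] pole_le_node_factor(1)[OF q nf p(2)]) auto
   ultimately show "(%s. Jacobi_coefficient n m f \<alpha> s tau) analytic_on {p}" by (rule analytic_at_transform)
  }
  {
   assume "of_nat (n + 1) * p \<in> Lat tau"
   then have p: "p \<in> D" by (simp add: D_def)
   have "filterlim (%s. N * s) (at (N * p)) (at p)"
    using N0 by (intro filterlim_atI tendsto_intros) (auto simp: eventually_at_filter)
   then have "eventually (%s. s ~: D) (at p)"
    using eventually_notin_period_lattice[OF tau, of "N * p"] unfolding filterlim_iff D_def N_def by auto
   moreover have "eventually (%s. nodes n m s (nome tau) Q) (at p)"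
    using nodes_eventually(1)[OF q Q] by (simp add: eventually_nhds_conv_at)
   ultimately have "eventually (%s. Jacobi_coefficient n m f \<alpha> s tau = interpolated_coefficient n f Q \<alpha> s tau) (at p)"
    by eventually_elim (simp add: eq)
   moreover have "pole_le (%s. interpolated_coefficient n f Q \<alpha> s tau) p (l + 3 * int m)"
    unfolding interpolated_coefficient_def
   proof (rule pole_le_sum[OF fin[OF Q]])
    fix S assume "S \<in> {S. S \<subseteq> Q \<and> card S = n}"
    then have S: "S \<subseteq> Q" "card S = n" "finite S" using Qf finite_subset by auto
    have c: "card (Q - S) = m" using card_Diff_subset[OF S(3,1)] S Qf by simp
    have "finite ((Q - S) \<rightarrow>\<^sub>E {0..n})" using Qf by (intro finite_PiE) auto
    then have "pole_le (%s. node_coefficient n (Q - S) \<alpha> s (nome tau)) p (\<Sum>x\<in>Q - S. 1)"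
     unfolding node_coefficient_def using Qf
     by (intro pole_le_sum pole_le_prod pole_le_node_factor(2)[OF q nf]) auto
    then have "pole_le (%s. f (0, node_point n s S, tau) *
      (1 / node_weight n (Q - S) S (nome tau) * node_coefficient n (Q - S) \<alpha> s (nome tau))) p (l + 2 * int m + (0 + (\<Sum>x\<in>Q - S. 1)))"
     by (intro pole_le_mult poles_bounded_imp_pole_le[OF pb p] S pole_le_analytic) auto
    then show "pole_le (%s. f (0, node_point n s S, tau) *
      (1 / node_weight n (Q - S) S (nome tau) * node_coefficient n (Q - S) \<alpha> s (nome tau))) p (l + 3 * int m)"
     by (simp add: c add.commute)
   qed
   ultimately show "pole_le (%s. Jacobi_coefficient n m f \<alpha> s tau) p (l + 3 * int m)"
    by (rule pole_le_cong[rotated])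
  }
 next
  fix tau s assume tau: "tau \<in> uhp" and s: "of_nat (n + 1) * s ~: Lat tau"
  define H where "H = {tau \<in> uhp. of_nat (n + 1) * s ~: Lat tau}"
  have q: "norm (nome tau) < 1" using tau by simp
  obtain Q where Q: "nodes n m s (nome tau) Q" using nodes_exist[OF q] .
  have s0: "th 0 (of_nat (n + 1) * s) (nome tau) ~= 0" using s th_eq_0_iff[OF tau] by simp
  have an: "nome analytic_on {tau}" using analytic_nome[of "%x. x" "{tau}"] by (simp add: analytic_intros)
  have lim: "filterlim nome (nhds (nome tau)) (nhds tau)"
   using analytic_at_imp_isCont[OF an] by (simp add: continuous_within tendsto_at_iff_tendsto_nhds)
  have "eventually (%tau. Im tau > 0) (nhds tau)"
   using tau eventually_nhds_in_open[of "{z. Im z > 0}" tau] by (simp add: open_halfspace_Im_gt upper_half_plane_iff)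
  moreover have "eventually (%tau. th 0 (of_nat (n + 1) * s) (nome tau) ~= 0) (nhds tau)"
   using analytic_eventually_nonzero[OF analytic_th_nome[OF q] s0] lim eventually_compose_filterlim by blast
  ultimately have H: "eventually (%tau. tau \<in> H) (nhds tau)"
   by eventually_elim (simp add: H_def upper_half_plane_iff th_eq_0_iff)
  have "eventually (%tau. nodes n m s (nome tau) Q) (nhds tau)"
   using nodes_eventually(2)[OF q Q] lim eventually_compose_filterlim by blast
  with H have "eventually (%tau. Jacobi_coefficient n m f \<alpha> s tau = interpolated_coefficient n f Q \<alpha> s tau) (nhds tau)"
   by eventually_elim (simp add: Jacobi_coefficient_interpolated[OF n f _ _ _ \<alpha>] H_def)
  moreover have "(%tau. interpolated_coefficient n f Q \<alpha> s tau) analytic_on {tau}"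
   unfolding interpolated_coefficient_def
  proof (rule analytic_on_sum)
   fix S assume "S \<in> {S. S \<subseteq> Q \<and> card S = n}"
   then have S: "S \<subseteq> Q" "card S = n" by auto
   obtain U where U: "open U" "tau \<in> U" "U \<subseteq> H" using H unfolding eventually_nhds by (auto simp: subset_iff)
   have "(%tau. f (0, node_point n s S, tau)) holomorphic_on H"
    using Jacobi_holomorphic_tau[OF f NV[OF Q S], of 0] by (simp add: H_def node_point_def)
   then have af: "(%tau. f (0, node_point n s S, tau)) analytic_on {tau}"
    using U holomorphic_on_subset unfolding analytic_at by blast
   have "(%q. 1 / node_weight n (Q - S) S q * node_coefficient n (Q - S) \<alpha> s q) analytic_on {nome tau}"
    by (rule node_coefficient_nome[OF n q Q s0 S])
   then have "(%tau. 1 / node_weight n (Q - S) S (nome tau) * node_coefficient n (Q - S) \<alpha> s (nome tau)) analytic_on {tau}"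
    using analytic_on_compose[OF an, of "%q. 1 / node_weight n (Q - S) S q * node_coefficient n (Q - S) \<alpha> s q"]
    by (simp add: o_def)
   from analytic_on_mult[OF af this]
   show "(%tau. f (0, node_point n s S, tau) *
     (1 / node_weight n (Q - S) S (nome tau) * node_coefficient n (Q - S) \<alpha> s (nome tau))) analytic_on {tau}" .
  qed
  ultimately show "Jacobi_coefficient n m f \<alpha> s analytic_on {tau}" by (rule analytic_at_transform)
 }
qed

section \<open>The algebra of Jacobi forms is a polynomial algebra\<close>

lemma Jacobi_zero_index: "f \<in> Jacobi n k l m ==> (%_. 0) \<in> Jacobi n k l m"
 using Jacobi_mult[OF Jacobi_zero[of n 0 0], of f k l m] by simp

lemma Jacobi_sum_single: "f \<in> Jacobi n k l m ==> (k, l, m) \<in> D ==> f \<in> Jacobi_sum n D"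
 unfolding Jacobi_sum_def by (intro CollectI exI[of _ "{(k, l, m)}"] exI[of _ "%_. f"]) auto

lemma Jacobi_sum_zero: "(%_. 0) \<in> Jacobi_sum n D"
 unfolding Jacobi_sum_def by (intro CollectI exI[of _ "{}"]) auto

lemma Jacobi_sumE:
 assumes "h \<in> Jacobi_sum n D"
 obtains I g where "finite I" "I \<subseteq> D" "!!k l m. (k, l, m) \<in> I ==> g (k, l, m) \<in> Jacobi n k l m" "!!x. h x = (\<Sum>d\<in>I. g d x)"
proof -
 obtain I g where *: "finite I \<and> I \<subseteq> D \<and> (\<forall>(k, l, m)\<in>I. g (k, l, m) \<in> Jacobi n k l m)" "h = (%x. \<Sum>d\<in>I. g d x)"
  using assms unfolding Jacobi_sum_def by blast
 show ?thesis by (rule that[of I g]) (use * in auto)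
qed

lemma Jacobi_sum_add:
 assumes f: "f \<in> Jacobi_sum n D" and g: "g \<in> Jacobi_sum n D"
 shows "(%x. f x + g x) \<in> Jacobi_sum n D"
proof -
 obtain I F where 1: "finite I" "I \<subseteq> D" "!!k l m. (k, l, m) \<in> I ==> F (k, l, m) \<in> Jacobi n k l m" "!!x. f x = (\<Sum>d\<in>I. F d x)"
  by (rule Jacobi_sumE[OF f]) (rule that, (assumption | blast)+)
 obtain J G where 2: "finite J" "J \<subseteq> D" "!!k l m. (k, l, m) \<in> J ==> G (k, l, m) \<in> Jacobi n k l m" "!!x. g x = (\<Sum>d\<in>J. G d x)"
  by (rule Jacobi_sumE[OF g]) (rule that, (assumption | blast)+)
 define H where "H = (%d x. (if d \<in> I then F d x else 0) + (if d \<in> J then G d x else 0))"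
 have "H (k, l, m) \<in> Jacobi n k l m" if d: "(k, l, m) \<in> I \<union> J" for k l m
 proof -
  have "\<exists>f. f \<in> Jacobi n k l m" using d 1(3) 2(3) by blast
  then have "(%_. 0) \<in> Jacobi n k l m" using Jacobi_zero_index by blast
  then have "(%x. if (k, l, m) \<in> I then F (k, l, m) x else 0) \<in> Jacobi n k l m"
   "(%x. if (k, l, m) \<in> J then G (k, l, m) x else 0) \<in> Jacobi n k l m"
   using 1(3)[of k l m] 2(3)[of k l m] by (cases "(k, l, m) \<in> I"; cases "(k, l, m) \<in> J"; simp)+
  then show ?thesis unfolding H_def by (rule Jacobi_add)
 qed
 moreover have "f x + g x = (\<Sum>d\<in>I \<union> J. H d x)" for x
 proof -
  have "(\<Sum>d\<in>I \<union> J. if d \<in> I then F d x else 0) = f x" "(\<Sum>d\<in>I \<union> J. if d \<in> J then G d x else 0) = g x"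
   unfolding 1(4) 2(4) using 1(1) 2(1) by (simp_all add: sum.If_cases Int_absorb1 Int_commute)
  then show ?thesis by (simp add: H_def sum.distrib)
 qed
 ultimately show ?thesis unfolding Jacobi_sum_def using 1(1,2) 2(1,2)
  by (intro CollectI exI[of _ "I \<union> J"] exI[of _ H]) auto
qed

lemma Jacobi_sum_sum:
 "finite A ==> (!!a. a \<in> A ==> h a \<in> Jacobi_sum n D) ==> (%x. \<Sum>a\<in>A. h a x) \<in> Jacobi_sum n D"
 by (induction rule: finite_induct) (simp_all add: Jacobi_sum_zero Jacobi_sum_add)

lemma Jacobi_mult_monomial:
 assumes n: "n \<ge> 1" and g: "g \<in> Jacobi n k l m" and I: "finite I" "I \<subseteq> {0..n}"
 shows "\<exists>k l m. (%x. g x * (\<Prod>i\<in>I. fundamental n i x ^ e i)) \<in> Jacobi n k l m"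
 using I
proof (induction rule: finite_induct)
 case (insert i I)
 have "\<exists>k l m. (%x. g x * (\<Prod>i\<in>I. fundamental n i x ^ e i) * fundamental n i x ^ r) \<in> Jacobi n k l m" for r
 proof (induction r)
  case (Suc r)
  then obtain k l m where "(%x. g x * (\<Prod>i\<in>I. fundamental n i x ^ e i) * fundamental n i x ^ r) \<in> Jacobi n k l m" by blast
  from Jacobi_mult[OF this fundamental_Jacobi[OF n, of i]] insert.prems show ?case by (auto simp: mult_ac)
 qed (use insert in auto)
 from this[of "e i"] show ?case using insert.hyps by (simp add: mult_ac)
qed (use g in auto)

text \<open>In index 0 only the monomial of degree 0 occurs, so the form equals its coefficient and
  depends on v (n + 1) and tau alone.\<close>

lemma Jacobi_index0_value:
 assumes n: "n \<ge> 1" and f: "f \<in> Jacobi n k l 0" and x: "(u, v, tau) \<in> Omega_reg n"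
 shows "f (u, v, tau) = Jacobi_coefficient n 0 f 0 (v (n + 1)) tau"
proof -
 have "monomials n 0 = {0}"
  by (auto simp: monomials_def intro!: poly_mapping_eqI) (metis atLeastAtMost_iff in_keys_iff subsetD zero_le)
 moreover have "tau \<in> uhp" "v \<in> V n" "of_nat (n + 1) * v (n + 1) ~: Lat tau"
  using x by (auto simp: Omega_reg_def Omega_def)
 ultimately show ?thesis using Jacobi_expansion[OF n, of f k l 0 tau "v (n + 1)"] f by (simp add: expansion_def)
qed

lemma Jacobi_index0_eq:
 assumes n: "n \<ge> 1" and f: "f \<in> Jacobi_index0 n"
  and x: "(u, v, tau) \<in> Omega_reg n" "(u', v', tau) \<in> Omega_reg n" "v (n + 1) = v' (n + 1)"
 shows "f (u, v, tau) = f (u', v', tau)"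
proof -
 obtain I g where I: "finite I" "I \<subseteq> {(k, l, m). m = 0}" "!!k l m. (k, l, m) \<in> I ==> g (k, l, m) \<in> Jacobi n k l m" "!!x. f x = (\<Sum>d\<in>I. g d x)"
  by (rule Jacobi_sumE[OF f[unfolded Jacobi_index0_def]]) (rule that, (assumption | blast)+)
 show ?thesis unfolding I(4)
 proof (rule sum.cong[OF refl])
  fix d assume d: "d \<in> I"
  obtain k l where kl: "d = (k, l, 0)" using d I(2) by auto
  then have "g d \<in> Jacobi n k l 0" using I(3) d by auto
  then show "g d (u, v, tau) = g d (u', v', tau)" using Jacobi_index0_value[OF n _ x(1)] Jacobi_index0_value[OF n _ x(2)] x(3) by metis
 qed
qed

text \<open>F is built from the values of f at the vectors \<open>e s\<close>, whose coordinates up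
  to n are 0; translations supported on coordinate n + 1 give its periods. On the divisor these
  values are 0 by convention, so \<open>remove_sings\<close> puts the correct values or poles there
  and keeps the periodicity.\<close>

lemma Jacobi_index0_elliptic:
 assumes n: "n \<ge> 1" and f: "f \<in> Jacobi_index0 n"
 shows "\<exists>F. (\<forall>(u, v, tau)\<in>Omega_reg n. f (u, v, tau) = F (v (n+1)) tau) \<and> (\<forall>tau\<in>uhp. elliptic tau (%s. F s tau))"
proof -
 obtain I g where I: "finite I" "I \<subseteq> {(k, l, m). m = 0}" "!!k l m. (k, l, m) \<in> I ==> g (k, l, m) \<in> Jacobi n k l m" "!!x. f x = (\<Sum>d\<in>I. g d x)"
  by (rule Jacobi_sumE[OF f[unfolded Jacobi_index0_def]]) (rule that, (assumption | blast)+)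
 have I0: "\<exists>k l. g d \<in> Jacobi n k l 0" if d: "d \<in> I" for d
 proof -
  obtain k l m where klm: "d = (k, l, m)" by (cases d)
  then have "m = 0" using I(2) d by auto
  then show ?thesis using I(3)[of k l m] d klm by auto
 qed
 define e :: "complex => nat => complex" where "e = (%t i. if i = n + 1 then t else 0)"
 have eV: "e t \<in> V n" for t by (simp add: V_def e_def)
 have e_upd: "(e 0)(n + 1 := s) = e s" for s by (auto simp: e_def)
 define h where "h = (%s tau. f (0, e s, tau))"
 define D where "D = (%tau. {s. of_nat (n + 1) * s \<in> Lat tau})"
 have pb: "\<exists>N. poles_bounded (%s. g d (0, e s, tau)) (D tau) N" if d: "d \<in> I" and tau: "tau \<in> uhp" for d tau
 proof -
  obtain k l where kl: "g d \<in> Jacobi n k l 0" using I0[OF d] by blast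
  show ?thesis using Jacobi_poles[OF kl, of 0 "e 0" tau] eV[of 0] tau unfolding e_upd D_def by (auto simp: Omega_def)
 qed
 have periodic: "h (s + \<omega>) tau = h s tau" if tau: "tau \<in> uhp" and "\<omega> \<in> Lat tau" for s \<omega> tau
 proof -
  obtain a b where \<omega>: "\<omega> = of_int a + of_int b * tau" using \<open>\<omega> \<in> Lat tau\<close> by (auto simp: period_lattice_def)
  have eL: "e (of_int t) \<in> L n" for t by (simp add: L_def V_def e_def)
  have O: "(u, e s, tau) \<in> Omega n" for u s using eV tau by (simp add: Omega_def)
  have "g d (0, e (s + \<omega>), tau) = g d (0, e s, tau)" if d: "d \<in> I" for d
  proof -
   obtain k l where kl: "g d \<in> Jacobi n k l 0" using I0[OF d] by blast
   have "(%i. e s i + e (of_int b) i * tau + e (of_int a) i) = e (s + \<omega>)" by (auto simp: e_def \<omega>)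
   then obtain u where "act_trans n (e (of_int b)) (e (of_int a)) (0, e s, tau) = (u, e (s + \<omega>), tau)" by simp
   then have "g d (u, e (s + \<omega>), tau) = g d (0, e s, tau)" using Jacobi_trans[OF kl eL eL O] by metis
   then show ?thesis using Jacobi_u[OF kl O, of u] by simp
  qed
  then show ?thesis by (simp add: h_def I(4))
 qed
 show ?thesis
 proof (intro exI[of _ "%s tau. remove_sings (%s. h s tau) s"] conjI ballI, clarify)
  fix u v tau assume x: "(u, v, tau) \<in> Omega_reg n"
  then have tau: "tau \<in> uhp" and s: "v (n + 1) ~: D tau" by (auto simp: Omega_reg_def Omega_def D_def)
  have clD: "closed (D tau)" unfolding D_def by (rule closed_divisor[OF tau])
  have "(%s. h s tau) analytic_on {v (n + 1)}" unfolding h_def I(4)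
   by (intro analytic_on_sum) (use pb[OF _ tau] poles_bounded_imp_analytic[OF _ clD s] in blast)
  then have "remove_sings (%s. h s tau) (v (n + 1)) = h (v (n + 1)) tau" by simp
  moreover have "(0, e (v (n + 1)), tau) \<in> Omega_reg n" using eV tau s by (simp add: Omega_reg_def Omega_def D_def e_def)
  ultimately show "f (u, v, tau) = remove_sings (%s. h s tau) (v (n + 1))"
   using Jacobi_index0_eq[OF n f x] by (simp add: h_def e_def)
 next
  fix tau assume tau: "tau \<in> uhp"
  have "(%s. h s tau) meromorphic_on UNIV" unfolding h_def I(4)
   by (intro meromorphic_on_sum) (use pb[OF _ tau] in \<open>auto simp: poles_bounded_def\<close>)
  then have "remove_sings (%s. h s tau) nicely_meromorphic_on UNIV" by (rule remove_sings_nicely_meromorphic)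
  moreover have "remove_sings (%s. h s tau) (z + \<omega>) = remove_sings (%s. h s tau) z" if "\<omega> \<in> Lat tau" for z \<omega>
  proof -
   have "h (z + \<omega> + w) tau = h (z + w) tau" for w using periodic[OF tau that, of "z + w"] by (simp add: add_ac)
   then show ?thesis by (subst (1 2) remove_sings_shift_0) simp
  qed
  ultimately show "elliptic tau (%s. remove_sings (%s. h s tau) s)" by (simp add: elliptic_def)
 qed
qed

section \<open>Evaluation of polynomials at the fundamental forms\<close>

lemma eval_fundamental_superset:
 assumes "finite A" "keys p \<subseteq> A"
 shows "eval_fundamental n p x = (\<Sum>\<alpha>\<in>A. lookup p \<alpha> x * (\<Prod>i=0..n. fundamental n i x ^ lookup \<alpha> i))"
 unfolding eval_fundamental_def using assms
 by (intro sum.mono_neutral_left) (auto simp: in_keys_iff)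

lemma eval_fundamental_add: "eval_fundamental n (p + p') x = eval_fundamental n p x + eval_fundamental n p' x"
proof -
 have "keys (p + p') \<subseteq> keys p \<union> keys p'" by (rule Poly_Mapping.keys_add)
 then show ?thesis
  using eval_fundamental_superset[of "keys p \<union> keys p'" _ n x]
  by (simp add: lookup_add distrib_right sum.distrib)
qed

lemma index0_polys_add: "p \<in> index0_polys n ==> p' \<in> index0_polys n ==> p + p' \<in> index0_polys n"
 using Poly_Mapping.keys_add[of p p'] Jacobi_sum_add[of "lookup p _" n _ "lookup p' _"]
 by (fastforce simp: index0_polys_def lookup_add Jacobi_index0_def plus_fun_def)

lemma index0_polys_zero: "0 \<in> index0_polys n"
 using Jacobi_sum_zero by (simp add: index0_polys_def Jacobi_index0_def zero_fun_def)

lemma eval_fundamental_zero: "eval_fundamental n 0 = (%_. 0)"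
 by (simp add: eval_fundamental_def fun_eq_iff)

lemma eval_fundamental_image_sum:
 assumes "finite A" "!!a. a \<in> A ==> \<exists>p\<in>index0_polys n. eval_fundamental n p = h a"
 shows "\<exists>p\<in>index0_polys n. eval_fundamental n p = (%x. \<Sum>a\<in>A. h a x)"
 using assms
proof (induction rule: finite_induct)
 case empty
 then show ?case using index0_polys_zero eval_fundamental_zero by auto
next
 case (insert a A)
 then obtain p p' where p: "p \<in> index0_polys n" "p' \<in> index0_polys n"
  "eval_fundamental n p = h a" "eval_fundamental n p' = (%x. \<Sum>a\<in>A. h a x)" by (metis insertCI)
 then show ?case using insert.hyps by (intro bexI[OF _ index0_polys_add[OF p(1,2)]]) (simp add: fun_eq_iff eval_fundamental_add)
qed

lemma Jacobi_in_image:
 assumes n: "n \<ge> 1" and f: "f \<in> Jacobi n k l m"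
 shows "\<exists>p\<in>index0_polys n. eval_fundamental n p = f"
proof (cases "m < 0")
 case True
 then have "f = (%_. 0)" using Jacobi_negative_index[OF n f] by blast
 then show ?thesis using index0_polys_zero eval_fundamental_zero by metis
next
 case False
 then obtain M where m: "m = int M" using nonneg_int_cases[of m] by auto
 define h where "h = (%\<alpha> x. index0_form n (Jacobi_coefficient n M f \<alpha>) x * (\<Prod>i=0..n. fundamental n i x ^ lookup \<alpha> i))"
 have "\<exists>p\<in>index0_polys n. eval_fundamental n p = h \<alpha>" if \<alpha>: "\<alpha> \<in> monomials n M" for \<alpha>
 proof (intro bexI[of _ "Poly_Mapping.single \<alpha> (index0_form n (Jacobi_coefficient n M f \<alpha>))"] ext)
  fix x
  show "eval_fundamental n (Poly_Mapping.single \<alpha> (index0_form n (Jacobi_coefficient n M f \<alpha>))) x = h \<alpha> x"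
   using eval_fundamental_superset[of "{\<alpha>}" "Poly_Mapping.single \<alpha> (index0_form n (Jacobi_coefficient n M f \<alpha>))" n x]
   by (simp add: h_def)
  have "index0_form n (Jacobi_coefficient n M f \<alpha>) \<in> Jacobi_index0 n"
   unfolding Jacobi_index0_def
   by (rule Jacobi_sum_single[OF Jacobi_coefficient_Jacobi[OF n f[unfolded m] \<alpha>]]) simp
  then show "Poly_Mapping.single \<alpha> (index0_form n (Jacobi_coefficient n M f \<alpha>)) \<in> index0_polys n"
   using \<alpha> Jacobi_sum_zero[of n "{(k, l, m). m = 0}"]
   by (auto simp: index0_polys_def lookup_single when_def monomials_def Jacobi_index0_def zero_fun_def split: if_splits)
 qed
 from eval_fundamental_image_sum[where h = h, OF finite_monomials this]
 obtain p where p: "p \<in> index0_polys n" "eval_fundamental n p = (%x. \<Sum>\<alpha>\<in>monomials n M. h \<alpha> x)" by blast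
 have "f x = (\<Sum>\<alpha>\<in>monomials n M. h \<alpha> x)" for x
 proof (cases "x \<in> Omega_reg n")
  case True
  obtain u v tau where x: "x = (u, v, tau)" by (cases x)
  have "tau \<in> uhp" "v \<in> V n" "of_nat (n + 1) * v (n + 1) ~: Lat tau"
   using True by (auto simp: x Omega_reg_def Omega_def)
  then show ?thesis
   using Jacobi_expansion[OF n f[unfolded m]] True by (simp add: expansion_def h_def index0_form_def x)
 next
  case False
  then show ?thesis using Jacobi_outside[OF f False] by (cases x) (simp add: h_def index0_form_def)
 qed
 then show ?thesis using p by (metis ext)
qed

lemma eval_fundamental_mem:
 assumes n: "n \<ge> 1" and p: "p \<in> index0_polys n"
 shows "eval_fundamental n p \<in> Jacobi_algebra n"
proof -
 have "(%x. \<Sum>\<alpha>\<in>keys p. lookup p \<alpha> x * (\<Prod>i=0..n. fundamental n i x ^ lookup \<alpha> i)) \<in> Jacobi_sum n UNIV"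
 proof (rule Jacobi_sum_sum)
  fix \<alpha>
  have "lookup p \<alpha> \<in> Jacobi_sum n {(k, l, m). m = 0}" using p by (simp add: index0_polys_def Jacobi_index0_def)
  then obtain I g where I: "finite I" "I \<subseteq> {(k, l, m). m = 0}" "!!k l m. (k, l, m) \<in> I ==> g (k, l, m) \<in> Jacobi n k l m"
   "!!x. lookup p \<alpha> x = (\<Sum>d\<in>I. g d x)" by (rule Jacobi_sumE) (rule that, (assumption | blast)+)
  have "(%x. \<Sum>d\<in>I. g d x * (\<Prod>i=0..n. fundamental n i x ^ lookup \<alpha> i)) \<in> Jacobi_sum n UNIV"
  proof (rule Jacobi_sum_sum[OF I(1)])
   fix d assume "d \<in> I"
   then have "g d \<in> Jacobi n (fst d) (fst (snd d)) (snd (snd d))" using I(3) by (cases d) auto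
   from Jacobi_mult_monomial[OF n this, of "{0..n}"]
   show "(%x. g d x * (\<Prod>i=0..n. fundamental n i x ^ lookup \<alpha> i)) \<in> Jacobi_sum n UNIV"
    using Jacobi_sum_single by blast
  qed
  then show "(%x. lookup p \<alpha> x * (\<Prod>i=0..n. fundamental n i x ^ lookup \<alpha> i)) \<in> Jacobi_sum n UNIV"
   by (simp add: I(4) sum_distrib_right)
 qed simp
 then show ?thesis by (simp add: Jacobi_algebra_def eval_fundamental_def[abs_def])
qed

text \<open>For injectivity s and tau are fixed. Coefficients of index 0 are constant on the slice,
  so equality of values becomes a polynomial relation between the fundamental forms with constant
  coefficients. Off \<open>Omega_reg\<close> the coefficients are 0.\<close>

lemma eval_fundamental_bij:
 assumes n: "n \<ge> 1"
 shows "bij_betw (eval_fundamental n) (index0_polys n) (Jacobi_algebra n)"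
 unfolding bij_betw_def
proof
 show "inj_on (eval_fundamental n) (index0_polys n)"
 proof (rule inj_onI, rule poly_mapping_eqI, rule ext)
  fix p p' \<alpha> x assume p: "p \<in> index0_polys n" "p' \<in> index0_polys n" and eq: "eval_fundamental n p = eval_fundamental n p'"
  have idx: "lookup p \<beta> \<in> Jacobi_index0 n" "lookup p' \<beta> \<in> Jacobi_index0 n" for \<beta>
   using p by (auto simp: index0_polys_def)
  show "lookup p \<alpha> x = lookup p' \<alpha> x"
  proof (cases "x \<in> Omega_reg n")
   case False
   have Z: "h x = 0" if "h \<in> Jacobi_index0 n" for h
   proof -
    obtain I g where I: "finite I" "I \<subseteq> {(k, l, m). m = 0}" "!!k l m. (k, l, m) \<in> I ==> g (k, l, m) \<in> Jacobi n k l m"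
     "!!x. h x = (\<Sum>d\<in>I. g d x)" by (rule Jacobi_sumE[OF \<open>h \<in> Jacobi_index0 n\<close>[unfolded Jacobi_index0_def]]) (rule that, (assumption | blast)+)
    have "g d x = 0" if d: "d \<in> I" for d
    proof -
     obtain k l m where klm: "d = (k, l, m)" by (cases d)
     then show ?thesis using Jacobi_outside[OF I(3)[of k l m] False] d by simp
    qed
    then show ?thesis by (simp add: I(4))
   qed
   show ?thesis using Z[OF idx(1)] Z[OF idx(2)] by simp
  next
   case True
   obtain u v tau where x: "x = (u, v, tau)" by (cases x)
   have tau: "tau \<in> uhp" and s: "of_nat (n + 1) * v (n + 1) ~: Lat tau"
    using True by (auto simp: x Omega_reg_def Omega_def)
   define A where "A = keys p \<union> keys p'"
   show ?thesis
   proof (cases "\<alpha> \<in> A")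
    case True
    have "lookup p \<alpha> x - lookup p' \<alpha> x = 0"
    proof (rule fundamental_independent[OF n tau s, of A "%\<alpha>. lookup p \<alpha> x - lookup p' \<alpha> x" \<alpha>])
     show "keys \<beta> \<subseteq> {0..n}" if "\<beta> \<in> A" for \<beta> using p that by (auto simp: index0_polys_def A_def)
     fix u' v' assume v': "v' \<in> V n" "v' (n + 1) = v (n + 1)"
     have x': "(u', v', tau) \<in> Omega_reg n" using v' tau s by (simp add: Omega_reg_def Omega_def)
     have "lookup p \<beta> x = lookup p \<beta> (u', v', tau)"
      "lookup p' \<beta> x = lookup p' \<beta> (u', v', tau)" for \<beta>
      using Jacobi_index0_eq[OF n _ \<open>x \<in> Omega_reg n\<close>[unfolded x] x'] idx[of \<beta>] v'(2) unfolding x by auto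
     then show "(\<Sum>\<beta>\<in>A. (lookup p \<beta> x - lookup p' \<beta> x) *
       (\<Prod>i=0..n. fundamental n i (u', v', tau) ^ lookup \<beta> i)) = 0"
      using eval_fundamental_superset[of A p n "(u', v', tau)"] eval_fundamental_superset[of A p' n "(u', v', tau)"] eq
      by (simp add: A_def left_diff_distrib sum_subtractf)
    qed (use True in \<open>auto simp: A_def\<close>)
    then show ?thesis by simp
   qed (simp add: A_def in_keys_iff)
  qed
 qed
 show "eval_fundamental n ` index0_polys n = Jacobi_algebra n"
 proof
  show "eval_fundamental n ` index0_polys n \<subseteq> Jacobi_algebra n" using eval_fundamental_mem[OF n] by blast
  show "Jacobi_algebra n \<subseteq> eval_fundamental n ` index0_polys n"
  proof
   fix h assume "h \<in> Jacobi_algebra n"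
   then obtain I g where I: "finite I" "I \<subseteq> UNIV" "!!k l m. (k, l, m) \<in> I ==> g (k, l, m) \<in> Jacobi n k l m" "!!x. h x = (\<Sum>d\<in>I. g d x)"
    unfolding Jacobi_algebra_def by (rule Jacobi_sumE) (rule that, (assumption | blast)+)
   have "\<exists>p\<in>index0_polys n. eval_fundamental n p = g d" if "d \<in> I" for d
    using Jacobi_in_image[OF n I(3)] that by (cases d) auto
   from eval_fundamental_image_sum[where h = g, OF I(1) this]
   show "h \<in> eval_fundamental n ` index0_polys n" using I(4) by (metis ext imageI)
  qed
 qed
qed

theorem theorem1p2:
  fixes n :: nat
  assumes "n \<ge> 1"
  shows
    \<comment> \<open>the spaces of Jacobi forms make up an algebra, graded by weight and index and filtered by
       order\<close>
    "Jacobi_one n \<in> Jacobi n 0 0 0 \<and>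
     (\<forall>k l m k' l' m'. \<forall>f\<in>Jacobi n k l m. \<forall>g\<in>Jacobi n k' l' m'.
        (\<lambda>x. f x * g x) \<in> Jacobi n (k + k') (l + l') (m + m')) \<and>
     (\<forall>K (g :: int \<times> int \<Rightarrow> point \<Rightarrow> complex).
        finite K \<and> (\<forall>(k, m)\<in>K. \<exists>l. g (k, m) \<in> Jacobi n k l m) \<and> (\<forall>x. (\<Sum>d\<in>K. g d x) = 0)
          \<longrightarrow> (\<forall>d\<in>K. \<forall>x. g d x = 0)) \<and>
     (\<forall>i\<le>n. \<exists>k l m. fundamental n i \<in> Jacobi n k l m) \<and>
     bij_betw (eval_fundamental n) (index0_polys n) (Jacobi_algebra n) \<and>
     (\<forall>f\<in>Jacobi_index0 n. \<exists>F. (\<forall>(u, v, \<tau>)\<in>Omega_reg n. f (u, v, \<tau>) = F (v (n+1)) \<tau>) \<and>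
        (\<forall>\<tau>\<in>upper_half_plane. elliptic \<tau> (\<lambda>s. F s \<tau>)))"
proof (intro conjI)
 show "\<forall>K (g :: int \<times> int => point => complex).
    finite K \<and> (\<forall>(k, m)\<in>K. \<exists>l. g (k, m) \<in> Jacobi n k l m) \<and> (\<forall>x. (\<Sum>d\<in>K. g d x) = 0)
     --> (\<forall>d\<in>K. \<forall>x. g d x = 0)"
 proof (intro allI impI ballI)
  fix K and g :: "int \<times> int => point => complex" and d x
  assume K: "finite K \<and> (\<forall>(k, m)\<in>K. \<exists>l. g (k, m) \<in> Jacobi n k l m) \<and> (\<forall>x. (\<Sum>d\<in>K. g d x) = 0)" and d: "d \<in> K"
  obtain k m where km: "d = (k, m)" by (cases d)
  show "g d x = 0" unfolding km
   by (rule Jacobi_direct_sum[of K g n k m x]) (use K d km in auto)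
 qed
 show "\<forall>i\<le>n. \<exists>k l m. fundamental n i \<in> Jacobi n k l m" using fundamental_Jacobi[OF assms] by blast
qed (use Jacobi_one Jacobi_mult eval_fundamental_bij[OF assms] Jacobi_index0_elliptic[OF assms] in blast)+

end
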